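(* Let $G$ be a connected, simply connected two step nilpotent Lie group, with all notation ($\mathfrak v$, $\mathfrak z$, $k$, $r$, $\Lambda$, $\mathcal U$, $\pi_{\mu,\nu}$, $\pi_\nu$, $Pf$) as in the context. Let $\theta:\mathbb{R}^k\to[0,\infty)$ be a radial decreasing function with $\lim_{|t|\to\infty}\theta(t)=0$ and let $$I=\int_{|t|\ge 1}\frac{\theta(t)}{|t|^k}\,dt .$$ (a) Let $f\in L^1(G)\cap L^2(G)$ be such that, for some constant $C$, $$\|\pi_{\mu,\nu}(f)\|_{HS}\le C\,|H(\mu)|\,|Pf(\nu)|^{1/2}e^{-|\nu|\theta(\nu)}\quad\text{for all }(\mu,\nu)\in\Lambda,$$ where $H\in L^1(\mathbb{R}^r)\cap L^2(\mathbb{R}^r)$. Suppose there exists $\epsilon>0$ such that $f(v,z)=0$ for $|z|<\epsilon$ and all $v\in\mathfrak v$. If $I=\infty$, then $f=0$. (b) Suppose $G$ is an MW group. If $I$ is finite, then there exists a nontrivial $f\in C_c(G)$ satisfying, for some constant $C$, $$\|\pi_\nu(f)\|_{HS}\le C\,|Pf(\nu)|^{1/2}e^{-|\nu|\theta(\nu)}\quad\text{for all }\nu\in\mathcal U .$$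
   Context: **Group.** $G$ has Lie algebra $\mathfrak g=\mathfrak v\oplus\mathfrak z$ with $\mathfrak z$ the center and $\{0\}\ne[\mathfrak g,\mathfrak g]=[\mathfrak v,\mathfrak v]\subset\mathfrak z$. Fix an inner product on $\mathfrak g$ and an orthonormal basis $\{V_1,\dots,V_m,Z_1,\dots,Z_k\}$ of $\mathfrak g$ with $\mathfrak v=\mathrm{span}\{V_i\}$, $\mathfrak z=\mathrm{span}\{Z_i\}$, and dual basis $V_i^*,Z_i^*$. $G$ is identified with $\mathfrak v\oplus\mathfrak z$ through $\exp$; write $(v,z)=\exp(v+z)$, so $(V,Z)(V',Z')=(V+V',Z+Z'+\frac12[V,V'])$. Haar measure is Lebesgue measure $dv\,dz$. $\mathfrak z$ and $\mathfrak z^*$ are identified with $\mathbb{R}^k$ via the bases. **Parameters.** For $\nu\in\mathfrak z^*$ let $B_\nu(V,V')=\nu([V,V'])$ on $\mathfrak v$, $\tau_\nu=\{V\in\mathfrak v:\nu([V,V'])=0\ \forall V'\in\mathfrak v\}$, and $m_\nu$ the orthogonal complement of $\tau_\nu$ in $\mathfrak v$. Let $S_\nu=(B_\nu(V_i,V_j))_{1\le i,j\le m}$. An index $i$ is a jump index for $\nu$ if the rank of the first $i$ rows of $S_\nu$ is strictly greater than the rank of the first $i-1$ rows. Let $P=\{j_1,\dots,j_{2n}\}$ be the set of jump indices of generic $\nu$, and $\mathcal U\subset\mathfrak z^*$ the Zariski open set of $\nu$ for which $\dim m_\nu$ is maximal ($=2n$) and the set of jump indices is $P$. Let $Q=\{n_1,\dots,n_r\}=\{1,\dots,m\}\setminus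 P$, $\widetilde A_Q^*=\mathrm{span}_{\mathbb{R}}\{V_{n_i}^*\}\cong\mathbb{R}^r$, and $\Lambda=\widetilde A_Q^*\times\mathcal U$, with elements $(\mu,\nu)=\sum_{i=1}^r\mu_iV_{n_i}^*+\sum_{i=1}^k\nu_iZ_i^*$. The Pfaffian is $|Pf(\nu)|=\sqrt{\det(\nu([V_{j_i},V_{j_s}]))_{1\le i,s\le 2n}}$; it is the absolute value of a homogeneous polynomial in $\nu$. **Representations.** For $\nu\in\mathcal U$ choose an orthonormal basis $\{X_1(\nu),Y_1(\nu),\dots,X_n(\nu),Y_n(\nu),U_1(\nu),\dots,U_r(\nu)\}$ of $\mathfrak v$ and $d_i(\nu)>0$ such that $\tau_\nu=\mathrm{span}\{U_i(\nu)\}$, $\nu([X_i(\nu),Y_j(\nu)])=\delta_{ij}d_j(\nu)$ and $\nu([X_i(\nu),X_j(\nu)])=\nu([Y_i(\nu),Y_j(\nu)])=0$. Put $\xi_\nu=\mathrm{span}\{X_i(\nu)\}$, $\eta_\nu=\mathrm{span}\{Y_i(\nu)\}$, and write elements of $G$ as $(x,y,u,z)=\exp(\sum x_jX_j(\nu)+\sum y_jY_j(\nu)+\sum u_jU_j(\nu)+\sum z_jZ_j)$. Let $\tilde\mu_i=\sum_{j=1}^r\mu_jV_{n_j}^*(U_i(\nu))$. The irreducible unitary representation $\pi_{\mu,\nu}$ acts on $L^2(\eta_\nu)$ by $$(\pi_{\mu,\nu}(x,y,u,z)\phi)(\xi)=e^{2\pi i\left(\sum_{j=1}^k\nu_jz_j+\sum_{j=1}^r\tilde\mu_ju_j+\sum_{j=1}^nd_j(\nu)(x_j\xi_j+\frac12x_jy_j)\right)}\phi(\xi+y).$$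 For $f\in L^1(G)$, $\pi_{\mu,\nu}(f)=\int f(x,y,u,z)\,\pi_{\mu,\nu}(-x,-y,-u,-z)\,dx\,dy\,du\,dz$. $\|\cdot\|_{HS}$ is the Hilbert–Schmidt norm. **MW groups.** $G$ is an MW group if $B_\nu$ is nondegenerate on $\mathfrak v$ for some $\nu\in\mathfrak z^*$. Then $r=0$, $\Lambda=\mathcal U=\{\nu:B_\nu\text{ nondegenerate}\}$, the variables $\mu$ and $u$ are absent, one writes $\pi_\nu$ for $\pi_{\mu,\nu}$, and $|H(\mu)|$ in part (a) is simply a constant. A radial function $\theta$ is decreasing if $\theta(t)$ is a decreasing function of $|t|$. $C_c(G)$ is the space of compactly supported continuous functions on $G$. *)

theory Defs
  imports "HOL-Analysis.Analysis" "HOL-Algebra.Group"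
begin

section \<open>Square-integrable functions and the Hilbert--Schmidt norm\<close>

text \<open>
  Elements of \<open>L\<^sup>2(M)\<close> are handled through representatives, so that equality in \<open>L\<^sup>2(M)\<close> is
  equality almost everywhere.
\<close>

definition L2 :: "'a measure \<Rightarrow> ('a \<Rightarrow> complex) set" where
  "L2 M = {\<phi> \<in> borel_measurable M. integrable M (\<lambda>x. (cmod (\<phi> x))\<^sup>2)}"

definition L2_inner :: "'a measure \<Rightarrow> ('a \<Rightarrow> complex) \<Rightarrow> ('a \<Rightarrow> complex) \<Rightarrow> complex" where
  "L2_inner M \<phi> \<psi> = (\<integral>x. \<phi> x * cnj (\<psi> x) \<partial>M)"

definition L2_orthonormal_basis :: "'a measure \<Rightarrow> ('a \<Rightarrow> complex) set \<Rightarrow> bool" where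
  "L2_orthonormal_basis M E \<longleftrightarrow>
     E \<subseteq> L2 M \<and>
     (\<forall>\<phi>\<in>E. \<forall>\<psi>\<in>E. L2_inner M \<phi> \<psi> = (if \<phi> = \<psi> then 1 else 0)) \<and>
     (\<forall>\<phi>\<in>L2 M. (\<forall>e\<in>E. L2_inner M \<phi> e = 0) \<longrightarrow> (AE x in M. \<phi> x = 0))"

text \<open>
  The sum of \<open>\<parallel>T e\<parallel>\<^sup>2\<close> over an orthonormal basis does not depend on the basis when \<open>T\<close> is a
  bounded operator on \<open>L\<^sup>2(M)\<close>; the value \<open>\<infinity>\<close> means that \<open>T\<close> is not Hilbert--Schmidt.
\<close>

definition hs_norm :: "'a measure \<Rightarrow> (('a \<Rightarrow> complex) \<Rightarrow> 'a \<Rightarrow> complex) \<Rightarrow> ennreal" where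
  "hs_norm M T =
     (let E = (SOME E. L2_orthonormal_basis M E);
          s = (\<Sum>\<^sub>\<infinity>e\<in>E. \<integral>\<^sup>+x. ennreal ((cmod (T e x))\<^sup>2) \<partial>M)
      in if s = \<infinity> then \<infinity> else ennreal (sqrt (enn2real s)))"


section \<open>Auxiliary notions\<close>

definition orthonormal_on :: "'i set \<Rightarrow> ('i \<Rightarrow> 'a::real_inner) \<Rightarrow> bool" where
  "orthonormal_on I b \<longleftrightarrow> (\<forall>i\<in>I. \<forall>j\<in>I. b i \<bullet> b j = (if i = j then 1 else 0))"

definition zariski_open :: "'a::real_normed_vector set \<Rightarrow> bool" where
  "zariski_open W \<longleftrightarrow>
     (\<exists>F. (\<forall>p\<in>F. real_polynomial_function p) \<and> W = {x. \<exists>p\<in>F. p x \<noteq> 0})"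

definition radial_decreasing :: "('a::real_normed_vector \<Rightarrow> real) \<Rightarrow> bool" where
  "radial_decreasing \<theta> \<longleftrightarrow>
     (\<exists>g. (\<forall>t. \<theta> t = g (norm t)) \<and> (\<forall>s t. 0 \<le> s \<and> s \<le> t \<longrightarrow> g t \<le> g s))"


section \<open>Two step nilpotent groups\<close>

definition lie_bracket :: "('g::real_vector \<Rightarrow> 'g \<Rightarrow> 'g) \<Rightarrow> bool" where
  "lie_bracket br \<longleftrightarrow>
     bilinear br \<and> (\<forall>x. br x x = 0) \<and>
     (\<forall>x y z. br x (br y z) + br y (br z x) + br z (br x y) = 0)"

definition lie_center :: "('g::real_vector \<Rightarrow> 'g \<Rightarrow> 'g) \<Rightarrow> 'g set" where
  "lie_center br = {x. \<forall>y. br x y = 0}"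

text \<open>
  The connected, simply connected group \<open>G\<close> is identified through \<open>exp\<close> with its Lie algebra, the
  Euclidean space \<open>'g\<close>; by Baker--Campbell--Hausdorff its product is \<open>x + y + [x, y]/2\<close> and
  the inverse of \<open>x\<close> is \<open>-x\<close>. Haar measure is \<open>lborel\<close>.

  The dimensions of \<open>\<vv>\<close> and \<open>\<zz>\<close> are \<open>m = CARD('m)\<close> and \<open>k = CARD('k)\<close>. The order on
  \<open>'m\<close> is the order of the basis \<open>V\<close> of \<open>\<vv>\<close>, on which the jump indices depend.
\<close>

locale two_step_group =
  fixes G :: "'g::euclidean_space monoid"
    and br :: "'g \<Rightarrow> 'g \<Rightarrow> 'g"
    and V :: "'m::{finite,linorder} \<Rightarrow> 'g"
    and Z :: "'k::finite \<Rightarrow> 'g"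
  assumes bracket: "lie_bracket br"
    and carrier_G: "carrier G = UNIV"
    and mult_G: "x \<otimes>\<^bsub>G\<^esub> y = x + y + (1/2) *\<^sub>R br x y"
    and one_G: "\<one>\<^bsub>G\<^esub> = 0"
    and V_orthonormal: "orthonormal_on UNIV V"
    and Z_orthonormal: "orthonormal_on UNIV Z"
    and V_Z_orthogonal: "V i \<bullet> Z j = 0"
    and basis: "span (range V \<union> range Z) = UNIV"
    and center: "span (range Z) = lie_center br"
    and derived_nontrivial: "span {br x y | x y. True} \<noteq> {0}"
    and derived_central: "span {br x y | x y. True} \<subseteq> lie_center br"
begin

definition vspace :: "'g set" where
  "vspace = span (range V)"

text \<open>
  Coordinates of the \<open>\<zz>\<close>-component. The element \<open>\<nu>\<close> of \<open>\<zz>\<^sup>*\<close> with coordinates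
  \<open>\<nu> :: real ^ 'k\<close> is the functional \<open>\<lambda>x. \<nu> \<bullet> zcoord x\<close>.
\<close>

definition zcoord :: "'g \<Rightarrow> real ^ 'k" where
  "zcoord x = (\<chi> i. x \<bullet> Z i)"

definition bform :: "real ^ 'k \<Rightarrow> 'g \<Rightarrow> 'g \<Rightarrow> real" where
  "bform \<nu> x y = \<nu> \<bullet> zcoord (br x y)"

definition radical :: "real ^ 'k \<Rightarrow> 'g set" where
  "radical \<nu> = {x \<in> vspace. \<forall>y\<in>vspace. bform \<nu> x y = 0}"

definition mspace :: "real ^ 'k \<Rightarrow> 'g set" where
  "mspace \<nu> = {x \<in> vspace. \<forall>y\<in>radical \<nu>. x \<bullet> y = 0}"

definition smat :: "real ^ 'k \<Rightarrow> real ^ ('m::{finite,linorder}) ^ ('m::{finite,linorder})" where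
  "smat \<nu> = (\<chi> i j. bform \<nu> (V i) (V j))"

definition jump_set :: "real ^ 'k \<Rightarrow> 'm set" where
  "jump_set \<nu> =
     {i. dim ((\<lambda>a. row a (smat \<nu>)) ` {..i}) > dim ((\<lambda>a. row a (smat \<nu>)) ` {..<i})}"

definition Pset :: "'m set" where
  "Pset = (THE P. \<exists>W. zariski_open W \<and> W \<noteq> {} \<and> (\<forall>\<nu>\<in>W. jump_set \<nu> = P))"

definition Qset :: "'m set" where
  "Qset = - Pset"

definition dim_n :: nat where
  "dim_n = card Pset div 2"

definition dim_r :: nat where
  "dim_r = card Qset"

definition Uset :: "(real ^ 'k) set" where
  "Uset = {\<nu>. (\<forall>\<nu>'. dim (mspace \<nu>') \<le> dim (mspace \<nu>)) \<and> jump_set \<nu> = Pset}"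

text \<open>
  An element \<open>\<mu>\<close> of \<open>\<real>\<^sup>r\<close> is a family of reals indexed by \<open>Q\<close>, that is, an element of
  \<open>Qset \<rightarrow>\<^sub>E UNIV\<close>. If \<open>Q\<close> is empty, there is exactly one such \<open>\<mu>\<close>.
\<close>

definition Lambda :: "(('m \<Rightarrow> real) \<times> (real ^ 'k)) set" where
  "Lambda = (Qset \<rightarrow>\<^sub>E UNIV) \<times> Uset"

definition mu_measure :: "('m \<Rightarrow> real) measure" where
  "mu_measure = Pi\<^sub>M Qset (\<lambda>_. lborel)"

text \<open>The sum under the root is the determinant of the submatrix of \<open>S\<^sub>\<nu>\<close> with rows and columns in \<open>P\<close>.\<close>

definition abs_Pf :: "real ^ 'k \<Rightarrow> real" where
  "abs_Pf \<nu> =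
     sqrt (\<Sum>p | p permutes Pset. of_int (sign p) * (\<Prod>i\<in>Pset. bform \<nu> (V i) (V (p i))))"

definition MW_group :: bool where
  "MW_group \<longleftrightarrow> (\<exists>\<nu>. \<forall>x\<in>vspace. (\<forall>y\<in>vspace. bform \<nu> x y = 0) \<longrightarrow> x = 0)"

end


section \<open>The representations\<close>

text \<open>\<open>X \<nu> j\<close>, \<open>Y \<nu> j\<close>, \<open>U \<nu> j\<close> and \<open>d \<nu> j\<close> are the choices made for each \<open>\<nu>\<close> in \<open>\<U>\<close>, indexed from \<open>0\<close>.\<close>

locale two_step_reps = two_step_group G br V Z
  for G :: "'g::euclidean_space monoid"
    and br :: "'g \<Rightarrow> 'g \<Rightarrow> 'g"
    and V :: "'m::{finite,linorder} \<Rightarrow> 'g"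
    and Z :: "'k::finite \<Rightarrow> 'g" +
  fixes X Y U :: "real ^ 'k \<Rightarrow> nat \<Rightarrow> 'g"
    and d :: "real ^ 'k \<Rightarrow> nat \<Rightarrow> real"
  assumes X_orthonormal: "\<nu> \<in> Uset \<Longrightarrow> orthonormal_on {..<dim_n} (X \<nu>)"
    and Y_orthonormal: "\<nu> \<in> Uset \<Longrightarrow> orthonormal_on {..<dim_n} (Y \<nu>)"
    and U_orthonormal: "\<nu> \<in> Uset \<Longrightarrow> orthonormal_on {..<dim_r} (U \<nu>)"
    and X_Y_orthogonal: "\<lbrakk>\<nu> \<in> Uset; i < dim_n; j < dim_n\<rbrakk> \<Longrightarrow> X \<nu> i \<bullet> Y \<nu> j = 0"
    and X_U_orthogonal: "\<lbrakk>\<nu> \<in> Uset; i < dim_n; j < dim_r\<rbrakk> \<Longrightarrow> X \<nu> i \<bullet> U \<nu> j = 0"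
    and Y_U_orthogonal: "\<lbrakk>\<nu> \<in> Uset; i < dim_n; j < dim_r\<rbrakk> \<Longrightarrow> Y \<nu> i \<bullet> U \<nu> j = 0"
    and frame_span: "\<nu> \<in> Uset \<Longrightarrow>
          span (X \<nu> ` {..<dim_n} \<union> Y \<nu> ` {..<dim_n} \<union> U \<nu> ` {..<dim_r}) = vspace"
    and U_span: "\<nu> \<in> Uset \<Longrightarrow> span (U \<nu> ` {..<dim_r}) = radical \<nu>"
    and d_pos: "\<lbrakk>\<nu> \<in> Uset; j < dim_n\<rbrakk> \<Longrightarrow> 0 < d \<nu> j"
    and bform_X_Y: "\<lbrakk>\<nu> \<in> Uset; i < dim_n; j < dim_n\<rbrakk> \<Longrightarrow>
          bform \<nu> (X \<nu> i) (Y \<nu> j) = (if i = j then d \<nu> j else 0)"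
    and bform_X_X: "\<lbrakk>\<nu> \<in> Uset; i < dim_n; j < dim_n\<rbrakk> \<Longrightarrow> bform \<nu> (X \<nu> i) (X \<nu> j) = 0"
    and bform_Y_Y: "\<lbrakk>\<nu> \<in> Uset; i < dim_n; j < dim_n\<rbrakk> \<Longrightarrow> bform \<nu> (Y \<nu> i) (Y \<nu> j) = 0"
begin

text \<open>
  \<open>L\<^sup>2(\<eta>\<^sub>\<nu>)\<close> is \<open>L\<^sup>2\<close> of this measure: a point of \<open>\<eta>\<^sub>\<nu>\<close> is given by its coordinates
  \<open>\<xi>\<close> with respect to the orthonormal basis \<open>Y \<nu>\<close>.
\<close>

definition eta_measure :: "(nat \<Rightarrow> real) measure" where
  "eta_measure = Pi\<^sub>M {..<dim_n} (\<lambda>_. lborel)"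

definition mu_tilde :: "('m \<Rightarrow> real) \<Rightarrow> real ^ 'k \<Rightarrow> nat \<Rightarrow> real" where
  "mu_tilde \<mu> \<nu> i = (\<Sum>j\<in>Qset. \<mu> j * (V j \<bullet> U \<nu> i))"

text \<open>
  The group element \<open>(x, y, u, z)\<close> is \<open>g\<close> with
  \<open>x\<^sub>j = g \<bullet> X \<nu> j\<close>, \<open>y\<^sub>j = g \<bullet> Y \<nu> j\<close>, \<open>u\<^sub>j = g \<bullet> U \<nu> j\<close> and \<open>z = zcoord g\<close>.
  With these signs the operators multiply in reverse order, \<open>\<pi>(g h) = \<pi>(h) \<pi>(g)\<close>; this has no
  influence on Hilbert--Schmidt norms.
\<close>

definition pi_rep ::
    "('m \<Rightarrow> real) \<Rightarrow> real ^ 'k \<Rightarrow> 'g \<Rightarrow> ((nat \<Rightarrow> real) \<Rightarrow> complex) \<Rightarrow> (nat \<Rightarrow> real) \<Rightarrow> complex" where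
  "pi_rep \<mu> \<nu> g \<phi> \<xi> =
     cis (2 * pi * (\<nu> \<bullet> zcoord g
            + (\<Sum>j<dim_r. mu_tilde \<mu> \<nu> j * (g \<bullet> U \<nu> j))
            + (\<Sum>j<dim_n. d \<nu> j * ((g \<bullet> X \<nu> j) * \<xi> j
                                  + 1/2 * (g \<bullet> X \<nu> j) * (g \<bullet> Y \<nu> j)))))
     * \<phi> (\<lambda>j\<in>{..<dim_n}. \<xi> j + g \<bullet> Y \<nu> j)"

text \<open>
  The operator-valued integral is evaluated pointwise: for \<open>f\<close> in \<open>L\<^sup>1(G)\<close> and \<open>\<phi>\<close> in
  \<open>L\<^sup>2(\<eta>\<^sub>\<nu>)\<close> the integral converges absolutely for almost every \<open>\<xi>\<close>. The coordinates
  \<open>(x, y, u, z)\<close> are orthonormal, so \<open>dx dy du dz\<close> is \<open>lborel\<close>.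
\<close>

definition pi_op ::
    "('m \<Rightarrow> real) \<Rightarrow> real ^ 'k \<Rightarrow> ('g \<Rightarrow> complex) \<Rightarrow>
     ((nat \<Rightarrow> real) \<Rightarrow> complex) \<Rightarrow> (nat \<Rightarrow> real) \<Rightarrow> complex" where
  "pi_op \<mu> \<nu> f \<phi> \<xi> = (\<integral>g. f g * pi_rep \<mu> \<nu> (- g) \<phi> \<xi> \<partial>lborel)"

definition pi_hs :: "('m \<Rightarrow> real) \<Rightarrow> real ^ 'k \<Rightarrow> ('g \<Rightarrow> complex) \<Rightarrow> ennreal" where
  "pi_hs \<mu> \<nu> f = hs_norm eta_measure (pi_op \<mu> \<nu> f)"

end

text \<open>The integral \<open>I\<close>; it is well defined in \<open>[0, \<infinity>]\<close> because \<open>\<theta>\<close> is nonnegative.\<close>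

definition theta_integral :: "(real ^ 'k \<Rightarrow> real) \<Rightarrow> ennreal" where
  "theta_integral \<theta> =
     (\<integral>\<^sup>+t\<in>{t. 1 \<le> norm t}. ennreal (\<theta> t / norm t ^ CARD('k)) \<partial>lborel)"

end

theory Submission
 imports Defs "HOL-Probability.Probability"
begin



text \<open>
 Fix \<open>\<nu>\<close> in \<open>\<U>\<close>. In the coordinates \<open>(x, y, u, z)\<close> the operator \<open>\<pi>\<^bsub>\<mu>,\<nu>\<^esub>(f)\<close> is an integral operator. Its
 kernel is the Fourier transform of \<open>f\<close> in \<open>z\<close> (at \<open>\<nu>\<close>), in \<open>u\<close> (at the frequencies given by \<open>\<mu>\<close>) and in
 \<open>x\<close>, with \<open>y\<close> the difference of the two arguments of the kernel. The change of variables to the frequency of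
 \<open>x\<close> has Jacobian \<open>d\<^sub>1 \<cdots> d\<^sub>n\<close>, so this product times the square of the Hilbert--Schmidt norm is an \<open>L\<^sup>2\<close> norm
 of the transform (\<open>weyl_hs_norm\<close>, \<open>pi_hs_square\<close>). Bessel's inequality and Plancherel's inequality are the only
 analytic inputs to this, once the sum over an orthonormal basis has been identified with the \<open>L\<^sup>2\<close> norm of
 the kernel (\<open>hs_norm_kernel\<close>).
 
 Uniqueness. Integrating the hypothesis over \<open>\<mu>\<close> bounds an \<open>L\<^sup>2\<close> norm of the transform of \<open>f\<close> in all
 variables but \<open>y\<close> by a power of \<open>|\<nu>|\<close> times \<open>e\<^bsup>-|\<nu>|\<theta>(\<nu>)\<^esup>\<close> (\<open>hs_mass_bound\<close>). The integral over \<open>\<mu>\<close> runs over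
 coordinates indexed by \<open>Q\<close> and not over the dual of the radical; the linear map between the two is onto since
 the radical is transversal to the span of the \<open>V\<^sub>j\<close> with \<open>j\<close> in \<open>P\<close> (\<open>radical_projections_span\<close>). The
 frames vary with \<open>\<nu>\<close> in no controlled way, but a Gaussian on \<open>\<vv>\<close> looks the same in all of them. Averaging
 \<open>f\<close> over \<open>\<vv>\<close> against a Gaussian gives a function on \<open>\<zz>\<close> alone, which vanishes near \<open>0\<close> and has a Fourier
 transform bounded by a power of \<open>|\<nu>|\<close> times \<open>e\<^bsup>-|\<nu>|\<theta>(\<nu>)\<^esup>\<close> (\<open>fourier_vtest_bound\<close>). By Ingham's theorem
 (\<open>ingham_uniqueness\<close>) it is zero, because the divergence of \<open>I\<close> makes the function quasi-analytic by the
 Denjoy--Carleman theorem. Averages against all Gaussians determine \<open>f\<close> (\<open>vtest_zero\<close>).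
 
 Existence. If \<open>I\<close> is finite, averaging a bump over infinitely many short segments of summable length yields a
 compactly supported \<open>b\<close> on \<open>\<zz>\<close> with Fourier transform \<open>O(e\<^bsup>-|\<nu>|\<theta>(\<nu>)-\<surd>|\<nu>|\<^esup>)\<close> (\<open>ingham_function\<close>). The norm of
 \<open>\<pi>\<^sub>\<nu>(f)\<close> contains a factor \<open>|Pf(\<nu>)|\<^bsup>-1/2\<^esup>\<close>, which is unbounded near the zeros of the Pfaffian. For an MW group
 \<open>Pf(\<nu>)\<^sup>2\<close> is the determinant of \<open>S\<^sub>\<nu>\<close>, a polynomial, and applying the corresponding differential operator to \<open>b\<close>
 multiplies the transform by it (\<open>determinant_multiplier\<close>). The tensor product of the resulting function with a
 tent function on \<open>\<vv>\<close> has the required properties.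
\<close>

section \<open>Orthonormal bases and Hilbert--Schmidt norms\<close>

abbreviation sqnorm :: "complex => ennreal" where
 "sqnorm z \<equiv> ennreal ((cmod z)\<^sup>2)"

lemma L2_measurable: "\<phi> \<in> L2 M ==> \<phi> \<in> borel_measurable M"
 and L2_integrable: "\<phi> \<in> L2 M ==> integrable M (%x. (cmod (\<phi> x))\<^sup>2)"
 by (auto simp: L2_def)

lemma L2_mult_integrable:
 assumes "\<phi> \<in> L2 M" "\<psi> \<in> L2 M"
 shows "integrable M (%x. \<phi> x * \<psi> x)"
proof (rule Bochner_Integration.integrable_bound)
 show "integrable M (%x. (cmod (\<phi> x))\<^sup>2 + (cmod (\<psi> x))\<^sup>2)"
  using assms by (auto simp: L2_def)
 show "(%x. \<phi> x * \<psi> x) \<in> borel_measurable M" using assms by (auto simp: L2_def)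
 show "AE x in M. norm (\<phi> x * \<psi> x) <= norm ((cmod (\<phi> x))\<^sup>2 + (cmod (\<psi> x))\<^sup>2)"
 proof (intro AE_I2)
  fix x
  have "2 * (cmod (\<phi> x) * cmod (\<psi> x)) <= (cmod (\<phi> x))\<^sup>2 + (cmod (\<psi> x))\<^sup>2"
   using sum_squares_bound[of "cmod (\<phi> x)" "cmod (\<psi> x)"] by simp
  moreover have "0 <= cmod (\<phi> x) * cmod (\<psi> x)" by simp
  ultimately show "norm (\<phi> x * \<psi> x) <= norm ((cmod (\<phi> x))\<^sup>2 + (cmod (\<psi> x))\<^sup>2)"
   unfolding norm_mult real_norm_def by linarith
 qed
qed

lemma borel_measurable_cnj[measurable (raw)]:
 "\<phi> \<in> borel_measurable M ==> (%x. cnj (\<phi> x)) \<in> borel_measurable M"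
 by (rule measurable_compose[OF _ borel_measurable_continuous_onI]) (auto intro: continuous_intros)

lemma L2_cnj: "\<phi> \<in> L2 M ==> (%x. cnj (\<phi> x)) \<in> L2 M"
 by (auto simp: L2_def)

lemma L2_scale: "\<phi> \<in> L2 M ==> (%x. c * \<phi> x) \<in> L2 M"
 by (auto simp: L2_def norm_mult power_mult_distrib)

lemma L2_zero: "(%x. 0) \<in> L2 M"
 by (auto simp: L2_def)

lemma L2_add:
 assumes "\<phi> \<in> L2 M" "\<psi> \<in> L2 M" shows "(%x. \<phi> x + \<psi> x) \<in> L2 M"
proof -
 have "integrable M (%x. (cmod (\<phi> x + \<psi> x))\<^sup>2)"
 proof (rule Bochner_Integration.integrable_bound)
  show "integrable M (%x. 2 * (cmod (\<phi> x))\<^sup>2 + 2 * (cmod (\<psi> x))\<^sup>2)"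
   using assms by (auto simp: L2_def)
  show "(%x. (cmod (\<phi> x + \<psi> x))\<^sup>2) \<in> borel_measurable M" using assms by (auto simp: L2_def)
  have "(cmod (a + b))\<^sup>2 <= 2 * (cmod a)\<^sup>2 + 2 * (cmod b)\<^sup>2" for a b :: complex
  proof -
   have "(cmod (a + b))\<^sup>2 <= (cmod a + cmod b)\<^sup>2"
    by (intro power_mono norm_triangle_ineq) auto
   also have "... <= 2 * (cmod a)\<^sup>2 + 2 * (cmod b)\<^sup>2"
    using sum_squares_bound[of "cmod a" "cmod b"] by (simp add: power2_sum)
   finally show ?thesis .
  qed
  then show "AE x in M. norm ((cmod (\<phi> x + \<psi> x))\<^sup>2) <= norm (2 * (cmod (\<phi> x))\<^sup>2 + 2 * (cmod (\<psi> x))\<^sup>2)"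
   by auto
 qed
 then show ?thesis using assms by (auto simp: L2_def)
qed

lemma L2_diff:
 assumes "\<phi> \<in> L2 M" "\<psi> \<in> L2 M" shows "(%x. \<phi> x - \<psi> x) \<in> L2 M"
 using L2_add[OF assms(1) L2_scale[OF assms(2), of "-1"]] by simp

lemma L2_sum:
 assumes "\<And>i. i \<in> F ==> \<phi> i \<in> L2 M" shows "(%x. \<Sum>i\<in>F. \<phi> i x) \<in> L2 M"
 using assms by (induction F rule: infinite_finite_induct) (auto intro!: L2_zero L2_add)

lemma L2_nn_integral:
 assumes "\<phi> \<in> L2 M"
 shows "(\<integral>\<^sup>+x. sqnorm (\<phi> x) \<partial>M) = ennreal (LINT x|M. (cmod (\<phi> x))\<^sup>2)"
 using assms by (intro nn_integral_eq_integral) (auto simp: L2_def)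

lemma L2_I_nn:
 assumes "\<phi> \<in> borel_measurable M" "(\<integral>\<^sup>+x. sqnorm (\<phi> x) \<partial>M) < \<infinity>"
 shows "\<phi> \<in> L2 M"
 using assms unfolding L2_def by (auto intro!: integrableI_nonneg)

lemma L2_inner_self:
 assumes "\<phi> \<in> L2 M"
 shows "L2_inner M \<phi> \<phi> = of_real (LINT x|M. (cmod (\<phi> x))\<^sup>2)"
 unfolding L2_inner_def complex_norm_square[symmetric] by (rule integral_of_real) (rule L2_integrable[OF assms])

lemma L2_inner_cnj: "L2_inner M \<psi> \<phi> = cnj (L2_inner M \<phi> \<psi>)"
 unfolding L2_inner_def Bochner_Integration.integral_cnj[symmetric] by (simp add: mult.commute)

lemma L2_inner_diff:
 assumes "\<phi> \<in> L2 M" "\<psi> \<in> L2 M" "\<omega> \<in> L2 M"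
 shows "L2_inner M (%x. \<phi> x - \<psi> x) \<omega> = L2_inner M \<phi> \<omega> - L2_inner M \<psi> \<omega>"
 unfolding L2_inner_def left_diff_distrib
 using assms by (intro Bochner_Integration.integral_diff L2_mult_integrable L2_cnj)

lemma L2_inner_sum:
 assumes "\<And>i. i \<in> F ==> \<phi> i \<in> L2 M" "\<omega> \<in> L2 M"
 shows "L2_inner M (%x. \<Sum>i\<in>F. c i * \<phi> i x) \<omega> = (\<Sum>i\<in>F. c i * L2_inner M (\<phi> i) \<omega>)"
proof -
 have "L2_inner M (%x. \<Sum>i\<in>F. c i * \<phi> i x) \<omega> = (LINT x|M. (\<Sum>i\<in>F. c i * (\<phi> i x * cnj (\<omega> x))))"
  unfolding L2_inner_def sum_distrib_right by (simp add: mult.assoc)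
 also have "... = (\<Sum>i\<in>F. (LINT x|M. c i * (\<phi> i x * cnj (\<omega> x))))"
  using assms by (intro Bochner_Integration.integral_sum integrable_mult_right L2_mult_integrable L2_cnj) auto
 finally show ?thesis unfolding L2_inner_def by simp
qed

definition L2_orthonormal :: "'a measure => ('a => complex) set => bool" where
 "L2_orthonormal M E \<longleftrightarrow> E \<subseteq> L2 M \<and>
  (\<forall>\<phi>\<in>E. \<forall>\<psi>\<in>E. L2_inner M \<phi> \<psi> = (if \<phi> = \<psi> then 1 else 0))"

definition L2_residual :: "'a measure => ('a => complex) set => ('a => complex) => 'a => complex" where
 "L2_residual M F \<phi> = (%x. \<phi> x - (\<Sum>e\<in>F. L2_inner M \<phi> e * e x))"

lemma L2_residual_L2:
 assumes "F \<subseteq> L2 M" "\<phi> \<in> L2 M" shows "L2_residual M F \<phi> \<in> L2 M"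
 unfolding L2_residual_def using assms by (intro L2_diff L2_sum L2_scale) auto

lemma L2_residual_inner:
 assumes E: "L2_orthonormal M E" and F: "finite F" "F \<subseteq> E" and e: "e \<in> E" and phi: "\<phi> \<in> L2 M"
 shows "L2_inner M (L2_residual M F \<phi>) e = (if e \<in> F then 0 else L2_inner M \<phi> e)"
proof -
 have sub: "E \<subseteq> L2 M" using E by (auto simp: L2_orthonormal_def)
 have "L2_inner M (L2_residual M F \<phi>) e
   = L2_inner M \<phi> e - (\<Sum>e'\<in>F. L2_inner M \<phi> e' * L2_inner M e' e)"
  unfolding L2_residual_def using sub F e phi
  by (subst L2_inner_diff) (auto intro!: L2_sum L2_scale simp: L2_inner_sum subset_eq)
 also have "(\<Sum>e'\<in>F. L2_inner M \<phi> e' * L2_inner M e' e) = (\<Sum>e'\<in>F. if e' = e then L2_inner M \<phi> e else 0)"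
  using E F e by (intro sum.cong) (auto simp: L2_orthonormal_def)
 finally show ?thesis using F by simp
qed

text \<open>Pythagoras, for two nested finite subfamilies: the residuals differ by the coefficients in between.\<close>

lemma L2_residual_diff_norm:
 assumes E: "L2_orthonormal M E" and F: "finite F" "F \<subseteq> E" and phi: "\<phi> \<in> L2 M"
  and G: "G \<subseteq> F"
 shows "(LINT x|M. (cmod (L2_residual M F \<phi> x - L2_residual M G \<phi> x))\<^sup>2)
   = (\<Sum>e\<in>F - G. (cmod (L2_inner M \<phi> e))\<^sup>2)"
proof -
 have sub: "E \<subseteq> L2 M" using E by (auto simp: L2_orthonormal_def)
 define s where "s = (%x. \<Sum>e\<in>F - G. L2_inner M \<phi> e * e x)"
 have eq: "cmod (L2_residual M F \<phi> x - L2_residual M G \<phi> x) = cmod (s x)" for x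
 proof -
  have "L2_residual M F \<phi> x - L2_residual M G \<phi> x = - s x"
   unfolding L2_residual_def s_def using F G by (subst sum_diff) auto
  then show ?thesis by (metis norm_minus_cancel)
 qed
 have sL: "s \<in> L2 M" unfolding s_def using sub F by (intro L2_sum L2_scale) auto
 have se: "L2_inner M s e = L2_inner M \<phi> e" if "e \<in> F - G" for e
 proof -
  have "L2_inner M s e = (\<Sum>e'\<in>F-G. L2_inner M \<phi> e' * L2_inner M e' e)"
   unfolding s_def using sub F that by (intro L2_inner_sum) auto
  also have "... = (\<Sum>e'\<in>F-G. if e' = e then L2_inner M \<phi> e else 0)"
   using E F that by (intro sum.cong) (auto simp: L2_orthonormal_def subset_eq)
  also have "... = L2_inner M \<phi> e" using F that by simp
  finally show ?thesis .
 qed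
 have "L2_inner M s s = (\<Sum>e\<in>F-G. L2_inner M \<phi> e * L2_inner M e s)"
  unfolding s_def[abs_def] using sub F sL[unfolded s_def[abs_def]] by (intro L2_inner_sum) auto
 also have "... = (\<Sum>e\<in>F-G. of_real ((cmod (L2_inner M \<phi> e))\<^sup>2))"
  by (intro sum.cong refl) (subst L2_inner_cnj, simp only: se complex_norm_square)
 finally have "of_real (LINT x|M. (cmod (s x))\<^sup>2) = (of_real (\<Sum>e\<in>F-G. (cmod (L2_inner M \<phi> e))\<^sup>2) :: complex)"
  by (simp add: L2_inner_self[OF sL])
 then show ?thesis unfolding eq of_real_eq_iff .
qed

lemma L2_residual_norm:
 assumes E: "L2_orthonormal M E" and F: "finite F" "F \<subseteq> E" and phi: "\<phi> \<in> L2 M"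
 shows "(LINT x|M. (cmod (L2_residual M F \<phi> x))\<^sup>2)
   = (LINT x|M. (cmod (\<phi> x))\<^sup>2) - (\<Sum>e\<in>F. (cmod (L2_inner M \<phi> e))\<^sup>2)"
proof -
 have sub: "E \<subseteq> L2 M" using E by (auto simp: L2_orthonormal_def)
 define s where "s = (%x. \<Sum>e\<in>F. L2_inner M \<phi> e * e x)"
 have sL: "s \<in> L2 M" unfolding s_def using sub F by (intro L2_sum L2_scale) auto
 define r where "r = L2_residual M F \<phi>"
 have rL: "r \<in> L2 M" unfolding r_def using sub F phi by (intro L2_residual_L2) auto
 have phieq: "\<phi> = (%x. r x - (- 1) * s x)" by (auto simp: r_def s_def L2_residual_def)
 have rs: "L2_inner M s r = 0"
  unfolding s_def using sub F rL
  by (subst L2_inner_sum) (auto intro!: sum.neutral simp: r_def L2_inner_cnj[of M _ "L2_residual M F \<phi>"]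
    L2_residual_inner[OF E F _ phi] subset_eq)
 have "L2_inner M \<phi> r = L2_inner M r r"
  by (subst phieq, subst L2_inner_diff) (use rL sL rs in \<open>auto simp: L2_inner_def intro!: L2_scale[of _ _ "-1", simplified]\<close>)
 moreover have "L2_inner M r \<phi> = L2_inner M \<phi> \<phi> - (\<Sum>e\<in>F. L2_inner M \<phi> e * L2_inner M e \<phi>)"
  unfolding r_def L2_residual_def using sub F phi
  by (subst L2_inner_diff) (auto intro!: L2_sum L2_scale simp: L2_inner_sum subset_eq)
 moreover have "(\<Sum>e\<in>F. L2_inner M \<phi> e * L2_inner M e \<phi>) = of_real (\<Sum>e\<in>F. (cmod (L2_inner M \<phi> e))\<^sup>2)"
  unfolding of_real_sum by (intro sum.cong refl) (subst (2) L2_inner_cnj, simp only: complex_norm_square)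
 moreover have "L2_inner M r \<phi> = cnj (L2_inner M \<phi> r)" by (rule L2_inner_cnj)
 ultimately have "of_real (LINT x|M. (cmod (r x))\<^sup>2)
   = (of_real ((LINT x|M. (cmod (\<phi> x))\<^sup>2) - (\<Sum>e\<in>F. (cmod (L2_inner M \<phi> e))\<^sup>2)) :: complex)"
  by (simp add: L2_inner_self[OF rL] L2_inner_self[OF phi])
 then show ?thesis unfolding of_real_eq_iff r_def .
qed

lemma Bessel:
 assumes "L2_orthonormal M E" "finite F" "F \<subseteq> E" "\<phi> \<in> L2 M"
 shows "(\<Sum>e\<in>F. (cmod (L2_inner M \<phi> e))\<^sup>2) <= (LINT x|M. (cmod (\<phi> x))\<^sup>2)"
proof -
 have "0 <= (LINT x|M. (cmod (L2_residual M F \<phi> x))\<^sup>2)" by simp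
 then show ?thesis using L2_residual_norm[OF assms] by simp
qed

text \<open>
 Completeness of \<open>L\<^sup>2\<close> for rapidly Cauchy sequences. Since \<open>a <= (2\<^sup>-\<^sup>j + 2\<^sup>j a\<^sup>2)/2\<close>, the increments are
 summable at every point where the weighted sum of their squares is finite, and this sum has
 finite integral.
\<close>

lemma L2_complete:
 fixes u :: "nat => 'a => complex"
 assumes u: "\<And>j. u j \<in> L2 M"
  and cauchy: "\<And>i j. i <= j ==> (LINT x|M. (cmod (u j x - u i x))\<^sup>2) <= (1/4)^i"
 shows "\<exists>v\<in>L2 M. \<forall>i. (LINT x|M. (cmod (v x - u i x))\<^sup>2) <= (1/4)^i"
proof -
 have um[measurable]: "u j \<in> borel_measurable M" for j using u by (auto simp: L2_def)
 have nn: "(\<integral>\<^sup>+x. sqnorm (u j x - u i x) \<partial>M) <= ennreal ((1/4)^i)" if "i <= j" for i j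
  using cauchy[OF that] L2_nn_integral[OF L2_diff[OF u u], of j i] by (simp add: ennreal_leI)
 define a where "a = (%i x. cmod (u (Suc i) x - u i x))"
 have am[measurable]: "a i \<in> borel_measurable M" for i unfolding a_def by measurable
 have "(\<integral>\<^sup>+x. (\<Sum>i. ennreal (2^i * (a i x)\<^sup>2)) \<partial>M) = (\<Sum>i. \<integral>\<^sup>+x. ennreal (2^i * (a i x)\<^sup>2) \<partial>M)"
  by (rule nn_integral_suminf) measurable
 also have "... <= (\<Sum>i. ennreal ((1/2)^i))"
 proof (rule suminf_le)
  fix i
  have "(\<integral>\<^sup>+x. ennreal (2^i * (a i x)\<^sup>2) \<partial>M) = ennreal (2^i) * (\<integral>\<^sup>+x. ennreal ((a i x)\<^sup>2) \<partial>M)"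
   by (subst nn_integral_cmult[symmetric]) (auto simp: ennreal_mult)
  also have "... <= ennreal (2^i) * ennreal ((1/4)^i)"
   unfolding a_def by (intro mult_left_mono nn) auto
  also have "... = ennreal ((1/2)^i)"
   by (simp add: ennreal_mult[symmetric] power_mult_distrib[symmetric])
  finally show "(\<integral>\<^sup>+x. ennreal (2^i * (a i x)\<^sup>2) \<partial>M) <= ennreal ((1/2)^i)" .
 qed auto
 also have "... < \<infinity>"
  by (subst suminf_ennreal2) (auto intro: summable_geometric)
 finally have fin: "(\<integral>\<^sup>+x. (\<Sum>i. ennreal (2^i * (a i x)\<^sup>2)) \<partial>M) < \<infinity>" .
 have "AE x in M. (\<Sum>i. ennreal (2^i * (a i x)\<^sup>2)) ~= \<infinity>"
  by (rule nn_integral_PInf_AE) (use fin in auto)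
 then have conv: "AE x in M. convergent (%i. u i x)"
 proof eventually_elim
  case (elim x)
  have s: "summable (%i. 2^i * (a i x)\<^sup>2)"
   by (rule summable_suminf_not_top) (use elim in auto)
  have "summable (%i. (1/2)^i + 2^i * (a i x)\<^sup>2)"
   by (intro summable_add s) (simp add: summable_geometric)
  then have "summable (%i. u (Suc i) x - u i x)"
  proof (rule summable_comparison_test'[where N=0])
   fix i :: nat
   have "2 * ((1/2)^i * (2^i * a i x)) <= ((1/2)^i) + 2^i * (a i x)\<^sup>2"
   proof -
    have "0 <= 2^i * ((1/2)^i - a i x)\<^sup>2" by simp
    also have "2^i * ((1/2)^i - a i x)\<^sup>2 = (1/2)^i - 2 * a i x + 2^i * (a i x)\<^sup>2"
     by (simp add: power2_eq_square field_simps power_one_over)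
    finally show ?thesis by (simp add: power_one_over)
   qed
   then have "a i x <= (1/2)^i + 2^i * (a i x)\<^sup>2"
    unfolding a_def by (simp add: power_one_over) (smt (verit) norm_ge_zero)
   then show "norm (u (Suc i) x - u i x) <= (1/2)^i + 2^i * (a i x)\<^sup>2" by (simp add: a_def)
  qed
  then have "convergent (%n. \<Sum>i<n. u (Suc i) x - u i x)" by (simp add: summable_iff_convergent)
  then have "convergent (%n. u n x - u 0 x)"
   unfolding sum_lessThan_telescope[where f="%n. u n x"] .
  then have "convergent (%n. (u n x - u 0 x) + u 0 x)" by (intro convergent_add convergent_const)
  then show ?case by simp
 qed
 define v where "v = (%x. lim (%i. u i x))"
 have vm[measurable]: "v \<in> borel_measurable M" unfolding v_def by measurable
 have bound: "(\<integral>\<^sup>+x. sqnorm (v x - u i x) \<partial>M) <= ennreal ((1/4)^i)" for i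
 proof -
  have "(\<integral>\<^sup>+x. sqnorm (v x - u i x) \<partial>M)
    = (\<integral>\<^sup>+x. liminf (%j. sqnorm (u j x - u i x)) \<partial>M)"
  proof (rule nn_integral_cong_AE, use conv in eventually_elim)
   case (elim x)
   have "(%j. u j x) \<longlonglongrightarrow> v x" using elim unfolding v_def by (simp add: convergent_LIMSEQ_iff)
   then have "(%j. sqnorm (u j x - u i x)) \<longlonglongrightarrow> sqnorm (v x - u i x)"
    by (intro tendsto_ennrealI tendsto_intros)
   then show ?case by (intro lim_imp_Liminf[symmetric]) auto
  qed
  also have "... <= liminf (%j. \<integral>\<^sup>+x. sqnorm (u j x - u i x) \<partial>M)"
   by (rule nn_integral_liminf) measurable
  also have "... <= limsup (%j. \<integral>\<^sup>+x. sqnorm (u j x - u i x) \<partial>M)"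
   by (rule Liminf_le_Limsup) simp
  also have "... <= ennreal ((1/4)^i)"
   by (rule Limsup_bounded) (use nn in \<open>auto simp: eventually_sequentially\<close>)
  finally show ?thesis .
 qed
 have dL: "(%x. v x - u i x) \<in> L2 M" for i
  by (rule L2_I_nn) (use bound[of i] in \<open>auto intro: le_less_trans simp del: ennreal_power\<close>)
 have "v \<in> L2 M" using L2_add[OF dL[of 0] u[of 0]] by simp
 moreover have "(LINT x|M. (cmod (v x - u i x))\<^sup>2) <= (1/4)^i" for i
  using bound[of i] unfolding L2_nn_integral[OF dL] by (subst (asm) ennreal_le_iff) auto
 ultimately show ?thesis by blast
qed

text \<open>
 Parseval without any separability: along finite subfamilies whose coefficient sums approach the
 supremum, the residuals are Cauchy; the limit is orthogonal to the whole basis, hence zero.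
\<close>

lemma Parseval:
 assumes ONB: "L2_orthonormal_basis M E" and phi: "\<phi> \<in> L2 M"
 shows "(SUP F\<in>{F. finite F \<and> F \<subseteq> E}. \<Sum>e\<in>F. sqnorm (L2_inner M \<phi> e))
   = (\<integral>\<^sup>+x. sqnorm (\<phi> x) \<partial>M)"
proof -
 have E: "L2_orthonormal M E" and sub: "E \<subseteq> L2 M"
  using ONB by (auto simp: L2_orthonormal_basis_def L2_orthonormal_def)
 have total: "AE x in M. \<psi> x = 0" if "\<psi> \<in> L2 M" "\<And>e. e \<in> E ==> L2_inner M \<psi> e = 0" for \<psi>
  using ONB that by (auto simp: L2_orthonormal_basis_def)
 define N where "N = (LINT x|M. (cmod (\<phi> x))\<^sup>2)"
 define c where "c = (%F. \<Sum>e\<in>F. (cmod (L2_inner M \<phi> e))\<^sup>2)"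
 define \<F> where "\<F> = {F. finite F \<and> F \<subseteq> E}"
 have bes: "c F <= N" if "F \<in> \<F>" for F
  unfolding c_def N_def using Bessel[OF E _ _ phi] that by (auto simp: \<F>_def)
 then have bdd: "bdd_above (c ` \<F>)" by (auto simp: bdd_above_def)
 have ne: "\<F> ~= {}" by (auto simp: \<F>_def)
 define B where "B = (SUP F\<in>\<F>. c F)"
 have cB: "c F <= B" if "F \<in> \<F>" for F unfolding B_def using bdd that by (intro cSUP_upper)
 have "\<exists>F\<in>\<F>. B - (1/4)^j < c F" for j :: nat
  unfolding B_def using ne bdd by (intro less_cSUP_iff[THEN iffD1]) auto
 then obtain F0 where F0: "\<And>j. F0 j \<in> \<F>" "\<And>j. B - (1/4)^j < c (F0 j)" by metis
 define F where "F = (%j. \<Union>i\<le>j. F0 i)"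
 have F\<F>: "F j \<in> \<F>" for j using F0(1) unfolding F_def \<F>_def by auto
 have Fmono: "F i \<subseteq> F j" if "i <= j" for i j using that unfolding F_def by (auto intro: order_trans)
 have cmono: "c G <= c F'" if "G \<subseteq> F'" "F' \<in> \<F>" for G F'
  unfolding c_def using that by (intro sum_mono2) (auto simp: \<F>_def)
 have Fc: "B - (1/4)^j < c (F j)" for j
  using F0(2)[of j] cmono[OF _ F\<F>, of "F0 j" j] by (fastforce simp: F_def)
 define u where "u = (%j. L2_residual M (F j) \<phi>)"
 have uL: "u j \<in> L2 M" for j
  unfolding u_def using F\<F>[of j] sub phi by (intro L2_residual_L2) (auto simp: \<F>_def)
 have "(LINT x|M. (cmod (u j x - u i x))\<^sup>2) <= (1/4)^i" if "i <= j" for i j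
 proof -
  have "(LINT x|M. (cmod (u j x - u i x))\<^sup>2) = c (F j - F i)"
   unfolding u_def c_def using L2_residual_diff_norm[OF E _ _ phi Fmono[OF that]] F\<F>[of j]
   by (auto simp: \<F>_def)
  also have "... = c (F j) - c (F i)"
   unfolding c_def using F\<F>[of j] Fmono[OF that] by (subst sum_diff) (auto simp: \<F>_def)
  also have "... <= (1/4)^i" using Fc[of i] cB[OF F\<F>[of j]] by linarith
  finally show ?thesis .
 qed
 from L2_complete[OF uL this] obtain v
  where v: "v \<in> L2 M" "\<And>i. (LINT x|M. (cmod (v x - u i x))\<^sup>2) <= (1/4)^i" by blast
 have "L2_inner M v e = 0" if e: "e \<in> E" for e
 proof -
  have ee: "L2_orthonormal M {e}" using E e by (auto simp: L2_orthonormal_def)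
  have b1: "(cmod (L2_inner M (u i) e))\<^sup>2 <= (1/4)^i" for i
  proof (cases "e \<in> F i")
   case True then show ?thesis
    unfolding u_def using F\<F>[of i] by (subst L2_residual_inner[OF E _ _ e phi]) (auto simp: \<F>_def)
  next
   case False
   have "insert e (F i) \<in> \<F>" using F\<F>[of i] e by (auto simp: \<F>_def)
   from cB[OF this] have "(cmod (L2_inner M \<phi> e))\<^sup>2 + c (F i) <= B"
    unfolding c_def using False F\<F>[of i] by (subst (asm) sum.insert) (auto simp: \<F>_def)
   then have "(cmod (L2_inner M \<phi> e))\<^sup>2 <= (1/4)^i" using Fc[of i] by linarith
   then show ?thesis unfolding u_def using F\<F>[of i] False
    by (subst L2_residual_inner[OF E _ _ e phi]) (auto simp: \<F>_def)
  qed
  have b2: "(cmod (L2_inner M v e - L2_inner M (u i) e))\<^sup>2 <= (1/4)^i" for i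
  proof -
   have "(cmod (L2_inner M (%x. v x - u i x) e))\<^sup>2 <= (LINT x|M. (cmod (v x - u i x))\<^sup>2)"
    using Bessel[OF ee _ _ L2_diff[OF v(1) uL[of i]], of "{e}"] by simp
   then show ?thesis using v(2)[of i] L2_inner_diff[OF v(1) uL[of i], of e] sub e by auto
  qed
  have sq: "x <= (1/2)^i" if "x\<^sup>2 <= (1/4)^i" "0 <= x" for x :: real and i :: nat
  proof -
   have "(1/4::real)^i = ((1/2)^i)\<^sup>2" by (simp add: power2_eq_square power_mult_distrib[symmetric])
   then show ?thesis using that by (auto intro: power2_le_imp_le)
  qed
  have "cmod (L2_inner M v e) <= 2 * (1/2)^i" for i
   using sq[OF b1[of i]] sq[OF b2[of i]] norm_triangle_sub[of "L2_inner M v e" "L2_inner M (u i) e"]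
   by simp
  moreover have "(%i. 2 * (1/2::real)^i) \<longlonglongrightarrow> 2 * 0"
   by (intro tendsto_intros) auto
  ultimately have "cmod (L2_inner M v e) <= 0"
   by (intro LIMSEQ_le_const[of "%i. 2 * (1/2)^i"]) auto
  then show ?thesis by simp
 qed
 from total[OF v(1) this] have v0: "AE x in M. v x = 0" .
 have "N - c (F i) <= (1/4)^i" for i
 proof -
  have "N - c (F i) = (LINT x|M. (cmod (u i x))\<^sup>2)"
   unfolding N_def c_def u_def using F\<F>[of i] by (subst L2_residual_norm[OF E _ _ phi]) (auto simp: \<F>_def)
  also have "... = (LINT x|M. (cmod (v x - u i x))\<^sup>2)"
   using L2_measurable[OF v(1)] L2_measurable[OF uL] v0 by (intro integral_cong_AE) auto
  finally show ?thesis using v(2)[of i] by simp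
 qed
 then have "N - B <= (1/4)^i" for i using cB[OF F\<F>[of i]] by (smt (verit))
 moreover have "(%i. (1/4::real)^i) \<longlonglongrightarrow> 0" by (intro tendsto_intros) auto
 ultimately have "N <= B" using LIMSEQ_le_const[of "%i. (1/4::real)^i" 0 "N - B"] by auto
 moreover have "B <= N" unfolding B_def using ne bes by (intro cSUP_least) auto
 ultimately have NB: "N = B" by simp
 have "(SUP F\<in>\<F>. \<Sum>e\<in>F. sqnorm (L2_inner M \<phi> e)) = (SUP F\<in>\<F>. ennreal (c F))"
  unfolding c_def by (subst sum_ennreal) auto
 also have "... = ennreal B"
 proof (rule antisym)
  show "(SUP F\<in>\<F>. ennreal (c F)) <= ennreal B" by (intro SUP_least ennreal_leI cB)
  have lim: "(%i. ennreal (B - (1/4)^i)) \<longlonglongrightarrow> ennreal (B - 0)"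
   by (intro tendsto_ennrealI tendsto_intros) auto
  show "ennreal B <= (SUP F\<in>\<F>. ennreal (c F))"
  proof (rule LIMSEQ_le_const2[OF lim[simplified]], intro exI allI impI)
   fix i :: nat
   show "ennreal (B - (1/4)^i) <= (SUP F\<in>\<F>. ennreal (c F))"
    using Fc[of i] F\<F>[of i] by (intro SUP_upper2[of "F i"] ennreal_leI) auto
  qed
 qed
 finally show ?thesis unfolding NB[symmetric] N_def L2_nn_integral[OF phi] \<F>_def .
qed

lemma L2_orthonormal_basis_exists: "\<exists>E. L2_orthonormal_basis M E"
proof -
 have "\<exists>E\<in>{E. L2_orthonormal M E}. \<forall>X\<in>{E. L2_orthonormal M E}. E \<subseteq> X \<longrightarrow> X = E"
 proof (rule subset_Zorn')
  fix C assume C: "subset.chain {E. L2_orthonormal M E} C"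
  have "\<exists>X\<in>C. \<phi> \<in> X \<and> \<psi> \<in> X" if "\<phi> \<in> \<Union>C" "\<psi> \<in> \<Union>C" for \<phi> \<psi>
  proof -
   from that obtain A B where AB: "A \<in> C" "B \<in> C" "\<phi> \<in> A" "\<psi> \<in> B" by blast
   then have "A \<subseteq> B \<or> B \<subseteq> A" using C by (auto simp: subset.chain_def)
   then show ?thesis using AB by auto
  qed
  note pair = this
  have X: "L2_orthonormal M X" if "X \<in> C" for X using C that by (auto simp: subset.chain_def)
  have "\<Union>C \<subseteq> L2 M" using X unfolding L2_orthonormal_def by blast
  moreover have "L2_inner M \<phi> \<psi> = (if \<phi> = \<psi> then 1 else 0)" if "\<phi> \<in> \<Union>C" "\<psi> \<in> \<Union>C" for \<phi> \<psi>
   using pair[OF that] X unfolding L2_orthonormal_def by meson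
  ultimately show "\<Union>C \<in> {E. L2_orthonormal M E}" unfolding L2_orthonormal_def by simp
 qed
 then obtain E where E: "L2_orthonormal M E"
  and max: "\<And>X. L2_orthonormal M X ==> E \<subseteq> X ==> X = E" by blast
 have "AE x in M. \<phi> x = 0" if phi: "\<phi> \<in> L2 M" and orth: "\<And>e. e \<in> E ==> L2_inner M \<phi> e = 0" for \<phi>
 proof (rule ccontr)
  assume nz: "\<not> (AE x in M. \<phi> x = 0)"
  define N where "N = (LINT x|M. (cmod (\<phi> x))\<^sup>2)"
  have "N ~= 0" unfolding N_def
   using nz integral_nonneg_eq_0_iff_AE[OF L2_integrable[OF phi]] by simp
  moreover have "0 <= N" unfolding N_def by simp
  ultimately have N: "0 < N" by simp
  define \<psi> where "\<psi> = (%x. complex_of_real (1 / sqrt N) * \<phi> x)"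
  have psiL: "\<psi> \<in> L2 M" unfolding \<psi>_def by (rule L2_scale[OF phi])
  have s1: "L2_inner M \<psi> e = 0" if "e \<in> E" for e
   using orth[OF that] unfolding \<psi>_def L2_inner_def by (simp add: mult.assoc)
  have s2: "L2_inner M e \<psi> = 0" if "e \<in> E" for e
   by (subst L2_inner_cnj) (simp add: s1[OF that])
  have "L2_inner M \<psi> \<psi> = of_real (LINT x|M. (1/N) * (cmod (\<phi> x))\<^sup>2)"
   unfolding L2_inner_self[OF psiL] unfolding \<psi>_def
   using N by (simp add: norm_mult power_mult_distrib norm_divide power_divide)
  also have "... = 1" using N by (simp add: N_def[symmetric])
  finally have s3: "L2_inner M \<psi> \<psi> = 1" .
  have notin: "\<psi> \<notin> E" using s1 s3 by force
  have "L2_inner M a b = (if a = b then 1 else 0)" if "a \<in> insert \<psi> E" "b \<in> insert \<psi> E" for a b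
  proof (cases "a = \<psi>"; cases "b = \<psi>")
   assume "a ~= \<psi>" "b ~= \<psi>"
   then show ?thesis using E that unfolding L2_orthonormal_def by blast
  qed (use s1 s2 s3 notin that in auto)
  then have "L2_orthonormal M (insert \<psi> E)"
   using E psiL unfolding L2_orthonormal_def by blast
  from max[OF this subset_insertI] notin show False by blast
 qed
 then have "L2_orthonormal_basis M E"
  using E unfolding L2_orthonormal_basis_def L2_orthonormal_def by simp
 then show ?thesis by (rule exI)
qed

text \<open>Every member of an orthonormal family is detected by some element of a total family, and by Bessel
 each of those detects only countably many.\<close>

lemma L2_orthonormal_countable:
 assumes E: "L2_orthonormal M E" and D: "countable D" "D \<subseteq> L2 M"
  and total: "\<And>\<phi>. \<phi> \<in> L2 M ==> (\<And>d. d \<in> D ==> L2_inner M d \<phi> = 0) ==> AE x in M. \<phi> x = 0"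
 shows "countable E"
proof -
 have "E \<subseteq> (\<Union>d\<in>D. {e\<in>E. (cmod (L2_inner M d e))\<^sup>2 ~= 0})"
 proof
  fix e assume e: "e \<in> E"
  then have eL: "e \<in> L2 M" and "L2_inner M e e = 1" using E by (auto simp: L2_orthonormal_def)
  moreover have "L2_inner M e e = 0" if "AE x in M. e x = 0"
   unfolding L2_inner_def using that by (intro integral_eq_zero_AE) auto
  ultimately have "\<not> (AE x in M. e x = 0)" by auto
  then show "e \<in> (\<Union>d\<in>D. {e\<in>E. (cmod (L2_inner M d e))\<^sup>2 ~= 0})" using total[OF eL] e by auto
 qed
 moreover have "countable {e\<in>E. (cmod (L2_inner M d e))\<^sup>2 ~= 0}" if "d \<in> D" for d
 proof (rule summable_countable_real, rule nonneg_bdd_above_summable_on)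
  show "bdd_above (sum (%e. (cmod (L2_inner M d e))\<^sup>2) ` {F. F \<subseteq> E \<and> finite F})"
   using Bessel[OF E, of _ d] D that by (intro bdd_aboveI2) auto
 qed auto
 ultimately show ?thesis using D(1) by (meson countable_UN countable_subset)
qed

lemma ennreal_infsum_countable:
 assumes "countable E"
 shows "\<exists>F :: nat => 'a set. incseq F \<and> (\<forall>n. finite (F n) \<and> F n \<subseteq> E) \<and>
     (\<forall>g::'a => ennreal. infsum g E = (SUP n. sum g (F n)))"
proof -
 define F where "F = (%n::nat. {e\<in>E. to_nat_on E e < n})"
 have fin: "finite (F n)" for n
 proof (rule finite_imageD)
  show "finite (to_nat_on E ` F n)" by (rule finite_subset[of _ "{..<n}"]) (auto simp: F_def)
  show "inj_on (to_nat_on E) (F n)"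
   using inj_on_to_nat_on[OF assms] by (rule inj_on_subset) (auto simp: F_def)
 qed
 have "infsum g E = (SUP n. sum g (F n))" for g :: "'a => ennreal"
 proof -
  have "infsum g E = (SUP G\<in>{G. finite G \<and> G \<subseteq> E}. sum g G)"
   by (rule nonneg_infsum_complete) auto
  also have "... = (SUP n. sum g (F n))"
  proof (rule antisym)
   show "(SUP n. sum g (F n)) <= (SUP G\<in>{G. finite G \<and> G \<subseteq> E}. sum g G)"
    using fin by (intro SUP_least SUP_upper) (auto simp: F_def)
   show "(SUP G\<in>{G. finite G \<and> G \<subseteq> E}. sum g G) <= (SUP n. sum g (F n))"
   proof (rule SUP_least)
    fix G assume G: "G \<in> {G. finite G \<and> G \<subseteq> E}"
    define n where "n = Suc (Max (to_nat_on E ` G))"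
    have "G \<subseteq> F n" using G by (auto simp: F_def n_def less_Suc_eq_le intro!: Max_ge)
    then have "sum g G <= sum g (F n)" using fin by (intro sum_mono2) auto
    then show "sum g G <= (SUP n. sum g (F n))" by (rule SUP_upper2[rotated]) simp
   qed
  qed
  finally show ?thesis .
 qed
 moreover have "incseq F" unfolding F_def by (auto simp: incseq_def)
 ultimately show ?thesis using fin by (intro exI[of _ F]) (auto simp: F_def)
qed

text \<open>
 For an operator with square integrable kernel, \<open>T e\<close> is at almost every point the inner product of a
 row of the kernel with the conjugate of \<open>e\<close>; so Parseval in each row gives the norm of the kernel.
 The basis has to be countable, since the exceptional null set depends on \<open>e\<close>.
\<close>

lemma hs_norm_kernel:
 assumes M: "sigma_finite_measure M"
  and D: "countable D" "D \<subseteq> L2 M"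
  and total: "\<And>\<phi>. \<phi> \<in> L2 M ==> (\<And>d. d \<in> D ==> L2_inner M d \<phi> = 0) ==> AE x in M. \<phi> x = 0"
  and K[measurable]: "(%(x, y). K x y) \<in> borel_measurable (M \<Otimes>\<^sub>M M)"
  and T: "\<And>e. e \<in> L2 M ==> AE x in M. T e x = (LINT y|M. K x y * e y)"
  and finI: "(\<integral>\<^sup>+x. \<integral>\<^sup>+y. sqnorm (K x y) \<partial>M \<partial>M) < \<infinity>"
 shows "(hs_norm M T)\<^sup>2 = (\<integral>\<^sup>+x. \<integral>\<^sup>+y. sqnorm (K x y) \<partial>M \<partial>M)"
proof -
 interpret sigma_finite_measure M by fact
 define E where "E = (SOME E. L2_orthonormal_basis M E)"
 have ONB: "L2_orthonormal_basis M E"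
  unfolding E_def using L2_orthonormal_basis_exists by (rule someI_ex)
 then have E: "L2_orthonormal M E" and sub: "E \<subseteq> L2 M"
  by (auto simp: L2_orthonormal_basis_def L2_orthonormal_def)
 have cE: "countable E" by (rule L2_orthonormal_countable[OF E D total])
 define I where "I = (\<integral>\<^sup>+x. \<integral>\<^sup>+y. sqnorm (K x y) \<partial>M \<partial>M)"
 have em: "e \<in> borel_measurable M" if "e \<in> E" for e using sub that by (auto simp: L2_def)
 have "AE x in M. (\<integral>\<^sup>+y. sqnorm (K x y) \<partial>M) ~= \<infinity>"
  by (rule nn_integral_PInf_AE) (use finI in auto)
 then have "AE x in M. (%y. cnj (K x y)) \<in> L2 M"
 proof (rule AE_mp, intro AE_I2 impI)
  fix x assume x: "x \<in> space M" "(\<integral>\<^sup>+y. sqnorm (K x y) \<partial>M) ~= \<infinity>"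
  have [measurable]: "(%y. K x y) \<in> borel_measurable M" using x(1) by measurable
  show "(%y. cnj (K x y)) \<in> L2 M" using x(2) by (intro L2_I_nn) (auto simp: less_top)
 qed
 moreover have "AE x in M. \<forall>e\<in>E. T e x = (LINT y|M. K x y * e y)"
  unfolding AE_ball_countable[OF cE] using T sub by blast
 ultimately have ptw: "AE x in M. (SUP F\<in>{F. finite F \<and> F \<subseteq> E}. \<Sum>e\<in>F. sqnorm (LINT y|M. K x y * e y))
   = (\<integral>\<^sup>+y. sqnorm (K x y) \<partial>M)"
 proof eventually_elim
  case (elim x)
  have "cmod (LINT y|M. K x y * e y) = cmod (L2_inner M (%y. cnj (K x y)) e)" for e
   unfolding L2_inner_def complex_cnj_mult[symmetric] Bochner_Integration.integral_cnj by simp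
  then show ?case using Parseval[OF ONB elim(1)] by simp
 qed
 obtain F where F: "incseq F" "\<And>n. finite (F n)" "\<And>n. F n \<subseteq> E"
  and Fs: "\<And>g::_ => ennreal. infsum g E = (SUP n. sum g (F n))"
  using ennreal_infsum_countable[OF cE] by blast
 have Fs': "(SUP G\<in>{G. finite G \<and> G \<subseteq> E}. sum g G) = (SUP n. sum g (F n))" for g :: "_ => ennreal"
  unfolding Fs[symmetric] by (rule nonneg_infsum_complete[symmetric]) auto
 have km: "(%x. sqnorm (LINT y|M. K x y * e y)) \<in> borel_measurable M" if "e \<in> E" for e
  using em[OF that] by measurable
 have "(\<Sum>\<^sub>\<infinity>e\<in>E. \<integral>\<^sup>+x. sqnorm (T e x) \<partial>M)
   = (\<Sum>\<^sub>\<infinity>e\<in>E. \<integral>\<^sup>+x. sqnorm (LINT y|M. K x y * e y) \<partial>M)"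
 proof (intro infsum_cong nn_integral_cong_AE)
  fix e assume "e \<in> E"
  then have "AE x in M. T e x = (LINT y|M. K x y * e y)" using T sub by blast
  then show "AE x in M. sqnorm (T e x) = sqnorm (LINT y|M. K x y * e y)"
   by eventually_elim simp
 qed
 also have "... = (SUP n. \<Sum>e\<in>F n. \<integral>\<^sup>+x. sqnorm (LINT y|M. K x y * e y) \<partial>M)"
  by (rule Fs)
 also have "... = (SUP n. \<integral>\<^sup>+x. (\<Sum>e\<in>F n. sqnorm (LINT y|M. K x y * e y)) \<partial>M)"
  using km F(3) by (intro SUP_cong refl nn_integral_sum[symmetric]) blast
 also have "... = (\<integral>\<^sup>+x. (SUP n. \<Sum>e\<in>F n. sqnorm (LINT y|M. K x y * e y)) \<partial>M)"
 proof (rule nn_integral_monotone_convergence_SUP[symmetric])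
  show "incseq (%n x. \<Sum>e\<in>F n. sqnorm (LINT y|M. K x y * e y))"
   by (intro incseq_SucI le_funI sum_mono2 F(2) incseq_SucD[OF F(1)]) simp
  show "(%x. \<Sum>e\<in>F n. sqnorm (LINT y|M. K x y * e y)) \<in> borel_measurable M" for n
   using km F(3) by (intro borel_measurable_sum) blast
 qed
 also have "... = I"
  unfolding I_def Fs'[symmetric] by (rule nn_integral_cong_AE) (rule ptw)
 finally have s: "(\<Sum>\<^sub>\<infinity>e\<in>E. \<integral>\<^sup>+x. sqnorm (T e x) \<partial>M) = I" .
 have "hs_norm M T = ennreal (sqrt (enn2real I))"
  using finI unfolding hs_norm_def E_def[symmetric] Let_def s I_def[symmetric] by (auto simp: less_top)
 then have "(hs_norm M T)\<^sup>2 = ennreal (enn2real I)" by (simp add: ennreal_power)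
 then show ?thesis using finI unfolding I_def[symmetric] by (simp add: less_top)
qed




section \<open>Gaussian integrals and the Fourier transform\<close>

lemma cis_measurable[measurable (raw)]:
 "f \<in> borel_measurable M ==> (%x. cis (f x)) \<in> borel_measurable M"
 by (rule measurable_compose[OF _ borel_measurable_continuous_onI]) (auto intro: continuous_intros)

lemma norm_integral_le_nn_integral:
 fixes f :: "_ => _ :: {banach, second_countable_topology}"
 shows "ennreal (norm (integral\<^sup>L M f)) <= (\<integral>\<^sup>+x. ennreal (norm (f x)) \<partial>M)"
 by (cases "integrable M f") (auto intro: integral_norm_bound_ennreal simp: not_integrable_integral_eq)

lemma gauss_integral_1:
 fixes t s :: real assumes t: "0 < t"
 shows "integrable lborel (%x. exp (- pi * t * x\<^sup>2))"
  and "(LINT x|lborel. exp (- pi * t * x\<^sup>2) * cis (2 * pi * (s * x))) = of_real (1 / sqrt t * exp (- pi * s\<^sup>2 / t))"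
proof -
 define c where "c = sqrt (2 * pi * t)"
 have c: "c > 0" "c\<^sup>2 = 2 * pi * t" using t by (auto simp: c_def)
 have sd: "std_normal_density (0 + c * x) = (1 / sqrt (2 * pi)) * exp (- pi * t * x\<^sup>2)" for x
  by (simp add: std_normal_density_def power_mult_distrib c(2))
 have "integrable lborel (%x. std_normal_density (0 + c * x))"
  using c by (intro lborel_integrable_real_affine integrable_normal_density) auto
 then show int: "integrable lborel (%x. exp (- pi * t * x\<^sup>2))"
  unfolding sd using integrable_mult_right[of "sqrt (2 * pi)" lborel "%x. 1 / sqrt (2 * pi) * exp (- pi * t * x\<^sup>2)"]
  by (simp add: mult.assoc[symmetric])
 define u where "u = 2 * pi * s / c"
 have "complex_of_real (exp (- (u\<^sup>2) / 2)) = char std_normal_distribution u"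
  by (simp add: char_std_normal_distribution)
 also have "... = (LINT x|lborel. std_normal_density x *\<^sub>R iexp (u * x))"
  unfolding char_def by (subst integral_density) (auto simp: normal_density_nonneg)
 also have "... = \<bar>c\<bar> *\<^sub>R (LINT x|lborel. std_normal_density (0 + c * x) *\<^sub>R iexp (u * (0 + c * x)))"
  using c by (intro lborel_integral_real_affine) auto
 also have "... = (LINT x|lborel. complex_of_real (sqrt t) * (exp (- pi * t * x\<^sup>2) * cis (2 * pi * (s * x))))"
  unfolding integral_scaleR_right[symmetric]
 proof (intro Bochner_Integration.integral_cong refl)
  fix x
  have u: "u * (0 + c * x) = 2 * pi * (s * x)" using c by (simp add: u_def)
  have st: "sqrt t = \<bar>c\<bar> * (1 / sqrt (2 * pi))" using t by (simp add: c_def real_sqrt_mult abs_mult)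
  show "\<bar>c\<bar> *\<^sub>R (std_normal_density (0 + c * x) *\<^sub>R iexp (u * (0 + c * x)))
    = complex_of_real (sqrt t) * (exp (- pi * t * x\<^sup>2) * cis (2 * pi * (s * x)))"
   unfolding sd u st cis_conv_exp scaleR_conv_of_real of_real_mult by (simp only: mult.assoc)
 qed
 finally have "complex_of_real (sqrt t) * (LINT x|lborel. exp (- pi * t * x\<^sup>2) * cis (2 * pi * (s * x)))
   = of_real (exp (- (u\<^sup>2) / 2))" by simp
 moreover have "u\<^sup>2 / 2 = pi * s\<^sup>2 / t"
 proof -
  have "u\<^sup>2 / 2 = 4 * pi\<^sup>2 * s\<^sup>2 / (2 * pi * t) / 2" unfolding u_def power_divide c(2) by (simp add: power_mult_distrib)
  then show ?thesis using t by (simp add: power2_eq_square)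
 qed
 ultimately show "(LINT x|lborel. exp (- pi * t * x\<^sup>2) * cis (2 * pi * (s * x))) = of_real (1 / sqrt t * exp (- pi * s\<^sup>2 / t))"
  using t by (simp add: field_simps)
qed

lemma integrable_pair_bounded:
 fixes f g :: "_ => complex"
 assumes "sigma_finite_measure M" "sigma_finite_measure N"
  and f: "integrable M f" and g: "integrable N g"
  and b[measurable]: "(%(x, y). b x y) \<in> borel_measurable (M \<Otimes>\<^sub>M N)"
  and bd: "\<And>x y. x \<in> space M ==> y \<in> space N ==> cmod (b x y) <= B"
 shows "integrable (M \<Otimes>\<^sub>M N) (%(x, y). f x * g y * b x y)"
proof -
 interpret M: sigma_finite_measure M by fact
 interpret N: sigma_finite_measure N by fact
 interpret P: pair_sigma_finite M N ..
 have [measurable]: "f \<in> borel_measurable M" "g \<in> borel_measurable N" using f g by auto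
 have "integrable (M \<Otimes>\<^sub>M N) (%(x, y). f x * g y)"
  by (rule P.Fubini_integrable) (use f g in \<open>auto simp: norm_mult split_beta'\<close>)
 then have "integrable (M \<Otimes>\<^sub>M N) (%z. of_real B * (case z of (x, y) => f x * g y))" by simp
 then show ?thesis
 proof (rule Bochner_Integration.integrable_bound)
  show "(%(x, y). f x * g y * b x y) \<in> borel_measurable (M \<Otimes>\<^sub>M N)" by measurable
  show "AE z in M \<Otimes>\<^sub>M N. norm (case z of (x, y) => f x * g y * b x y)
    <= norm (of_real B * (case z of (x, y) => f x * g y))"
  proof (rule AE_I2, clarify)
   fix x y assume "(x, y) \<in> space (M \<Otimes>\<^sub>M N)"
   then have "cmod (b x y) <= \<bar>B\<bar>" using bd[of x y] by (auto simp: space_pair_measure)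
   then show "norm (f x * g y * b x y) <= norm (of_real B * (f x * g y))"
    by (simp add: norm_mult mult.commute) (intro mult_right_mono, auto)
  qed
 qed
qed

text \<open>
 What the Fourier transform of a Euclidean space needs to know about it: the pairing \<open>p\<close>, the squared
 norm \<open>q\<close>, the squared distance \<open>\<delta>\<close>, and the transform of the Gaussians. Euclidean spaces,
 finite powers of the line given as spaces of functions, and products of these are of this kind.
\<close>

locale gaussian_space = sigma_finite_measure M
 for M :: "'a measure" and p \<delta> :: "'a => 'a => real" and q :: "'a => real" and D :: nat +
 assumes p_measurable[measurable]: "(%(x, y). p x y) \<in> borel_measurable (M \<Otimes>\<^sub>M M)"
  and \<delta>_measurable[measurable]: "(%(x, y). \<delta> x y) \<in> borel_measurable (M \<Otimes>\<^sub>M M)"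
  and q_measurable[measurable]: "q \<in> borel_measurable M"
  and q_nonneg: "x \<in> space M ==> 0 <= q x"
  and \<delta>_sym: "\<delta> x y = \<delta> y x"
  and gauss_integrable: "0 < t ==> integrable M (%s. exp (- pi * t * q s))"
  and gauss_char: "[|0 < t; x \<in> space M; y \<in> space M|] ==>
     (LINT s|M. exp (- pi * t * q s) * cis (2 * pi * (p s x - p s y)))
      = of_real ((1 / sqrt t) ^ D * exp (- pi * \<delta> x y / t))"
  and gauss_mass: "[|0 < t; y \<in> space M|] ==>
     (\<integral>\<^sup>+x. ennreal (exp (- pi * t * \<delta> x y)) \<partial>M) = ennreal ((1 / sqrt t) ^ D)"
begin

definition ft :: "('a => complex) => 'a => complex" where
 "ft h s = (LINT x|M. h x * cis (- (2 * pi * p s x)))"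

lemma ft_measurable[measurable]:
 assumes [measurable]: "h \<in> borel_measurable M"
 shows "ft h \<in> borel_measurable M"
 unfolding ft_def by measurable

lemma ft_bound:
 assumes "integrable M h"
 shows "cmod (ft h s) <= (LINT x|M. cmod (h x))"
proof -
 have "cmod (ft h s) <= (LINT x|M. cmod (h x * cis (- (2 * pi * p s x))))"
  unfolding ft_def by (rule integral_norm_bound)
 then show ?thesis by (simp add: norm_mult)
qed

text \<open>The Fourier transform of a Gaussian, tested against an integrable function.\<close>

lemma gauss_pairing:
 assumes h: "integrable M h" and t: "0 < t" and a: "a \<in> space M"
 shows "(LINT x|M. h x * of_real ((1 / sqrt t) ^ D * exp (- pi * \<delta> a x / t)))
   = (LINT s|M. exp (- pi * t * q s) * cis (2 * pi * p s a) * ft h s)"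
proof -
 have [measurable]: "h \<in> borel_measurable M" using h by auto
 interpret P: pair_sigma_finite M M ..
 define F where "F = (%x s. h x * exp (- pi * t * q s) * cis (2 * pi * (p s a - p s x)))"
 have F: "integrable (M \<Otimes>\<^sub>M M) (%(x, s). F x s)"
  unfolding F_def using a gauss_integrable[OF t] h
  by (intro integrable_pair_bounded[where B=1] sigma_finite_measure_axioms) (auto intro: integrable_of_real)
 have "(LINT x|M. h x * of_real ((1 / sqrt t) ^ D * exp (- pi * \<delta> a x / t)))
   = (LINT x|M. (LINT s|M. F x s))"
  unfolding F_def
 proof (intro Bochner_Integration.integral_cong refl)
  fix x assume x: "x \<in> space M"
  have "(LINT s|M. h x * exp (- pi * t * q s) * cis (2 * pi * (p s a - p s x)))
    = h x * (LINT s|M. exp (- pi * t * q s) * cis (2 * pi * (p s a - p s x)))"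
   by (subst integral_mult_right_zero[symmetric]) (simp add: mult.assoc)
  then show "h x * of_real ((1 / sqrt t) ^ D * exp (- pi * \<delta> a x / t))
    = (LINT s|M. h x * exp (- pi * t * q s) * cis (2 * pi * (p s a - p s x)))"
   using gauss_char[OF t a x] by simp
 qed
 also have "... = (LINT s|M. (LINT x|M. F x s))"
  by (rule P.Fubini_integral[symmetric, OF F])
 also have "... = (LINT s|M. exp (- pi * t * q s) * cis (2 * pi * p s a) * ft h s)"
 proof (intro Bochner_Integration.integral_cong refl)
  fix s
  have "F x s = exp (- pi * t * q s) * cis (2 * pi * p s a) * (h x * cis (- (2 * pi * p s x)))" for x
   unfolding F_def by (simp add: cis_mult right_diff_distrib mult.assoc)
  then show "(LINT x|M. F x s) = exp (- pi * t * q s) * cis (2 * pi * p s a) * ft h s"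
   by (simp add: ft_def)
 qed
 finally show ?thesis .
qed

text \<open>
 Half of Plancherel. Damped by a Gaussian, the integral of \<open>|ft h|\<^sup>2\<close> is a double integral of
 \<open>h(x)\<close>, the conjugate of \<open>h(y)\<close> and a positive kernel of mass one; then use \<open>2|ab| <= |a|\<^sup>2 + |b|\<^sup>2\<close> and remove the damping.
\<close>

lemma plancherel_le:
 assumes h: "integrable M h"
 shows "(\<integral>\<^sup>+s. sqnorm (ft h s) \<partial>M) <= (\<integral>\<^sup>+x. sqnorm (h x) \<partial>M)"
proof -
 have [measurable]: "h \<in> borel_measurable M" using h by auto
 interpret P: pair_sigma_finite M M ..
 define R where "R = (\<integral>\<^sup>+x. sqnorm (h x) \<partial>M)"
 define L where "L = (LINT x|M. cmod (h x))"
 have damped: "(\<integral>\<^sup>+s. ennreal (exp (- pi * t * q s) * (cmod (ft h s))\<^sup>2) \<partial>M) <= R" if t: "0 < t" for t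
 proof -
  define w where "w = (%s. exp (- pi * t * q s))"
  have [measurable]: "w \<in> borel_measurable M" unfolding w_def by measurable
  have wi: "integrable M (%s. complex_of_real (w s))" unfolding w_def by (intro integrable_of_real gauss_integrable t)
  define k where "k = (%x y. (1 / sqrt t) ^ D * exp (- pi * \<delta> x y / t))"
  have k0: "0 <= k x y" for x y unfolding k_def using t by simp
  have [measurable]: "(%(x, y). k x y) \<in> borel_measurable (M \<Otimes>\<^sub>M M)" unfolding k_def by measurable
  have kmass: "(\<integral>\<^sup>+x. ennreal (k x y) \<partial>M) = 1" if "y \<in> space M" for y
  proof -
   have "(\<integral>\<^sup>+x. ennreal (k x y) \<partial>M)
     = ennreal ((1 / sqrt t) ^ D) * (\<integral>\<^sup>+x. ennreal (exp (- pi * (1/t) * \<delta> x y)) \<partial>M)"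
    unfolding k_def using t that by (subst nn_integral_cmult[symmetric]) (auto simp: ennreal_mult)
   also have "... = ennreal ((1 / sqrt t) ^ D * (1 / sqrt (1 / t)) ^ D)"
    using t that by (subst gauss_mass) (auto simp: ennreal_mult)
   also have "(1 / sqrt t) ^ D * (1 / sqrt (1 / t)) ^ D = 1"
    using t by (simp add: power_mult_distrib[symmetric] real_sqrt_divide)
   finally show ?thesis by simp
  qed
  have ksym: "k x y = k y x" for x y unfolding k_def by (subst \<delta>_sym) simp
  have Lb: "cmod (ft h s) <= L" for s unfolding L_def by (rule ft_bound[OF h])
  have damp_int: "integrable M (%s. w s * (cmod (ft h s))\<^sup>2)"
  proof (rule Bochner_Integration.integrable_bound)
   show "integrable M (%s. w s * L\<^sup>2)" unfolding w_def by (intro integrable_mult_left gauss_integrable t)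
   show "AE s in M. norm (w s * (cmod (ft h s))\<^sup>2) <= norm (w s * L\<^sup>2)"
    using Lb by (intro AE_I2) (auto simp: abs_mult w_def intro!: power_mono)
  qed measurable
  \<comment> \<open>expand one factor \<open>ft h\<close>, then the other, and integrate out the frequency\<close>
  have inner: "(LINT s|M. w s * cis (- (2 * pi * p s x)) * cnj (ft h s)) = (LINT y|M. cnj (h y) * of_real (k x y))"
   if x: "x \<in> space M" for x
  proof -
   have "(LINT s|M. w s * cis (- (2 * pi * p s x)) * cnj (ft h s))
     = cnj (LINT s|M. w s * cis (2 * pi * p s x) * ft h s)"
    by (subst Bochner_Integration.integral_cnj[symmetric]) (simp add: cis_cnj)
   also have "... = cnj (LINT y|M. h y * of_real (k x y))"
    unfolding w_def k_def by (subst gauss_pairing[OF h t x]) simp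
   finally show ?thesis by (subst (asm) Bochner_Integration.integral_cnj[symmetric]) simp
  qed
  have F: "integrable (M \<Otimes>\<^sub>M M) (%(x, s). h x * w s * (cis (- (2 * pi * p s x)) * cnj (ft h s)))"
   using h wi Lb by (intro integrable_pair_bounded[where B=L] sigma_finite_measure_axioms) (auto simp: norm_mult)
  have "complex_of_real (LINT s|M. w s * (cmod (ft h s))\<^sup>2) = (LINT s|M. of_real (w s * (cmod (ft h s))\<^sup>2))"
   by (rule integral_of_real[OF damp_int, symmetric])
  also have "... = (LINT s|M. (LINT x|M. h x * w s * (cis (- (2 * pi * p s x)) * cnj (ft h s))))"
  proof (intro Bochner_Integration.integral_cong refl)
   fix s
   have "(LINT x|M. h x * w s * (cis (- (2 * pi * p s x)) * cnj (ft h s)))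
     = (LINT x|M. (w s * cnj (ft h s)) * (h x * cis (- (2 * pi * p s x))))"
    by (intro Bochner_Integration.integral_cong refl) (simp add: mult_ac)
   also have "... = w s * cnj (ft h s) * ft h s" by (simp add: ft_def)
   finally show "of_real (w s * (cmod (ft h s))\<^sup>2)
     = (LINT x|M. h x * w s * (cis (- (2 * pi * p s x)) * cnj (ft h s)))"
    by (simp add: complex_norm_square mult_ac del: of_real_power)
  qed
  also have "... = (LINT x|M. (LINT s|M. h x * w s * (cis (- (2 * pi * p s x)) * cnj (ft h s))))"
   by (rule P.Fubini_integral[OF F])
  also have "... = (LINT x|M. h x * (LINT y|M. cnj (h y) * of_real (k x y)))"
  proof (intro Bochner_Integration.integral_cong refl)
   fix x assume x: "x \<in> space M"
   have "(LINT s|M. h x * w s * (cis (- (2 * pi * p s x)) * cnj (ft h s)))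
     = h x * (LINT s|M. w s * cis (- (2 * pi * p s x)) * cnj (ft h s))"
    by (subst integral_mult_right_zero[symmetric]) (simp add: mult.assoc)
   then show "(LINT s|M. h x * w s * (cis (- (2 * pi * p s x)) * cnj (ft h s)))
     = h x * (LINT y|M. cnj (h y) * of_real (k x y))" using inner[OF x] by simp
  qed
  finally have eq: "complex_of_real (LINT s|M. w s * (cmod (ft h s))\<^sup>2)
    = (LINT x|M. h x * (LINT y|M. cnj (h y) * of_real (k x y)))" .
  have "(\<integral>\<^sup>+s. ennreal (w s * (cmod (ft h s))\<^sup>2) \<partial>M) = ennreal (LINT s|M. w s * (cmod (ft h s))\<^sup>2)"
   by (intro nn_integral_eq_integral damp_int AE_I2) (auto simp: w_def)
  also have "... <= ennreal (cmod (LINT x|M. h x * (LINT y|M. cnj (h y) * of_real (k x y))))"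
   unfolding eq[symmetric] by (simp add: ennreal_leI)
  also have "... <= (\<integral>\<^sup>+x. ennreal (cmod (h x * (LINT y|M. cnj (h y) * of_real (k x y)))) \<partial>M)"
   by (rule norm_integral_le_nn_integral) 
  also have "... <= (\<integral>\<^sup>+x. \<integral>\<^sup>+y. ennreal (cmod (h x) * (cmod (h y) * k x y)) \<partial>M \<partial>M)"
  proof (intro nn_integral_mono)
   fix x assume x: "x \<in> space M"
   have "ennreal (cmod (h x * (LINT y|M. cnj (h y) * of_real (k x y))))
     = ennreal (cmod (h x)) * ennreal (cmod (LINT y|M. cnj (h y) * of_real (k x y)))"
    by (simp add: norm_mult ennreal_mult)
   also have "... <= ennreal (cmod (h x)) * (\<integral>\<^sup>+y. ennreal (cmod (cnj (h y) * of_real (k x y))) \<partial>M)"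
    by (intro mult_left_mono norm_integral_le_nn_integral) auto
   also have "... = (\<integral>\<^sup>+y. ennreal (cmod (h x) * (cmod (h y) * k x y)) \<partial>M)"
    using x k0 by (subst nn_integral_cmult[symmetric]) (auto simp: norm_mult ennreal_mult)
   finally show "ennreal (cmod (h x * (LINT y|M. cnj (h y) * of_real (k x y))))
     <= (\<integral>\<^sup>+y. ennreal (cmod (h x) * (cmod (h y) * k x y)) \<partial>M)" .
  qed
  also have "... <= (\<integral>\<^sup>+x. \<integral>\<^sup>+y. (ennreal ((cmod (h x))\<^sup>2 / 2) * ennreal (k y x) + ennreal ((cmod (h y))\<^sup>2 / 2) * ennreal (k x y)) \<partial>M \<partial>M)"
  proof (intro nn_integral_mono)
   fix x y
   have "cmod (h x) * cmod (h y) <= (cmod (h x))\<^sup>2 / 2 + (cmod (h y))\<^sup>2 / 2"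
    using sum_squares_bound[of "cmod (h x)" "cmod (h y)"] by simp
   then have "cmod (h x) * cmod (h y) * k x y <= ((cmod (h x))\<^sup>2 / 2 + (cmod (h y))\<^sup>2 / 2) * k x y"
    by (intro mult_right_mono k0)
   then have "ennreal (cmod (h x) * (cmod (h y) * k x y)) <= ennreal ((cmod (h x))\<^sup>2 / 2 * k y x + (cmod (h y))\<^sup>2 / 2 * k x y)"
    by (intro ennreal_leI) (simp add: ksym[of y x] algebra_simps)
   then show "ennreal (cmod (h x) * (cmod (h y) * k x y))
     <= ennreal ((cmod (h x))\<^sup>2 / 2) * ennreal (k y x) + ennreal ((cmod (h y))\<^sup>2 / 2) * ennreal (k x y)"
    by (simp add: k0 flip: ennreal_mult ennreal_plus)
  qed
  also have "... = (\<integral>\<^sup>+x. \<integral>\<^sup>+y. ennreal ((cmod (h x))\<^sup>2 / 2) * ennreal (k y x) \<partial>M \<partial>M)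
    + (\<integral>\<^sup>+x. \<integral>\<^sup>+y. ennreal ((cmod (h y))\<^sup>2 / 2) * ennreal (k x y) \<partial>M \<partial>M)"
   by (subst nn_integral_add[symmetric]) (auto intro!: nn_integral_cong nn_integral_add)
  also have "(\<integral>\<^sup>+x. \<integral>\<^sup>+y. ennreal ((cmod (h y))\<^sup>2 / 2) * ennreal (k x y) \<partial>M \<partial>M)
    = (\<integral>\<^sup>+x. \<integral>\<^sup>+y. ennreal ((cmod (h x))\<^sup>2 / 2) * ennreal (k y x) \<partial>M \<partial>M)"
   by (rule P.Fubini') measurable
  also have "(\<integral>\<^sup>+x. \<integral>\<^sup>+y. ennreal ((cmod (h x))\<^sup>2 / 2) * ennreal (k y x) \<partial>M \<partial>M) = (\<integral>\<^sup>+x. ennreal ((cmod (h x))\<^sup>2 / 2) \<partial>M)"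
   by (intro nn_integral_cong) (simp add: nn_integral_cmult kmass)
  also have "(\<integral>\<^sup>+x. ennreal ((cmod (h x))\<^sup>2 / 2) \<partial>M) + (\<integral>\<^sup>+x. ennreal ((cmod (h x))\<^sup>2 / 2) \<partial>M) = R"
   unfolding R_def by (subst nn_integral_add[symmetric]) (auto simp flip: ennreal_plus)
  finally show ?thesis unfolding w_def .
 qed
 have "(\<integral>\<^sup>+s. sqnorm (ft h s) \<partial>M)
   = (\<integral>\<^sup>+s. liminf (%n. ennreal (exp (- pi * (1 / real (Suc n)) * q s) * (cmod (ft h s))\<^sup>2)) \<partial>M)"
 proof (intro nn_integral_cong)
  fix s
  have "(%n. exp (- pi * (1 / real (Suc n)) * q s) * (cmod (ft h s))\<^sup>2) \<longlonglongrightarrow> exp (- pi * 0 * q s) * (cmod (ft h s))\<^sup>2"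
   by (intro tendsto_intros LIMSEQ_Suc[OF lim_1_over_n])
  then have "(%n. ennreal (exp (- pi * (1 / real (Suc n)) * q s) * (cmod (ft h s))\<^sup>2)) \<longlonglongrightarrow> sqnorm (ft h s)"
   by (intro tendsto_ennrealI) simp
  then show "sqnorm (ft h s) = liminf (%n. ennreal (exp (- pi * (1 / real (Suc n)) * q s) * (cmod (ft h s))\<^sup>2))"
   by (intro lim_imp_Liminf[symmetric]) auto
 qed
 also have "... <= liminf (%n. \<integral>\<^sup>+s. ennreal (exp (- pi * (1 / real (Suc n)) * q s) * (cmod (ft h s))\<^sup>2) \<partial>M)"
  by (rule nn_integral_liminf) measurable
 also have "... <= limsup (%n. \<integral>\<^sup>+s. ennreal (exp (- pi * (1 / real (Suc n)) * q s) * (cmod (ft h s))\<^sup>2) \<partial>M)"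
  by (rule Liminf_le_Limsup) simp
 also have "... <= R"
  by (rule Limsup_bounded) (intro always_eventually allI damped, simp)
 finally show ?thesis unfolding R_def .
qed

end


lemma cis_sum: "cis (\<Sum>i\<in>I. f i) = (\<Prod>i\<in>I. cis (f i))"
 by (induction I rule: infinite_finite_induct) (auto simp: cis_mult[symmetric])

lemma gauss_mass_1:
 fixes t y :: real assumes t: "0 < t"
 shows "(\<integral>\<^sup>+x. ennreal (exp (- pi * t * (x - y)\<^sup>2)) \<partial>lborel) = ennreal (1 / sqrt t)"
proof -
 have "complex_of_real (LINT x|lborel. exp (- pi * t * x\<^sup>2)) = (LINT x|lborel. of_real (exp (- pi * t * x\<^sup>2)))"
  by (rule integral_of_real[OF gauss_integral_1(1)[OF t], symmetric])
 also have "... = of_real (1 / sqrt t)"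
  using gauss_integral_1(2)[OF t, of 0] by simp
 finally have v: "(LINT x|lborel. exp (- pi * t * x\<^sup>2)) = 1 / sqrt t" by (simp only: of_real_eq_iff)
 have "(\<integral>\<^sup>+x. ennreal (exp (- pi * t * (x - y)\<^sup>2)) \<partial>lborel)
   = (\<integral>\<^sup>+x. ennreal (exp (- pi * t * x\<^sup>2)) \<partial>lborel)"
  by (subst nn_integral_real_affine[where c=1 and t=y]) (auto simp: add.commute)
 also have "... = ennreal (1 / sqrt t)"
  unfolding v[symmetric] by (intro nn_integral_eq_integral gauss_integral_1(1)[OF t]) auto
 finally show ?thesis .
qed

lemma gaussian_space_PiM:
 assumes fin: "finite I"
 shows "gaussian_space (Pi\<^sub>M I (%_. lborel)) (%s x. \<Sum>i\<in>I. s i * x i)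
     (%x y. \<Sum>i\<in>I. (x i - y i)\<^sup>2) (%x. \<Sum>i\<in>I. (x i)\<^sup>2) (card I)"
proof -
 interpret L: product_sigma_finite "%_::'a. lborel :: real measure" ..
 interpret finite_product_sigma_finite "%_::'a. lborel :: real measure" I by standard (rule fin)
 have e: "exp (- pi * t * (\<Sum>i\<in>I. (s i)\<^sup>2)) = (\<Prod>i\<in>I. exp (- pi * t * (s i)\<^sup>2))" for t and s :: "'a => real"
  using fin by (simp add: sum_distrib_left exp_sum)
 show ?thesis
 proof (unfold_locales, goal_cases)
  case (6 t)
  show ?case unfolding e by (intro L.product_integrable_prod fin gauss_integral_1(1) 6)
 next
  case (7 t x y)
  have "exp (- pi * t * (\<Sum>i\<in>I. (s i)\<^sup>2)) * cis (2 * pi * ((\<Sum>i\<in>I. s i * x i) - (\<Sum>i\<in>I. s i * y i)))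
    = (\<Prod>i\<in>I. exp (- pi * t * (s i)\<^sup>2) * cis (2 * pi * ((x i - y i) * s i)))" for s
   unfolding e prod.distrib cis_sum[symmetric] of_real_prod
   by (simp add: sum_distrib_left sum_subtractf algebra_simps)
  then have "(LINT s|(Pi\<^sub>M I (%_. lborel)). exp (- pi * t * (\<Sum>i\<in>I. (s i)\<^sup>2)) * cis (2 * pi * ((\<Sum>i\<in>I. s i * x i) - (\<Sum>i\<in>I. s i * y i))))
    = (LINT s|(Pi\<^sub>M I (%_. lborel)). (\<Prod>i\<in>I. exp (- pi * t * (s i)\<^sup>2) * cis (2 * pi * ((x i - y i) * s i))))"
   by simp
  also have "... = (\<Prod>i\<in>I. \<integral>s. exp (- pi * t * s\<^sup>2) * cis (2 * pi * ((x i - y i) * s)) \<partial>lborel)"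
  proof (rule L.product_integral_prod[OF fin])
   fix i
   show "integrable lborel (%s. exp (- pi * t * s\<^sup>2) * cis (2 * pi * ((x i - y i) * s)))"
    by (rule Bochner_Integration.integrable_bound[OF gauss_integral_1(1)[OF 7(1)]]) (auto simp: norm_mult)
  qed
  also have "... = (\<Prod>i\<in>I. of_real (1 / sqrt t * exp (- pi * (x i - y i)\<^sup>2 / t)))"
   by (intro prod.cong refl gauss_integral_1(2) 7(1))
  also have "... = of_real ((1 / sqrt t) ^ card I * exp (- pi * (\<Sum>i\<in>I. (x i - y i)\<^sup>2) / t))"
   unfolding of_real_prod[symmetric] prod.distrib using fin
   by (simp add: sum_distrib_left sum_divide_distrib exp_sum)
  finally show ?case .
 next
  case (8 t y)
  have "(\<integral>\<^sup>+x. ennreal (exp (- pi * t * (\<Sum>i\<in>I. (x i - y i)\<^sup>2))) \<partial>Pi\<^sub>M I (%_. lborel))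
    = (\<integral>\<^sup>+x. (\<Prod>i\<in>I. ennreal (exp (- pi * t * (x i - y i)\<^sup>2))) \<partial>Pi\<^sub>M I (%_. lborel))"
   by (subst prod_ennreal) (use fin in \<open>auto simp: sum_distrib_left exp_sum\<close>)
  also have "... = (\<Prod>i\<in>I. \<integral>\<^sup>+x. ennreal (exp (- pi * t * (x - y i)\<^sup>2)) \<partial>lborel)"
   by (rule L.product_nn_integral_prod) (use fin in auto)
  also have "... = ennreal ((1 / sqrt t) ^ card I)"
   unfolding gauss_mass_1[OF 8(1)] using 8(1) by (simp add: ennreal_power)
  finally show ?case .
 qed (auto intro!: sum_nonneg simp: power2_commute)
qed

lemma gaussian_space_prod:
 assumes "gaussian_space M p1 \<delta>1 q1 D1" "gaussian_space N p2 \<delta>2 q2 D2"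
 shows "gaussian_space (M \<Otimes>\<^sub>M N) (%(a, b) (c, d). p1 a c + p2 b d) (%(a, b) (c, d). \<delta>1 a c + \<delta>2 b d)
     (%(a, b). q1 a + q2 b) (D1 + D2)"
proof -
 interpret A: gaussian_space M p1 \<delta>1 q1 D1 by fact
 interpret B: gaussian_space N p2 \<delta>2 q2 D2 by fact
 interpret P: pair_sigma_finite M N ..
 have int: "integrable (M \<Otimes>\<^sub>M N) (%s. complex_of_real (exp (- pi * t * (case s of (a, b) => q1 a + q2 b))) * cis (c s))"
  if [measurable]: "c \<in> borel_measurable (M \<Otimes>\<^sub>M N)" and t: "0 < t" for c t
 proof -
  have "integrable (M \<Otimes>\<^sub>M N) (%(a, b). complex_of_real (exp (- pi * t * q1 a)) * complex_of_real (exp (- pi * t * q2 b)) * cis (c (a, b)))"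
   using A.gauss_integrable[OF t] B.gauss_integrable[OF t]
   by (intro integrable_pair_bounded[where B=1] A.sigma_finite_measure_axioms B.sigma_finite_measure_axioms)
    (auto intro!: integrable_of_real)
  then show ?thesis
   by (rule Bochner_Integration.integrable_cong[THEN iffD1, OF refl, rotated])
    (auto simp: algebra_simps exp_diff exp_minus exp_add field_simps)
 qed
 show ?thesis
 proof (unfold_locales, goal_cases)
  case 1
  show ?case unfolding split_beta' by measurable
 next
  case 2
  show ?case unfolding split_beta' by measurable
 next
  case (6 t)
  then show ?case using integrable_norm[OF int[of "%_. 0" t]] by (simp add: split_beta')
 next
  case (7 t x y)
  obtain x1 x2 y1 y2 where xy: "x = (x1, x2)" "y = (y1, y2)" by (cases x, cases y) auto
  have sp: "x1 \<in> space M" "x2 \<in> space N" "y1 \<in> space M" "y2 \<in> space N"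
   using 7 by (auto simp: xy space_pair_measure)
  define F where "F = (%a. exp (- pi * t * q1 a) * cis (2 * pi * (p1 a x1 - p1 a y1)))"
  define G where "G = (%b. exp (- pi * t * q2 b) * cis (2 * pi * (p2 b x2 - p2 b y2)))"
  define c where "c = (%s. 2 * pi * ((case s of (a, b) => p1 a x1 + p2 b x2) - (case s of (a, b) => p1 a y1 + p2 b y2)))"
  have [measurable]: "c \<in> borel_measurable (M \<Otimes>\<^sub>M N)" unfolding c_def using sp by measurable
  have eq: "complex_of_real (exp (- pi * t * (case s of (a, b) => q1 a + q2 b))) * cis (c s) = F (fst s) * G (snd s)" for s
  proof -
   have "exp (- pi * t * (q1 a + q2 b)) = exp (- pi * t * q1 a) * exp (- pi * t * q2 b)" for a b
    unfolding exp_add[symmetric] by (simp add: algebra_simps)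
   moreover have "cis (2 * pi * ((u + v) - (u' + v'))) = cis (2 * pi * (u - u')) * cis (2 * pi * (v - v'))" for u v u' v'
    unfolding cis_mult by (simp add: algebra_simps)
   ultimately show ?thesis by (simp add: F_def G_def c_def split_beta')
  qed
  have FG: "integrable (M \<Otimes>\<^sub>M N) (%s. F (fst s) * G (snd s))"
   using int[of c t] 7(1) unfolding eq by simp
  have "(LINT s|(M \<Otimes>\<^sub>M N). F (fst s) * G (snd s)) = (LINT a|M. (LINT b|N. F a * G b))"
   by (subst P.integral_fst'[OF FG, symmetric]) simp
  also have "... = (LINT a|M. F a) * (LINT b|N. G b)" by simp
  also have "(LINT a|M. F a) = of_real ((1 / sqrt t) ^ D1 * exp (- pi * \<delta>1 x1 y1 / t))"
   unfolding F_def using 7(1) sp by (intro A.gauss_char)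
  also have "(LINT b|N. G b) = of_real ((1 / sqrt t) ^ D2 * exp (- pi * \<delta>2 x2 y2 / t))"
   unfolding G_def using 7(1) sp by (intro B.gauss_char)
  also have "complex_of_real ((1 / sqrt t) ^ D1 * exp (- pi * \<delta>1 x1 y1 / t)) * of_real ((1 / sqrt t) ^ D2 * exp (- pi * \<delta>2 x2 y2 / t))
    = of_real ((1 / sqrt t) ^ (D1 + D2) * exp (- pi * (\<delta>1 x1 y1 + \<delta>2 x2 y2) / t))"
  proof -
   have "exp (- pi * (\<delta>1 x1 y1 + \<delta>2 x2 y2) / t) = exp (- pi * \<delta>1 x1 y1 / t) * exp (- pi * \<delta>2 x2 y2 / t)"
    unfolding exp_add[symmetric] using 7(1) by (simp add: field_simps)
   then show ?thesis by (simp add: power_add)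
  qed
  finally show ?case by (simp add: xy eq[symmetric] c_def split_beta')
 next
  case (8 t y)
  obtain y1 y2 where xy: "y = (y1, y2)" by (cases y) auto
  have sp: "y1 \<in> space M" "y2 \<in> space N" using 8 by (auto simp: xy space_pair_measure)
  have m[measurable]: "(%a. \<delta>1 a y1) \<in> borel_measurable M" "(%a. \<delta>2 a y2) \<in> borel_measurable N"
   using sp by measurable
  have e: "ennreal (exp (- pi * t * (\<delta>1 a y1 + \<delta>2 b y2))) = ennreal (exp (- pi * t * \<delta>1 a y1)) * ennreal (exp (- pi * t * \<delta>2 b y2))" for a b
   unfolding ennreal_mult[symmetric, OF exp_ge_zero exp_ge_zero] exp_add[symmetric] by (simp add: algebra_simps)
  have "(\<integral>\<^sup>+x. ennreal (exp (- pi * t * (case x of (a, b) => \<delta>1 a y1 + \<delta>2 b y2))) \<partial>(M \<Otimes>\<^sub>M N))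
    = (\<integral>\<^sup>+a. \<integral>\<^sup>+b. ennreal (exp (- pi * t * \<delta>1 a y1)) * ennreal (exp (- pi * t * \<delta>2 b y2)) \<partial>N \<partial>M)"
   unfolding e[symmetric] by (subst B.nn_integral_fst[symmetric]) auto
  also have "... = (\<integral>\<^sup>+a. ennreal (exp (- pi * t * \<delta>1 a y1)) * ennreal ((1 / sqrt t) ^ D2) \<partial>M)"
   unfolding B.gauss_mass[OF 8(1) sp(2), symmetric] by (subst nn_integral_cmult) auto
  also have "... = ennreal ((1 / sqrt t) ^ D1) * ennreal ((1 / sqrt t) ^ D2)"
   unfolding A.gauss_mass[OF 8(1) sp(1), symmetric] by (subst nn_integral_multc) auto
  also have "... = ennreal ((1 / sqrt t) ^ (D1 + D2))"
   using 8(1) by (simp add: power_add ennreal_mult)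
  finally show ?case by (simp add: xy split_beta')
 qed (auto simp: space_pair_measure A.q_nonneg B.q_nonneg A.\<delta>_sym B.\<delta>_sym add_nonneg_nonneg)
qed

lemma gaussian_space_lborel:
 "gaussian_space (lborel :: 'a::euclidean_space measure) (\<bullet>) (%x y. (norm (x - y))\<^sup>2) (%x. (norm x)\<^sup>2) DIM('a)"
proof -
 define \<Gamma> :: "('a => real) => 'a" where "\<Gamma> = (%f. \<Sum>b\<in>Basis. f b *\<^sub>R b)"
 define co :: "'a => 'a => real" where "co = (%x. \<lambda>b\<in>Basis. x \<bullet> b)"
 let ?P = "Pi\<^sub>M (Basis :: 'a set) (%_. lborel :: real measure)"
 interpret A: gaussian_space ?P "%s x. \<Sum>i\<in>Basis. s i * x i" "%x y. \<Sum>i\<in>Basis. (x i - y i)\<^sup>2" "%x. \<Sum>i\<in>Basis. (x i)\<^sup>2" "DIM('a)"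
  by (rule gaussian_space_PiM) simp
 have \<Gamma>[measurable]: "\<Gamma> \<in> ?P \<rightarrow>\<^sub>M borel" unfolding \<Gamma>_def by measurable
 have eq: "lborel = distr ?P borel \<Gamma>" unfolding \<Gamma>_def by (rule lborel_eq)
 have co: "co x \<in> space ?P" for x by (simp add: co_def space_PiM)
 have \<Gamma>b: "\<Gamma> f \<bullet> b = f b" if "b \<in> Basis" for f b unfolding \<Gamma>_def using that by simp
 have nq: "(norm (\<Gamma> f))\<^sup>2 = (\<Sum>i\<in>Basis. (f i)\<^sup>2)" for f
  unfolding power2_norm_eq_inner by (subst euclidean_inner) (auto intro!: sum.cong simp: \<Gamma>b power2_eq_square)
 have np: "\<Gamma> f \<bullet> x = (\<Sum>i\<in>Basis. f i * co x i)" for f x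
  by (subst euclidean_inner) (auto intro!: sum.cong simp: \<Gamma>b co_def)
 have nd: "(norm (\<Gamma> f - y))\<^sup>2 = (\<Sum>i\<in>Basis. (f i - co y i)\<^sup>2)" for f y
  unfolding power2_norm_eq_inner
  by (subst euclidean_inner) (auto intro!: sum.cong simp: \<Gamma>b co_def power2_eq_square inner_diff_left)
 have nc: "(norm (x - y))\<^sup>2 = (\<Sum>i\<in>Basis. (co x i - co y i)\<^sup>2)" for x y
  unfolding power2_norm_eq_inner
  by (subst euclidean_inner) (auto intro!: sum.cong simp: co_def power2_eq_square inner_diff_left)
 show ?thesis
 proof (unfold_locales, goal_cases)
  case (6 t)
  from A.gauss_integrable[OF this] show ?case
   unfolding eq by (subst integrable_distr_eq) (auto simp: nq)
 next
  case (7 t x y)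
  have "(LINT s|lborel. exp (- pi * t * (norm s)\<^sup>2) * cis (2 * pi * (s \<bullet> x - s \<bullet> y)))
   = (LINT f|?P. exp (- pi * t * (\<Sum>i\<in>Basis. (f i)\<^sup>2)) * cis (2 * pi * ((\<Sum>i\<in>Basis. f i * co x i) - (\<Sum>i\<in>Basis. f i * co y i))))"
   unfolding eq by (subst integral_distr) (auto simp: nq np)
  also have "... = of_real ((1 / sqrt t) ^ DIM('a) * exp (- pi * (\<Sum>i\<in>Basis. (co x i - co y i)\<^sup>2) / t))"
   by (rule A.gauss_char[OF 7(1) co co])
  finally show ?case by (simp add: nc)
 next
  case (8 t y)
  have "(\<integral>\<^sup>+x. ennreal (exp (- pi * t * (norm (x - y))\<^sup>2)) \<partial>lborel)
   = (\<integral>\<^sup>+f. ennreal (exp (- pi * t * (\<Sum>i\<in>Basis. (f i - co y i)\<^sup>2))) \<partial>?P)"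
   unfolding eq by (subst nn_integral_distr) (auto simp: nd)
  also have "... = ennreal ((1 / sqrt t) ^ DIM('a))" by (rule A.gauss_mass[OF 8(1) co])
  finally show ?case .
 qed (auto simp: norm_minus_commute)
qed




lemma AE_zero_of_generator:
 fixes f :: "'a => complex"
 assumes M: "sigma_finite_measure M" and f: "integrable M f" and G: "Int_stable G" "G \<subseteq> Pow (space M)"
  and gen: "sets M = sigma_sets (space M) G"
  and zero: "\<And>A. A \<in> G ==> (LINT x|M. indicator A x *\<^sub>R f x) = 0"
  and total: "(LINT x|M. f x) = 0"
 shows "AE x in M. f x = 0"
proof (rule sigma_finite_measure.density_zero[OF M f])
 have [measurable]: "f \<in> borel_measurable M" using f by auto
 have ii: "integrable M (%x. indicator A x *\<^sub>R f x)" if "A \<in> sets M" for A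
  using integrable_mult_indicator[OF that f] .
 fix A assume "A \<in> sets M"
 then have "A \<in> sigma_sets (space M) G" by (simp add: gen)
 with G show "set_lebesgue_integral M A f = 0"
 proof (induction A rule: sigma_sets_induct_disjoint)
  case (basic A) then show ?case using zero by (simp add: set_lebesgue_integral_def)
 next
  case empty show ?case by (simp add: set_lebesgue_integral_def)
 next
  case (compl A)
  then have A: "A \<in> sets M" by (simp add: gen)
  have "set_lebesgue_integral M (space M - A) f = (LINT x|M. f x - indicator A x *\<^sub>R f x)"
   unfolding set_lebesgue_integral_def by (intro Bochner_Integration.integral_cong) (auto simp: indicator_def)
  also have "... = 0" using ii[OF A] f total compl by (simp add: set_lebesgue_integral_def)
  finally show ?case .
 next
  case (union A)
  then have A: "A i \<in> sets M" for i by (auto simp: gen)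
  have "set_lebesgue_integral M (\<Union>i. A i) f = (\<Sum>i. set_lebesgue_integral M (A i) f)"
   using A union(1) ii[of "\<Union>i. A i"]
   by (intro lebesgue_integral_countable_add) (auto simp: disjoint_family_on_def set_integrable_def)
  then show ?case using union by simp
 qed
qed

lemma PiM_lborel_affine:
 fixes c a :: "'i => real"
 assumes fin: "finite I" and c: "\<And>i. i \<in> I ==> c i ~= 0"
  and h[measurable]: "h \<in> borel_measurable (Pi\<^sub>M I (%_. lborel))"
 shows "(\<integral>\<^sup>+x. h x \<partial>Pi\<^sub>M I (%_. lborel))
   = ennreal (\<Prod>i\<in>I. \<bar>c i\<bar>) * (\<integral>\<^sup>+x. h (\<lambda>i\<in>I. a i + c i * x i) \<partial>Pi\<^sub>M I (%_. lborel))"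
proof -
 let ?P = "Pi\<^sub>M I (%_. lborel :: real measure)"
 interpret L: product_sigma_finite "%_::'i. lborel :: real measure" ..
 define T where "T = (%x::'i => real. \<lambda>i\<in>I. a i + c i * x i)"
 have T[measurable]: "T \<in> ?P \<rightarrow>\<^sub>M ?P" unfolding T_def by measurable
 have "scale_measure (ennreal (\<Prod>i\<in>I. \<bar>c i\<bar>)) (distr ?P ?P T) = ?P"
 proof (rule L.PiM_eqI[OF fin])
  fix A :: "'i => real set" assume A: "\<And>i. i \<in> I ==> A i \<in> sets lborel"
  have "T -` (Pi\<^sub>E I A) \<inter> space ?P = Pi\<^sub>E I (%i. (%x. a i + c i * x) -` A i)"
   by (auto simp: T_def space_PiM PiE_def Pi_def extensional_def)
  then have "emeasure (distr ?P ?P T) (Pi\<^sub>E I A) = emeasure ?P (Pi\<^sub>E I (%i. (%x. a i + c i * x) -` A i))"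
   using A fin by (subst emeasure_distr) (auto intro!: sets_PiM_I_finite)
  also have "... = (\<Prod>i\<in>I. emeasure lborel ((%x. a i + c i * x) -` A i))"
  proof (rule L.emeasure_PiM[OF fin])
   fix i assume "i \<in> I"
   then have "(%x. a i + c i * x) -` A i \<inter> space borel \<in> sets borel"
    using A[of i] by (intro measurable_sets[where A=borel]) auto
   then show "(%x. a i + c i * x) -` A i \<in> sets lborel" by simp
  qed
  finally have "emeasure (scale_measure (ennreal (\<Prod>i\<in>I. \<bar>c i\<bar>)) (distr ?P ?P T)) (Pi\<^sub>E I A)
    = (\<Prod>i\<in>I. ennreal \<bar>c i\<bar> * emeasure lborel ((%x. a i + c i * x) -` A i))"
   by (simp add: prod.distrib prod_ennreal[symmetric])
  also have "... = (\<Prod>i\<in>I. emeasure lborel (A i))"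
  proof (intro prod.cong refl)
   fix i assume i: "i \<in> I"
   have Ai[measurable]: "A i \<in> sets borel" using A[OF i] by simp
   have "emeasure lborel (A i) = (\<integral>\<^sup>+x. indicator (A i) x \<partial>lborel)" by simp
   also have "... = \<bar>c i\<bar> * (\<integral>\<^sup>+x. indicator (A i) (a i + c i * x) \<partial>lborel)"
    using c[OF i] by (intro nn_integral_real_affine) auto
   also have "(%x. indicator (A i) (a i + c i * x)) = (%x. indicator ((%x. a i + c i * x) -` A i) x :: ennreal)"
    by (auto simp: indicator_def)
   also have "(\<integral>\<^sup>+x. indicator ((%x. a i + c i * x) -` A i) x \<partial>lborel) = emeasure lborel ((%x. a i + c i * x) -` A i)"
   proof (rule nn_integral_indicator)
    have "(%x. a i + c i * x) -` A i \<inter> space borel \<in> sets borel"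
     by (intro measurable_sets[where A=borel]) auto
    then show "(%x. a i + c i * x) -` A i \<in> sets lborel" by simp
   qed
   finally show "ennreal \<bar>c i\<bar> * emeasure lborel ((%x. a i + c i * x) -` A i) = emeasure lborel (A i)" by simp
  qed
  finally show "emeasure (scale_measure (ennreal (\<Prod>i\<in>I. \<bar>c i\<bar>)) (distr ?P ?P T)) (Pi\<^sub>E I A)
    = (\<Prod>i\<in>I. emeasure lborel (A i))" .
 qed simp
 then have "(\<integral>\<^sup>+x. h x \<partial>?P) = (\<integral>\<^sup>+x. h x \<partial>scale_measure (ennreal (\<Prod>i\<in>I. \<bar>c i\<bar>)) (distr ?P ?P T))" by simp
 also have "... = ennreal (\<Prod>i\<in>I. \<bar>c i\<bar>) * (\<integral>\<^sup>+x. h x \<partial>distr ?P ?P T)"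
  by (rule nn_integral_scale_measure) simp
 also have "(\<integral>\<^sup>+x. h x \<partial>distr ?P ?P T) = (\<integral>\<^sup>+x. h (T x) \<partial>?P)"
  by (rule nn_integral_distr) simp_all
 finally show ?thesis unfolding T_def .
qed

text \<open>Indicators of boxes with rational corners, cut off by large cubes.\<close>

lemma L2_PiM_total:
 assumes fin: "finite I"
 obtains D where "countable D" "D \<subseteq> L2 (Pi\<^sub>M I (%_. lborel :: real measure))"
  "\<And>\<phi>. \<phi> \<in> L2 (Pi\<^sub>M I (%_. lborel)) ==> (\<And>d. d \<in> D ==> L2_inner (Pi\<^sub>M I (%_. lborel)) d \<phi> = 0)
   ==> AE x in Pi\<^sub>M I (%_. lborel). \<phi> x = 0"
proof -
 let ?P = "Pi\<^sub>M I (%_. lborel :: real measure)"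
 interpret L: product_sigma_finite "%_::'a. lborel :: real measure" ..
 interpret F: finite_product_sigma_finite "%_::'a. lborel :: real measure" I by standard (rule fin)
 define C where "C = (%N::nat. Pi\<^sub>E I (%_. {- real N..real N}))"
 define B where "B = (%b::'a => real. Pi\<^sub>E I (%i. {..b i}))"
 define D where "D = (%(b, N). indicator (B b \<inter> C N) :: ('a => real) => complex) ` ((I \<rightarrow>\<^sub>E \<rat>) \<times> UNIV)"
 have B[measurable]: "B b \<in> sets ?P" for b unfolding B_def by (intro sets_PiM_I_finite fin) auto
 have C[measurable]: "C N \<in> sets ?P" for N unfolding C_def by (intro sets_PiM_I_finite fin) auto
 have Cfin: "emeasure ?P (C N) < \<infinity>" for N
  unfolding C_def by (subst L.emeasure_PiM[OF fin]) (auto simp: ennreal_power)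
 have indL: "(%x. indicator (B b \<inter> C N) x) \<in> L2 ?P" for b N
 proof (rule L2_I_nn)
  have "(\<integral>\<^sup>+x. sqnorm (indicator (B b \<inter> C N) x) \<partial>?P) <= (\<integral>\<^sup>+x. indicator (C N) x \<partial>?P)"
   by (intro nn_integral_mono) (auto simp: indicator_def)
  then show "(\<integral>\<^sup>+x. sqnorm (indicator (B b \<inter> C N) x) \<partial>?P) < \<infinity>"
   using Cfin[of N] by (auto intro: le_less_trans)
 qed measurable
 have gen: "sets ?P = sigma_sets (space ?P) (B ` (I \<rightarrow>\<^sub>E \<rat>))"
 proof -
  have bl: "sets (borel :: real measure) = sets (sigma UNIV ((%a. {..a}) ` \<rat>))"
  proof -
   have "sigma_sets UNIV (range (%a::real. {..a})) = sigma_sets UNIV ((%a. {..a}) ` \<rat>)"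
   proof (rule sigma_sets_eqI)
    fix A assume "A \<in> range (%a::real. {..a})"
    then obtain a where A: "A = {..a}" by auto
    have "{..a} = (\<Inter>q\<in>{q\<in>\<rat>. a < q}. {..q})"
    proof (intro equalityI subsetI)
     fix x assume x: "x \<in> (\<Inter>q\<in>{q\<in>\<rat>. a < q}. {..q})"
     show "x \<in> {..a}"
     proof (rule ccontr)
      assume "x \<notin> {..a}"
      then obtain q where "q \<in> \<rat>" "a < q" "q < x" using Rats_dense_in_real[of a x] by auto
      then show False using x by force
     qed
    qed auto
    moreover interpret S: sigma_algebra UNIV "sigma_sets UNIV ((%a::real. {..a}) ` \<rat>)"
     by (rule sigma_algebra_sigma_sets) auto
    have "countable {q::real\<in>\<rat>. a < q}" by (rule countable_subset[OF _ countable_rat]) auto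
    moreover have "{q::real\<in>\<rat>. a < q} ~= {}"
     using Rats_dense_in_real[of a "a + 1"] by auto
    ultimately show "A \<in> sigma_sets UNIV ((%a. {..a}) ` \<rat>)"
     unfolding A by (auto intro!: S.countable_INT'')
   qed auto
   then show ?thesis by (subst borel_eq_atMost) (simp add: sets_measure_of_conv)
  qed
  have "sets ?P = sets (Pi\<^sub>M I (%_. sigma UNIV ((%a::real. {..a}) ` \<rat>)))"
   by (intro sets_PiM_cong refl) (simp add: bl)
  also have "... = sets (sigma (\<Pi>\<^sub>E i\<in>I. UNIV) {{f\<in>(\<Pi>\<^sub>E i\<in>I. UNIV). \<forall>i\<in>j. f i \<in> A i} | A j. j \<in> {I} \<and> A \<in> Pi j (%_. (%a::real. {..a}) ` \<rat>)})"
  proof (rule sets_PiM_sigma)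
   fix i
   have "(UNIV :: real set) = (\<Union>n. {..real n})" using real_arch_simple by auto
   then show "\<exists>S\<subseteq>(%a. {..a}) ` \<rat>. countable S \<and> (UNIV :: real set) = \<Union>S"
    by (intro exI[of _ "range (%n. {..real n})"]) auto
  qed (use fin in auto)
  also have "{{f\<in>(\<Pi>\<^sub>E i\<in>I. UNIV). \<forall>i\<in>j. f i \<in> A i} | A j. j \<in> {I} \<and> A \<in> Pi j (%_. (%a::real. {..a}) ` \<rat>)}
    = B ` (I \<rightarrow>\<^sub>E \<rat>)" (is "?L = ?R")
  proof (intro equalityI subsetI)
   fix S assume "S \<in> ?L"
   then obtain A where S: "S = {f\<in>(\<Pi>\<^sub>E i\<in>I. UNIV). \<forall>i\<in>I. f i \<in> A i}" and A: "\<And>i. i \<in> I ==> \<exists>q\<in>\<rat>. A i = {..q}"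
    by (auto simp: Pi_def image_def)
   from A obtain b where b: "\<And>i. i \<in> I ==> b i \<in> \<rat> \<and> A i = {..b i}" by metis
   have "S = B (restrict b I)" unfolding S B_def using b by (auto simp: PiE_def Pi_def)
   then show "S \<in> ?R" using b by auto
  next
   fix S assume "S \<in> ?R"
   then obtain b where "b \<in> I \<rightarrow>\<^sub>E \<rat>" "S = B b" by auto
   then show "S \<in> ?L" unfolding B_def by (intro CollectI exI[of _ "%i. {..b i}"] exI[of _ I]) (auto simp: PiE_def Pi_def)
  qed
  also have "sets (sigma (\<Pi>\<^sub>E i\<in>I. UNIV) (B ` (I \<rightarrow>\<^sub>E \<rat>))) = sigma_sets (space ?P) (B ` (I \<rightarrow>\<^sub>E \<rat>))"
   by (subst sets_measure_of) (auto simp: B_def space_PiM PiE_def)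
  finally show ?thesis .
 qed
 show thesis
 proof (rule that[of D])
  show "countable D" unfolding D_def
   by (intro countable_image countable_SIGMA countable_PiE fin countable_rat) auto
  show "D \<subseteq> L2 ?P" unfolding D_def using indL by auto
  fix \<phi> assume phi: "\<phi> \<in> L2 ?P" and z: "\<And>d. d \<in> D ==> L2_inner ?P d \<phi> = 0"
  have [measurable]: "\<phi> \<in> borel_measurable ?P" using phi by (rule L2_measurable)
  have "AE x in ?P. indicator (C N) x *\<^sub>R cnj (\<phi> x) = 0" for N
  proof (rule AE_zero_of_generator[OF F.sigma_finite_measure_axioms _ _ _ gen])
   have "(%x. indicator (C N) x :: complex) \<in> L2 ?P"
   proof (rule L2_I_nn)
    have "sqnorm (indicator (C N) x) = indicator (C N) x" for x by (simp add: indicator_def)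
    then show "(\<integral>\<^sup>+x. sqnorm (indicator (C N) x) \<partial>?P) < \<infinity>" using Cfin[of N] by simp
   qed measurable
   from L2_mult_integrable[OF this L2_cnj[OF phi]]
   show int: "integrable ?P (%x. indicator (C N) x *\<^sub>R cnj (\<phi> x))"
    by (rule Bochner_Integration.integrable_cong[THEN iffD1, OF refl, rotated]) (auto simp: indicator_def)
   show "Int_stable (B ` (I \<rightarrow>\<^sub>E \<rat>))"
   proof (rule Int_stableI)
    fix S T assume "S \<in> B ` (I \<rightarrow>\<^sub>E \<rat>)" "T \<in> B ` (I \<rightarrow>\<^sub>E \<rat>)"
    then obtain b b' where b: "b \<in> I \<rightarrow>\<^sub>E \<rat>" "S = B b" "b' \<in> I \<rightarrow>\<^sub>E \<rat>" "T = B b'" by auto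
    have "S \<inter> T = B (\<lambda>i\<in>I. min (b i) (b' i))" unfolding b B_def by (auto simp: PiE_def Pi_def)
    moreover have "(\<lambda>i\<in>I. min (b i) (b' i)) \<in> I \<rightarrow>\<^sub>E \<rat>" using b by (auto simp: min_def PiE_def Pi_def)
    ultimately show "S \<inter> T \<in> B ` (I \<rightarrow>\<^sub>E \<rat>)" by blast
   qed
   show "B ` (I \<rightarrow>\<^sub>E \<rat>) \<subseteq> Pow (space ?P)" by (auto simp: B_def space_PiM PiE_def)
   have z': "(LINT x|?P. indicator (B b) x *\<^sub>R (indicator (C N) x *\<^sub>R cnj (\<phi> x))) = 0" if "b \<in> I \<rightarrow>\<^sub>E \<rat>" for b
   proof -
    have "L2_inner ?P (indicator (B b \<inter> C N)) \<phi> = 0" by (rule z) (use that in \<open>auto simp: D_def\<close>)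
    then show ?thesis unfolding L2_inner_def
     by (subst Bochner_Integration.integral_cong[OF refl, of _ _ "%x. indicator (B b \<inter> C N) x * cnj (\<phi> x)"]) (auto simp: indicator_def)
   qed
   then show "(LINT x|?P. indicator A x *\<^sub>R (indicator (C N) x *\<^sub>R cnj (\<phi> x))) = 0" if "A \<in> B ` (I \<rightarrow>\<^sub>E \<rat>)" for A
    using that by auto
   have "C N \<subseteq> B (\<lambda>i\<in>I. real N)" by (auto simp: C_def B_def PiE_def Pi_def)
   then have "(%x. indicator (B (\<lambda>i\<in>I. real N)) x *\<^sub>R (indicator (C N) x *\<^sub>R cnj (\<phi> x))) = (%x. indicator (C N) x *\<^sub>R cnj (\<phi> x))"
    by (auto simp: indicator_def fun_eq_iff)
   then show "(LINT x|?P. indicator (C N) x *\<^sub>R cnj (\<phi> x)) = 0"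
    using z'[of "\<lambda>i\<in>I. real N"] by simp
  qed
  then have "AE x in ?P. \<forall>N. indicator (C N) x *\<^sub>R cnj (\<phi> x) = 0" unfolding AE_all_countable by blast
  then show "AE x in ?P. \<phi> x = 0"
  proof (rule AE_mp, intro AE_I2 impI)
   fix x assume x: "x \<in> space ?P" "\<forall>N. indicator (C N) x *\<^sub>R cnj (\<phi> x) = 0"
   obtain N :: nat where N: "(\<Sum>i\<in>I. \<bar>x i\<bar>) <= real N" using real_arch_simple by blast
   have "\<bar>x i\<bar> <= real N" if "i \<in> I" for i
    using member_le_sum[of i I "%i. \<bar>x i\<bar>"] that fin N by auto
   then have "x \<in> C N" using x(1) by (fastforce simp: C_def space_PiM PiE_def Pi_def abs_le_iff)
   then show "\<phi> x = 0" using x(2) by (auto dest: spec[of _ N])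
  qed
 qed
qed


section \<open>Euclidean coordinates and translation invariant parametrisations\<close>

lemma orthonormal_sum_inner:
 assumes "orthonormal_on I b" "finite I" "i \<in> I"
 shows "(\<Sum>j\<in>I. x j *\<^sub>R b j) \<bullet> b i = x i"
proof -
 have "(\<Sum>j\<in>I. x j *\<^sub>R b j) \<bullet> b i = (\<Sum>j\<in>I. if j = i then x i else 0)"
  unfolding inner_sum_left using assms by (intro sum.cong) (auto simp: orthonormal_on_def)
 then show ?thesis using assms by simp
qed

lemma orthonormal_sum_norm:
 assumes "orthonormal_on I b" "finite I"
 shows "(norm (\<Sum>j\<in>I. x j *\<^sub>R b j))\<^sup>2 = (\<Sum>i\<in>I. (x i)\<^sup>2)"
 unfolding power2_norm_eq_inner
 by (subst inner_sum_right) (auto simp: orthonormal_sum_inner[OF assms] power2_eq_square intro!: sum.cong)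

lemma orthonormal_expansion:
 assumes "orthonormal_on I b" "finite I" "v \<in> span (b ` I)"
 shows "(\<Sum>i\<in>I. (v \<bullet> b i) *\<^sub>R b i) = v"
 using assms(3)
proof (induction rule: span_induct)
 case base show ?case
  by (auto simp: subspace_def inner_add_left scaleR_add_left sum.distrib simp flip: scaleR_scaleR scaleR_sum_right)
next
 case (step x)
 then obtain i where i: "i \<in> I" "x = b i" by auto
 have "(\<Sum>j\<in>I. (b i \<bullet> b j) *\<^sub>R b j) = (\<Sum>j\<in>I. if j = i then b i else 0)"
  using assms i by (intro sum.cong) (auto simp: orthonormal_on_def)
 then show ?case using assms i by simp
qed

definition shift_invariant :: "'a measure => ('a => 'g::euclidean_space) => 'g set => bool" where
 "shift_invariant A \<Gamma> S \<longleftrightarrow> sigma_finite_measure A \<and> \<Gamma> \<in> A \<rightarrow>\<^sub>M borel \<and> (\<forall>x\<in>space A. \<Gamma> x \<in> S) \<and>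
  (\<forall>v\<in>S. \<forall>h\<in>borel_measurable borel. (\<integral>\<^sup>+x. h (\<Gamma> x + v) \<partial>A) = (\<integral>\<^sup>+x. h (\<Gamma> x) \<partial>A :: ennreal))"

definition gauss :: "'g::euclidean_space => real" where
 "gauss x = exp (- pi * (norm x)\<^sup>2)"

text \<open>The Gaussian serves to normalise: it makes the image of \<open>A\<close> the Lebesgue measure of the subspace \<open>S\<close>.\<close>

definition frame :: "'a measure => ('a => 'g::euclidean_space) => 'g set => bool" where
 "frame A \<Gamma> S \<longleftrightarrow> shift_invariant A \<Gamma> S \<and> (\<integral>\<^sup>+x. ennreal (gauss (\<Gamma> x)) \<partial>A) = 1"

lemma gauss_measurable[measurable]: "gauss \<in> borel_measurable borel"
 unfolding gauss_def by measurable

lemma gauss_uminus: "gauss (- x) = gauss x" by (simp add: gauss_def)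

text \<open>
 Uniqueness of Haar measure by Fubini: in the double integral of \<open>h(\<Gamma> x) gauss(\<Gamma>' y)\<close> replace
 \<open>\<Gamma> x\<close> by \<open>\<Gamma> x + \<Gamma>' y\<close>, then \<open>\<Gamma>' y\<close> by \<open>\<Gamma>' y - \<Gamma> x\<close>, and the roles of the two measures are exchanged.

\<close>

lemma shift_invariant_unique:
 fixes \<Gamma> :: "'a => 'g::euclidean_space" and \<Gamma>' :: "'b => 'g"
 assumes A: "shift_invariant A \<Gamma> S" and B: "frame B \<Gamma>' S" and S: "subspace S"
  and h[measurable]: "h \<in> borel_measurable borel"
 shows "(\<integral>\<^sup>+x. h (\<Gamma> x) \<partial>A) = (\<integral>\<^sup>+x. ennreal (gauss (\<Gamma> x)) \<partial>A) * (\<integral>\<^sup>+y. h (\<Gamma>' y) \<partial>B)"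
proof -
 interpret A: sigma_finite_measure A using A by (simp add: shift_invariant_def)
 interpret B: sigma_finite_measure B using B by (simp add: frame_def shift_invariant_def)
 interpret P: pair_sigma_finite A B ..
 have [measurable]: "\<Gamma> \<in> A \<rightarrow>\<^sub>M borel" using A by (simp add: shift_invariant_def)
 have [measurable]: "\<Gamma>' \<in> B \<rightarrow>\<^sub>M borel" using B by (simp add: frame_def shift_invariant_def)
 have AS: "\<Gamma> x \<in> S" if "x \<in> space A" for x using A that by (simp add: shift_invariant_def)
 have BS: "\<Gamma>' x \<in> S" if "x \<in> space B" for x using B that by (simp add: frame_def shift_invariant_def)
 have Ash: "(\<integral>\<^sup>+x. g (\<Gamma> x + v) \<partial>A) = (\<integral>\<^sup>+x. g (\<Gamma> x) \<partial>A)" if "v \<in> S" "g \<in> borel_measurable borel" for v and g :: "'g => ennreal"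
  using A that by (simp add: shift_invariant_def)
 have Bsh: "(\<integral>\<^sup>+x. g (\<Gamma>' x + v) \<partial>B) = (\<integral>\<^sup>+x. g (\<Gamma>' x) \<partial>B)" if "v \<in> S" "g \<in> borel_measurable borel" for v and g :: "'g => ennreal"
  using B that by (simp add: frame_def shift_invariant_def)
 have "(\<integral>\<^sup>+x. h (\<Gamma> x) \<partial>A) = (\<integral>\<^sup>+y. ennreal (gauss (\<Gamma>' y)) \<partial>B) * (\<integral>\<^sup>+x. h (\<Gamma> x) \<partial>A)"
  using B by (simp add: frame_def)
 also have "... = (\<integral>\<^sup>+y. ennreal (gauss (\<Gamma>' y)) * (\<integral>\<^sup>+x. h (\<Gamma> x) \<partial>A) \<partial>B)"
  by (rule nn_integral_multc[symmetric]) measurable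
 also have "... = (\<integral>\<^sup>+y. \<integral>\<^sup>+x. ennreal (gauss (\<Gamma>' y)) * h (\<Gamma> x + \<Gamma>' y) \<partial>A \<partial>B)"
  using BS by (intro nn_integral_cong) (simp add: nn_integral_cmult Ash)
 also have "... = (\<integral>\<^sup>+x. \<integral>\<^sup>+y. ennreal (gauss (\<Gamma>' y)) * h (\<Gamma> x + \<Gamma>' y) \<partial>B \<partial>A)"
  by (rule P.Fubini') measurable
 also have "... = (\<integral>\<^sup>+x. \<integral>\<^sup>+y. ennreal (gauss (\<Gamma>' y - \<Gamma> x)) * h (\<Gamma>' y) \<partial>B \<partial>A)"
 proof (rule nn_integral_cong)
  fix x assume x: "x \<in> space A"
  have [measurable]: "(%w. ennreal (gauss (w - \<Gamma> x)) * h w) \<in> borel_measurable borel" by measurable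
  show "(\<integral>\<^sup>+y. ennreal (gauss (\<Gamma>' y)) * h (\<Gamma> x + \<Gamma>' y) \<partial>B) = (\<integral>\<^sup>+y. ennreal (gauss (\<Gamma>' y - \<Gamma> x)) * h (\<Gamma>' y) \<partial>B)"
   using Bsh[OF AS[OF x], of "%w. ennreal (gauss (w - \<Gamma> x)) * h w"] by (simp add: add.commute)
 qed
 also have "... = (\<integral>\<^sup>+y. \<integral>\<^sup>+x. ennreal (gauss (\<Gamma>' y - \<Gamma> x)) * h (\<Gamma>' y) \<partial>A \<partial>B)"
  by (rule P.Fubini'[symmetric]) measurable
 also have "... = (\<integral>\<^sup>+y. (\<integral>\<^sup>+x. ennreal (gauss (\<Gamma> x)) \<partial>A) * h (\<Gamma>' y) \<partial>B)"
 proof (rule nn_integral_cong)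
  fix y assume y: "y \<in> space B"
  have "(\<integral>\<^sup>+x. ennreal (gauss (\<Gamma>' y - \<Gamma> x)) \<partial>A) = (\<integral>\<^sup>+x. ennreal (gauss (\<Gamma> x + - \<Gamma>' y)) \<partial>A)"
   by (intro nn_integral_cong) (metis gauss_uminus minus_diff_eq diff_conv_add_uminus)
  also have "... = (\<integral>\<^sup>+x. ennreal (gauss (\<Gamma> x)) \<partial>A)"
   by (rule Ash) (use BS[OF y] S in \<open>auto intro: subspace_neg\<close>)
  finally show "(\<integral>\<^sup>+x. ennreal (gauss (\<Gamma>' y - \<Gamma> x)) * h (\<Gamma>' y) \<partial>A)
    = (\<integral>\<^sup>+x. ennreal (gauss (\<Gamma> x)) \<partial>A) * h (\<Gamma>' y)"
   using y by (simp add: nn_integral_multc)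
 qed
 also have "... = (\<integral>\<^sup>+x. ennreal (gauss (\<Gamma> x)) \<partial>A) * (\<integral>\<^sup>+y. h (\<Gamma>' y) \<partial>B)"
  by (rule nn_integral_cmult) measurable
 finally show ?thesis .
qed

lemma frame_unique:
 assumes "frame A \<Gamma> S" "frame B \<Gamma>' S" "subspace S" "h \<in> borel_measurable borel"
 shows "(\<integral>\<^sup>+x. h (\<Gamma> x) \<partial>A) = (\<integral>\<^sup>+y. h (\<Gamma>' y) \<partial>B)"
 using shift_invariant_unique[OF _ assms(2-4), of A \<Gamma>] assms(1) by (simp add: frame_def)

lemma shift_invariant_PiM:
 fixes L :: "('i => real) => 'g::euclidean_space"
 assumes fin: "finite I"
  and L: "\<And>x. L x = (\<Sum>i\<in>I. x i *\<^sub>R w i)" and S: "span (w ` I) = S"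
 shows "shift_invariant (Pi\<^sub>M I (%_. lborel)) L S"
proof -
 let ?P = "Pi\<^sub>M I (%_. lborel :: real measure)"
 interpret finite_product_sigma_finite "%_::'i. lborel :: real measure" I by standard (rule fin)
 have Lm[measurable]: "L \<in> ?P \<rightarrow>\<^sub>M borel" unfolding L by measurable
 have rep: "\<exists>a. v = L a" if "v \<in> span (w ` I)" for v
  using that
 proof (induction rule: span_induct_alt)
  case base show ?case by (intro exI[of _ "%_. 0"]) (simp add: L)
 next
  case (step c x y)
  then obtain i a where i: "i \<in> I" "x = w i" and a: "y = L a" by auto
  have "L (%j. (if j = i then c else 0) + a j) = c *\<^sub>R x + y"
   unfolding L a using i fin by (simp add: scaleR_add_left sum.distrib if_distrib[of "%u. u *\<^sub>R _"] cong: if_cong)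
  then show ?case by metis
 qed
 have "(\<integral>\<^sup>+x. h (L x + v) \<partial>?P) = (\<integral>\<^sup>+x. h (L x) \<partial>?P)"
  if v: "v \<in> S" and [measurable]: "h \<in> borel_measurable borel" for v and h :: "'g => ennreal"
 proof -
  obtain a where a: "v = L a" using rep v S by auto
  have "(\<integral>\<^sup>+x. h (L x) \<partial>?P) = ennreal (\<Prod>i\<in>I. \<bar>1\<bar>) * (\<integral>\<^sup>+x. h (L (\<lambda>i\<in>I. a i + 1 * x i)) \<partial>?P)"
   by (rule PiM_lborel_affine[OF fin]) auto
  also have "... = (\<integral>\<^sup>+x. h (L x + v) \<partial>?P)"
   unfolding a L by (simp add: scaleR_add_left sum.distrib add.commute)
  finally show ?thesis by simp
 qed
 moreover have "L x \<in> S" for x unfolding L S[symmetric] by (intro span_sum span_scale span_base) auto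
 ultimately show ?thesis unfolding shift_invariant_def using sigma_finite_measure_axioms Lm by blast
qed

lemma frame_PiM:
 assumes fin: "finite I" and b: "orthonormal_on I b"
 shows "frame (Pi\<^sub>M I (%_. lborel)) (%x. \<Sum>i\<in>I. x i *\<^sub>R b i) (span (b ` I))"
proof -
 let ?P = "Pi\<^sub>M I (%_. lborel :: real measure)"
 interpret gaussian_space ?P "%s x. \<Sum>i\<in>I. s i * x i"
     "%x y. \<Sum>i\<in>I. (x i - y i)\<^sup>2" "%x. \<Sum>i\<in>I. (x i)\<^sup>2" "card I"
  by (rule gaussian_space_PiM[OF fin])
 have "(\<integral>\<^sup>+x. ennreal (gauss (\<Sum>i\<in>I. x i *\<^sub>R b i)) \<partial>?P)
   = (\<integral>\<^sup>+x. ennreal (exp (- pi * 1 * (\<Sum>i\<in>I. (x i - (\<lambda>i\<in>I. 0) i)\<^sup>2))) \<partial>?P)"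
  unfolding gauss_def orthonormal_sum_norm[OF b fin] by (intro nn_integral_cong) simp
 also have "... = 1" by (subst gauss_mass) (auto simp: space_PiM)
 finally show ?thesis unfolding frame_def using shift_invariant_PiM[OF fin refl refl] by blast
qed

lemma lborel_shift:
 fixes h :: "'a::euclidean_space => ennreal"
 assumes [measurable]: "h \<in> borel_measurable borel"
 shows "(\<integral>\<^sup>+x. h (x + v) \<partial>lborel) = (\<integral>\<^sup>+x. h x \<partial>lborel)"
 by (subst lborel_distr_plus[symmetric, of v], subst nn_integral_distr) (auto simp: add.commute)

lemma gauss_mass_lborel: "(\<integral>\<^sup>+x. ennreal (gauss (x :: 'a::euclidean_space)) \<partial>lborel) = 1"
 using gaussian_space.gauss_mass[OF gaussian_space_lborel, of 1 "0::'a"] by (simp add: gauss_def)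

lemma frame_lborel: "frame lborel (%x. x) (UNIV :: 'a::euclidean_space set)"
 unfolding frame_def shift_invariant_def
 by (auto simp: lborel_shift gauss_mass_lborel lborel.sigma_finite_measure_axioms)

lemma frame_vec:
 fixes Z :: "'k::finite => 'g::euclidean_space"
 assumes Z: "orthonormal_on UNIV Z"
 shows "frame (lborel :: (real ^ 'k) measure) (%z. \<Sum>j\<in>UNIV. z $ j *\<^sub>R Z j) (span (range Z))"
proof -
 define \<Gamma> where "\<Gamma> = (%z::real ^ 'k. \<Sum>j\<in>UNIV. z $ j *\<^sub>R Z j)"
 have m[measurable]: "\<Gamma> \<in> borel_measurable borel"
  unfolding \<Gamma>_def by (intro borel_measurable_continuous_onI continuous_intros)
 have n: "(norm (\<Gamma> z))\<^sup>2 = (norm z)\<^sup>2" for z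
  unfolding \<Gamma>_def orthonormal_sum_norm[OF Z finite] by (simp add: norm_vec_def L2_set_def sum_nonneg)
 have "(\<integral>\<^sup>+x. h (\<Gamma> x + v) \<partial>lborel) = (\<integral>\<^sup>+x. h (\<Gamma> x) \<partial>lborel)"
  if v: "v \<in> span (range Z)" and [measurable]: "h \<in> borel_measurable borel" for v and h :: "'g => ennreal"
 proof -
  have "\<Gamma> x + v = \<Gamma> (x + (\<chi> j. v \<bullet> Z j))" for x
   using orthonormal_expansion[OF Z finite v] by (simp add: \<Gamma>_def scaleR_add_left sum.distrib)
  then show ?thesis using lborel_shift[of "%x. h (\<Gamma> x)"] by simp
 qed
 moreover have "\<Gamma> z \<in> span (range Z)" for z
  unfolding \<Gamma>_def by (intro span_sum span_scale span_base) auto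
 moreover have "gauss (\<Gamma> z) = gauss z" for z by (simp add: gauss_def n)
 ultimately show ?thesis
  unfolding frame_def shift_invariant_def \<Gamma>_def[symmetric] using m
  by (simp add: lborel.sigma_finite_measure_axioms gauss_mass_lborel)
qed

lemma frame_prod:
 fixes \<Gamma> :: "'a => 'g::euclidean_space" and \<Delta> :: "'b => 'g"
 assumes A: "frame A \<Gamma> S" and B: "frame B \<Delta> T" and orth: "\<And>s t. s \<in> S ==> t \<in> T ==> s \<bullet> t = 0"
  and W: "W = (%(s, t). s + t) ` (S \<times> T)"
 shows "frame (A \<Otimes>\<^sub>M B) (%(x, y). \<Gamma> x + \<Delta> y) W"
proof -
 interpret A: sigma_finite_measure A using A by (simp add: frame_def shift_invariant_def)
 interpret B: sigma_finite_measure B using B by (simp add: frame_def shift_invariant_def)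
 interpret P: pair_sigma_finite A B ..
 have [measurable]: "\<Gamma> \<in> A \<rightarrow>\<^sub>M borel" using A by (simp add: frame_def shift_invariant_def)
 have [measurable]: "\<Delta> \<in> B \<rightarrow>\<^sub>M borel" using B by (simp add: frame_def shift_invariant_def)
 have AS: "\<Gamma> x \<in> S" if "x \<in> space A" for x using A that by (simp add: frame_def shift_invariant_def)
 have BS: "\<Delta> x \<in> T" if "x \<in> space B" for x using B that by (simp add: frame_def shift_invariant_def)
 have Ash: "(\<integral>\<^sup>+x. g (\<Gamma> x + v) \<partial>A) = (\<integral>\<^sup>+x. g (\<Gamma> x) \<partial>A)" if "v \<in> S" "g \<in> borel_measurable borel" for v and g :: "'g => ennreal"
  using A that by (simp add: frame_def shift_invariant_def)
 have Bsh: "(\<integral>\<^sup>+x. g (\<Delta> x + v) \<partial>B) = (\<integral>\<^sup>+x. g (\<Delta> x) \<partial>B)" if "v \<in> T" "g \<in> borel_measurable borel" for v and g :: "'g => ennreal"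
  using B that by (simp add: frame_def shift_invariant_def)
 have Am: "(\<integral>\<^sup>+x. ennreal (gauss (\<Gamma> x)) \<partial>A) = 1" and Bm: "(\<integral>\<^sup>+x. ennreal (gauss (\<Delta> x)) \<partial>B) = 1"
  using A B by (auto simp: frame_def)
 have "(\<integral>\<^sup>+z. h ((case z of (x, y) => \<Gamma> x + \<Delta> y) + v) \<partial>(A \<Otimes>\<^sub>M B)) = (\<integral>\<^sup>+z. h (case z of (x, y) => \<Gamma> x + \<Delta> y) \<partial>(A \<Otimes>\<^sub>M B))"
  if v: "v \<in> W" and [measurable]: "h \<in> borel_measurable borel" for v and h :: "'g => ennreal"
 proof -
  obtain s t where st: "s \<in> S" "t \<in> T" "v = s + t" using v W by auto
  have "(\<integral>\<^sup>+z. h ((case z of (x, y) => \<Gamma> x + \<Delta> y) + v) \<partial>(A \<Otimes>\<^sub>M B)) = (\<integral>\<^sup>+x. \<integral>\<^sup>+y. h (\<Gamma> x + \<Delta> y + v) \<partial>B \<partial>A)"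
   by (subst B.nn_integral_fst[symmetric]) auto
  also have "... = (\<integral>\<^sup>+x. \<integral>\<^sup>+y. h (\<Gamma> x + \<Delta> y + s) \<partial>B \<partial>A)"
  proof (rule nn_integral_cong)
   fix x
   show "(\<integral>\<^sup>+y. h (\<Gamma> x + \<Delta> y + v) \<partial>B) = (\<integral>\<^sup>+y. h (\<Gamma> x + \<Delta> y + s) \<partial>B)"
    using Bsh[OF st(2), of "%w. h (\<Gamma> x + w + s)"] by (simp add: st(3) algebra_simps)
  qed
  also have "... = (\<integral>\<^sup>+y. \<integral>\<^sup>+x. h (\<Gamma> x + \<Delta> y + s) \<partial>A \<partial>B)"
   by (rule P.Fubini'[symmetric]) measurable
  also have "... = (\<integral>\<^sup>+y. \<integral>\<^sup>+x. h (\<Gamma> x + \<Delta> y) \<partial>A \<partial>B)"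
  proof (rule nn_integral_cong)
   fix y
   show "(\<integral>\<^sup>+x. h (\<Gamma> x + \<Delta> y + s) \<partial>A) = (\<integral>\<^sup>+x. h (\<Gamma> x + \<Delta> y) \<partial>A)"
    using Ash[OF st(1), of "%w. h (w + \<Delta> y)"] by (simp add: algebra_simps)
  qed
  also have "... = (\<integral>\<^sup>+x. \<integral>\<^sup>+y. h (\<Gamma> x + \<Delta> y) \<partial>B \<partial>A)"
   by (rule P.Fubini') measurable
  also have "... = (\<integral>\<^sup>+z. h (case z of (x, y) => \<Gamma> x + \<Delta> y) \<partial>(A \<Otimes>\<^sub>M B))"
   by (subst B.nn_integral_fst[symmetric]) auto
  finally show ?thesis .
 qed
 moreover have "(\<integral>\<^sup>+z. ennreal (gauss (case z of (x, y) => \<Gamma> x + \<Delta> y)) \<partial>(A \<Otimes>\<^sub>M B)) = 1"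
 proof -
  have g: "ennreal (gauss (\<Gamma> x + \<Delta> y)) = ennreal (gauss (\<Gamma> x)) * ennreal (gauss (\<Delta> y))"
   if "x \<in> space A" "y \<in> space B" for x y
  proof -
   have "(norm (\<Gamma> x + \<Delta> y))\<^sup>2 = (norm (\<Gamma> x))\<^sup>2 + (norm (\<Delta> y))\<^sup>2"
    using orth[OF AS[OF that(1)] BS[OF that(2)]] unfolding power2_norm_eq_inner
    by (simp add: inner_add_left inner_add_right inner_commute)
   then show ?thesis unfolding gauss_def by (simp add: ennreal_mult[symmetric] exp_add[symmetric] algebra_simps)
  qed
  have "(\<integral>\<^sup>+z. ennreal (gauss (case z of (x, y) => \<Gamma> x + \<Delta> y)) \<partial>(A \<Otimes>\<^sub>M B))
    = (\<integral>\<^sup>+x. \<integral>\<^sup>+y. ennreal (gauss (\<Gamma> x + \<Delta> y)) \<partial>B \<partial>A)"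
   by (subst B.nn_integral_fst[symmetric]) auto
  also have "... = (\<integral>\<^sup>+x. \<integral>\<^sup>+y. ennreal (gauss (\<Gamma> x)) * ennreal (gauss (\<Delta> y)) \<partial>B \<partial>A)"
   by (intro nn_integral_cong) (simp add: g)
  also have "... = 1" by (simp add: nn_integral_cmult Am Bm)
  finally show ?thesis .
 qed
 moreover have "(case z of (x, y) => \<Gamma> x + \<Delta> y) \<in> W" if "z \<in> space (A \<Otimes>\<^sub>M B)" for z
  using that AS BS unfolding W by (auto simp: space_pair_measure)
 ultimately show ?thesis
  unfolding frame_def shift_invariant_def using P.sigma_finite_measure_axioms by auto
qed

lemma frame_distr_lborel:
 assumes "frame A \<Gamma> (UNIV :: 'g::euclidean_space set)"
 shows "distr A borel \<Gamma> = lborel"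
proof (rule measure_eqI)
 have [measurable]: "\<Gamma> \<in> A \<rightarrow>\<^sub>M borel" using assms by (simp add: frame_def shift_invariant_def)
 fix X assume "X \<in> sets (distr A borel \<Gamma>)"
 then have [measurable]: "X \<in> sets borel" by simp
 have "emeasure (distr A borel \<Gamma>) X = (\<integral>\<^sup>+x. indicator X (\<Gamma> x) \<partial>A)"
  by (subst nn_integral_indicator[symmetric], simp, subst nn_integral_distr) auto
 also have "... = (\<integral>\<^sup>+x. indicator X x \<partial>lborel)"
  by (rule frame_unique[OF assms frame_lborel]) (auto simp: subspace_UNIV)
 finally show "emeasure (distr A borel \<Gamma>) X = emeasure lborel X" by simp
qed simp




section \<open>Fourier inversion and mollification\<close>

definition fourier :: "('a::euclidean_space => complex) => 'a => complex" where
 "fourier f s = (LINT x|lborel. f x * cis (- (2 * pi * (s \<bullet> x))))"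

lemma fourier_ft: "fourier = gaussian_space.ft lborel (\<bullet>)"
 by (rule ext, rule ext) (simp add: fourier_def gaussian_space.ft_def[OF gaussian_space_lborel])

lemma fourier_measurable[measurable]:
 fixes f :: "'a::euclidean_space => complex"
 assumes [measurable]: "f \<in> borel_measurable borel"
 shows "fourier f \<in> borel_measurable borel"
 using gaussian_space.ft_measurable[OF gaussian_space_lborel, of f] by (simp add: fourier_ft)

lemma fourier_bound:
 assumes "integrable lborel f"
 shows "cmod (fourier f s) <= (LINT x|lborel. cmod (f x))"
 unfolding fourier_ft by (rule gaussian_space.ft_bound[OF gaussian_space_lborel assms])

lemma lborel_integral_affine:
 fixes f :: "'a::euclidean_space => 'b::{banach, second_countable_topology}"
 assumes c: "c ~= 0" and [measurable]: "f \<in> borel_measurable borel"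
 shows "(LINT x|lborel. f x) = \<bar>c\<bar> ^ DIM('a) *\<^sub>R (LINT x|lborel. f (t + c *\<^sub>R x))"
proof -
 have "(LINT x|lborel. f x) = (LINT x|(density (distr lborel borel (%x. t + c *\<^sub>R x)) (%_. ennreal (\<bar>c\<bar> ^ DIM('a)))). f x)"
  by (subst lborel_affine[OF c, of t]) simp
 also have "... = (LINT x|(distr lborel borel (%x. t + c *\<^sub>R x)). \<bar>c\<bar> ^ DIM('a) *\<^sub>R f x)"
  by (subst integral_density) auto
 also have "... = (LINT x|lborel. \<bar>c\<bar> ^ DIM('a) *\<^sub>R f (t + c *\<^sub>R x))"
  by (subst integral_distr) auto
 finally show ?thesis by simp
qed

lemma lborel_integrable_affine:
 fixes f :: "'a::euclidean_space => 'b::{banach, second_countable_topology}"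
 assumes c: "c ~= 0" and f: "integrable lborel f"
 shows "integrable lborel (%x. f (t + c *\<^sub>R x))"
proof -
 have [measurable]: "f \<in> borel_measurable borel" using f by auto
 have "integrable (density (distr lborel borel (%x. t + c *\<^sub>R x)) (%_. ennreal (\<bar>c\<bar> ^ DIM('a)))) f"
  using f by (subst (asm) lborel_affine[OF c, of t]) simp
 then have "integrable (distr lborel borel (%x. t + c *\<^sub>R x)) (%x. \<bar>c\<bar> ^ DIM('a) *\<^sub>R f x)"
  by (subst (asm) integrable_density) auto
 then have "integrable lborel (%x. \<bar>c\<bar> ^ DIM('a) *\<^sub>R f (t + c *\<^sub>R x))"
  by (subst (asm) integrable_distr_eq) auto
 from integrable_scaleR_right[OF this, of "1 / \<bar>c\<bar> ^ DIM('a)"] show ?thesis using c by simp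
qed

lemma gauss_nonneg: "0 <= gauss x" by (simp add: gauss_def)

lemma gauss_integrable_lborel: "integrable lborel (gauss :: 'a::euclidean_space => real)"
 by (rule integrableI_nonneg) (simp_all add: gauss_mass_lborel gauss_nonneg)

lemma gauss_integral_lborel: "(LINT x|lborel. gauss (x :: 'a::euclidean_space)) = 1"
proof -
 have "ennreal (LINT x|lborel. gauss (x :: 'a)) = (\<integral>\<^sup>+x. ennreal (gauss (x :: 'a)) \<partial>lborel)"
  by (rule nn_integral_eq_integral[OF gauss_integrable_lborel, symmetric]) (simp add: gauss_nonneg)
 then have "ennreal (LINT x|lborel. gauss (x :: 'a)) = ennreal 1" by (simp add: gauss_mass_lborel)
 then show ?thesis by (subst (asm) ennreal_inj) (simp_all add: gauss_nonneg)
qed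

text \<open>The inverse transform, damped by a Gaussian, is the average of \<open>\<psi>\<close> against a shrinking Gaussian.\<close>

lemma fourier_inversion:
 fixes \<psi> :: "'a::euclidean_space => complex"
 assumes int: "integrable lborel \<psi>" and cont: "continuous_on UNIV \<psi>" and bd: "\<And>x. cmod (\<psi> x) <= B"
  and fint: "integrable lborel (fourier \<psi>)"
 shows "\<psi> a = (LINT s|lborel. fourier \<psi> s * cis (2 * pi * (s \<bullet> a)))"
proof -
 interpret gaussian_space "lborel :: 'a measure" "(\<bullet>)" "%x y. (norm (x - y))\<^sup>2" "%x. (norm x)\<^sup>2" "DIM('a)"
  by (rule gaussian_space_lborel)
 have [measurable]: "\<psi> \<in> borel_measurable borel" using int by auto
 define r where "r = (%n. 1 / real (Suc n))"
 have r: "0 < r n" for n by (simp add: r_def)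
 have rlim: "r \<longlonglongrightarrow> 0" unfolding r_def by (rule LIMSEQ_Suc[OF lim_1_over_n])
 have eq: "(LINT u|lborel. gauss u *\<^sub>R \<psi> (a + r n *\<^sub>R u))
   = (LINT s|lborel. exp (- pi * (r n)\<^sup>2 * (norm s)\<^sup>2) *\<^sub>R (cis (2 * pi * (s \<bullet> a)) * fourier \<psi> s))" for n
 proof -
  have t: "0 < (r n)\<^sup>2" using r[of n] by simp
  have sq: "sqrt ((r n)\<^sup>2) = r n" using r[of n] by simp
  have "(LINT x|lborel. \<psi> x * of_real ((1 / sqrt ((r n)\<^sup>2)) ^ DIM('a) * exp (- pi * (norm (a - x))\<^sup>2 / (r n)\<^sup>2)))
    = \<bar>r n\<bar> ^ DIM('a) *\<^sub>R (LINT u|lborel. \<psi> (a + r n *\<^sub>R u) * of_real ((1 / sqrt ((r n)\<^sup>2)) ^ DIM('a) * exp (- pi * (norm (a - (a + r n *\<^sub>R u)))\<^sup>2 / (r n)\<^sup>2)))"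
   using r[of n] by (intro lborel_integral_affine) auto
  also have "... = (LINT u|lborel. gauss u *\<^sub>R \<psi> (a + r n *\<^sub>R u))"
   unfolding integral_scaleR_right[symmetric] sq
  proof (rule Bochner_Integration.integral_cong[OF refl])
   fix u
   have "exp (- pi * (norm (a - (a + r n *\<^sub>R u)))\<^sup>2 / (r n)\<^sup>2) = gauss u"
    using r[of n] by (simp add: gauss_def power_mult_distrib)
   then show "\<bar>r n\<bar> ^ DIM('a) *\<^sub>R (\<psi> (a + r n *\<^sub>R u) * of_real ((1 / r n) ^ DIM('a) * exp (- pi * (norm (a - (a + r n *\<^sub>R u)))\<^sup>2 / (r n)\<^sup>2)))
     = gauss u *\<^sub>R \<psi> (a + r n *\<^sub>R u)"
    using r[of n] by (simp add: scaleR_conv_of_real power_one_over)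
  qed
  finally show ?thesis
   using gauss_pairing[OF int t, of a] by (simp add: fourier_ft scaleR_conv_of_real mult.assoc)
 qed
 have L: "(%n. \<integral>u. gauss u *\<^sub>R \<psi> (a + r n *\<^sub>R u) \<partial>lborel) \<longlonglongrightarrow> (LINT u|lborel. gauss (u::'a) *\<^sub>R \<psi> a)"
 proof (rule integral_dominated_convergence[where w="%u::'a. gauss u * B"])
  show "integrable lborel (%u::'a. gauss u * B)" by (intro integrable_mult_left gauss_integrable_lborel)
  show "AE u in lborel. (%n. gauss u *\<^sub>R \<psi> (a + r n *\<^sub>R u)) \<longlonglongrightarrow> gauss u *\<^sub>R \<psi> a"
  proof (rule AE_I2)
   fix u
   have "(%n. a + r n *\<^sub>R u) \<longlonglongrightarrow> a + 0 *\<^sub>R u" by (intro tendsto_intros rlim)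
   then have "(%n. \<psi> (a + r n *\<^sub>R u)) \<longlonglongrightarrow> \<psi> a"
    using cont by (auto simp: continuous_on_eq_continuous_at intro: isCont_tendsto_compose)
   then show "(%n. gauss u *\<^sub>R \<psi> (a + r n *\<^sub>R u)) \<longlonglongrightarrow> gauss u *\<^sub>R \<psi> a" by (intro tendsto_intros)
  qed
  show "AE u in lborel. norm (gauss u *\<^sub>R \<psi> (a + r n *\<^sub>R u)) <= gauss u * B" for n
   by (auto simp: gauss_def intro!: mult_left_mono bd)
 qed measurable
 have R: "(%n. \<integral>s. exp (- pi * (r n)\<^sup>2 * (norm s)\<^sup>2) *\<^sub>R (cis (2 * pi * (s \<bullet> a)) * fourier \<psi> s) \<partial>lborel)
   \<longlonglongrightarrow> (LINT s|lborel. exp (- pi * 0\<^sup>2 * (norm s)\<^sup>2) *\<^sub>R (cis (2 * pi * (s \<bullet> a)) * fourier \<psi> s))"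
 proof (rule integral_dominated_convergence[where w="%s. cmod (fourier \<psi> s)"])
  show "integrable lborel (%s. cmod (fourier \<psi> s))" using fint by simp
  show "AE s in lborel. (%n. exp (- pi * (r n)\<^sup>2 * (norm s)\<^sup>2) *\<^sub>R (cis (2 * pi * (s \<bullet> a)) * fourier \<psi> s))
    \<longlonglongrightarrow> exp (- pi * 0\<^sup>2 * (norm s)\<^sup>2) *\<^sub>R (cis (2 * pi * (s \<bullet> a)) * fourier \<psi> s)"
   by (intro AE_I2 tendsto_intros rlim)
  show "AE s in lborel. norm (exp (- pi * (r n)\<^sup>2 * (norm s)\<^sup>2) *\<^sub>R (cis (2 * pi * (s \<bullet> a)) * fourier \<psi> s))
    <= cmod (fourier \<psi> s)" for n
   by (auto simp: norm_mult intro!: mult_left_le_one_le)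
 qed measurable
 have "(LINT u|lborel. gauss (u::'a) *\<^sub>R \<psi> a) = \<psi> a"
  by (subst integral_scaleR_left) (simp_all add: gauss_integral_lborel gauss_integrable_lborel)
 then show ?thesis
  using LIMSEQ_unique[OF L[unfolded eq] R] by (simp add: mult.commute)
qed

lemma convolution_integrable:
 fixes F \<rho> :: "'a::euclidean_space => complex"
 assumes F: "integrable lborel F" and \<rho>: "integrable lborel \<rho>"
 shows "integrable (lborel \<Otimes>\<^sub>M lborel) (%(y, z). F y * \<rho> (z - y))"
proof -
 have [measurable]: "F \<in> borel_measurable borel" "\<rho> \<in> borel_measurable borel" using F \<rho> by auto
 have sh: "integrable lborel (%z. \<rho> (z - y))" for y
  using lborel_integrable_affine[OF _ \<rho>, of 1 "- y"] by simp
 have nsh: "(LINT z|lborel. cmod (\<rho> (z - y))) = (LINT z|lborel. cmod (\<rho> z))" for y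
  using lborel_integral_affine[of 1 "%z. cmod (\<rho> z)" "- y"] by simp
 show ?thesis
  by (rule lborel_pair.Fubini_integrable) (use F sh in \<open>auto simp: norm_mult nsh split_beta'\<close>)
qed

text \<open>
 If the averages of \<open>F\<close> against all dilates of \<open>\<rho>\<close> vanish, so do those of a bounded continuous \<open>\<phi> F\<close>
 in the limit; indicators of open sets are limits of such \<open>\<phi>\<close>.
\<close>

lemma mollify_zero:
 fixes F \<rho> :: "'a::euclidean_space => complex"
 assumes F: "integrable lborel F" and \<rho>: "integrable lborel \<rho>" and nz: "(LINT x|lborel. \<rho> x) ~= 0"
  and r: "\<And>n. 0 < r n" and rlim: "r \<longlonglongrightarrow> 0"
  and zero: "\<And>n z. (LINT y|lborel. F y * \<rho> ((1 / r n) *\<^sub>R (z - y))) = 0"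
 shows "AE x in lborel. F x = 0"
proof -
 have [measurable]: "F \<in> borel_measurable borel" "\<rho> \<in> borel_measurable borel" using F \<rho> by auto
 have test: "(LINT y|lborel. of_real (\<phi> y) * F y) = 0"
  if cont: "continuous_on UNIV \<phi>" and bd: "\<And>x. \<bar>\<phi> x\<bar> <= 1" for \<phi> :: "'a => real"
 proof -
  have [measurable]: "\<phi> \<in> borel_measurable borel" using cont by (rule borel_measurable_continuous_onI)
  have "(LINT y|lborel. F y * (LINT u|lborel. of_real (\<phi> (y + r n *\<^sub>R u)) * \<rho> u)) = 0" for n
  proof -
   define \<rho>n where "\<rho>n = (%x. \<rho> ((1 / r n) *\<^sub>R x))"
   have \<rho>n: "integrable lborel \<rho>n"
    unfolding \<rho>n_def using lborel_integrable_affine[OF _ \<rho>, of "1 / r n" 0] r[of n] by simp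
   then have [measurable]: "\<rho>n \<in> borel_measurable borel" by auto
   have "integrable (lborel \<Otimes>\<^sub>M lborel) (%(y, z). of_real (\<phi> z) * (F y * \<rho>n (z - y)))"
    by (rule Bochner_Integration.integrable_bound[OF convolution_integrable[OF F \<rho>n]])
     (auto simp: norm_mult split_beta' intro!: mult_left_le_one_le bd)
   from lborel_pair.Fubini_integral[OF this]
   have "(LINT y|lborel. (LINT z|lborel. of_real (\<phi> z) * (F y * \<rho>n (z - y))))
     = (LINT z|lborel. of_real (\<phi> z) * (LINT y|lborel. F y * \<rho>n (z - y)))" by simp
   also have "... = 0" using zero[of n] by (simp add: \<rho>n_def)
   finally have z0: "(LINT y|lborel. F y * (LINT z|lborel. of_real (\<phi> z) * \<rho>n (z - y))) = 0"
    by (simp add: mult.left_commute)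
   have sub: "(LINT z|lborel. of_real (\<phi> z) * \<rho>n (z - y))
     = \<bar>r n\<bar> ^ DIM('a) *\<^sub>R (LINT u|lborel. of_real (\<phi> (y + r n *\<^sub>R u)) * \<rho> u)" for y
    using r[of n] by (subst lborel_integral_affine[where c="r n" and t=y]) (auto simp: \<rho>n_def)
   show ?thesis using z0 r[of n] unfolding sub by simp
  qed
  moreover have "(%n. \<integral>y. F y * (LINT u|lborel. of_real (\<phi> (y + r n *\<^sub>R u)) * \<rho> u) \<partial>lborel)
    \<longlonglongrightarrow> (LINT y|lborel. F y * (LINT u|lborel. of_real (\<phi> y) * \<rho> u))"
  proof (rule integral_dominated_convergence[where w="%y. cmod (F y) * (LINT u|lborel. cmod (\<rho> u))"])
   show "integrable lborel (%y. cmod (F y) * (LINT u|lborel. cmod (\<rho> u)))" using F by simp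
   show "AE y in lborel. (%n. F y * (LINT u|lborel. of_real (\<phi> (y + r n *\<^sub>R u)) * \<rho> u))
     \<longlonglongrightarrow> F y * (LINT u|lborel. of_real (\<phi> y) * \<rho> u)"
   proof (intro AE_I2 tendsto_intros)
    fix y
    show "(%n. \<integral>u. of_real (\<phi> (y + r n *\<^sub>R u)) * \<rho> u \<partial>lborel) \<longlonglongrightarrow> (LINT u|lborel. of_real (\<phi> y) * \<rho> u)"
    proof (rule integral_dominated_convergence[where w="%u. cmod (\<rho> u)"])
     show "AE u in lborel. (%n. of_real (\<phi> (y + r n *\<^sub>R u)) * \<rho> u) \<longlonglongrightarrow> of_real (\<phi> y) * \<rho> u"
     proof (intro AE_I2 tendsto_intros)
      fix u
      have "(%n. y + r n *\<^sub>R u) \<longlonglongrightarrow> y + 0 *\<^sub>R u" by (intro tendsto_intros rlim)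
      then show "(%n. \<phi> (y + r n *\<^sub>R u)) \<longlonglongrightarrow> \<phi> y"
       using cont by (auto simp: continuous_on_eq_continuous_at intro: isCont_tendsto_compose)
     qed
    qed (use \<rho> in \<open>auto simp: norm_mult intro!: mult_left_le_one_le bd\<close>)
   qed
   show "AE y in lborel. norm (F y * (LINT u|lborel. of_real (\<phi> (y + r n *\<^sub>R u)) * \<rho> u))
     <= cmod (F y) * (LINT u|lborel. cmod (\<rho> u))" for n
   proof (rule AE_I2)
    fix y
    have "cmod (LINT u|lborel. of_real (\<phi> (y + r n *\<^sub>R u)) * \<rho> u) <= (LINT u|lborel. cmod (of_real (\<phi> (y + r n *\<^sub>R u)) * \<rho> u))"
     by (rule integral_norm_bound)
    also have "... <= (LINT u|lborel. cmod (\<rho> u))"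
    proof (rule integral_mono)
     show "integrable lborel (%u. cmod (of_real (\<phi> (y + r n *\<^sub>R u)) * \<rho> u))"
      by (rule Bochner_Integration.integrable_bound[OF \<rho>])
       (auto simp: norm_mult intro!: mult_left_le_one_le bd)
    qed (use \<rho> in \<open>auto simp: norm_mult intro!: mult_left_le_one_le bd\<close>)
    finally show "norm (F y * (LINT u|lborel. of_real (\<phi> (y + r n *\<^sub>R u)) * \<rho> u))
     <= cmod (F y) * (LINT u|lborel. cmod (\<rho> u))" by (simp add: norm_mult mult_left_mono)
   qed
  qed measurable
  ultimately have "(LINT y|lborel. F y * (LINT u|lborel. of_real (\<phi> y) * \<rho> u)) = 0"
   by (simp add: LIMSEQ_const_iff)
  moreover have "(LINT y|lborel. F y * (LINT u|lborel. of_real (\<phi> y) * \<rho> u))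
    = (LINT y|lborel. of_real (\<phi> y) * F y) * (LINT u|lborel. \<rho> u)"
   by (simp add: mult.assoc[symmetric] mult.commute[of "F _"])
  ultimately show ?thesis using nz by simp
 qed
 have opn: "(LINT x|lborel. indicator S x *\<^sub>R F x) = 0" if S: "open S" for S
 proof (cases "S = UNIV")
  case True
  then show ?thesis using test[of "%_. 1"] by simp
 next
  case False
  define \<phi> where "\<phi> = (%n x. min 1 (real n * infdist x (- S)))"
  have "(%n. \<integral>x. of_real (\<phi> n x) * F x \<partial>lborel) \<longlonglongrightarrow> (LINT x|lborel. indicator S x *\<^sub>R F x)"
  proof (rule integral_dominated_convergence[where w="%x. cmod (F x)"])
   show "AE x in lborel. (%n. of_real (\<phi> n x) * F x) \<longlonglongrightarrow> indicator S x *\<^sub>R F x"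
   proof (rule AE_I2)
    fix x
    have "(%n. \<phi> n x) \<longlonglongrightarrow> indicator S x"
    proof (cases "x \<in> S")
     case True
     then have "infdist x (- S) > 0"
      using False S by (subst infdist_pos_not_in_closed) (auto simp: closed_Compl)
     then obtain N :: nat where N: "1 < real N * infdist x (- S)" using reals_Archimedean3 by blast
     have "\<forall>\<^sub>F n in sequentially. \<phi> n x = 1"
      using eventually_ge_at_top[of N]
     proof eventually_elim
      case (elim n)
      then have "real N * infdist x (- S) <= real n * infdist x (- S)"
       by (intro mult_right_mono infdist_nonneg) auto
      then show ?case using N by (simp add: \<phi>_def)
     qed
     then show ?thesis using True by (simp add: tendsto_eventually)
    next
     case x: False
     then have "infdist x (- S) = 0" by simp
     then show ?thesis using x by (simp add: \<phi>_def)
    qed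
    then have "(%n. of_real (\<phi> n x) * F x) \<longlonglongrightarrow> of_real (indicator S x) * F x" by (intro tendsto_intros)
    then show "(%n. of_real (\<phi> n x) * F x) \<longlonglongrightarrow> indicator S x *\<^sub>R F x" by (simp add: scaleR_conv_of_real)
   qed
   show "AE x in lborel. norm (of_real (\<phi> n x) * F x) <= cmod (F x)" for n
    by (auto simp: norm_mult \<phi>_def infdist_nonneg intro!: mult_left_le_one_le)
   have "\<phi> n \<in> borel_measurable borel" for n
    unfolding \<phi>_def by (intro borel_measurable_continuous_onI continuous_intros)
   then show "(%x. of_real (\<phi> n x) * F x) \<in> borel_measurable lborel" for n by measurable
   show "(%x. indicator S x *\<^sub>R F x) \<in> borel_measurable lborel" using S F by (auto intro!: borel_measurable_scaleR borel_measurable_indicator)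
  qed (use F in simp)
  moreover have "(LINT x|lborel. of_real (\<phi> n x) * F x) = 0" for n
   by (rule test) (auto simp: \<phi>_def infdist_nonneg intro!: continuous_intros)
  ultimately show ?thesis by (simp add: LIMSEQ_const_iff)
 qed
 show ?thesis
 proof (rule AE_zero_of_generator[OF lborel.sigma_finite_measure_axioms F, of "{S. open S}"])
  show "Int_stable {S::'a set. open S}" by (auto intro!: Int_stableI)
  show "(LINT x|lborel. F x) = 0" using opn[of UNIV] by simp
 qed (auto simp: opn sets_borel)
qed

section \<open>Quasi-analyticity\<close>

text \<open>
 Bang's proof of the Denjoy--Carleman theorem. With the norm \<open>B(x) = sup\<^sub>j |g\<^sub>j(x)| / (e\<^sup>j M\<^sub>j)\<close>, Taylor
 expansion up to order \<open>N\<close> shows that \<open>B(x) <= e\<^sup>-\<^sup>N\<close> implies \<open>B(x + h) <= e\<^sup>-\<^sup>N\<^sup>+\<^sup>1\<close> for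
 \<open>|h| <= M\<^sub>N\<^sub>-\<^sub>1 / (e M\<^sub>N)\<close>: the terms below \<open>N\<close> are controlled by \<open>B(x)\<close>, the others are small anyway.
 The function vanishing with all its derivatives at \<open>0\<close> therefore needs infinitely many steps of divergent
 total length to become large.
\<close>

lemma exp_partial_sum_le:
 fixes y :: real assumes "0 <= y" "y <= 1"
 shows "(\<Sum>i\<le>n. y ^ i / fact i) <= exp 1"
proof -
 have "(\<Sum>i\<le>n. y ^ i / fact i) <= (\<Sum>i\<le>n. 1 ^ i /\<^sub>R fact i)"
  using assms by (intro sum_mono) (auto simp: power_le_one divide_simps)
 also have "... <= (\<Sum>i. 1 ^ i /\<^sub>R fact i)"
  by (intro sum_le_suminf summable_exp_generic) auto
 finally show ?thesis by (simp add: exp_def)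
qed

lemma Bang_step:
 fixes g :: "nat => real => complex" and M :: "nat => real"
 assumes Mpos: "\<And>n. 0 < M n"
  and ratio: "\<And>n. M (Suc n) * M (Suc n) <= M n * M (Suc (Suc n))"
  and taylor: "\<And>j m x h. cmod (g j (x + h) - (\<Sum>i<m. g (j + i) x * of_real (h ^ i / fact i))) <= M (j + m) * \<bar>h\<bar> ^ m / fact m"
  and B: "\<And>j. cmod (g j x) <= exp (- real (Suc N)) * exp (real j) * M j"
  and h: "\<bar>h\<bar> <= M N / (exp 1 * M (Suc N))"
 shows "cmod (g j (x + h)) <= exp (- real N) * exp (real j) * M j"
proof (cases "j <= N")
 case False
 have "cmod (g j (x + h)) <= M j" using taylor[of j "x + h" 0 0] by simp
 also have "M j <= exp (real j - real N) * M j"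
  using False Mpos[of j] by (simp add: mult_le_cancel_right1)
 finally show ?thesis by (simp add: exp_diff exp_minus field_simps)
next
 case True
 define \<mu> where "\<mu> = M (Suc N) / M N"
 have mono: "M (Suc n) / M n <= M (Suc (Suc n)) / M (Suc n)" for n
  using ratio[of n] Mpos[of n] Mpos[of "Suc n"] by (simp add: divide_simps mult.commute)
 have incr: "M (Suc n) / M n <= \<mu>" if "n <= N" for n
  unfolding \<mu>_def by (rule lift_Suc_mono_le[where f="%n. M (Suc n) / M n", OF mono that])
 have \<mu>: "0 < \<mu>" unfolding \<mu>_def using Mpos by simp
 have growth: "M (j + i) <= M j * \<mu> ^ i" if "j + i <= Suc N" for i
  using that
 proof (induction i)
  case (Suc i)
  have "M (Suc (j + i)) <= \<mu> * M (j + i)"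
   using incr[of "j + i"] Suc.prems Mpos[of "j + i"] by (simp add: divide_le_eq)
  also have "... <= \<mu> * (M j * \<mu> ^ i)" using Suc \<mu> by (intro mult_left_mono) auto
  finally show ?case by (simp add: algebra_simps)
 qed simp
 define m where "m = Suc N - j"
 have jm: "j + m = Suc N" using True by (simp add: m_def)
 define y where "y = exp 1 * \<bar>h\<bar> * \<mu>"
 have y: "0 <= y" "y <= 1"
 proof -
  have "exp 1 * \<bar>h\<bar> * \<mu> <= exp 1 * (M N / (exp 1 * M (Suc N))) * \<mu>"
   using h \<mu> by (intro mult_right_mono mult_left_mono) auto
  then show "y <= 1" using Mpos[of N] Mpos[of "Suc N"] by (simp add: y_def \<mu>_def)
 qed (use \<mu> in \<open>simp add: y_def\<close>)
 define E where "E = exp (- real (Suc N)) * exp (real j) * M j"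
 have E: "0 <= E" unfolding E_def using Mpos[of j] by simp
 have tm: "exp (- real (Suc N)) * exp (real (j + i)) * M (j + i) * (\<bar>h\<bar> ^ i / fact i) <= E * (y ^ i / fact i)"
  if "i <= m" for i
 proof -
  have "exp (- real (Suc N)) * exp (real (j + i)) * M (j + i) * (\<bar>h\<bar> ^ i / fact i)
   <= exp (- real (Suc N)) * exp (real (j + i)) * (M j * \<mu> ^ i) * (\<bar>h\<bar> ^ i / fact i)"
   using growth[of i] that jm by (intro mult_right_mono mult_left_mono) auto
  also have "... = E * (y ^ i / fact i)"
   by (simp add: E_def y_def power_mult_distrib exp_add exp_of_nat_mult[symmetric] mult_ac)
  finally show ?thesis .
 qed
 have "cmod (g j (x + h)) <= cmod (\<Sum>i<m. g (j + i) x * of_real (h ^ i / fact i)) + M (j + m) * \<bar>h\<bar> ^ m / fact m"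
  using taylor[of j x h m] norm_triangle_ineq2[of "g j (x + h)" "\<Sum>i<m. g (j + i) x * of_real (h ^ i / fact i)"] by linarith
 also have "cmod (\<Sum>i<m. g (j + i) x * of_real (h ^ i / fact i)) <= (\<Sum>i<m. E * (y ^ i / fact i))"
 proof (rule order_trans[OF norm_sum sum_mono])
  fix i assume i: "i \<in> {..<m}"
  have "cmod (g (j + i) x * of_real (h ^ i / fact i)) = cmod (g (j + i) x) * (\<bar>h\<bar> ^ i / fact i)"
   by (simp add: norm_mult norm_divide norm_power)
  also have "... <= exp (- real (Suc N)) * exp (real (j + i)) * M (j + i) * (\<bar>h\<bar> ^ i / fact i)"
   by (intro mult_right_mono B) auto
  also have "... <= E * (y ^ i / fact i)" using tm i by auto
  finally show "cmod (g (j + i) x * of_real (h ^ i / fact i)) <= E * (y ^ i / fact i)" .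
 qed
 also have "M (j + m) * \<bar>h\<bar> ^ m / fact m <= E * (y ^ m / fact m)"
 proof -
  have "exp (- real (Suc N)) * exp (real (j + m)) = 1" unfolding jm exp_add[symmetric] by simp
  then show ?thesis using tm[of m] by (simp add: mult.assoc)
 qed
 also have "(\<Sum>i<m. E * (y ^ i / fact i)) + E * (y ^ m / fact m) = E * (\<Sum>i\<le>m. y ^ i / fact i)"
  by (simp only: lessThan_Suc_atMost[symmetric] sum.lessThan_Suc sum_distrib_left distrib_left)
 also have "... <= E * exp 1" by (intro mult_left_mono exp_partial_sum_le y E)
 also have "... = exp (- real N) * exp (real j) * M j"
  by (simp add: E_def exp_diff exp_minus exp_add field_simps)
 finally show ?thesis by simp
qed

lemma Denjoy_Carleman:
 fixes g :: "nat => real => complex" and M :: "nat => real"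
 assumes Mpos: "\<And>n. 0 < M n"
  and ratio: "\<And>n. M (Suc n) * M (Suc n) <= M n * M (Suc (Suc n))"
  and taylor: "\<And>j m x h. cmod (g j (x + h) - (\<Sum>i<m. g (j + i) x * of_real (h ^ i / fact i))) <= M (j + m) * \<bar>h\<bar> ^ m / fact m"
  and flat: "\<And>j. g j 0 = 0"
  and div: "\<not> summable (%n. M n / M (Suc n))"
 shows "g j x = 0"
proof -
 have claim: "cmod (g j x) <= exp (- real L) * exp (real j) * M j"
  if "\<bar>x\<bar> <= (\<Sum>n\<in>{L..<L + k}. M n / (exp 1 * M (Suc n)))" for L k j x
  using that
 proof (induction k arbitrary: L x j)
  case 0
  then show ?case using flat Mpos[of j] by simp
 next
  case (Suc k)
  define s where "s = M L / (exp 1 * M (Suc L))"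
  have s: "0 < s" unfolding s_def using Mpos by simp
  define h where "h = max (- s) (min s x)"
  have "{L..<L + Suc k} = insert L {Suc L..<Suc L + k}" by auto
  then have tot: "\<bar>x\<bar> <= s + (\<Sum>n\<in>{Suc L..<Suc L + k}. M n / (exp 1 * M (Suc n)))"
   using Suc.prems by (simp add: s_def)
  have nn: "0 <= (\<Sum>n\<in>{Suc L..<Suc L + k}. M n / (exp 1 * M (Suc n)))"
   using Mpos by (intro sum_nonneg) (auto simp: less_imp_le)
  have "\<bar>x - h\<bar> <= (\<Sum>n\<in>{Suc L..<Suc L + k}. M n / (exp 1 * M (Suc n)))"
   using tot nn s unfolding h_def by (auto simp: max_def min_def abs_if split: if_splits)
  from Suc.IH[OF this] have "cmod (g j (x - h)) <= exp (- real (Suc L)) * exp (real j) * M j" for j .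
  moreover have "\<bar>h\<bar> <= M L / (exp 1 * M (Suc L))" using s unfolding h_def s_def by auto
  ultimately have "cmod (g j ((x - h) + h)) <= exp (- real L) * exp (real j) * M j"
   by (intro Bang_step[OF Mpos ratio taylor])
  then show ?case by simp
 qed
 have "cmod (g j x) <= exp (- real L) * (exp (real j) * M j)" for L
 proof -
  have ns: "\<not> summable (%n. M (n + L) / (exp 1 * M (Suc (n + L))))"
  proof
   assume "summable (%n. M (n + L) / (exp 1 * M (Suc (n + L))))"
   then have "summable (%n. exp 1 * (M (n + L) / (exp 1 * M (Suc (n + L)))))" by (rule summable_mult)
   then have "summable (%n. M (n + L) / M (Suc (n + L)))" by simp
   then show False using div summable_iff_shift[of "%n. M n / M (Suc n)" L] by simp
  qed
  have "\<exists>k. \<bar>x\<bar> <= (\<Sum>n<k. M (n + L) / (exp 1 * M (Suc (n + L))))"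
  proof (rule ccontr)
   assume "\<not> ?thesis"
   then have "(\<Sum>n<k. norm (M (n + L) / (exp 1 * M (Suc (n + L))))) <= \<bar>x\<bar>" for k
    using Mpos by (simp add: abs_of_pos not_le less_imp_le)
   then have "summable (%n. M (n + L) / (exp 1 * M (Suc (n + L))))"
    by (intro summable_norm_cancel[OF bounded_imp_summable[of _ "\<bar>x\<bar>"]]) (auto simp: lessThan_Suc_atMost[symmetric] simp del: sum.lessThan_Suc)
   with ns show False ..
  qed
  then obtain k where "\<bar>x\<bar> <= (\<Sum>n<k. M (n + L) / (exp 1 * M (Suc (n + L))))" by blast
  also have "... = (\<Sum>n\<in>{L..<L + k}. M n / (exp 1 * M (Suc n)))"
   by (rule sum.reindex_bij_witness[of _ "%n. n - L" "%n. n + L"]) auto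
  finally show ?thesis using claim[of x L k j] by (simp add: mult.assoc)
 qed
 moreover have "(%L. exp (- real L) * (exp (real j) * M j)) \<longlonglongrightarrow> 0 * (exp (real j) * M j)"
  by (intro tendsto_mult tendsto_const filterlim_compose[OF exp_at_bot] filterlim_compose[OF filterlim_uminus_at_bot_at_top] filterlim_real_sequentially)
 ultimately have "cmod (g j x) <= 0 * (exp (real j) * M j)"
  by (intro LIMSEQ_le_const) auto
 then show ?thesis by simp
qed

text \<open>Carleman's inequality, with a constant that is not sharp: weight the geometric mean by \<open>n!\<close>.\<close>

lemma fact_lower_bound: "(real n / exp 1) ^ n <= fact n"
proof -
 have "real n ^ n / fact n <= exp (real n)"
 proof -
  have "real n ^ n / fact n = (\<Sum>i\<in>{n}. real n ^ i /\<^sub>R fact i)" by (simp add: divide_inverse mult.commute)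
  also have "... <= (\<Sum>i. real n ^ i /\<^sub>R fact i)"
   by (intro sum_le_suminf summable_exp_generic) auto
  finally show ?thesis by (simp add: exp_def)
 qed
 then show ?thesis by (simp add: power_divide exp_of_nat_mult[symmetric] field_simps)
qed

lemma Carleman_inequality:
 fixes a c :: "nat => real"
 assumes a: "\<And>n. 0 <= a n" and c: "\<And>n. 0 <= c n"
  and le: "\<And>n. c (Suc n) ^ Suc n <= K * (\<Prod>i\<le>n. a i)" and K: "1 <= K"
  and sum: "summable a"
 shows "summable (%n. c (Suc n))"
proof -
 have tm: "c (Suc n) <= K * exp 1 * (\<Sum>i\<le>n. real (Suc i) * a i) / (real (Suc n))\<^sup>2" for n
 proof -
  define S where "S = (\<Sum>i\<le>n. real (Suc i) * a i)"
  have S: "0 <= S" unfolding S_def using a by (intro sum_nonneg) auto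
  define Pr where "Pr = (\<Prod>i\<in>{..n}. real (Suc i) * a i)"
  have Pr: "0 <= Pr" unfolding Pr_def using a by (intro prod_nonneg) auto
  have "Pr powr (1 / card {..n}) <= (\<Sum>i\<in>{..n}. real (Suc i) * a i / card {..n})"
   unfolding Pr_def using a by (intro arith_geom_mean) auto
  then have "Pr powr (1 / real (Suc n)) <= S / real (Suc n)" by (simp add: S_def sum_divide_distrib)
  then have "(Pr powr (1 / real (Suc n))) ^ Suc n <= (S / real (Suc n)) ^ Suc n" by (intro power_mono) auto
  moreover have "(Pr powr (1 / real (Suc n))) ^ Suc n = Pr"
  proof (cases "Pr = 0")
   case False
   then have "0 < Pr powr (1 / real (Suc n))" by simp
   from powr_realpow[OF this, of "Suc n"]
   have "(Pr powr (1 / real (Suc n))) ^ Suc n = Pr powr (1 / real (Suc n) * real (Suc n))"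
    by (simp only: powr_powr)
   then show ?thesis using Pr by simp
  qed simp
  ultimately have amgm: "(\<Prod>i\<in>{..n}. real (Suc i) * a i) <= (S / real (Suc n)) ^ Suc n"
   by (simp only: Pr_def)
  have pf: "(\<Prod>i\<in>{..n}. real (Suc i)) = fact (Suc n)"
   by (simp add: fact_prod_Suc atLeast0LessThan lessThan_Suc_atMost del: fact_Suc)
  have "c (Suc n) ^ Suc n * (real (Suc n) / exp 1) ^ Suc n <= (K * (\<Prod>i\<le>n. a i)) * fact (Suc n)"
   using a K by (intro mult_mono le fact_lower_bound) (auto intro!: prod_nonneg mult_nonneg_nonneg)
  also have "... = K * (\<Prod>i\<in>{..n}. real (Suc i) * a i)" unfolding prod.distrib pf by simp
  also have "... <= K ^ Suc n * (S / real (Suc n)) ^ Suc n"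
   using K S amgm self_le_power[OF K, of "Suc n"] a by (intro mult_mono) (auto intro!: prod_nonneg mult_nonneg_nonneg)
  finally have "(c (Suc n) * (real (Suc n) / exp 1)) ^ Suc n <= (K * (S / real (Suc n))) ^ Suc n"
   by (simp only: power_mult_distrib)
  then have "c (Suc n) * (real (Suc n) / exp 1) <= K * (S / real (Suc n))"
   by (rule power_le_imp_le_base) (use K S in simp)
  then have "c (Suc n) <= K * (S / real (Suc n)) / (real (Suc n) / exp 1)"
   by (subst pos_le_divide_eq) (simp_all only: divide_pos_pos of_nat_0_less_iff zero_less_Suc exp_gt_zero)
  also have "... = K * exp 1 * S / (real (Suc n))\<^sup>2" by (simp add: power2_eq_square del: of_nat_Suc)
  finally show ?thesis by (simp only: S_def)
 qed
 have tail: "(\<Sum>n\<in>{i..<m}. 1 / (real (Suc n))\<^sup>2) <= 2 / real (Suc i)" if "i < m" for i m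
 proof -
  have "(\<Sum>n\<in>{i..<m}. 1 / (real (Suc n))\<^sup>2) <= 2 / real (Suc i) - 1 / real m"
   using Suc_leI[OF that]
  proof (induction m rule: dec_induct)
   case base
   have "1 / (real (Suc i))\<^sup>2 <= 1 / real (Suc i)" by (simp add: divide_simps power2_eq_square)
   then show ?case by simp
  next
   case (step m)
   have "1 / (real (Suc m))\<^sup>2 <= 1 / real m - 1 / real (Suc m)"
    using step.hyps by (simp add: divide_simps power2_eq_square)
   then show ?case using step by (simp add: atLeastLessThanSuc)
  qed
  moreover have "0 <= 1 / real m" by simp
  ultimately show ?thesis by linarith
 qed
 show ?thesis
 proof (rule bounded_imp_summable)
  show "0 <= c (Suc n)" for n by (rule c)
  fix m
  have "(\<Sum>n\<le>m. c (Suc n)) <= (\<Sum>n<Suc m. K * exp 1 * (\<Sum>i\<le>n. real (Suc i) * a i) / (real (Suc n))\<^sup>2)"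
   unfolding lessThan_Suc_atMost by (intro sum_mono tm)
  also have "... = K * exp 1 * (\<Sum>n<Suc m. \<Sum>i\<le>n. real (Suc i) * a i * (1 / (real (Suc n))\<^sup>2))"
   by (simp only: sum_distrib_left sum_distrib_right sum_divide_distrib) (simp add: mult_ac)
  also have "(\<Sum>n<Suc m. \<Sum>i\<le>n. real (Suc i) * a i * (1 / (real (Suc n))\<^sup>2))
    = (\<Sum>n<Suc m. \<Sum>i<Suc m. if i <= n then real (Suc i) * a i * (1 / (real (Suc n))\<^sup>2) else 0)"
   by (intro sum.cong refl sum.mono_neutral_cong_left) auto
  also have "... = (\<Sum>i<Suc m. \<Sum>n<Suc m. if i <= n then real (Suc i) * a i * (1 / (real (Suc n))\<^sup>2) else 0)"
   by (rule sum.swap)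
  also have "... = (\<Sum>i<Suc m. \<Sum>n\<in>{i..<Suc m}. real (Suc i) * a i * (1 / (real (Suc n))\<^sup>2))"
   by (intro sum.cong refl sum.mono_neutral_cong_right) auto
  also have "... = (\<Sum>i<Suc m. real (Suc i) * a i * (\<Sum>n\<in>{i..<Suc m}. 1 / (real (Suc n))\<^sup>2))"
   by (simp only: sum_distrib_left)
  also have "... <= (\<Sum>i<Suc m. real (Suc i) * a i * (2 / real (Suc i)))"
   by (intro sum_mono mult_left_mono tail mult_nonneg_nonneg a) auto
  also have "... = 2 * (\<Sum>i<Suc m. a i)" by (simp add: sum_distrib_left mult.commute del: sum.lessThan_Suc)
  also have "... <= 2 * suminf a" by (intro mult_left_mono sum_le_suminf sum a) auto
  finally show "(\<Sum>n\<le>m. c (Suc n)) <= K * exp 1 * (2 * suminf a)"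
   using K by (simp add: mult_left_mono)
 qed
qed




section \<open>Compactly supported functions with small Fourier transform\<close>

definition lip_supp :: "real => real => ('a::euclidean_space => complex) => bool" where
 "lip_supp L R f \<longleftrightarrow> 0 <= L \<and> 0 <= R \<and> (\<forall>x y. cmod (f x - f y) <= L * norm (x - y)) \<and> (\<forall>x. R < norm x \<longrightarrow> f x = 0)"

lemma lip_supp_continuous: "lip_supp L R f ==> continuous_on S f"
 by (rule lipschitz_on_continuous_on[of L]) (auto simp: lipschitz_on_def lip_supp_def dist_norm)

lemma lip_supp_bound:
 fixes f :: "'a::euclidean_space => complex"
 assumes "lip_supp L R f"
 shows "cmod (f x) <= L * (2 * R + 1)"
proof (cases "R < norm x")
 case True
 then show ?thesis using assms by (auto simp: lip_supp_def)
next
 case False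
 obtain b :: 'a where b: "b \<in> Basis" using nonempty_Basis by blast
 define y where "y = (R + 1) *\<^sub>R b"
 have ny: "norm y = R + 1" using b assms by (simp add: y_def lip_supp_def)
 then have "f y = 0" using assms by (simp add: lip_supp_def)
 then have "cmod (f x) <= L * norm (x - y)" using assms unfolding lip_supp_def by (metis diff_zero)
 also have "... <= L * (2 * R + 1)"
  using norm_triangle_ineq4[of x y] False ny assms by (intro mult_left_mono) (auto simp: lip_supp_def)
 finally show ?thesis .
qed

lemma compact_support_integrable:
 fixes f :: "'a::euclidean_space => complex"
 assumes "continuous_on UNIV f" "\<And>x. R < norm x ==> f x = 0"
 shows "integrable lborel f"
proof -
 have "integrable lborel (%x. indicator (cball 0 R) x *\<^sub>R f x)"
  using assms by (intro borel_integrable_compact) (auto intro: continuous_on_subset)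
 also have "(%x. indicator (cball 0 R) x *\<^sub>R f x) = f"
  using assms by (auto simp: indicator_def fun_eq_iff not_le)
 finally show ?thesis .
qed

lemma lip_supp_integrable: "lip_supp L R f ==> integrable lborel f"
 by (rule compact_support_integrable[OF lip_supp_continuous]) (auto simp: lip_supp_def)

lemma lip_supp_cmult:
 assumes "lip_supp L R f" shows "lip_supp (cmod c * L) R (%x. c * f x)"
 using assms unfolding lip_supp_def
 by (auto simp: norm_mult right_diff_distrib[symmetric] mult.assoc intro!: mult_left_mono)

lemma lip_supp_add:
 assumes "lip_supp L R f" "lip_supp L' R' g" shows "lip_supp (L + L') (max R R') (%x. f x + g x)"
proof -
 have "cmod (f x + g x - (f y + g y)) <= (L + L') * norm (x - y)" for x y
 proof -
  have "cmod (f x + g x - (f y + g y)) <= cmod (f x - f y) + cmod (g x - g y)"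
   by (metis add_diff_add norm_triangle_ineq)
  also have "... <= L * norm (x - y) + L' * norm (x - y)"
   using assms by (intro add_mono) (auto simp: lip_supp_def)
  finally show ?thesis by (simp add: distrib_right)
 qed
 then show ?thesis using assms unfolding lip_supp_def by auto
qed

lemma lip_supp_shift:
 assumes "lip_supp L R f" shows "lip_supp L (R + norm w) (%x. f (x + w))"
proof -
 have "f (x + w) = 0" if "R + norm w < norm x" for x
 proof -
  have "norm x <= norm (x + w) + norm w" by (metis add_diff_cancel norm_triangle_ineq4)
  then show ?thesis using assms that by (auto simp: lip_supp_def)
 qed
 moreover have "cmod (f (x + w) - f (y + w)) <= L * norm (x - y)" for x y
  using assms unfolding lip_supp_def by (metis add_diff_cancel_right)
 ultimately show ?thesis using assms unfolding lip_supp_def by auto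
qed

lemma fourier_cmult: "fourier (%x. c * f x) s = c * fourier f s"
 unfolding fourier_def by (simp add: mult.assoc)

lemma cis_integrable_mult: "integrable lborel f ==> integrable lborel (%x. f x * cis (- (2 * pi * (s \<bullet> x))))"
 for f :: "'a::euclidean_space => complex"
 by (rule Bochner_Integration.integrable_bound) (auto simp: norm_mult)

lemma fourier_add:
 fixes f :: "'a::euclidean_space => complex"
 assumes "integrable lborel f" "integrable lborel g"
 shows "fourier (%x. f x + g x) s = fourier f s + fourier g s"
 unfolding fourier_def distrib_right by (intro Bochner_Integration.integral_add cis_integrable_mult assms)

lemma fourier_shift:
 fixes f :: "'a::euclidean_space => complex"
 assumes [measurable]: "f \<in> borel_measurable borel"
 shows "fourier (%x. f (x + w)) s = cis (2 * pi * (s \<bullet> w)) * fourier f s"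
proof -
 have "fourier f s = (LINT x|lborel. f (w + 1 *\<^sub>R x) * cis (- (2 * pi * (s \<bullet> (w + 1 *\<^sub>R x)))))"
  unfolding fourier_def by (subst lborel_integral_affine[of 1 _ w]) auto
 also have "... = (LINT x|lborel. cis (- (2 * pi * (s \<bullet> w))) * (f (x + w) * cis (- (2 * pi * (s \<bullet> x)))))"
 proof (rule Bochner_Integration.integral_cong[OF refl])
  fix x
  have "cis (- (2 * pi * (s \<bullet> (w + 1 *\<^sub>R x)))) = cis (- (2 * pi * (s \<bullet> w))) * cis (- (2 * pi * (s \<bullet> x)))"
   unfolding cis_mult by (simp add: inner_add_right algebra_simps)
  then show "f (w + 1 *\<^sub>R x) * cis (- (2 * pi * (s \<bullet> (w + 1 *\<^sub>R x)))) = cis (- (2 * pi * (s \<bullet> w))) * (f (x + w) * cis (- (2 * pi * (s \<bullet> x))))"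
   by (simp add: add.commute)
 qed
 finally have "fourier f s = cis (- (2 * pi * (s \<bullet> w))) * fourier (%x. f (x + w)) s"
  by (simp add: fourier_def)
 then have "cis (2 * pi * (s \<bullet> w)) * fourier f s = (cis (2 * pi * (s \<bullet> w)) * cis (- (2 * pi * (s \<bullet> w)))) * fourier (%x. f (x + w)) s"
  by (simp only: mult.assoc)
 then show ?thesis by (simp add: cis_mult)
qed

definition cardinal_sine :: "real => real" where
 "cardinal_sine x = (if x = 0 then 1 else sin x / x)"

lemma cardinal_sine_le_1: "\<bar>cardinal_sine x\<bar> <= 1"
 using abs_sin_x_le_abs_x[of x] by (auto simp: cardinal_sine_def divide_simps)

lemma cardinal_sine_le: "\<bar>cardinal_sine x\<bar> <= 1 / \<bar>x\<bar>" if "x ~= 0"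
 using that abs_sin_le_one[of x] by (auto simp: cardinal_sine_def divide_simps)

lemma cardinal_sine_integral:
 "(LINT t|lborel. indicator {-1..1::real} t *\<^sub>R cis (t * a)) = of_real (2 * cardinal_sine a)"
proof (cases "a = 0")
 case True
 then show ?thesis by (simp add: cardinal_sine_def scaleR_conv_of_real)
next
 case False
 have "(LINT t|lborel. indicator {-1..1::real} t *\<^sub>R cis (t * a)) = cis (1 * a) / (\<i> * a) - cis (- 1 * a) / (\<i> * a)"
 proof (rule integral_FTC_atLeastAtMost)
  fix x :: real
  show "((%t. cis (t * a) / (\<i> * a)) has_vector_derivative cis (x * a)) (at x within {-1..1})"
  proof -
   have "((%z. exp (\<i> * of_real a * z) / (\<i> * of_real a)) has_field_derivative exp (\<i> * of_real a * of_real x)) (at (of_real x))"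
    using False by (auto intro!: derivative_eq_intros)
   from has_vector_derivative_real_field[OF this] show ?thesis
    by (simp add: cis_conv_exp mult_ac)
  qed
 qed (auto intro!: continuous_intros)
 also have "... = of_real (2 * cardinal_sine a)"
  using False by (simp add: cardinal_sine_def complex_eq_iff Re_divide Im_divide power2_eq_square)
 finally show ?thesis .
qed

definition avg :: "'a::euclidean_space => ('a => complex) => 'a => complex" where
 "avg w f x = (1/2) *\<^sub>R (LINT t|lborel. indicator {-1..1::real} t *\<^sub>R f (x + t *\<^sub>R w))"

lemma avg_integrable:
 assumes "lip_supp L R f"
 shows "integrable lborel (%t. indicator {-1..1::real} t *\<^sub>R f (x + t *\<^sub>R w))"
 by (intro borel_integrable_compact continuous_on_compose2[OF lip_supp_continuous[OF assms, of UNIV]] continuous_intros) auto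

lemma avg_norm_le:
 assumes f: "integrable lborel (%t. indicator {-1..1::real} t *\<^sub>R (f t :: complex))"
  and bd: "\<And>t. \<bar>t\<bar> <= 1 ==> cmod (f t) <= B"
 shows "cmod ((1/2) *\<^sub>R (LINT t|lborel. indicator {-1..1} t *\<^sub>R f t)) <= B"
proof -
 have "cmod (LINT t|lborel. indicator {-1..1} t *\<^sub>R f t) <= (LINT t|lborel. B * indicator {-1..1::real} t)"
 proof (rule order_trans[OF integral_norm_bound integral_mono])
  show "integrable lborel (%t. norm (indicator {-1..1::real} t *\<^sub>R f t))" by (rule integrable_norm[OF f])
  show "integrable lborel (%t. B * indicator {-1..1::real} t)" by simp
  show "norm (indicator {-1..1} t *\<^sub>R f t) <= B * indicator {-1..1} t" for t :: real
   using bd[of t] by (auto simp: indicator_def)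
 qed
 then show ?thesis by simp
qed

lemma avg_near:
 assumes f: "lip_supp L R f"
 shows "cmod (avg w f x - f x) <= L * norm w"
proof -
 have i: "integrable lborel (%t. indicator {-1..1::real} t *\<^sub>R f x)"
  by (intro borel_integrable_compact) auto
 have "avg w f x - f x = (1/2) *\<^sub>R ((LINT t|lborel. indicator {-1..1::real} t *\<^sub>R f (x + t *\<^sub>R w)) - (LINT t|lborel. indicator {-1..1::real} t *\<^sub>R f x))"
  by (simp add: avg_def scaleR_diff_right)
 also have "... = (1/2) *\<^sub>R (LINT t|lborel. indicator {-1..1::real} t *\<^sub>R (f (x + t *\<^sub>R w) - f x))"
  by (simp add: scaleR_diff_right Bochner_Integration.integral_diff[OF avg_integrable[OF f] i])
 finally have eq: "avg w f x - f x = (1/2) *\<^sub>R (LINT t|lborel. indicator {-1..1::real} t *\<^sub>R (f (x + t *\<^sub>R w) - f x))" .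
 show ?thesis unfolding eq
 proof (rule avg_norm_le)
  show "integrable lborel (%t. indicator {-1..1::real} t *\<^sub>R (f (x + t *\<^sub>R w) - f x))"
   using Bochner_Integration.integrable_diff[OF avg_integrable[OF f] i] by (simp add: scaleR_diff_right)
  fix t :: real assume t: "\<bar>t\<bar> <= 1"
  have "cmod (f (x + t *\<^sub>R w) - f x) <= L * norm (t *\<^sub>R w)"
   using f unfolding lip_supp_def by (metis add_diff_cancel_left')
  also have "... <= L * norm w" using t f by (auto simp: lip_supp_def intro!: mult_left_mono mult_left_le_one_le)
  finally show "cmod (f (x + t *\<^sub>R w) - f x) <= L * norm w" .
 qed
qed

lemma avg_lip_supp:
 assumes f: "lip_supp L R f"
 shows "lip_supp L (R + norm w) (avg w f)"
proof -
 have "cmod (avg w f x - avg w f y) <= L * norm (x - y)" for x y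
 proof -
  have eq: "avg w f x - avg w f y = (1/2) *\<^sub>R (LINT t|lborel. indicator {-1..1::real} t *\<^sub>R (f (x + t *\<^sub>R w) - f (y + t *\<^sub>R w)))"
   by (simp add: avg_def scaleR_diff_right Bochner_Integration.integral_diff[OF avg_integrable[OF f] avg_integrable[OF f]])
  show ?thesis unfolding eq
  proof (rule avg_norm_le)
   show "integrable lborel (%t. indicator {-1..1::real} t *\<^sub>R (f (x + t *\<^sub>R w) - f (y + t *\<^sub>R w)))"
    using Bochner_Integration.integrable_diff[OF avg_integrable[OF f] avg_integrable[OF f]] by (simp add: scaleR_diff_right)
   fix t :: real
   show "cmod (f (x + t *\<^sub>R w) - f (y + t *\<^sub>R w)) <= L * norm (x - y)"
    using f unfolding lip_supp_def by (metis add_diff_cancel_right)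
  qed
 qed
 moreover have "avg w f x = 0" if x: "R + norm w < norm x" for x
 proof -
  have "indicator {-1..1::real} t *\<^sub>R f (x + t *\<^sub>R w) = 0" for t
  proof (cases "\<bar>t\<bar> <= 1")
   case True
   have "norm x <= norm (x + t *\<^sub>R w) + norm (t *\<^sub>R w)" by (metis add_diff_cancel norm_triangle_ineq4)
   moreover have "norm (t *\<^sub>R w) <= norm w" using True by (simp add: mult_left_le_one_le)
   ultimately show ?thesis using x f by (auto simp: lip_supp_def)
  qed (auto simp: indicator_def)
  then have "(%t. indicator {-1..1::real} t *\<^sub>R f (x + t *\<^sub>R w)) = (%_. 0)" by (rule ext)
  then show ?thesis unfolding avg_def by (simp only: integral_zero scaleR_zero_right)
 qed
 ultimately show ?thesis using f unfolding lip_supp_def by auto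
qed

lemma fourier_avg:
 fixes f :: "'a::euclidean_space => complex"
 assumes f: "lip_supp L R f"
 shows "fourier (avg w f) s = cardinal_sine (2 * pi * (s \<bullet> w)) * fourier f s"
proof -
 have fi: "integrable lborel f" by (rule lip_supp_integrable[OF f])
 have [measurable]: "f \<in> borel_measurable borel" using fi by auto
 have sh: "integrable lborel (%x. f (x + t *\<^sub>R w))" for t
  using lborel_integrable_affine[OF _ fi, of 1 "t *\<^sub>R w"] by (simp add: add.commute)
 have nsh: "(LINT x|lborel. cmod (f (x + t *\<^sub>R w))) = (LINT x|lborel. cmod (f x))" for t
  using lborel_integral_affine[of 1 "%z. cmod (f z)" "t *\<^sub>R w"] by (simp add: add.commute)
 have int: "integrable (lborel \<Otimes>\<^sub>M lborel) (%(t, x). indicator {-1..1::real} t *\<^sub>R (f (x + t *\<^sub>R w) * cis (- (2 * pi * (s \<bullet> x)))))"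
 proof (rule lborel_pair.Fubini_integrable)
  show "(%(t, x). indicator {-1..1::real} t *\<^sub>R (f (x + t *\<^sub>R w) * cis (- (2 * pi * (s \<bullet> x))))) \<in> borel_measurable (lborel \<Otimes>\<^sub>M lborel)"
   by measurable
  show "integrable lborel (%t. \<integral>x. norm (case (t, x) of (t, x) => indicator {-1..1::real} t *\<^sub>R (f (x + t *\<^sub>R w) * cis (- (2 * pi * (s \<bullet> x))))) \<partial>lborel)"
   by (simp add: norm_mult nsh)
  show "AE t in lborel. integrable lborel (%x. case (t, x) of (t, x) => indicator {-1..1::real} t *\<^sub>R (f (x + t *\<^sub>R w) * cis (- (2 * pi * (s \<bullet> x)))))"
   by (intro AE_I2) (simp add: cis_integrable_mult[OF sh])
 qed
 have "fourier (avg w f) s = (LINT x|lborel. (1/2) *\<^sub>R (LINT t|lborel. indicator {-1..1::real} t *\<^sub>R (f (x + t *\<^sub>R w) * cis (- (2 * pi * (s \<bullet> x))))))"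
  unfolding fourier_def avg_def
 proof (rule Bochner_Integration.integral_cong[OF refl])
  fix x
  show "(1/2) *\<^sub>R (LINT t|lborel. indicator {-1..1::real} t *\<^sub>R f (x + t *\<^sub>R w)) * cis (- (2 * pi * (s \<bullet> x)))
    = (1/2) *\<^sub>R (LINT t|lborel. indicator {-1..1::real} t *\<^sub>R (f (x + t *\<^sub>R w) * cis (- (2 * pi * (s \<bullet> x)))))"
   by (subst scaleR_left_commute[symmetric] mult_scaleR_left[symmetric])+ (simp flip: mult_scaleR_left)
 qed
 also have "... = (1/2) *\<^sub>R (LINT t|lborel. (LINT x|lborel. indicator {-1..1::real} t *\<^sub>R (f (x + t *\<^sub>R w) * cis (- (2 * pi * (s \<bullet> x))))))"
  using lborel_pair.Fubini_integral[OF int] by simp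
 also have "... = (1/2) *\<^sub>R (LINT t|lborel. (indicator {-1..1::real} t *\<^sub>R cis (t * (2 * pi * (s \<bullet> w)))) * fourier f s)"
 proof -
  have "(LINT x|lborel. indicator {-1..1::real} t *\<^sub>R (f (x + t *\<^sub>R w) * cis (- (2 * pi * (s \<bullet> x)))))
    = (indicator {-1..1::real} t *\<^sub>R cis (t * (2 * pi * (s \<bullet> w)))) * fourier f s" for t
  proof -
   have "fourier (%x. f (x + t *\<^sub>R w)) s = cis (t * (2 * pi * (s \<bullet> w))) * fourier f s"
    by (subst fourier_shift) (auto simp: mult_ac)
   then show ?thesis unfolding integral_scaleR_right by (simp add: fourier_def)
  qed
  then show ?thesis by (simp only:)
 qed
 also have "... = cardinal_sine (2 * pi * (s \<bullet> w)) * fourier f s"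
  by (simp only: integral_mult_left_zero cardinal_sine_integral) (simp add: scaleR_conv_of_real)
 finally show ?thesis .
qed

lemma infinite_average:
 fixes f :: "'a::euclidean_space => complex"
 assumes f: "lip_supp L R f" and w: "summable (%n. norm (w n))"
 obtains g R' where "lip_supp L R' g" "fourier g 0 = fourier f 0"
  "\<And>s n. cmod (fourier g s) <= cmod (fourier f s) * (\<Prod>i<n. \<bar>cardinal_sine (2 * pi * (s \<bullet> w i))\<bar>)"
proof -
 define F where "F = (%n. rec_nat f (%i. avg (w i)) n)"
 have F0: "F 0 = f" and FS: "F (Suc n) = avg (w n) (F n)" for n by (simp_all add: F_def)
 define W where "W = (\<Sum>n. norm (w n))"
 have W0: "0 <= W" unfolding W_def by (intro suminf_nonneg w) auto
 have F: "lip_supp L (R + (\<Sum>i<n. norm (w i))) (F n)" for n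
 proof (induction n)
  case (Suc n)
  then show ?case using avg_lip_supp[OF Suc, of "w n"] by (simp add: FS add.assoc)
 qed (simp add: F0 f)
 have FW: "lip_supp L (R + W) (F n)" for n
 proof -
  have "(\<Sum>i<n. norm (w i)) <= W" unfolding W_def by (intro sum_le_suminf w) auto
  then show ?thesis using F[of n] f W0 unfolding lip_supp_def by auto
 qed
 have ftF: "fourier (F n) s = of_real (\<Prod>i<n. cardinal_sine (2 * pi * (s \<bullet> w i))) * fourier f s" for n s
  by (induction n) (simp_all add: F0 FS fourier_avg[OF F] mult_ac)
 have conv: "convergent (%n. F n x)" for x
 proof -
  have "summable (%n. F (Suc n) x - F n x)"
  proof (rule summable_comparison_test'[where N=0])
   show "summable (%n. L * norm (w n))" by (intro summable_mult w)
   show "norm (F (Suc n) x - F n x) <= L * norm (w n)" for n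
    unfolding FS by (rule avg_near[OF F])
  qed
  then have "convergent (%n. \<Sum>i<n. F (Suc i) x - F i x)" by (simp add: summable_iff_convergent)
  then have "convergent (%n. F n x - F 0 x)"
   unfolding sum_lessThan_telescope[where f="%n. F n x"] .
  then have "convergent (%n. (F n x - F 0 x) + F 0 x)" by (intro convergent_add convergent_const)
  then show ?thesis by simp
 qed
 define g where "g = (%x. lim (%n. F n x))"
 have lim: "(%n. F n x) \<longlonglongrightarrow> g x" for x
  unfolding g_def using conv by (simp add: convergent_LIMSEQ_iff)
 have g: "lip_supp L (R + W) g"
 proof -
  have "cmod (g x - g y) <= L * norm (x - y)" for x y
   by (rule LIMSEQ_le_const2[OF tendsto_norm[OF tendsto_diff[OF lim lim]]])
    (use FW in \<open>auto simp: lip_supp_def\<close>)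
  moreover have "g x = 0" if "R + W < norm x" for x
   using lim[of x] FW that by (auto simp: lip_supp_def LIMSEQ_const_iff)
  ultimately show ?thesis using f W0 by (auto simp: lip_supp_def)
 qed
 have flim: "(%n. fourier (F n) s) \<longlonglongrightarrow> fourier g s" for s
  unfolding fourier_def
 proof (rule integral_dominated_convergence[where w="%x. L * (2 * (R + W) + 1) * indicator (cball 0 (R + W)) x"])
  show "(%x. g x * cis (- (2 * pi * (s \<bullet> x)))) \<in> borel_measurable lborel"
   using lip_supp_integrable[OF g] by measurable
  show "(%x. F n x * cis (- (2 * pi * (s \<bullet> x)))) \<in> borel_measurable lborel" for n
   using lip_supp_integrable[OF FW, of n] by measurable
  show "integrable lborel (%x::'a. L * (2 * (R + W) + 1) * indicator (cball 0 (R + W)) x)"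
   by (intro integrable_mult_right integrable_real_indicator) (use emeasure_lborel_cball_finite[of "0::'a" "R + W"] in auto)
  show "AE x in lborel. norm (F n x * cis (- (2 * pi * (s \<bullet> x)))) <= L * (2 * (R + W) + 1) * indicator (cball 0 (R + W)) x" for n
  proof (rule AE_I2)
   fix x
   show "norm (F n x * cis (- (2 * pi * (s \<bullet> x)))) <= L * (2 * (R + W) + 1) * indicator (cball 0 (R + W)) x"
    using lip_supp_bound[OF FW, of n x] FW[of n] by (cases "R + W < norm x") (auto simp: norm_mult lip_supp_def indicator_def)
  qed
  show "AE x in lborel. (%n. F n x * cis (- (2 * pi * (s \<bullet> x)))) \<longlonglongrightarrow> g x * cis (- (2 * pi * (s \<bullet> x)))"
   by (intro AE_I2 tendsto_intros lim)
 qed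
 have cs0: "cardinal_sine 0 = 1" by (simp add: cardinal_sine_def)
 have "fourier g 0 = fourier f 0"
  using flim[of 0] by (simp add: ftF cs0 LIMSEQ_const_iff)
 moreover have "cmod (fourier g s) <= cmod (fourier f s) * (\<Prod>i<n. \<bar>cardinal_sine (2 * pi * (s \<bullet> w i))\<bar>)" for s n
 proof (rule LIMSEQ_le_const2[OF tendsto_norm[OF flim]], intro exI[of _ n] allI impI)
  fix k assume k: "n <= k"
  have "(\<Prod>i<k. \<bar>cardinal_sine (2 * pi * (s \<bullet> w i))\<bar>) <= (\<Prod>i<n. \<bar>cardinal_sine (2 * pi * (s \<bullet> w i))\<bar>)"
   using k
  proof (induction k rule: dec_induct)
   case (step k)
   have "(\<Prod>i<Suc k. \<bar>cardinal_sine (2 * pi * (s \<bullet> w i))\<bar>) <= (\<Prod>i<k. \<bar>cardinal_sine (2 * pi * (s \<bullet> w i))\<bar>) * 1"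
    unfolding prod.lessThan_Suc by (intro mult_left_mono cardinal_sine_le_1 prod_nonneg) auto
   then show ?case using step.IH by simp
  qed simp
  then show "cmod (fourier (F k) s) <= cmod (fourier f s) * (\<Prod>i<n. \<bar>cardinal_sine (2 * pi * (s \<bullet> w i))\<bar>)"
   by (simp add: ftF norm_mult abs_prod mult.commute mult_left_mono del: of_real_prod)
 qed
 ultimately show thesis using that[OF g] by blast
qed

lemma bump_exists:
 obtains f :: "'a::euclidean_space => complex" where "lip_supp 1 1 f" "fourier f 0 ~= 0"
proof -
 define f where "f = (%x::'a. complex_of_real (max 0 (1 - norm x)))"
 have l: "lip_supp 1 1 f"
 proof -
  have "cmod (f x - f y) <= norm (x - y)" for x y
  proof -
   have "cmod (f x - f y) = \<bar>max 0 (1 - norm x) - max 0 (1 - norm y)\<bar>"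
    unfolding f_def of_real_diff[symmetric] norm_of_real ..
   also have "... <= \<bar>norm x - norm y\<bar>" by (auto simp: max_def abs_if)
   also have "... <= norm (x - y)" by (rule norm_triangle_ineq3)
   finally show ?thesis .
  qed
  then show ?thesis by (auto simp: lip_supp_def f_def)
 qed
 have ri: "integrable lborel (%x::'a. max 0 (1 - norm x))"
  using integrable_Re[OF lip_supp_integrable[OF l]] by (simp add: f_def)
 have "0 < measure lborel (ball (0::'a) (1/2)) * (1/2)" by (simp add: content_ball_pos)
 also have "... = (LINT x|lborel. indicator (ball 0 (1/2)) (x::'a) * (1/2))" by simp
 also have "... <= (LINT x|lborel. max 0 (1 - norm (x::'a)))"
 proof (rule integral_mono[OF _ ri])
  show "integrable lborel (%x::'a. indicator (ball 0 (1/2)) x * (1/2 :: real))"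
   by (intro integrable_mult_left integrable_real_indicator emeasure_lborel_ball_finite) simp
 qed (auto simp: indicator_def)
 finally have "(LINT x|lborel. max 0 (1 - norm (x::'a))) ~= 0" by simp
 moreover have "fourier f 0 = of_real (LINT x|lborel. max 0 (1 - norm (x::'a)))"
  unfolding fourier_def f_def by (simp add: integral_of_real[OF ri])
 ultimately show thesis using that[OF l] by simp
qed

text \<open>
 Ingham's construction. Averaging over segments of lengths \<open>\<epsilon>\<^sub>n = \<kappa> \<vartheta>(n)/n\<close> in each coordinate direction keeps the
 support bounded since \<open>\<Sum> \<epsilon>\<^sub>n\<close> converges; at the frequency \<open>s\<close>, each of the first \<open>|s| \<vartheta>(|s|)\<close> averages
 divides the transform by at least \<open>e\<close>, because \<open>\<vartheta>(n) \<ge> \<vartheta>(|s|)\<close> there.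
\<close>

theorem ingham_function:
 fixes \<theta> :: "real => real"
 assumes nn: "\<And>t. 1 <= t ==> 0 <= \<theta> t" and dec: "\<And>s t. 1 <= s ==> s <= t ==> \<theta> t <= \<theta> s"
  and lim: "(\<theta> \<longlongrightarrow> 0) at_top" and sum: "summable (%n. \<theta> (real (Suc n)) / real (Suc n))"
 obtains g :: "'a::euclidean_space => complex" and L R C where
  "lip_supp L R g" "fourier g 0 ~= 0" "0 <= C"
  "\<And>s. 1 <= norm s ==> cmod (fourier g s) <= C * exp (- norm s * \<theta> (norm s))"
proof -
 define \<kappa> where "\<kappa> = exp 1 * sqrt DIM('a) / (2 * pi)"
 have \<kappa>: "0 < \<kappa>" unfolding \<kappa>_def by simp
 define \<epsilon> where "\<epsilon> = (%n. \<kappa> * (\<theta> (real (Suc n)) / real (Suc n)))"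
 have \<epsilon>0: "0 <= \<epsilon> n" for n unfolding \<epsilon>_def using \<kappa> nn[of "real (Suc n)"] by simp
 have \<epsilon>s: "summable \<epsilon>" unfolding \<epsilon>_def by (intro summable_mult sum)
 obtain f0 :: "'a => complex" where f0: "lip_supp 1 1 f0" "fourier f0 0 ~= 0" by (rule bump_exists)
 define C0 where "C0 = (LINT x|lborel. cmod (f0 x))"
 have "\<exists>g R. lip_supp 1 R g \<and> fourier g 0 = fourier f0 0 \<and> (\<forall>s. cmod (fourier g s) <= C0) \<and>
     (\<forall>s. \<forall>b\<in>B. \<forall>n. cmod (fourier g s) <= C0 * (\<Prod>i<n. \<bar>cardinal_sine (2 * pi * (s \<bullet> (\<epsilon> i *\<^sub>R b)))\<bar>))"
  if "finite B" "B \<subseteq> (Basis :: 'a set)" for B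
  using that
 proof (induction B rule: finite_induct)
  case empty
  then show ?case using f0 fourier_bound[OF lip_supp_integrable[OF f0(1)]] by (auto simp: C0_def)
 next
  case (insert b B)
  then obtain g R where g: "lip_supp 1 R g" "fourier g 0 = fourier f0 0" "\<And>s. cmod (fourier g s) <= C0"
   "\<And>s b n. b \<in> B ==> cmod (fourier g s) <= C0 * (\<Prod>i<n. \<bar>cardinal_sine (2 * pi * (s \<bullet> (\<epsilon> i *\<^sub>R b)))\<bar>)"
   by auto
  have "summable (%n. norm (\<epsilon> n *\<^sub>R b))" using \<epsilon>s \<epsilon>0 insert.prems by (simp add: norm_Basis)
  from infinite_average[OF g(1) this] obtain g' R' where g': "lip_supp 1 R' g'" "fourier g' 0 = fourier g 0"
   "\<And>s n. cmod (fourier g' s) <= cmod (fourier g s) * (\<Prod>i<n. \<bar>cardinal_sine (2 * pi * (s \<bullet> (\<epsilon> i *\<^sub>R b)))\<bar>)" by metis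
  have le: "cmod (fourier g' s) <= cmod (fourier g s)" for s using g'(3)[of s 0] by simp
  have "cmod (fourier g' s) <= C0 * (\<Prod>i<n. \<bar>cardinal_sine (2 * pi * (s \<bullet> (\<epsilon> i *\<^sub>R b')))\<bar>)" if "b' \<in> insert b B" for s n b'
  proof (cases "b' = b")
   case True
   have "cmod (fourier g' s) <= cmod (fourier g s) * (\<Prod>i<n. \<bar>cardinal_sine (2 * pi * (s \<bullet> (\<epsilon> i *\<^sub>R b)))\<bar>)" by (rule g'(3))
   also have "... <= C0 * (\<Prod>i<n. \<bar>cardinal_sine (2 * pi * (s \<bullet> (\<epsilon> i *\<^sub>R b)))\<bar>)"
    by (intro mult_right_mono g(3) prod_nonneg) auto
   finally show ?thesis using True by simp
  next
   case False
   then show ?thesis using that order_trans[OF le g(4)] by auto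
  qed
  then show ?case using g' g(2) order_trans[OF le g(3)] by (intro exI[of _ g'] exI[of _ R']) auto
 qed
 from this[OF finite_Basis order_refl] obtain g :: "'a => complex" and R where gR:
  "lip_supp 1 R g \<and> fourier g 0 = fourier f0 0 \<and> (\<forall>s. cmod (fourier g s) <= C0) \<and>
   (\<forall>s. \<forall>b\<in>Basis. \<forall>n. cmod (fourier g s) <= C0 * (\<Prod>i<n. \<bar>cardinal_sine (2 * pi * (s \<bullet> (\<epsilon> i *\<^sub>R b)))\<bar>))"
  by (elim exE) (rule that)
 then have g: "lip_supp 1 R g" "fourier g 0 = fourier f0 0" "\<And>s. cmod (fourier g s) <= C0"
  and gb: "\<And>s b n. b \<in> Basis ==> cmod (fourier g s) <= C0 * (\<Prod>i<n. \<bar>cardinal_sine (2 * pi * (s \<bullet> (\<epsilon> i *\<^sub>R b)))\<bar>)"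
  by blast+
 have C0: "0 <= C0" unfolding C0_def by simp
 have "\<forall>\<^sub>F t in at_top. \<theta> t < 1" using lim by (rule order_tendstoD) simp
 then obtain R0 where R0: "\<And>t. R0 <= t ==> \<theta> t < 1" by (auto simp: eventually_at_top_linorder)
 define C where "C = C0 * (exp 1 + exp (\<bar>R0\<bar> * \<theta> 1))"
 have "cmod (fourier g s) <= C * exp (- norm s * \<theta> (norm s))" if s: "1 <= norm s" for s
 proof (cases "\<theta> (norm s) <= 1")
  case True
  define T where "T = \<theta> (norm s)"
  have T: "0 <= T" "T <= 1" using nn[OF s] True by (auto simp: T_def)
  define J where "J = nat \<lfloor>norm s * T\<rfloor>"
  have J: "real J <= norm s * T" "norm s * T < real J + 1"
   unfolding J_def using T by (auto simp: of_nat_nat)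
  have Js: "real J <= norm s" using J(1) T by (smt (verit) mult_left_le norm_ge_zero)
  have "Max ((%i. \<bar>s \<bullet> i\<bar>) ` Basis) \<in> (%i. \<bar>s \<bullet> i\<bar>) ` (Basis :: 'a set)" by (intro Max_in) auto
  then obtain b where bB: "b \<in> Basis" and mb: "Max ((%i. \<bar>s \<bullet> i\<bar>) ` Basis) = \<bar>s \<bullet> b\<bar>" by (rule imageE)
  then have b: "b \<in> Basis" "infnorm s = \<bar>s \<bullet> b\<bar>" by (simp_all only: infnorm_Max)
  have sb: "norm s <= sqrt DIM('a) * \<bar>s \<bullet> b\<bar>" using norm_le_infnorm[of s] b by simp
  have "(\<Prod>i<J. \<bar>cardinal_sine (2 * pi * (s \<bullet> (\<epsilon> i *\<^sub>R b)))\<bar>) <= (\<Prod>i<J. exp (- 1))"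
  proof (intro prod_mono conjI)
   fix i assume i: "i \<in> {..<J}"
   then have iJ: "real (Suc i) <= real J" by simp
   have "T <= \<theta> (real (Suc i))" unfolding T_def using iJ Js s by (intro dec) auto
   then have "\<epsilon> i \<ge> \<kappa> * (T / real (Suc i))" unfolding \<epsilon>_def using \<kappa> by (intro mult_left_mono divide_right_mono) auto
   then have "2 * pi * (\<epsilon> i * \<bar>s \<bullet> b\<bar>) \<ge> 2 * pi * (\<kappa> * (T / real (Suc i)) * \<bar>s \<bullet> b\<bar>)"
    by (intro mult_left_mono mult_right_mono) auto
   moreover have "2 * pi * (\<kappa> * (T / real (Suc i)) * \<bar>s \<bullet> b\<bar>) = exp 1 * (T / real (Suc i)) * (sqrt DIM('a) * \<bar>s \<bullet> b\<bar>)"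
    by (simp add: \<kappa>_def)
   moreover have "exp 1 * (T / real (Suc i)) * (sqrt DIM('a) * \<bar>s \<bullet> b\<bar>) \<ge> exp 1 * (T / real (Suc i)) * norm s"
    using T by (intro mult_left_mono sb) auto
   moreover have "exp 1 * (T / real (Suc i)) * norm s \<ge> exp 1 * 1"
   proof -
    have "1 <= T / real (Suc i) * norm s" using iJ J(1) by (simp add: field_simps)
    then show ?thesis unfolding mult.assoc by (intro mult_left_mono) auto
   qed
   ultimately have "exp 1 <= 2 * pi * (\<epsilon> i * \<bar>s \<bullet> b\<bar>)" by linarith
   then have big: "exp 1 <= \<bar>2 * pi * (s \<bullet> (\<epsilon> i *\<^sub>R b))\<bar>"
    using \<epsilon>0[of i] by (simp add: abs_mult)
   then have "2 * pi * (s \<bullet> (\<epsilon> i *\<^sub>R b)) ~= 0" by (smt (verit) exp_gt_zero)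
   from cardinal_sine_le[OF this] have "\<bar>cardinal_sine (2 * pi * (s \<bullet> (\<epsilon> i *\<^sub>R b)))\<bar> <= 1 / \<bar>2 * pi * (s \<bullet> (\<epsilon> i *\<^sub>R b))\<bar>" .
   also have "... <= 1 / exp 1"
    using big less_le_trans[OF exp_gt_zero big] by (intro divide_left_mono mult_pos_pos) simp_all
   finally show "\<bar>cardinal_sine (2 * pi * (s \<bullet> (\<epsilon> i *\<^sub>R b)))\<bar> <= exp (- 1)" by (simp add: exp_minus inverse_eq_divide)
  qed auto
  also have "... = exp (- real J)" by (simp add: exp_of_nat_mult[symmetric])
  also have "... <= exp (1 - norm s * T)" using J(2) by simp
  finally have "C0 * (\<Prod>i<J. \<bar>cardinal_sine (2 * pi * (s \<bullet> (\<epsilon> i *\<^sub>R b)))\<bar>) <= C0 * exp (1 - norm s * T)"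
   using C0 by (intro mult_left_mono)
  also have "... = C0 * exp 1 * exp (- norm s * T)" by (simp add: exp_diff exp_minus field_simps)
  also have "... <= C * exp (- norm s * T)"
   unfolding C_def using C0 by (intro mult_right_mono mult_left_mono) auto
  finally show ?thesis using gb[OF b(1), of s J] by (simp add: T_def)
 next
  case False
  then have "norm s < R0" using R0[of "norm s"] by force
  then have "norm s * \<theta> (norm s) <= \<bar>R0\<bar> * \<theta> 1"
   using dec[OF order_refl s] nn[OF s] by (intro mult_mono) auto
  then have "1 <= exp (\<bar>R0\<bar> * \<theta> 1) * exp (- norm s * \<theta> (norm s))"
   unfolding exp_add[symmetric] by simp
  then have "C0 * 1 <= C0 * (exp (\<bar>R0\<bar> * \<theta> 1) * exp (- norm s * \<theta> (norm s)))"
   using C0 by (intro mult_left_mono)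
  also have "... <= C * exp (- norm s * \<theta> (norm s))"
   unfolding C_def mult.assoc[symmetric] using C0 by (intro mult_right_mono mult_left_mono) auto
  finally show ?thesis using g(3)[of s] by simp
 qed
 moreover have "0 <= C" unfolding C_def using C0 by simp
 ultimately show thesis using that[OF g(1)] g(2) f0(2) by simp
qed

text \<open>
 Averaging in direction \<open>w\<close> multiplies the transform by the cardinal sine of \<open>2\<pi> (s \<bullet> w)\<close>; the difference of the two
 translates by \<open>\<plusminus>w\<close> gives in addition a factor \<open>s \<bullet> w\<close>. So products of distinct linear forms can be multiplied in
 at the price of a bounded factor that is the same for every choice of the forms.
\<close>

lemma fourier_multiplier:
 fixes f :: "'a::euclidean_space => complex"
 assumes "lip_supp L R f" "finite J" "M \<subseteq> J"
 shows "\<exists>h L' R'. lip_supp L' R' h \<and> (\<forall>s. fourier h s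
   = of_real (\<Prod>j\<in>M. s \<bullet> w j) * of_real (\<Prod>j\<in>J. cardinal_sine (2 * pi * (s \<bullet> w j))) * fourier f s)"
 using assms(2,3)
proof (induction J arbitrary: M rule: finite_induct)
 case empty
 then show ?case using assms(1) by auto
next
 case (insert j J)
 have fM: "finite M" using insert by (meson finite_insert finite_subset)
 obtain h L' R' where h: "lip_supp L' R' h" "\<And>s. fourier h s
   = of_real (\<Prod>j\<in>M - {j}. s \<bullet> w j) * of_real (\<Prod>j\<in>J. cardinal_sine (2 * pi * (s \<bullet> w j))) * fourier f s"
  using insert.IH[of "M - {j}"] insert.prems by (metis Diff_subset_conv insert_is_Un)
 show ?case
 proof (cases "j \<in> M")
  case False
  then have "M - {j} = M" by auto
  then have "fourier (avg (w j) h) s = of_real (\<Prod>j\<in>M. s \<bullet> w j) * of_real (\<Prod>j\<in>insert j J. cardinal_sine (2 * pi * (s \<bullet> w j))) * fourier f s" for s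
   using insert.hyps by (simp add: fourier_avg[OF h(1)] h(2) mult_ac)
  then show ?thesis using avg_lip_supp[OF h(1)] by blast
 next
  case True
  define c where "c = 1 / (4 * complex_of_real pi * \<i>)"
  define h' where "h' = (%x. c * h (x + w j) + (- c) * h (x + - w j))"
  have hl: "lip_supp L' (R' + norm (w j)) (%x. h (x + w j))" "lip_supp L' (R' + norm (- w j)) (%x. h (x + - w j))"
   by (rule lip_supp_shift[OF h(1)])+
  have l: "\<exists>L R. lip_supp L R h'"
   unfolding h'_def using lip_supp_add[OF lip_supp_cmult[OF hl(1)] lip_supp_cmult[OF hl(2)]] by blast
  have [measurable]: "h \<in> borel_measurable borel" using lip_supp_integrable[OF h(1)] by auto
  have "fourier h' s = of_real (\<Prod>j\<in>M. s \<bullet> w j) * of_real (\<Prod>j\<in>insert j J. cardinal_sine (2 * pi * (s \<bullet> w j))) * fourier f s" for s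
  proof -
   define a where "a = s \<bullet> w j"
   have "fourier h' s = c * fourier (%x. h (x + w j)) s + (- c) * fourier (%x. h (x + - w j)) s"
    unfolding h'_def fourier_cmult[symmetric]
    by (intro fourier_add integrable_mult_right lip_supp_integrable[OF hl(1)] lip_supp_integrable[OF hl(2)])
   also have "... = c * (cis (2 * pi * a) * fourier h s) + (- c) * (cis (2 * pi * - a) * fourier h s)"
    by (simp add: fourier_shift[of h, unfolded diff_conv_add_uminus] fourier_shift a_def inner_minus_right del: add_uminus_conv_diff)
   also have "... = (c * (cis (2 * pi * a) - cis (2 * pi * - a))) * fourier h s"
    by (simp add: algebra_simps)
   also have "c * (cis (2 * pi * a) - cis (2 * pi * - a)) = of_real (a * cardinal_sine (2 * pi * a))"
    unfolding c_def by (simp add: complex_eq_iff Re_divide Im_divide cardinal_sine_def power2_eq_square)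
   finally have "fourier h' s = of_real (a * cardinal_sine (2 * pi * a)) * fourier h s" .
   moreover have "(\<Prod>j\<in>M. s \<bullet> w j) = a * (\<Prod>j\<in>M - {j}. s \<bullet> w j)"
    unfolding a_def using True fM by (subst prod.remove[of _ j]) auto
   moreover have "(\<Prod>j\<in>insert j J. cardinal_sine (2 * pi * (s \<bullet> w j))) = cardinal_sine (2 * pi * a) * (\<Prod>j\<in>J. cardinal_sine (2 * pi * (s \<bullet> w j)))"
    using insert.hyps by (simp add: a_def)
   ultimately show ?thesis by (simp add: h(2) mult_ac)
  qed
  then show ?thesis using l by blast
 qed
qed




section \<open>Integrals over spherical shells\<close>

definition shell :: "nat => 'a::euclidean_space set" where
 "shell n = {s. real n <= norm s \<and> norm s < real n + 1}"

lemma shell_measurable[measurable]: "shell n \<in> sets borel"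
 unfolding shell_def by measurable

lemma nn_integral_shells:
 fixes f :: "'a::euclidean_space => ennreal"
 assumes [measurable]: "f \<in> borel_measurable borel"
 shows "(\<integral>\<^sup>+s. f s \<partial>lborel) = (\<Sum>n. \<integral>\<^sup>+s. f s * indicator (shell n) s \<partial>lborel)"
proof -
 have "(\<Sum>n. f s * indicator (shell n) s) = f s" for s
 proof -
  define m where "m = nat \<lfloor>norm s\<rfloor>"
  have "indicator (shell n) s = (if n = m then 1 else 0 :: ennreal)" for n
   unfolding shell_def m_def indicator_def
   by (auto simp: floor_unique le_nat_floor nat_eq_iff) (metis floor_unique of_int_of_nat_eq nat_int of_nat_floor)+
  then have "(%n. f s * indicator (shell n) s) = (%n. if n = m then f s else 0)" by auto
  then show ?thesis using sums_single[of m "%_. f s"] by (simp add: sums_iff)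
 qed
 then have "(\<integral>\<^sup>+s. f s \<partial>lborel) = (\<integral>\<^sup>+s. (\<Sum>n. f s * indicator (shell n) s) \<partial>lborel)" by simp
 also have "... = (\<Sum>n. \<integral>\<^sup>+s. f s * indicator (shell n) s \<partial>lborel)" by (rule nn_integral_suminf) measurable
 finally show ?thesis .
qed

lemma emeasure_shell:
 "emeasure lborel (shell n :: 'a::euclidean_space set)
  = ennreal (unit_ball_vol DIM('a) * ((real n + 1) ^ DIM('a) - real n ^ DIM('a)))"
proof -
 have eq: "(shell n :: 'a set) = ball 0 (real n + 1) - ball 0 (real n)" by (auto simp: shell_def)
 have fin: "emeasure lborel (ball (0::'a) (real n)) ~= \<infinity>"
  using emeasure_lborel_ball_finite[of "0::'a" "real n"] by simp
 have "emeasure lborel (shell n :: 'a set) = emeasure lborel (ball (0::'a) (real n + 1)) - emeasure lborel (ball (0::'a) (real n))"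
  unfolding eq by (rule emeasure_Diff[OF fin]) (simp_all add: subset_ball)
 also have "... = ennreal (unit_ball_vol DIM('a) * (real n + 1) ^ DIM('a)) - ennreal (unit_ball_vol DIM('a) * real n ^ DIM('a))"
  by (simp add: emeasure_ball)
 also have "... = ennreal (unit_ball_vol DIM('a) * ((real n + 1) ^ DIM('a) - real n ^ DIM('a)))"
  by (subst ennreal_minus) (auto simp: right_diff_distrib)
 finally show ?thesis .
qed

lemma shell_power_upper: "(real n + 1) ^ Suc D - real n ^ Suc D <= 2 ^ Suc D * real n ^ D" if "1 <= n"
proof (induction D)
 case 0 then show ?case by simp
next
 case (Suc D)
 have "(real n + 1) ^ Suc (Suc D) = real n * (real n + 1) ^ Suc D + (real n + 1) ^ Suc D" by (simp add: algebra_simps)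
 also have "... <= real n * (real n ^ Suc D + 2 ^ Suc D * real n ^ D) + (2 * real n) ^ Suc D"
  using Suc that by (intro add_mono mult_left_mono power_mono) auto
 also have "... = real n ^ Suc (Suc D) + 2 ^ Suc (Suc D) * real n ^ Suc D" by (simp add: power_mult_distrib algebra_simps)
 finally show ?case by simp
qed

lemma shell_power_lower: "(real n + 1) ^ D <= (real n + 1) ^ Suc D - real n ^ Suc D"
proof -
 have "real n * real n ^ D <= real n * (real n + 1) ^ D" by (intro mult_left_mono power_mono) auto
 then show ?thesis by (simp add: algebra_simps)
qed

lemma shell_power_nonneg: "0 <= (real n + 1) ^ D - real n ^ D"
 by (simp add: power_mono)

lemma nn_integral_shell_const:
 assumes "0 <= c"
 shows "(\<integral>\<^sup>+s. ennreal c * indicator (shell n) (s::'a::euclidean_space) \<partial>lborel)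
   = ennreal (c * (unit_ball_vol DIM('a) * ((real n + 1) ^ DIM('a) - real n ^ DIM('a))))"
proof -
 have "(\<integral>\<^sup>+s. ennreal c * indicator (shell n) (s::'a) \<partial>lborel) = ennreal c * emeasure lborel (shell n :: 'a set)"
  by (rule nn_integral_cmult_indicator) simp
 then show ?thesis unfolding emeasure_shell using assms by (simp only: ennreal_mult')
qed

lemma power_exp_bound:
 fixes x a :: real assumes "0 <= x" "0 < a"
 shows "x ^ k * exp (- a * x) <= fact k / a ^ k"
proof -
 have "(a * x) ^ k / fact k = (\<Sum>i\<in>{k}. (a * x) ^ i /\<^sub>R fact i)" by (simp add: divide_inverse mult.commute)
 also have "... <= (\<Sum>i. (a * x) ^ i /\<^sub>R fact i)"
  using assms by (intro sum_le_suminf summable_exp_generic) auto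
 finally have "(a * x) ^ k / fact k <= exp (a * x)" by (simp add: exp_def)
 then have "(a * x) ^ k * exp (- (a * x)) <= fact k"
  by (simp add: exp_minus field_simps)
 then show ?thesis using assms by (simp add: power_mult_distrib field_simps)
qed

lemma integrable_exp_sqrt:
 assumes a: "0 < a"
 shows "integrable lborel (%s::'a::euclidean_space. exp (- a * sqrt (norm s)))"
proof (rule integrableI_nonneg)
 obtain D where D: "DIM('a) = Suc D" using DIM_positive[where 'a='a] by (metis Suc_pred)
 define V where "V = unit_ball_vol DIM('a)"
 have V: "0 < V" unfolding V_def by simp
 define K where "K = fact (2 * (D + 2)) / a ^ (2 * (D + 2))"
 have K: "0 <= K" unfolding K_def using a by simp
 define c where "c = (%n. if n = 0 then V else V * K * 2 ^ Suc D * (1 / real n ^ 2))"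
 have "(\<integral>\<^sup>+s. ennreal (exp (- a * sqrt (norm s))) * indicator (shell n) (s::'a) \<partial>lborel) <= ennreal (c n)" for n
 proof -
  have "(\<integral>\<^sup>+s. ennreal (exp (- a * sqrt (norm s))) * indicator (shell n) (s::'a) \<partial>lborel)
   <= (\<integral>\<^sup>+s. ennreal (exp (- a * sqrt (real n))) * indicator (shell n) (s::'a) \<partial>lborel)"
   using a by (intro nn_integral_mono) (auto simp: indicator_def shell_def)
  also have "... = ennreal (exp (- a * sqrt (real n)) * (V * ((real n + 1) ^ Suc D - real n ^ Suc D)))"
   by (subst nn_integral_shell_const) (simp_all only: D V_def exp_ge_zero)
  also have "... <= ennreal (c n)"
  proof (cases "n = 0")
   case True
   then show ?thesis by (simp add: c_def)
  next
   case False
   have "real n ^ (D + 2) * exp (- a * sqrt (real n)) = sqrt (real n) ^ (2 * (D + 2)) * exp (- a * sqrt (real n))"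
    by (subst power_mult) simp
   also have "... <= K" unfolding K_def using a by (intro power_exp_bound) auto
   finally have e: "exp (- a * sqrt (real n)) <= K / real n ^ (D + 2)" using False by (simp add: field_simps)
   have "exp (- a * sqrt (real n)) * (V * ((real n + 1) ^ Suc D - real n ^ Suc D)) <= K / real n ^ (D + 2) * (V * (2 ^ Suc D * real n ^ D))"
    using V K False by (intro mult_mono e mult_left_mono shell_power_upper mult_nonneg_nonneg shell_power_nonneg) auto
   also have "... = c n" using False by (simp add: c_def power_add power2_eq_square mult_ac)
   finally show ?thesis by (rule ennreal_leI)
  qed
  finally show ?thesis .
 qed
 then have "(\<integral>\<^sup>+s. ennreal (exp (- a * sqrt (norm (s::'a)))) \<partial>lborel) <= (\<Sum>n. ennreal (c n))"
  by (subst nn_integral_shells) (auto intro!: suminf_le)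
 also have "... < \<infinity>"
 proof -
  have "summable (%n. 1 / real n ^ 2)" using inverse_power_summable[of 2, where 'a=real] by (simp add: inverse_eq_divide)
  then have "summable (%n. V * K * 2 ^ Suc D * (1 / real n ^ 2))" by (rule summable_mult)
  then have "summable c" 
   by (rule summable_cong[THEN iffD1, rotated]) (auto simp: c_def eventually_at_top_linorder intro!: exI[of _ 1])
  then show ?thesis using V K by (subst suminf_ennreal2) (auto simp: c_def)
 qed
 finally show "(\<integral>\<^sup>+s. ennreal (exp (- a * sqrt (norm (s::'a)))) \<partial>lborel) < \<infinity>" .
qed auto

text \<open>In polar coordinates \<open>I\<close> is a multiple of \<open>\<integral> \<theta>(t)/t dt\<close>, which is finite or infinite together with \<open>\<Sum> \<theta>(n)/n\<close>.\<close>

lemma theta_integral_shells: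
 fixes \<theta> :: "real ^ 'k => real"
 assumes nn: "\<And>t. 0 <= \<theta> t" and g: "\<And>t. \<theta> t = g (norm t)" and dec: "\<And>s t. 0 <= s ==> s <= t ==> g t <= g s"
 shows "summable (%n. g (real (Suc n)) / real (Suc n)) \<longleftrightarrow> theta_integral \<theta> < \<infinity>"
proof -
 obtain D where D: "DIM(real ^ 'k) = Suc D" using DIM_positive[where 'a="real ^ 'k"] by (metis Suc_pred)
 have Dk: "CARD('k) = Suc D" using D by simp
 define V where "V = unit_ball_vol DIM(real ^ 'k)"
 have V: "0 < V" unfolding V_def by simp
 have g0: "0 <= g t" if "0 <= t" for t
 proof -
  obtain b :: "real ^ 'k" where "b \<in> Basis" using nonempty_Basis by blast
  then have "norm (t *\<^sub>R b) = t" using that by simp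
  then show ?thesis using nn[of "t *\<^sub>R b"] g by metis
 qed
 have \<theta>m[measurable]: "\<theta> \<in> borel_measurable borel"
 proof -
  define g' where "g' = (%t. - g (max 0 t))"
  have "mono g'" unfolding g'_def mono_def using dec by auto
  then have [measurable]: "g' \<in> borel_measurable borel" by (rule borel_measurable_mono)
  have "\<theta> = (%t. - g' (norm t))" by (auto simp: g g'_def fun_eq_iff)
  then show ?thesis by simp
 qed
 have [measurable]: "{t :: real ^ 'k. 1 <= norm t} \<in> sets borel" by measurable
 define S where "S = (%n. \<integral>\<^sup>+t. ennreal (\<theta> t / norm t ^ Suc D) * indicator {t. 1 <= norm t} t * indicator (shell n) t \<partial>lborel)"
 have I: "theta_integral \<theta> = (\<Sum>n. S n)"
  unfolding theta_integral_def S_def Dk by (rule nn_integral_shells) measurable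
 have S0: "S 0 = 0"
  unfolding S_def by (subst nn_integral_0_iff_AE) (auto simp: shell_def indicator_def)
 have up: "S (Suc n) <= ennreal (V * 2 ^ Suc D * (g (real (Suc n)) / real (Suc n)))" for n
 proof -
  have "S (Suc n) <= (\<integral>\<^sup>+t. ennreal (g (real (Suc n)) / real (Suc n) ^ Suc D) * indicator (shell (Suc n)) (t :: real ^ 'k) \<partial>lborel)"
   unfolding S_def
  proof (intro nn_integral_mono)
   fix t :: "real ^ 'k"
   show "ennreal (\<theta> t / norm t ^ Suc D) * indicator {t. 1 <= norm t} t * indicator (shell (Suc n)) t
     <= ennreal (g (real (Suc n)) / real (Suc n) ^ Suc D) * indicator (shell (Suc n)) t"
   proof (cases "t \<in> shell (Suc n)")
    case True
    then have t: "real (Suc n) <= norm t" by (simp add: shell_def)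
    have "\<theta> t / norm t ^ Suc D <= g (real (Suc n)) / real (Suc n) ^ Suc D"
     unfolding g using t by (intro frac_le g0 dec power_mono zero_less_power) (auto simp del: of_nat_Suc)
    then show ?thesis using True by (auto simp: indicator_def intro!: ennreal_leI)
   qed simp
  qed
  also have "... = ennreal (g (real (Suc n)) / real (Suc n) ^ Suc D * (V * ((real (Suc n) + 1) ^ Suc D - real (Suc n) ^ Suc D)))"
   using g0[of "real (Suc n)"] by (subst nn_integral_shell_const) (simp_all only: D V_def divide_nonneg_nonneg zero_le_power of_nat_0_le_iff)
  also have "... <= ennreal (g (real (Suc n)) / real (Suc n) ^ Suc D * (V * (2 ^ Suc D * real (Suc n) ^ D)))"
   using V g0[of "real (Suc n)"] by (intro ennreal_leI mult_left_mono shell_power_upper) auto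
  also have "g (real (Suc n)) / real (Suc n) ^ Suc D * (V * (2 ^ Suc D * real (Suc n) ^ D)) = V * 2 ^ Suc D * (g (real (Suc n)) / real (Suc n))"
   by (simp add: field_simps del: of_nat_Suc)
  finally show ?thesis .
 qed
 have low: "ennreal (V * (g (real (Suc (Suc n))) / real (Suc (Suc n)))) <= S (Suc n)" for n
 proof -
  have "ennreal (V * (g (real (Suc (Suc n))) / real (Suc (Suc n))))
    = ennreal (g (real (Suc (Suc n))) / real (Suc (Suc n)) ^ Suc D * (V * real (Suc (Suc n)) ^ D))"
   by (simp add: field_simps del: of_nat_Suc)
  also have "... <= ennreal (g (real (Suc (Suc n))) / real (Suc (Suc n)) ^ Suc D * (V * ((real (Suc n) + 1) ^ Suc D - real (Suc n) ^ Suc D)))"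
   using V g0[of "real (Suc (Suc n))"] shell_power_lower[of "Suc n" D]
   by (intro ennreal_leI mult_left_mono) (auto simp: add.commute)
  also have "... = (\<integral>\<^sup>+t. ennreal (g (real (Suc (Suc n))) / real (Suc (Suc n)) ^ Suc D) * indicator (shell (Suc n)) (t :: real ^ 'k) \<partial>lborel)"
   using g0[of "real (Suc (Suc n))"] by (subst nn_integral_shell_const) (simp_all only: D V_def divide_nonneg_nonneg zero_le_power of_nat_0_le_iff)
  also have "... <= S (Suc n)" unfolding S_def
  proof (intro nn_integral_mono)
   fix t :: "real ^ 'k"
   show "ennreal (g (real (Suc (Suc n))) / real (Suc (Suc n)) ^ Suc D) * indicator (shell (Suc n)) t
     <= ennreal (\<theta> t / norm t ^ Suc D) * indicator {t. 1 <= norm t} t * indicator (shell (Suc n)) t"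
   proof (cases "t \<in> shell (Suc n)")
    case True
    then have t: "real (Suc n) <= norm t" "norm t < real (Suc (Suc n))" by (auto simp: shell_def)
    have "0 < norm t" using t(1) by (rule less_le_trans[rotated]) simp
    then have "g (real (Suc (Suc n))) / real (Suc (Suc n)) ^ Suc D <= \<theta> t / norm t ^ Suc D"
     unfolding g using t by (intro frac_le g0 dec power_mono zero_less_power) auto
    moreover have "1 <= norm t" using t(1) by simp
    ultimately show ?thesis using True by (auto simp: indicator_def intro!: ennreal_leI)
   qed simp
  qed
  finally show ?thesis .
 qed
 show ?thesis
 proof
  assume s: "summable (%n. g (real (Suc n)) / real (Suc n))"
  have "theta_integral \<theta> = (\<Sum>n. S (Suc n))"
   unfolding I using suminf_offset[of S 1] S0 by simp
  also have "... <= (\<Sum>n. ennreal (V * 2 ^ Suc D * (g (real (Suc n)) / real (Suc n))))"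
   by (intro suminf_le up) auto
  also have "... = ennreal (\<Sum>n. V * 2 ^ Suc D * (g (real (Suc n)) / real (Suc n)))"
   using V g0 by (intro suminf_ennreal2 summable_mult s) auto
  finally show "theta_integral \<theta> < \<infinity>" by (auto intro: le_less_trans)
 next
  assume fin: "theta_integral \<theta> < \<infinity>"
  have "(\<Sum>n. ennreal (V * (g (real (Suc (Suc n))) / real (Suc (Suc n))))) <= (\<Sum>n. S (Suc n))"
   by (intro suminf_le low) auto
  also have "... <= theta_integral \<theta>"
   unfolding I using suminf_offset[of S 1] S0 by simp
  finally have "(\<Sum>n. ennreal (V * (g (real (Suc (Suc n))) / real (Suc (Suc n))))) ~= \<infinity>" using fin by auto
  then have "summable (%n. V * (g (real (Suc (Suc n))) / real (Suc (Suc n))))"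
   using V g0 by (intro summable_suminf_not_top) auto
  then have "summable (%n. (1 / V) * (V * (g (real (Suc (Suc n))) / real (Suc (Suc n)))))" by (rule summable_mult)
  then have "summable (%n. g (real (Suc (Suc n))) / real (Suc (Suc n)))" using V by simp
  then show "summable (%n. g (real (Suc n)) / real (Suc n))"
   by (subst summable_Suc_iff[symmetric])
 qed
qed


section \<open>Ingham's uniqueness theorem\<close>

lemma summable_fourth_powers:
 fixes \<theta> :: "real => real"
 assumes nn: "\<And>t. 1 <= t ==> 0 <= \<theta> t" and dec: "\<And>s t. 1 <= s ==> s <= t ==> \<theta> t <= \<theta> s"
  and sum: "summable (%n. \<theta> (real (Suc n) ^ 4) / real (Suc n))"
 shows "summable (%n. \<theta> (real (Suc n)) / real (Suc n))"
proof (rule bounded_imp_summable)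
 define b where "b = (%m::nat. \<theta> (real m) / real m)"
 have b0: "0 <= b m" if "1 <= m" for m unfolding b_def using nn[of "real m"] that by simp
 show "0 <= \<theta> (real (Suc n)) / real (Suc n)" for n using nn[of "real (Suc n)"] by simp
 have block: "(\<Sum>m\<in>{n^4..<(Suc n)^4}. b m) <= 15 * (\<theta> (real n ^ 4) / real n)" if n: "1 <= n" for n :: nat
 proof -
  have n4: "1 <= n ^ 4" using n by simp
  have th: "0 <= \<theta> (real n ^ 4)" using n by (intro nn) (simp add: one_le_power)
  have "(\<Sum>m\<in>{n^4..<(Suc n)^4}. b m) <= (\<Sum>m\<in>{n^4..<(Suc n)^4}. \<theta> (real n ^ 4) / real n ^ 4)"
  proof (rule sum_mono)
   fix m assume m: "m \<in> {n^4..<(Suc n)^4}"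
   then have mm: "real n ^ 4 <= real m" by (metis atLeastLessThan_iff of_nat_le_iff of_nat_power)
   show "b m <= \<theta> (real n ^ 4) / real n ^ 4"
    unfolding b_def using mm n by (intro frac_le th dec) (auto simp: one_le_power)
  qed
  also have "... = real ((Suc n)^4 - n^4) * (\<theta> (real n ^ 4) / real n ^ 4)" by simp
  also have "... <= (15 * real n ^ 3) * (\<theta> (real n ^ 4) / real n ^ 4)"
  proof (rule mult_right_mono)
   have "(Suc n)^4 <= n^4 + 15 * n^3"
   proof -
    have "n^2 <= n^3" "n <= n^3" "1 <= n^3" using n by (auto simp: self_le_power power_increasing)
    moreover have "(Suc n)^4 = n^4 + 4 * n^3 + 6 * n^2 + 4 * n + 1" by (simp add: power4_eq_xxxx power3_eq_cube power2_eq_square algebra_simps)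
    ultimately show ?thesis by linarith
   qed
   then have "(Suc n)^4 - n^4 <= 15 * n^3" by linarith
   then have "real ((Suc n)^4 - n^4) <= real (15 * n^3)" by (simp only: of_nat_le_iff)
   then show "real ((Suc n)^4 - n^4) <= 15 * real n ^ 3" by simp
  qed (use th in simp)
  also have "... = 15 * (\<theta> (real n ^ 4) / real n)" using n by (simp add: power4_eq_xxxx power3_eq_cube)
  finally show ?thesis .
 qed
 have blocks: "(\<Sum>m\<in>{1..<(Suc k)^4}. b m) <= (\<Sum>n<k. 15 * (\<theta> (real (Suc n) ^ 4) / real (Suc n)))" for k
 proof (induction k)
  case (Suc k)
  have "{1..<(Suc (Suc k))^4} = {1..<(Suc k)^4} \<union> {(Suc k)^4..<(Suc (Suc k))^4}"
   by (rule ivl_disj_un_two(3)[symmetric]) (auto intro: power_mono simp: one_le_power)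
  then have "(\<Sum>m\<in>{1..<(Suc (Suc k))^4}. b m) = (\<Sum>m\<in>{1..<(Suc k)^4}. b m) + (\<Sum>m\<in>{(Suc k)^4..<(Suc (Suc k))^4}. b m)"
   by (simp add: sum.union_disjoint)
  then show ?case using Suc block[of "Suc k"] by simp
 qed simp
 fix k
 have "(\<Sum>n\<le>k. \<theta> (real (Suc n)) / real (Suc n)) = (\<Sum>m\<in>{1..<Suc (Suc k)}. b m)"
  unfolding b_def by (rule sum.reindex_bij_witness[of _ "%m. m - 1" Suc]) auto
 also have "... <= (\<Sum>m\<in>{1..<(Suc (Suc k))^4}. b m)"
  by (intro sum_mono2 b0) (auto intro: order.strict_trans2 self_le_power)
 also have "... <= (\<Sum>n<Suc k. 15 * (\<theta> (real (Suc n) ^ 4) / real (Suc n)))" by (rule blocks)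
 also have "... <= (\<Sum>n. 15 * (\<theta> (real (Suc n) ^ 4) / real (Suc n)))"
  by (intro sum_le_suminf summable_mult sum) (auto intro!: nn divide_nonneg_nonneg simp: one_le_power)
 finally show "(\<Sum>n\<le>k. \<theta> (real (Suc n)) / real (Suc n)) <= (\<Sum>n. 15 * (\<theta> (real (Suc n) ^ 4) / real (Suc n)))" .
qed

lemma power_exp_sqrt_bound:
 assumes a: "0 < a"
 shows "\<exists>K\<ge>1. \<forall>n x. 1 <= n \<and> real n ^ 4 <= x \<longrightarrow> x ^ n * exp (- a * sqrt x) <= K"
proof (intro exI[of _ "exp (8 * (8/a)^3)"] conjI allI impI)
 show "1 <= exp (8 * (8 / a)^3)" using a by simp
 fix n :: nat and x :: real assume nx: "1 <= n \<and> real n ^ 4 <= x"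
 define y where "y = sqrt (sqrt x)"
 have "1 <= real n ^ 4" using nx by (simp add: one_le_power)
 then have x: "1 <= x" using nx by linarith
 then have y1: "1 <= y" by (simp add: y_def)
 have y2: "y\<^sup>2 = sqrt x" unfolding y_def using x by simp
 have y4: "y ^ 4 = x" using x by (simp add: y_def power4_eq_xxxx flip: power2_eq_square mult.assoc) (simp add: mult.assoc)
 have ny: "real n <= y"
 proof (rule power_le_imp_le_base)
  show "real n ^ Suc 3 <= y ^ Suc 3" using nx y4 by simp
 qed (use y1 in simp)
 have lny: "ln y <= 2 * sqrt y"
 proof -
  have "ln y = 2 * ln (sqrt y)" using y1 by (simp add: ln_sqrt)
  also have "... <= 2 * sqrt y" using ln_bound[of "sqrt y"] y1 by simp
  finally show ?thesis .
 qed
 have "x ^ n = exp (real n * (4 * ln y))"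
 proof -
  have "x = exp (4 * ln y)" unfolding y4[symmetric] using y1 by (simp add: exp_of_nat_mult[of 4, simplified])
  then show ?thesis by (simp add: exp_of_nat_mult)
 qed
 also have "... <= exp (y * (4 * (2 * sqrt y)))"
 proof -
  have "real n * (4 * ln y) <= y * (4 * (2 * sqrt y))"
   using y1 by (intro mult_mono mult_left_mono ny lny) auto
  then show ?thesis by simp
 qed
 finally have "x ^ n * exp (- a * sqrt x) <= exp (8 * y * sqrt y) * exp (- a * sqrt x)"
  by (intro mult_right_mono) (simp_all add: mult_ac)
 also have "... = exp (8 * y * sqrt y - a * y\<^sup>2)" by (simp add: exp_add[symmetric] y2)
 also have "... <= exp (8 * (8/a)^3)"
 proof (cases "8 / a <= sqrt y")
  case True
  then have "8 <= a * sqrt y" using a by (simp add: field_simps)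
  then have "8 * (y * sqrt y) <= (a * sqrt y) * (y * sqrt y)" using y1 by (intro mult_right_mono) auto
  also have "... = a * y\<^sup>2" using y1 by (simp add: power2_eq_square)
  finally have "8 * y * sqrt y - a * y\<^sup>2 <= 0" by simp
  also have "0 <= 8 * (8/a)^3" using a by simp
  finally show ?thesis by simp
 next
  case False
  then have "(sqrt y) ^ 3 <= (8/a) ^ 3" using y1 by (intro power_mono) auto
  moreover have "(sqrt y) ^ 3 = y * sqrt y" using y1 by (simp add: power3_eq_cube)
  moreover have "0 <= a * y\<^sup>2" using a by simp
  ultimately show ?thesis by simp
 qed
 finally show "x ^ n * exp (- a * sqrt x) <= exp (8 * (8 / a)^3)" .
qed

text \<open>
 An integrable function whose moments grow slowly enough is the transform of a quasi-analytic function: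
 along each line through the origin the inverse transform satisfies the hypotheses of the
 Denjoy--Carleman theorem, so if it vanishes near the origin it vanishes everywhere.
\<close>

lemma inverse_fourier_quasi_analytic:
 fixes W :: "'a::euclidean_space => complex" and \<theta> :: "real => real"
 assumes Wm[measurable]: "W \<in> borel_measurable borel"
  and nn: "\<And>t. 1 <= t ==> 0 <= \<theta> t" and dec: "\<And>s t. 1 <= s ==> s <= t ==> \<theta> t <= \<theta> s"
  and div: "\<not> summable (%n. \<theta> (real (Suc n)) / real (Suc n))"
  and a: "0 < a" and C: "0 <= C"
  and small: "AE s in lborel. cmod (W s) <= C * exp (- 2 * a * sqrt (norm s))"
  and decay: "AE s in lborel. 1 <= norm s \<longrightarrow> cmod (W s) <= C * exp (- norm s * \<theta> (norm s)) * exp (- 2 * a * sqrt (norm s))"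
  and r: "0 < r" and zero: "\<And>z. norm z < r ==> (LINT s|lborel. W s * cis (2 * pi * (s \<bullet> z))) = 0"
 shows "(LINT s|lborel. W s * cis (2 * pi * (s \<bullet> z))) = 0"
proof -
 define \<omega> where "\<omega> = (%s. 2 * pi * (s \<bullet> z))"
 define u where "u = (%s::'a. 2 * pi * norm z * norm s)"
 define w where "w = (%s. cmod (W s))"
 define M where "M = (%j. \<integral>s. u s ^ j * w s \<partial>lborel)"
 define g where "g = (%j \<tau>. \<integral>s. (\<i> * of_real (\<omega> s)) ^ j * W s * cis (\<tau> * \<omega> s) \<partial>lborel)"
 have [measurable]: "\<omega> \<in> borel_measurable borel" "u \<in> borel_measurable borel" "w \<in> borel_measurable borel"
  unfolding \<omega>_def u_def w_def by measurable
 have u0: "0 <= u s" and w0: "0 <= w s" for s by (auto simp: u_def w_def)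
 have \<omega>u: "\<bar>\<omega> s\<bar> <= u s" for s
  using Cauchy_Schwarz_ineq2[of s z] by (simp add: \<omega>_def u_def abs_mult mult.commute)
 have expi: "integrable lborel (%s::'a. exp (- a * sqrt (norm s)))" by (rule integrable_exp_sqrt[OF a])
 have ui: "integrable lborel (%s. u s ^ j * w s)" for j
 proof (rule Bochner_Integration.integrable_bound)
  define K where "K = (2 * pi * norm z) ^ j * C * (fact (2 * j) / a ^ (2 * j))"
  show "integrable lborel (%s::'a. K * exp (- a * sqrt (norm s)))" by (intro integrable_mult_right expi)
  show "AE s in lborel. norm (u s ^ j * w s) <= norm (K * exp (- a * sqrt (norm s)))"
   using small
  proof eventually_elim
   case (elim s)
   have "norm s ^ j * exp (- a * sqrt (norm s)) = sqrt (norm s) ^ (2 * j) * exp (- a * sqrt (norm s))"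
    by (subst power_mult) simp
   also have "... <= fact (2 * j) / a ^ (2 * j)" by (rule power_exp_bound[OF _ a]) simp
   finally have p: "norm s ^ j * exp (- a * sqrt (norm s)) <= fact (2 * j) / a ^ (2 * j)" .
   have "u s ^ j * w s <= u s ^ j * (C * exp (- 2 * a * sqrt (norm s)))"
    using elim u0[of s] by (intro mult_left_mono) (auto simp: w_def)
   also have "... = (2 * pi * norm z) ^ j * C * (norm s ^ j * exp (- a * sqrt (norm s))) * exp (- a * sqrt (norm s))"
    by (simp add: u_def power_mult_distrib mult_ac exp_add[symmetric])
   also have "... <= K * exp (- a * sqrt (norm s))"
    unfolding K_def using C by (intro mult_right_mono mult_left_mono p) auto
   finally show ?case using u0[of s] w0[of s] by simp
  qed
 qed measurable
 have gi: "integrable lborel (%s. (\<i> * of_real (\<omega> s)) ^ j * W s * cis (\<tau> * \<omega> s))" for j \<tau>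
 proof (rule Bochner_Integration.integrable_bound[OF ui[of j]])
  show "AE s in lborel. norm ((\<i> * of_real (\<omega> s)) ^ j * W s * cis (\<tau> * \<omega> s)) <= norm (u s ^ j * w s)"
  proof (rule AE_I2)
   fix s
   have "\<bar>\<omega> s\<bar> ^ j <= u s ^ j" by (intro power_mono \<omega>u) simp
   then show "norm ((\<i> * of_real (\<omega> s)) ^ j * W s * cis (\<tau> * \<omega> s)) <= norm (u s ^ j * w s)"
    using u0[of s] by (simp add: norm_mult norm_power w_def mult_right_mono)
  qed
 qed measurable
 have goal: "(LINT s|lborel. W s * cis (2 * pi * (s \<bullet> z))) = g 0 1" by (simp add: g_def \<omega>_def)
 have "g 0 1 = 0"
 proof (cases "z = 0 \<or> M 0 = 0")
  case True
  then show ?thesis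
  proof
   assume "z = 0" then show ?thesis using zero[of 0] r goal by simp
  next
   assume "M 0 = 0"
   then have "AE s in lborel. u s ^ 0 * w s = 0"
    unfolding M_def using integral_nonneg_eq_0_iff_AE[OF ui[of 0]] u0 w0 by simp
   then show ?thesis unfolding g_def w_def by (intro integral_eq_zero_AE) auto
  qed
 next
  case False
  then have z: "z ~= 0" and M0: "M 0 ~= 0" by auto
  have Mnn: "0 <= M j" for j unfolding M_def using u0 w0 by (intro Bochner_Integration.integral_nonneg) auto
  have Mpos: "0 < M j" for j
  proof (rule ccontr)
   assume "\<not> 0 < M j"
   then have "M j = 0" using Mnn[of j] by simp
   then have "AE s in lborel. u s ^ j * w s = 0"
    unfolding M_def using integral_nonneg_eq_0_iff_AE[OF ui[of j]] u0 w0 by simp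
   moreover have "AE s in lborel. s ~= (0::'a)" by (rule AE_lborel_singleton)
   ultimately have "AE s in lborel. w s = 0"
    by eventually_elim (use z in \<open>auto simp: u_def\<close>)
   then have "M 0 = 0" unfolding M_def by (intro integral_eq_zero_AE) auto
   then show False using M0 by simp
  qed
  have ratio: "M (Suc n) * M (Suc n) <= M n * M (Suc (Suc n))" for n
  proof -
   define t where "t = M (Suc n) / M n"
   have "0 <= (LINT s|lborel. u s ^ n * w s * (u s - t)\<^sup>2)" using u0 w0 by (intro Bochner_Integration.integral_nonneg) auto
   also have "(LINT s|lborel. u s ^ n * w s * (u s - t)\<^sup>2)
     = (LINT s|lborel. (u s ^ Suc (Suc n) * w s - 2 * t * (u s ^ Suc n * w s)) + t\<^sup>2 * (u s ^ n * w s))"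
    by (intro Bochner_Integration.integral_cong refl) (simp add: power2_eq_square algebra_simps)
   also have "... = (M (Suc (Suc n)) - 2 * t * M (Suc n)) + t\<^sup>2 * M n"
    unfolding M_def using ui
    by (subst Bochner_Integration.integral_add, (intro Bochner_Integration.integrable_diff integrable_mult_right ui)+,
      subst Bochner_Integration.integral_diff, (intro integrable_mult_right ui)+, simp only: integral_mult_right_zero)
   also have "... = M (Suc (Suc n)) - M (Suc n) * M (Suc n) / M n"
    using Mpos[of n] by (simp add: t_def power2_eq_square field_simps)
   finally show ?thesis using Mpos[of n] by (simp add: field_simps)
  qed
  have iexp: "cmod (cis y - (\<Sum>i<m. (\<i> * of_real y) ^ i / fact i)) <= \<bar>y\<bar> ^ m / fact m" for y m
  proof (cases m)
   case (Suc n)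
   then show ?thesis using iexp_approx1[of y n] by (simp add: cis_conv_exp lessThan_Suc_atMost)
  qed simp
  have taylor: "cmod (g j (x + h) - (\<Sum>i<m. g (j + i) x * of_real (h ^ i / fact i))) <= M (j + m) * \<bar>h\<bar> ^ m / fact m" for j m x h
  proof -
   define E where "E = (%s. cis (h * \<omega> s) - (\<Sum>i<m. (\<i> * of_real (h * \<omega> s)) ^ i / fact i))"
   have "g j (x + h) - (\<Sum>i<m. g (j + i) x * of_real (h ^ i / fact i))
     = (LINT s|lborel. (\<i> * of_real (\<omega> s)) ^ j * W s * cis ((x + h) * \<omega> s)
       - (\<Sum>i<m. (\<i> * of_real (\<omega> s)) ^ (j + i) * W s * cis (x * \<omega> s) * of_real (h ^ i / fact i)))"
   proof -
    have gc: "integrable lborel (%s. (\<i> * of_real (\<omega> s)) ^ (j + i) * W s * cis (x * \<omega> s) * of_real (h ^ i / fact i))" for i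
     by (intro integrable_mult_left gi)
    show ?thesis
     unfolding Bochner_Integration.integral_diff[OF gi Bochner_Integration.integrable_sum[OF gc]]
      Bochner_Integration.integral_sum[OF gc] by (simp only: g_def integral_mult_left_zero)
   qed
   also have "... = (LINT s|lborel. (\<i> * of_real (\<omega> s)) ^ j * W s * cis (x * \<omega> s) * E s)"
   proof (rule Bochner_Integration.integral_cong[OF refl])
    fix s
    have "cis ((x + h) * \<omega> s) = cis (x * \<omega> s) * cis (h * \<omega> s)" by (simp add: cis_mult distrib_right)
    then show "(\<i> * of_real (\<omega> s)) ^ j * W s * cis ((x + h) * \<omega> s)
       - (\<Sum>i<m. (\<i> * of_real (\<omega> s)) ^ (j + i) * W s * cis (x * \<omega> s) * of_real (h ^ i / fact i))
      = (\<i> * of_real (\<omega> s)) ^ j * W s * cis (x * \<omega> s) * E s"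
     unfolding E_def right_diff_distrib sum_distrib_left
     by (simp add: power_add power_mult_distrib mult_ac)
   qed
   finally have eq: "g j (x + h) - (\<Sum>i<m. g (j + i) x * of_real (h ^ i / fact i))
     = (LINT s|lborel. (\<i> * of_real (\<omega> s)) ^ j * W s * cis (x * \<omega> s) * E s)" .
   have pt: "cmod ((\<i> * of_real (\<omega> s)) ^ j * W s * cis (x * \<omega> s) * E s) <= u s ^ (j + m) * w s * (\<bar>h\<bar> ^ m / fact m)" for s
   proof -
    have "cmod (E s) <= \<bar>h * \<omega> s\<bar> ^ m / fact m" unfolding E_def by (rule iexp)
    also have "... <= (\<bar>h\<bar> * u s) ^ m / fact m"
     using \<omega>u[of s] by (intro divide_right_mono power_mono) (auto simp: abs_mult intro: mult_left_mono)
    finally have "cmod (E s) <= (\<bar>h\<bar> * u s) ^ m / fact m" .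
    moreover have "\<bar>\<omega> s\<bar> ^ j <= u s ^ j" by (intro power_mono \<omega>u) simp
    ultimately have "\<bar>\<omega> s\<bar> ^ j * w s * cmod (E s) <= u s ^ j * w s * ((\<bar>h\<bar> * u s) ^ m / fact m)"
     using u0[of s] w0[of s] by (intro mult_mono) auto
    then show ?thesis by (simp add: norm_mult norm_power w_def power_add power_mult_distrib mult_ac)
   qed
   have "cmod (LINT s|lborel. (\<i> * of_real (\<omega> s)) ^ j * W s * cis (x * \<omega> s) * E s)
     <= (LINT s|lborel. u s ^ (j + m) * w s * (\<bar>h\<bar> ^ m / fact m))"
   proof (rule order_trans[OF integral_norm_bound integral_mono])
    have [measurable]: "E \<in> borel_measurable borel" unfolding E_def by measurable
    show i2: "integrable lborel (%s. u s ^ (j + m) * w s * (\<bar>h\<bar> ^ m / fact m))" by (intro integrable_mult_left ui)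
    show "integrable lborel (%s. cmod ((\<i> * of_real (\<omega> s)) ^ j * W s * cis (x * \<omega> s) * E s))"
     by (rule Bochner_Integration.integrable_bound[OF i2])
      (use pt u0 w0 in \<open>auto intro!: AE_I2 simp del: norm_mult\<close>)
   qed (rule pt)
   also have "... = M (j + m) * \<bar>h\<bar> ^ m / fact m" unfolding M_def by simp
   finally show ?thesis unfolding eq .
  qed
  have flat: "g j \<tau> = 0" if "\<bar>\<tau>\<bar> * norm z < r" for j \<tau>
   using that
  proof (induction j arbitrary: \<tau>)
   case 0
   have "g 0 \<tau> = (LINT s|lborel. W s * cis (2 * pi * (s \<bullet> (\<tau> *\<^sub>R z))))"
    unfolding g_def \<omega>_def by (simp add: mult_ac)
   also have "... = 0" using 0 by (intro zero) simp
   finally show ?case .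
  next
   case (Suc j)
   define \<rho> where "\<rho> = (r / norm z - \<bar>\<tau>\<bar>) / 2"
   have \<rho>: "0 < \<rho>" unfolding \<rho>_def using Suc.prems z by (simp add: field_simps)
   have "cmod (g (Suc j) \<tau>) <= M (j + 2) * h / 2" if h: "0 < h" "h <= \<rho>" for h
   proof -
    have "\<bar>\<tau> + h\<bar> < r / norm z" using h \<rho> unfolding \<rho>_def by (auto simp: abs_if field_simps split: if_splits)
    then have "\<bar>\<tau> + h\<bar> * norm z < r" using z by (simp add: field_simps)
    then have "g j (\<tau> + h) = 0" "g j \<tau> = 0" using Suc by auto
    then have "cmod (g (Suc j) \<tau>) * h <= M (j + 2) * h\<^sup>2 / 2"
     using taylor[of j \<tau> h 2] h by (simp add: numeral_2_eq_2 norm_mult)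
    then have "cmod (g (Suc j) \<tau>) * h <= (M (j + 2) * h / 2) * h" by (simp add: power2_eq_square)
    then show ?thesis using h(1) by (rule mult_right_le_imp_le)
   qed
   then have "\<forall>\<^sub>F h in at_right 0. cmod (g (Suc j) \<tau>) <= M (j + 2) * h / 2"
    unfolding eventually_at_right_field using \<rho> by (intro exI[of _ \<rho>]) auto
   moreover have "((%h. M (j + 2) * h / 2) \<longlongrightarrow> M (j + 2) * 0 / 2) (at_right 0)" by (intro tendsto_intros) auto
   ultimately have "cmod (g (Suc j) \<tau>) <= M (j + 2) * 0 / 2"
    by (intro tendsto_lowerbound[of "%h. M (j + 2) * h / 2" _ "at_right 0"]) auto
   then show ?case by simp
  qed
  have \<theta>pos: "0 < \<theta> t" if t: "1 <= t" for t
  proof (rule ccontr)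
   assume "\<not> 0 < \<theta> t"
   then have z: "\<theta> t' = 0" if "t <= t'" for t' using dec[OF t that] nn[of t'] t that by auto
   have "\<forall>\<^sub>F n in sequentially. \<theta> (real (Suc n)) / real (Suc n) = 0"
    using eventually_ge_at_top[of "nat \<lceil>t\<rceil>"] by eventually_elim (auto intro!: z simp: nat_ceiling_le_eq)
   then have "summable (%n. \<theta> (real (Suc n)) / real (Suc n)) \<longleftrightarrow> summable (%n::nat. 0::real)" by (rule summable_cong)
   then show False using div by simp
  qed
  obtain K1 where K1: "1 <= K1" "\<And>n x. 1 <= n ==> real n ^ 4 <= x ==> x ^ n * exp (- a * sqrt x) <= K1"
   using power_exp_sqrt_bound[OF a] by blast
  define P where "P = max 1 (\<theta> 1)"
  define B where "B = 2 * pi * norm z * P"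
  have P: "1 <= P" "\<theta> 1 <= P" by (auto simp: P_def)
  have B: "0 < B" unfolding B_def using z P by simp
  define A where "A = C * K1 * (LINT s|lborel. exp (- a * sqrt (norm (s::'a))))"
  have Mbound: "M n <= A * (B * real n / \<theta> (real n ^ 4)) ^ n" if n: "1 <= n" for n
  proof -
   have n4: "1 <= real n ^ 4" using n by (simp add: one_le_power)
   define T where "T = \<theta> (real n ^ 4)"
   have T: "0 < T" "T <= P" unfolding T_def using \<theta>pos[OF n4] dec[OF order_refl n4] P by auto
   have q1: "1 <= P * real n / T"
   proof -
    have "T * 1 <= P * real n" using T n by (intro mult_mono) auto
    then show ?thesis using T by (simp add: field_simps)
   qed
   have pt: "AE s in lborel. norm s ^ n * w s <= C * K1 * (P * real n / T) ^ n * exp (- a * sqrt (norm s))"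
    using small decay
   proof eventually_elim
    case (elim s)
    define e where "e = exp (- a * sqrt (norm s))"
    have e: "0 < e" "e <= 1" "exp (- 2 * a * sqrt (norm s)) = e * e"
     unfolding e_def using a by (auto simp: exp_add[symmetric])
    have w1: "w s <= C * (e * e)" using elim(1) unfolding w_def e(3) .
    have w2: "w s <= C * exp (- norm s * \<theta> (norm s)) * (e * e)" if "1 <= norm s"
     using elim(2) that unfolding w_def e(3) by simp
    have qn: "1 <= (P * real n / T) ^ n" using q1 by (rule one_le_power)
    consider "norm s < 1" | "1 <= norm s" "norm s <= real n ^ 4" | "real n ^ 4 <= norm s" by linarith
    then have "norm s ^ n * w s <= C * (K1 * (P * real n / T) ^ n) * e"
    proof cases
     case 1
     have "norm s ^ n * w s <= 1 * (C * (e * e))"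
      using 1 w0[of s] by (intro mult_mono w1) (auto simp: power_le_one)
     also have "... <= C * (1 * 1) * e" using C e by (simp add: mult_left_le_one_le mult_left_mono)
     also have "... <= C * (K1 * (P * real n / T) ^ n) * e"
      using C e K1 qn by (intro mult_right_mono mult_left_mono mult_mono) auto
     finally show ?thesis .
    next
     case 2
     have "exp (- norm s * \<theta> (norm s)) <= exp (- T * norm s)"
      unfolding T_def using dec[OF 2] by (simp add: mult.commute mult_left_mono)
     then have "norm s ^ n * exp (- norm s * \<theta> (norm s)) <= norm s ^ n * exp (- T * norm s)" by (intro mult_left_mono) auto
     also have "... <= fact n / T ^ n" using T by (intro power_exp_bound) auto
     also have "... <= (P * real n / T) ^ n"
     proof -
      have "fact n <= real n ^ n" using fact_le_power[of n, where 'a=real] by simp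
      also have "... <= (P * real n) ^ n" using P n by (intro power_mono) (auto simp: mult_le_cancel_right1)
      finally show ?thesis using T by (simp add: power_divide divide_right_mono)
     qed
     also have "... <= K1 * (P * real n / T) ^ n" using mult_right_mono[OF K1(1), of "(P * real n / T) ^ n"] qn by linarith
     finally have b: "norm s ^ n * exp (- norm s * \<theta> (norm s)) <= K1 * (P * real n / T) ^ n" .
     have "norm s ^ n * w s <= norm s ^ n * (C * exp (- norm s * \<theta> (norm s)) * (e * e))"
      using 2 by (intro mult_left_mono w2) auto
     also have "... = C * (norm s ^ n * exp (- norm s * \<theta> (norm s))) * (e * e)" by (simp add: mult_ac)
     also have "... <= C * (K1 * (P * real n / T) ^ n) * (e * e)"
      using C e by (intro mult_right_mono mult_left_mono b) auto
     also have "... <= C * (K1 * (P * real n / T) ^ n) * e"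
     proof (rule mult_left_mono)
      show "e * e <= e" using e by (simp add: mult_left_le_one_le)
      show "0 <= C * (K1 * (P * real n / T) ^ n)" using C K1(1) qn by (intro mult_nonneg_nonneg) linarith+
     qed
     finally show ?thesis .
    next
     case 3
     have "norm s ^ n * e <= K1" unfolding e_def by (rule K1(2)[OF n 3])
     also have "... <= K1 * (P * real n / T) ^ n" using mult_left_mono[OF qn, of K1] K1(1) by linarith
     finally have b: "norm s ^ n * e <= K1 * (P * real n / T) ^ n" .
     have "norm s ^ n * w s <= norm s ^ n * (C * (e * e))"
      by (intro mult_left_mono w1) auto
     also have "... = C * (norm s ^ n * e) * e" by (simp add: mult_ac)
     also have "... <= C * (K1 * (P * real n / T) ^ n) * e" using C e b by (intro mult_right_mono mult_left_mono) auto
     finally show ?thesis .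
    qed
    then show ?case unfolding e_def by (simp add: mult_ac)
   qed
   have "M n <= (LINT s|lborel. (2 * pi * norm z) ^ n * (C * K1 * (P * real n / T) ^ n * exp (- a * sqrt (norm (s::'a)))))"
    unfolding M_def
   proof (rule integral_mono_AE[OF ui])
    show "integrable lborel (%s::'a. (2 * pi * norm z) ^ n * (C * K1 * (P * real n / T) ^ n * exp (- a * sqrt (norm s))))"
     by (intro integrable_mult_right expi)
    show "AE s in lborel. u s ^ n * w s <= (2 * pi * norm z) ^ n * (C * K1 * (P * real n / T) ^ n * exp (- a * sqrt (norm s)))"
     using pt
    proof eventually_elim
     case (elim s)
     have "u s ^ n * w s = (2 * pi * norm z) ^ n * (norm s ^ n * w s)" by (simp add: u_def power_mult_distrib mult_ac)
     also have "... <= (2 * pi * norm z) ^ n * (C * K1 * (P * real n / T) ^ n * exp (- a * sqrt (norm s)))"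
      by (rule mult_left_mono[OF elim]) simp
     finally show ?case .
    qed
   qed
   also have "... = A * ((2 * pi * norm z) ^ n * (P * real n / T) ^ n)" by (simp add: A_def mult_ac)
   also have "... = A * (B * real n / T) ^ n" unfolding power_mult_distrib[symmetric] by (simp add: B_def mult_ac)
   finally show ?thesis by (simp add: T_def)
  qed
  have div': "\<not> summable (%n. M n / M (Suc n))"
  proof
   assume sm: "summable (%n. M n / M (Suc n))"
   define c where "c = (%n. if n = 0 then 0 else \<theta> (real n ^ 4) / (B * real n))"
   have th4: "0 < \<theta> (real (Suc n) ^ 4)" for n by (intro \<theta>pos one_le_power) simp
   have "summable (%n. c (Suc n))"
   proof (rule Carleman_inequality[OF _ _ _ _ sm])
    show "0 <= M n / M (Suc n)" for n using Mpos by (simp add: less_imp_le)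
    show "0 <= c n" for n
     unfolding c_def using th4[of "n - 1"] B by (cases n) auto
    show "1 <= max 1 (A / M 0)" by simp
    fix n
    have pr: "(\<Prod>i\<le>n. M i / M (Suc i)) = M 0 / M (Suc n)"
     using Mpos by (induction n) (simp_all add: less_imp_neq[symmetric] divide_simps)
    define q where "q = B * real (Suc n) / \<theta> (real (Suc n) ^ 4)"
    have q: "0 < q" unfolding q_def using B th4[of n] by simp
    have "c (Suc n) = 1 / q" by (simp add: c_def q_def)
    then have "c (Suc n) ^ Suc n = 1 / q ^ Suc n" by (simp only: power_one_over)
    also have "... <= A / M (Suc n)"
     using Mbound[of "Suc n"] Mpos[of "Suc n"] q unfolding q_def[symmetric]
     by (simp add: field_simps del: power_Suc)
    also have "... = A / M 0 * (M 0 / M (Suc n))" using Mpos[of 0] by simp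
    also have "... <= max 1 (A / M 0) * (\<Prod>i\<le>n. M i / M (Suc i))"
     unfolding pr using Mpos[of 0] Mpos[of "Suc n"] by (intro mult_right_mono) auto
    finally show "c (Suc n) ^ Suc n <= max 1 (A / M 0) * (\<Prod>i\<le>n. M i / M (Suc i))" .
   qed
   then have "summable (%n. B * c (Suc n))" by (rule summable_mult)
   then have "summable (%n. \<theta> (real (Suc n) ^ 4) / real (Suc n))" using B by (simp add: c_def)
   from summable_fourth_powers[OF nn dec this] show False using div by simp
  qed
  show ?thesis
   by (rule Denjoy_Carleman[OF Mpos ratio taylor _ div']) (use flat r in simp)
 qed
 then show ?thesis unfolding goal .
qed


text \<open>
 The decay of the transform of \<open>F\<close> may be too weak for this, since \<open>t \<theta>(t)\<close> need not grow; the convolution of \<open>F\<close> with a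
 function of Ingham's type for the weight \<open>t\<^sup>-\<^sup>1\<^sup>/\<^sup>2\<close> decays in addition like \<open>exp (- c \<surd>|s|)\<close>, which also absorbs
 polynomial factors, and it still vanishes near the origin if the support is small.
\<close>

theorem ingham_uniqueness:
 fixes F :: "'a::euclidean_space => complex" and \<theta> :: "real => real"
 assumes F: "integrable lborel F"
  and \<epsilon>: "0 < \<epsilon>" and vanish: "AE x in lborel. norm x < \<epsilon> \<longrightarrow> F x = 0"
  and nn: "\<And>t. 1 <= t ==> 0 <= \<theta> t" and dec: "\<And>s t. 1 <= s ==> s <= t ==> \<theta> t <= \<theta> s"
  and div: "\<not> summable (%n. \<theta> (real (Suc n)) / real (Suc n))"
  and decay: "AE s in lborel. 1 <= norm s \<longrightarrow> cmod (fourier F s) <= C * norm s ^ N * exp (- norm s * \<theta> (norm s))"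
 shows "AE x in lborel. F x = 0"
proof -
 have lim: "((%t::real. 1 / sqrt t) \<longlongrightarrow> 0) at_top"
  by (intro tendsto_divide_0[OF tendsto_const] filterlim_at_top_imp_at_infinity sqrt_at_top)
 have sm: "summable (%n. 1 / sqrt (real (Suc n)) / real (Suc n))"
 proof -
  have "summable (%n. real (Suc n) powr (- (3/2)))"
   using summable_real_powr_iff[of "- (3/2)"] by (subst summable_Suc_iff) simp
  moreover have "x powr (- (3/2)) = 1 / sqrt x / x" if "0 < x" for x :: real
  proof -
   have "x powr (- (3/2)) = 1 / (x powr (1/2 + 1))" by (simp add: powr_minus_divide)
   also have "x powr (1/2 + 1) = sqrt x * x" unfolding powr_add using that by (simp add: powr_half_sqrt)
   finally show ?thesis by simp
  qed
  ultimately show ?thesis by simp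
 qed
 obtain \<psi> :: "'a => complex" and L R C1 where \<psi>: "lip_supp L R \<psi>" "fourier \<psi> 0 ~= 0" and C1: "0 <= C1"
  "\<And>s. 1 <= norm s ==> cmod (fourier \<psi> s) <= C1 * exp (- norm s * (1 / sqrt (norm s)))"
  by (rule ingham_function[OF _ _ lim sm]) (auto simp: frac_le)
 have R: "0 <= R" using \<psi>(1) by (simp add: lip_supp_def)
 have \<psi>i: "integrable lborel \<psi>" by (rule lip_supp_integrable[OF \<psi>(1)])
 have [measurable]: "\<psi> \<in> borel_measurable borel" "F \<in> borel_measurable borel" using \<psi>i F by auto
 define r where "r = (%n. \<epsilon> / (2 * (R + 1)) * (1 / real (Suc n)))"
 have r0: "0 < r n" for n unfolding r_def using \<epsilon> R by simp
 have rlim: "r \<longlonglongrightarrow> 0" unfolding r_def by (rule tendsto_mult_right_zero[OF LIMSEQ_Suc[OF lim_1_over_n]])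
 have rR: "r n * R <= \<epsilon> / 2" for n
 proof -
  have "r n <= \<epsilon> / (2 * (R + 1)) * 1" unfolding r_def using \<epsilon> R by (intro mult_left_mono) auto
  then have "r n * R <= \<epsilon> / (2 * (R + 1)) * R" using R by (intro mult_right_mono) auto
  also have "... <= \<epsilon> / 2" using \<epsilon> R by (simp add: field_simps)
  finally show ?thesis .
 qed
 show ?thesis
 proof (rule mollify_zero[OF F \<psi>i _ r0 rlim])
  show "(LINT x|lborel. \<psi> x) ~= 0" using \<psi>(2) by (simp add: fourier_def)
  fix n z
  define q where "q = r n"
  have q: "0 < q" unfolding q_def by (rule r0)
  define \<rho> where "\<rho> = (%x. \<psi> ((1 / q) *\<^sub>R x))"
  have \<rho>i: "integrable lborel \<rho>" unfolding \<rho>_def using lborel_integrable_affine[OF _ \<psi>i, of "1 / q" 0] q by simp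
  have [measurable]: "\<rho> \<in> borel_measurable borel" using \<rho>i by auto
  have ft\<rho>: "fourier \<rho> s = q ^ DIM('a) *\<^sub>R fourier \<psi> (q *\<^sub>R s)" for s
  proof -
   have "fourier \<rho> s = \<bar>q\<bar> ^ DIM('a) *\<^sub>R (LINT x|lborel. \<rho> (0 + q *\<^sub>R x) * cis (- (2 * pi * (s \<bullet> (0 + q *\<^sub>R x)))))"
    unfolding fourier_def using q by (intro lborel_integral_affine) auto
   then show ?thesis using q by (simp add: \<rho>_def fourier_def)
  qed
  define a where "a = sqrt q / 4"
  have a: "0 < a" unfolding a_def using q by simp
  define I where "I = (LINT x|lborel. cmod (\<psi> x))"
  have I: "0 <= I" unfolding I_def by simp
  define C2 where "C2 = q ^ DIM('a) * (C1 + I * exp 1)"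
  have C2: "0 <= C2" unfolding C2_def using C1 I q by simp
  have b\<rho>: "cmod (fourier \<rho> s) <= C2 * exp (- (4 * a) * sqrt (norm s))" for s
  proof -
   have sq: "4 * a * sqrt (norm s) = sqrt (norm (q *\<^sub>R s))" using q by (simp add: a_def real_sqrt_mult)
   have "cmod (fourier \<psi> (q *\<^sub>R s)) <= (C1 + I * exp 1) * exp (- sqrt (norm (q *\<^sub>R s)))"
   proof (cases "1 <= norm (q *\<^sub>R s)")
    case True
    have "norm (q *\<^sub>R s) * (1 / sqrt (norm (q *\<^sub>R s))) = sqrt (norm (q *\<^sub>R s))"
     by (simp add: real_div_sqrt)
    then have "cmod (fourier \<psi> (q *\<^sub>R s)) <= C1 * exp (- sqrt (norm (q *\<^sub>R s)))"
     using C1(2)[OF True] by simp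
    also have "... <= (C1 + I * exp 1) * exp (- sqrt (norm (q *\<^sub>R s)))"
     using I by (intro mult_right_mono) auto
    finally show ?thesis .
   next
    case False
    then have "sqrt (norm (q *\<^sub>R s)) <= 1" by simp
    then have "1 <= exp 1 * exp (- sqrt (norm (q *\<^sub>R s)))" unfolding exp_add[symmetric] by simp
    then have "I * 1 <= I * (exp 1 * exp (- sqrt (norm (q *\<^sub>R s))))" using I by (rule mult_left_mono)
    also have "... <= (C1 + I * exp 1) * exp (- sqrt (norm (q *\<^sub>R s)))"
     unfolding mult.assoc[symmetric] using C1(1) by (intro mult_right_mono) auto
    finally show ?thesis using fourier_bound[OF \<psi>i, of "q *\<^sub>R s"] unfolding I_def by simp
   qed
   then have "q ^ DIM('a) * cmod (fourier \<psi> (q *\<^sub>R s)) <= q ^ DIM('a) * ((C1 + I * exp 1) * exp (- sqrt (norm (q *\<^sub>R s))))"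
    using q by (intro mult_left_mono) auto
   moreover have "cmod (fourier \<rho> s) = q ^ DIM('a) * cmod (fourier \<psi> (q *\<^sub>R s))" using q by (simp add: ft\<rho>)
   moreover have "exp (- (4 * a) * sqrt (norm s)) = exp (- sqrt (norm (q *\<^sub>R s)))"
    unfolding sq[symmetric] by simp
   ultimately show ?thesis by (simp only: C2_def mult.assoc)
  qed
  have ft\<rho>i: "integrable lborel (fourier \<rho>)"
  proof (rule Bochner_Integration.integrable_bound)
   show "integrable lborel (%s::'a. C2 * exp (- (4 * a) * sqrt (norm s)))"
    using a by (intro integrable_mult_right integrable_exp_sqrt) simp
   show "AE s in lborel. norm (fourier \<rho> s) <= norm (C2 * exp (- (4 * a) * sqrt (norm s)))"
    using b\<rho> C2 by (intro AE_I2) simp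
  qed measurable
  have inv: "\<rho> x = (LINT s|lborel. fourier \<rho> s * cis (2 * pi * (s \<bullet> x)))" for x
  proof (rule fourier_inversion[OF \<rho>i _ _ ft\<rho>i])
   show "continuous_on UNIV \<rho>"
    unfolding \<rho>_def by (intro continuous_on_compose2[OF lip_supp_continuous[OF \<psi>(1), of UNIV]] continuous_intros) auto
   show "cmod (\<rho> x) <= L * (2 * R + 1)" for x unfolding \<rho>_def by (rule lip_supp_bound[OF \<psi>(1)])
  qed
  define W where "W = (%s. fourier F s * fourier \<rho> s)"
  have conv: "(LINT y|lborel. F y * \<rho> (x - y)) = (LINT s|lborel. W s * cis (2 * pi * (s \<bullet> x)))" for x
  proof -
   have int: "integrable (lborel \<Otimes>\<^sub>M lborel) (%(y, s). F y * fourier \<rho> s * cis (2 * pi * (s \<bullet> (x - y))))"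
    by (intro integrable_pair_bounded[where B=1] F ft\<rho>i lborel.sigma_finite_measure_axioms) auto
   have "(LINT y|lborel. F y * \<rho> (x - y)) = (LINT y|lborel. (LINT s|lborel. F y * fourier \<rho> s * cis (2 * pi * (s \<bullet> (x - y)))))"
    by (subst inv) (simp add: mult.assoc)
   also have "... = (LINT s|lborel. (LINT y|lborel. F y * fourier \<rho> s * cis (2 * pi * (s \<bullet> (x - y)))))"
    by (rule lborel_pair.Fubini_integral[OF int, symmetric])
   also have "... = (LINT s|lborel. W s * cis (2 * pi * (s \<bullet> x)))"
   proof (rule Bochner_Integration.integral_cong[OF refl])
    fix s
    have "F y * fourier \<rho> s * cis (2 * pi * (s \<bullet> (x - y)))
      = (fourier \<rho> s * cis (2 * pi * (s \<bullet> x))) * (F y * cis (- (2 * pi * (s \<bullet> y))))" for y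
    proof -
     have "cis (2 * pi * (s \<bullet> (x - y))) = cis (2 * pi * (s \<bullet> x)) * cis (- (2 * pi * (s \<bullet> y)))"
      unfolding cis_mult by (simp add: inner_diff_right right_diff_distrib)
     then show ?thesis by (simp add: mult_ac)
    qed
    then show "(LINT y|lborel. F y * fourier \<rho> s * cis (2 * pi * (s \<bullet> (x - y)))) = W s * cis (2 * pi * (s \<bullet> x))"
     by (simp only: integral_mult_right_zero fourier_def[of F, symmetric] W_def) (simp only: mult_ac)
   qed
   finally show ?thesis .
  qed
  define IF where "IF = (LINT x|lborel. cmod (F x))"
  have IF: "0 <= IF" unfolding IF_def by simp
  define KN where "KN = fact (2 * N) / (2 * a) ^ (2 * N)"
  have KN: "0 <= KN" unfolding KN_def using a by simp
  define C3 where "C3 = IF * C2 + \<bar>C\<bar> * C2 * KN"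
  have C3: "0 <= C3" unfolding C3_def using IF C2 KN by simp
  have small: "cmod (W s) <= C3 * exp (- 2 * a * sqrt (norm s))" for s
  proof -
   have "cmod (W s) <= IF * (C2 * exp (- (4 * a) * sqrt (norm s)))"
    unfolding W_def norm_mult using fourier_bound[OF F, of s] IF by (intro mult_mono b\<rho>) (auto simp: IF_def)
   also have "... <= IF * (C2 * exp (- 2 * a * sqrt (norm s)))"
    using a IF C2 by (intro mult_left_mono) auto
   also have "... <= C3 * exp (- 2 * a * sqrt (norm s))"
    unfolding C3_def mult.assoc[symmetric] using C2 KN by (intro mult_right_mono) auto
   finally show ?thesis .
  qed
  have "(LINT s|lborel. W s * cis (2 * pi * (s \<bullet> z))) = 0"
  proof (rule inverse_fourier_quasi_analytic[OF _ nn dec div a C3])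
   show "W \<in> borel_measurable borel" unfolding W_def by measurable
   show "AE s in lborel. cmod (W s) <= C3 * exp (- 2 * a * sqrt (norm s))" using small by simp
   show "AE s in lborel. 1 <= norm s \<longrightarrow> cmod (W s) <= C3 * exp (- norm s * \<theta> (norm s)) * exp (- 2 * a * sqrt (norm s))"
    using decay
   proof eventually_elim
    case (elim s)
    show ?case
    proof
     assume s: "1 <= norm s"
     define E where "E = exp (- norm s * \<theta> (norm s))"
     define e where "e = exp (- 2 * a * sqrt (norm s))"
     have ee: "exp (- (4 * a) * sqrt (norm s)) = e * e" by (simp add: e_def exp_add[symmetric])
     have "norm s ^ N * e = sqrt (norm s) ^ (2 * N) * exp (- (2 * a) * sqrt (norm s))"
      by (subst power_mult) (simp add: e_def)
     also have "... <= KN" unfolding KN_def using a by (intro power_exp_bound) auto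
     finally have p: "norm s ^ N * e <= KN" .
     have "cmod (fourier F s) <= \<bar>C\<bar> * norm s ^ N * E"
      using elim s unfolding E_def by (rule_tac order_trans[of _ "C * norm s ^ N * exp (- norm s * \<theta> (norm s))"]) (auto intro!: mult_right_mono)
     then have "cmod (W s) <= (\<bar>C\<bar> * norm s ^ N * E) * (C2 * (e * e))"
      unfolding W_def norm_mult ee[symmetric] by (intro mult_mono b\<rho>) (auto simp: E_def)
     also have "... = \<bar>C\<bar> * C2 * (norm s ^ N * e) * (E * e)" by (simp add: mult_ac)
     also have "... <= \<bar>C\<bar> * C2 * KN * (E * e)"
      using C2 by (intro mult_right_mono mult_left_mono p) (auto simp: E_def e_def)
     also have "... <= C3 * (E * e)"
      unfolding C3_def using IF C2 by (intro mult_right_mono) (auto simp: E_def e_def)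
     finally show "cmod (W s) <= C3 * exp (- norm s * \<theta> (norm s)) * exp (- 2 * a * sqrt (norm s))"
      by (simp add: E_def e_def mult.assoc)
    qed
   qed
   show "0 < \<epsilon> / 2" using \<epsilon> by simp
   fix x :: 'a assume x: "norm x < \<epsilon> / 2"
   have "AE y in lborel. F y * \<rho> (x - y) = 0"
    using vanish
   proof eventually_elim
    case (elim y)
    show ?case
    proof (cases "norm y < \<epsilon>")
     case False
     have "norm y <= norm x + norm (x - y)" by (rule norm_triangle_sub[of y x, unfolded norm_minus_commute[of y x]])
     then have "q * R < norm (x - y)" using False x rR[of n] by (simp add: q_def)
     then have "R < norm (x - y) / q" using q by (simp add: pos_less_divide_eq mult.commute)
     then have "R < norm ((1 / q) *\<^sub>R (x - y))" unfolding norm_scaleR using q by simp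
     then show ?thesis using \<psi>(1) by (simp add: \<rho>_def lip_supp_def)
    qed (use elim in simp)
   qed
   then show "(LINT s|lborel. W s * cis (2 * pi * (s \<bullet> x))) = 0"
    unfolding conv[symmetric] by (intro integral_eq_zero_AE)
  qed
  then show "(LINT y|lborel. F y * \<psi> ((1 / r n) *\<^sub>R (z - y))) = 0"
   unfolding conv[symmetric] by (simp add: \<rho>_def q_def)
 qed
qed




section \<open>Zariski open sets and generic ranks\<close>

lemma polynomial_zero_set_null:
 fixes p :: "'a::euclidean_space => real"
 assumes p: "real_polynomial_function p" and x0: "p x0 ~= 0"
 shows "AE x in lborel. p x ~= 0"
proof -
 have cont: "continuous_on UNIV p"
  using p by (simp add: real_polynomial_function_eq continuous_on_polymonial_function)
 have [measurable]: "p \<in> borel_measurable borel" using cont by (rule borel_measurable_continuous_onI)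
 define N where "N = {x. p x = 0}"
 have N[measurable]: "N \<in> sets borel" unfolding N_def by measurable
 have scale: "emeasure lborel N = ennreal (\<bar>s\<bar> ^ DIM('a)) * (\<integral>\<^sup>+y. indicator N (x0 + s *\<^sub>R y) \<partial>lborel)" if "s ~= 0" for s
 proof -
  have "emeasure lborel N = (\<integral>\<^sup>+x. indicator N x \<partial>density (distr lborel borel (%x. x0 + s *\<^sub>R x)) (%_. ennreal (\<bar>s\<bar> ^ DIM('a))))"
   by (subst lborel_affine[OF that, of x0, symmetric]) simp
  also have "... = (\<integral>\<^sup>+x. ennreal (\<bar>s\<bar> ^ DIM('a)) * indicator N x \<partial>distr lborel borel (%x. x0 + s *\<^sub>R x))"
   by (subst nn_integral_density) auto
  also have "... = (\<integral>\<^sup>+y. ennreal (\<bar>s\<bar> ^ DIM('a)) * indicator N (x0 + s *\<^sub>R y) \<partial>lborel)"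
   by (subst nn_integral_distr) auto
  also have "... = ennreal (\<bar>s\<bar> ^ DIM('a)) * (\<integral>\<^sup>+y. indicator N (x0 + s *\<^sub>R y) \<partial>lborel)"
   by (rule nn_integral_cmult) measurable
  finally show ?thesis .
 qed
 have fin: "finite {s. p (x0 + s *\<^sub>R y) = 0}" for y
 proof -
  have "polynomial_function (%s::real. x0 + s *\<^sub>R y)"
   by (intro polynomial_function_add polynomial_function_const polynomial_function_mult polynomial_function_id)
  from real_polynomial_function_compose[OF this p]
  have "real_polynomial_function (%s. p (x0 + s *\<^sub>R y))" by (simp only: comp_def)
  from real_polynomial_function_imp_sum[OF this]
  obtain a n where a: "(%s. p (x0 + s *\<^sub>R y)) = (%s. \<Sum>i\<le>n. a i * s ^ i)" by (elim exE) (rule that)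
  have "(\<Sum>i\<le>n. a i * 0 ^ i) ~= 0" using x0 fun_cong[OF a, of 0] by simp
  then have "\<exists>k\<le>n. a k ~= 0" by (force intro: sum.neutral)
  then show ?thesis using polyfun_rootbound[of n a] fun_cong[OF a] by simp
 qed
 have "(\<integral>\<^sup>+s. \<integral>\<^sup>+y. indicator {1..2::real} s * indicator N (x0 + s *\<^sub>R y) \<partial>lborel \<partial>lborel)
   = (\<integral>\<^sup>+y. \<integral>\<^sup>+s. indicator {1..2::real} s * indicator N (x0 + s *\<^sub>R y) \<partial>lborel \<partial>lborel)"
  by (rule lborel_pair.Fubini'[symmetric]) measurable
 also have "... = (\<integral>\<^sup>+y. 0 \<partial>(lborel :: 'a measure))"
 proof (rule nn_integral_cong)
  fix y
  have "(\<integral>\<^sup>+s. indicator {1..2::real} s * indicator N (x0 + s *\<^sub>R y) \<partial>lborel)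
    <= (\<integral>\<^sup>+s. indicator {s. p (x0 + s *\<^sub>R y) = 0} s \<partial>lborel)"
   by (intro nn_integral_mono) (auto simp: indicator_def N_def)
  also have "... = 0" using fin[of y] by (simp add: finite_imp_null_set_lborel null_setsD1 finite_imp_closed borel_closed)
  finally show "(\<integral>\<^sup>+s. indicator {1..2::real} s * indicator N (x0 + s *\<^sub>R y) \<partial>lborel) = 0" by simp
 qed
 finally have "(\<integral>\<^sup>+s. \<integral>\<^sup>+y. indicator {1..2::real} s * indicator N (x0 + s *\<^sub>R y) \<partial>lborel \<partial>lborel) = 0" by simp
 then have "AE s in lborel. (\<integral>\<^sup>+y. indicator {1..2::real} s * indicator N (x0 + s *\<^sub>R y) \<partial>lborel) = 0"
  by (subst (asm) nn_integral_0_iff_AE) auto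
 then have ae: "AE s in lborel. s \<in> {1..2::real} \<longrightarrow> (\<integral>\<^sup>+y. indicator N (x0 + s *\<^sub>R y) \<partial>lborel) = 0"
  by eventually_elim auto
 have "\<exists>s\<in>{1..2::real}. (\<integral>\<^sup>+y. indicator N (x0 + s *\<^sub>R y) \<partial>lborel) = 0"
 proof (rule ccontr)
  assume n: "\<not> ?thesis"
  from ae have "AE s in lborel. s \<notin> {1..2::real}" by eventually_elim (use n in auto)
  then have "{1..2::real} \<in> null_sets lborel" by (subst (asm) AE_iff_null_sets[symmetric]) auto
  then show False by (simp add: null_sets_def)
 qed
 then obtain s where s: "s \<in> {1..2::real}" "(\<integral>\<^sup>+y. indicator N (x0 + s *\<^sub>R y) \<partial>lborel) = 0" by blast
 have "emeasure lborel N = 0" using scale[of s] s by simp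
 then have "N \<in> null_sets lborel" by (simp add: null_sets_def)
 then have "AE x in lborel. x \<notin> N" by (rule AE_not_in)
 then show ?thesis by (simp add: N_def)
qed

lemma zariski_open_conull:
 assumes "zariski_open W" "W ~= {}"
 shows "AE x in lborel. (x :: 'a::euclidean_space) \<in> W"
proof -
 obtain F where F: "\<And>p. p \<in> F ==> real_polynomial_function p" "W = {x. \<exists>p\<in>F. p x ~= 0}"
  using assms by (auto simp: zariski_open_def)
 then obtain p x0 where p: "p \<in> F" "p x0 ~= 0" using assms(2) by auto
 have "AE x in lborel. p x ~= 0" by (rule polynomial_zero_set_null[OF F(1)[OF p(1)] p(2)])
 then show ?thesis by eventually_elim (use p F in auto)
qed

lemma AE_lborel_ex: "AE x in lborel. P (x :: 'a::euclidean_space) ==> \<exists>x. P x"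
proof (rule ccontr)
 assume "AE x in lborel. P (x :: 'a)" "\<nexists>x. P x"
 then have "AE x in (lborel :: 'a measure). x \<notin> UNIV" by simp
 then have "(UNIV :: 'a set) \<in> null_sets lborel" by (subst (asm) AE_iff_null_sets[symmetric]) auto
 then show False by (simp add: null_sets_def)
qed

lemma det_nonzero_row_combination:
 fixes M :: "real ^ 'm ^ 'm::finite"
 assumes "det M ~= 0" "\<And>b. (\<Sum>a\<in>UNIV. c a * M $ a $ b) = 0"
 shows "c a = 0"
proof -
 have "transpose M *v (\<chi> a. c a) = 0"
  using assms(2) by (simp add: vec_eq_iff matrix_vector_mult_def transpose_def mult.commute)
 moreover have "invertible (transpose M)" using assms(1) by (simp add: invertible_det_nz)
 ultimately have "(\<chi> a. c a) = 0" using invertible_eq_bij[of "transpose M"]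
  by (metis bij_is_inj injD matrix_vector_mult_0_right)
 then show ?thesis by (simp add: vec_eq_iff)
qed

lemma det_polynomial:
 assumes "\<And>i j. real_polynomial_function (%x. M x $ i $ j)"
 shows "real_polynomial_function (%x. det (M x :: real ^ 'm ^ 'm::finite))"
 unfolding det_def
 by (intro real_polynomial_function_sum real_polynomial_function_prod real_polynomial_function.intros(4)
    real_polynomial_function.intros(2) assms) auto

text \<open>Along the segment from \<open>A\<close> to the identity the quadratic form is positive, so the determinant cannot change sign.\<close>

lemma det_skew_nonneg:
 fixes A :: "real ^ 'n::finite ^ 'n"
 assumes skew: "transpose A = - A"
 shows "0 <= det A"
proof (rule ccontr)
 assume neg: "\<not> 0 <= det A"
 define M where "M = (%t::real. (\<chi> i j. (1 - t) * A $ i $ j + t * (if i = j then 1 else 0)) :: real ^ 'n ^ 'n)"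
 have "continuous_on {0..1} (%t. det (M t))"
  unfolding det_def M_def by (simp, intro continuous_intros)
 moreover have "M 0 = A" "M 1 = mat 1" by (auto simp: M_def vec_eq_iff mat_def)
 then have "det (M 0) < 0" "0 < det (M 1)" using neg by auto
 ultimately obtain t where t: "0 <= t" "t <= 1" "det (M t) = 0"
  using IVT'[of "%t. det (M t)" 0 0 1] by force
 have t0: "t ~= 0" using t(3) \<open>det (M 0) < 0\<close> by auto
 have "\<not> invertible (M t)" using t(3) by (simp add: invertible_det_nz)
 then have "\<not> (\<forall>x. M t *v x = 0 \<longrightarrow> x = 0)"
  unfolding matrix_left_invertible_ker[symmetric] invertible_left_inverse .
 then obtain x where x: "M t *v x = 0" "x ~= 0" by blast
 have q0: "x \<bullet> (A *v x) = 0"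
 proof -
  have sk: "A $ j $ i = - A $ i $ j" for i j
  proof -
   have "transpose A $ i $ j = (- A) $ i $ j" by (simp only: skew)
   then show ?thesis by (simp only: transpose_def vec_lambda_beta vector_uminus_component)
  qed
  have S: "x \<bullet> (A *v x) = (\<Sum>i\<in>UNIV. \<Sum>j\<in>UNIV. x $ i * A $ i $ j * x $ j)"
   by (simp add: inner_vec_def matrix_vector_mult_def sum_distrib_left mult.assoc)
  also have "... = (\<Sum>j\<in>UNIV. \<Sum>i\<in>UNIV. x $ i * A $ i $ j * x $ j)" by (rule sum.swap)
  also have "... = (\<Sum>j\<in>UNIV. \<Sum>i\<in>UNIV. - (x $ j * A $ j $ i * x $ i))"
  proof (intro sum.cong refl)
   fix i j show "x $ i * A $ i $ j * x $ j = - (x $ j * A $ j $ i * x $ i)" using sk[of i j] by simp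
  qed
  also have "... = - (x \<bullet> (A *v x))" unfolding S by (simp add: sum_negf)
  finally have "x \<bullet> (A *v x) = - (x \<bullet> (A *v x))" .
  then show ?thesis by linarith
 qed
 have "M t *v x = (1 - t) *\<^sub>R (A *v x) + t *\<^sub>R x"
  by (simp add: M_def vec_eq_iff matrix_vector_mult_def distrib_right sum.distrib sum_distrib_left mult.assoc if_distrib[of "%u. u * _"] cong: if_cong)
   (simp add: sum_distrib_left[symmetric])
 then have "x \<bullet> (M t *v x) = (1 - t) * (x \<bullet> (A *v x)) + t * (x \<bullet> x)" by (simp add: inner_add_right)
 then have "t * (x \<bullet> x) = 0" using x q0 by simp
 then show False using t0 x(2) by simp
qed

section \<open>The structure of a two step group\<close>

context two_step_group
begin

lemma br_bilinear: "bilinear br"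
 using bracket by (simp add: lie_bracket_def)

lemma br_skew: "br x y = - br y x"
proof -
 have "br (x + y) (x + y) = 0" "br x x = 0" "br y y = 0" using bracket by (auto simp: lie_bracket_def)
 then have "br x y + br y x = 0"
  using br_bilinear by (simp add: bilinear_ladd bilinear_radd)
 then show ?thesis by (rule eq_neg_iff_add_eq_0[THEN iffD2])
qed

lemma zcoord_linear: "linear zcoord"
 by (rule linearI) (auto simp: zcoord_def vec_eq_iff inner_add_left)

lemma bform_add_left: "bform \<nu> (x + y) z = bform \<nu> x z + bform \<nu> y z"
 and bform_add_right: "bform \<nu> z (x + y) = bform \<nu> z x + bform \<nu> z y"
 and bform_scale_left: "bform \<nu> (c *\<^sub>R x) z = c * bform \<nu> x z"
 and bform_scale_right: "bform \<nu> z (c *\<^sub>R x) = c * bform \<nu> z x"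
 unfolding bform_def
 by (simp_all add: bilinear_ladd[OF br_bilinear] bilinear_radd[OF br_bilinear] bilinear_lmul[OF br_bilinear]
   bilinear_rmul[OF br_bilinear] linear_add[OF zcoord_linear] linear_cmul[OF zcoord_linear] inner_add_right)

lemma bform_linear_left: "linear (%x. bform \<nu> x y)" and bform_linear_right: "linear (bform \<nu> x)"
 by (auto intro!: linearI simp: bform_add_left bform_add_right bform_scale_left bform_scale_right)

lemma bform_skew: "bform \<nu> x y = - bform \<nu> y x"
 unfolding bform_def by (subst br_skew) (simp add: linear_neg[OF zcoord_linear])

lemma bform_bounded: "\<exists>B>0. \<forall>\<nu> x y. \<bar>bform \<nu> x y\<bar> <= B * norm \<nu> * norm x * norm y"
proof -
 obtain B1 where B1: "B1 > 0" "\<And>x y. norm (br x y) <= B1 * norm x * norm y"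
  using bilinear_bounded_pos[OF br_bilinear] by blast
 obtain B2 where B2: "B2 > 0" "\<And>x. norm (zcoord x) <= B2 * norm x"
  using linear_bounded_pos[OF zcoord_linear] by blast
 have "\<bar>bform \<nu> x y\<bar> <= (B2 * B1) * norm \<nu> * norm x * norm y" for \<nu> x y
 proof -
  have "\<bar>bform \<nu> x y\<bar> <= norm \<nu> * norm (zcoord (br x y))" unfolding bform_def by (rule Cauchy_Schwarz_ineq2)
  also have "... <= norm \<nu> * (B2 * (B1 * norm x * norm y))"
   using B2 order_trans[OF B2(2) mult_left_mono[OF B1(2)]] by (intro mult_left_mono) (auto simp: mult.assoc)
  finally show ?thesis by (simp add: mult_ac)
 qed
 then show ?thesis using B1(1) B2(1) by (intro exI[of _ "B2 * B1"]) auto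
qed

lemma vspace_expansion: "x \<in> vspace ==> (\<Sum>i\<in>UNIV. (x \<bullet> V i) *\<^sub>R V i) = x"
 unfolding vspace_def using orthonormal_expansion[OF V_orthonormal finite] by simp

lemma vspace_subspace: "subspace vspace" by (simp add: vspace_def)

lemma V_vspace: "V i \<in> vspace" by (simp add: vspace_def span_base)

lemma radical_subspace: "subspace (radical \<nu>)"
 unfolding radical_def subspace_def
 using vspace_subspace linear_0[OF bform_linear_left[of \<nu>]]
 by (auto simp: subspace_0 subspace_add subspace_scale bform_add_left bform_scale_left)

text \<open>The map with \<open>V\<^sub>i\<close> going to the \<open>i\<close>-th row of \<open>S\<^sub>\<nu>\<close>; its kernel in \<open>\<vv>\<close> is the radical.\<close>

definition rowmap :: "real ^ 'k => 'g => real ^ ('m::{finite,linorder})" where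
 "rowmap \<nu> x = (\<chi> j. bform \<nu> x (V j))"

definition rows :: "real ^ 'k => 'm set => (real ^ ('m::{finite,linorder})) set" where
 "rows \<nu> S = (%a. row a (smat \<nu>)) ` S"

lemma rowmap_linear: "linear (rowmap \<nu>)"
 by (intro linearI) (auto simp: rowmap_def vec_eq_iff bform_add_left bform_scale_left)

lemma rowmap_V: "rowmap \<nu> (V i) = row i (smat \<nu>)"
 by (simp add: rowmap_def smat_def row_def vec_eq_iff)

lemma rowmap_eq_0_iff:
 assumes "x \<in> vspace" shows "rowmap \<nu> x = 0 \<longleftrightarrow> x \<in> radical \<nu>"
proof
 assume r: "rowmap \<nu> x = 0"
 have "bform \<nu> x y = 0" if "y \<in> vspace" for y
 proof -
  have "bform \<nu> x y = bform \<nu> x (\<Sum>i\<in>UNIV. (y \<bullet> V i) *\<^sub>R V i)" using vspace_expansion[OF that] by simp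
  also have "... = (\<Sum>i\<in>UNIV. (y \<bullet> V i) * bform \<nu> x (V i))"
   using bform_linear_right[of \<nu> x] by (simp add: linear_sum linear_cmul)
  also have "... = 0" using r by (simp add: rowmap_def vec_eq_iff)
  finally show ?thesis .
 qed
 then show "x \<in> radical \<nu>" using assms by (simp add: radical_def)
qed (auto simp: radical_def rowmap_def vec_eq_iff V_vspace)

lemma dim_mspace: "dim (mspace \<nu>) = dim (rows \<nu> UNIV)"
proof -
 have sub: "subspace (mspace \<nu>)"
  unfolding mspace_def subspace_def using vspace_subspace
  by (auto simp: subspace_0 subspace_add subspace_scale inner_add_left)
 have inj: "inj_on (rowmap \<nu>) (mspace \<nu>)"
 proof (subst linear_inj_on_iff_eq_0[OF rowmap_linear sub], intro ballI impI)
  fix x assume x: "x \<in> mspace \<nu>" "rowmap \<nu> x = 0"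
  then have "x \<in> radical \<nu>" by (subst rowmap_eq_0_iff[symmetric]) (auto simp: mspace_def)
  then have "x \<bullet> x = 0" using x(1) by (auto simp: mspace_def)
  then show "x = 0" by simp
 qed
 have img: "rowmap \<nu> ` mspace \<nu> = span (rows \<nu> UNIV)"
 proof (intro equalityI subsetI)
  fix w assume "w \<in> rowmap \<nu> ` mspace \<nu>"
  then obtain x where x: "x \<in> vspace" "w = rowmap \<nu> x" by (auto simp: mspace_def)
  have "w = rowmap \<nu> (\<Sum>i\<in>UNIV. (x \<bullet> V i) *\<^sub>R V i)" using x vspace_expansion by simp
  also have "... = (\<Sum>i\<in>UNIV. (x \<bullet> V i) *\<^sub>R row i (smat \<nu>))"
   using rowmap_linear[of \<nu>] by (simp add: linear_sum linear_cmul rowmap_V)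
  also have "... \<in> span (rows \<nu> UNIV)" by (intro span_sum span_scale span_base) (auto simp: rows_def)
  finally show "w \<in> span (rows \<nu> UNIV)" .
 next
  have "rows \<nu> UNIV \<subseteq> rowmap \<nu> ` mspace \<nu>"
  proof
   fix w assume "w \<in> rows \<nu> UNIV"
   then obtain i where w: "w = rowmap \<nu> (V i)" by (auto simp: rows_def rowmap_V)
   obtain y z where y: "y \<in> span (radical \<nu>)" and z: "\<And>u. u \<in> span (radical \<nu>) ==> orthogonal z u" and yz: "V i = y + z"
    using orthogonal_subspace_decomp_exists[of "radical \<nu>" "V i"] by blast
   have yr: "y \<in> radical \<nu>" using y span_minimal[OF order_refl radical_subspace] by blast
   then have yv: "y \<in> vspace" by (simp add: radical_def)
   have "z = V i - y" using yz by simp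
   then have zv: "z \<in> vspace" using V_vspace yv vspace_subspace by (simp add: subspace_diff)
   then have "z \<in> mspace \<nu>" using z by (auto simp: mspace_def orthogonal_def span_base)
   moreover have "w = rowmap \<nu> z"
    using yr yv rowmap_eq_0_iff[OF yv] rowmap_linear[of \<nu>] by (simp add: w yz linear_add)
   ultimately show "w \<in> rowmap \<nu> ` mspace \<nu>" by blast
  qed
  then have "span (rows \<nu> UNIV) \<subseteq> rowmap \<nu> ` mspace \<nu>"
   by (intro span_minimal linear_subspace_image[OF rowmap_linear sub])
  then show "w \<in> span (rows \<nu> UNIV) ==> w \<in> rowmap \<nu> ` mspace \<nu>" for w by blast
 qed
 have "dim (mspace \<nu>) = dim (rowmap \<nu> ` mspace \<nu>)"
  by (rule dim_image_eq[OF rowmap_linear, symmetric]) (unfold span_eq_iff[THEN iffD2, OF sub], rule inj)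
 then show ?thesis unfolding img by simp
qed

lemma smat_entry_polynomial: "real_polynomial_function (%\<nu>. smat \<nu> $ i $ j)"
 unfolding smat_def bform_def
 by (simp, intro real_polynomial_function.intros(1) bounded_linear_inner_left)

text \<open>Ranks are lower semicontinuous for the Zariski topology.\<close>

lemma rank_semicontinuous:
 "\<exists>p. real_polynomial_function p \<and> p \<nu>0 ~= 0 \<and> (\<forall>\<nu>. p \<nu> ~= 0 \<longrightarrow> dim (rows \<nu>0 S) <= dim (rows \<nu> S))"
proof -
 obtain C where C: "C \<subseteq> rows \<nu>0 S" "independent C" and "rows \<nu>0 S \<subseteq> span C"
  and cardC: "card C = dim (rows \<nu>0 S)"
  by (rule basis_exists)
 from C(1) obtain B where B: "B \<subseteq> S" "inj_on (%a. row a (smat \<nu>0)) B" "C = (%a. row a (smat \<nu>0)) ` B"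
  unfolding rows_def subset_image_inj by blast
 have "\<exists>w. \<forall>a\<in>B. w \<bullet> row a (smat \<nu>0) = (if a = b then 1 else 0)" if b: "b \<in> B" for b
 proof -
  obtain h where h: "linear h" "\<And>x. x \<in> C ==> h x = (if x = row b (smat \<nu>0) then 1 else 0 :: real)"
   using linear_independent_extend[OF C(2), of "%x. if x = row b (smat \<nu>0) then 1 else 0 :: real"] by blast
  define w where "w = (\<Sum>e\<in>Basis. h e *\<^sub>R e)"
  have "w \<bullet> x = h x" for x
  proof -
   have "h x = h (\<Sum>e\<in>Basis. (x \<bullet> e) *\<^sub>R e)" by (simp add: euclidean_representation)
   also have "... = (\<Sum>e\<in>Basis. (x \<bullet> e) * h e)" using h(1) by (simp add: linear_sum linear_cmul)
   also have "... = x \<bullet> w" unfolding w_def inner_sum_right by (simp add: mult.commute)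
   finally show ?thesis by (simp only: inner_commute)
  qed
  then show ?thesis using h(2) B(2,3) b by (intro exI[of _ w]) (auto dest: inj_onD)
 qed
 then obtain w where w: "\<And>a b. a \<in> B ==> b \<in> B ==> w b \<bullet> row a (smat \<nu>0) = (if a = b then 1 else 0)" by metis
 define M where "M = (%\<nu>. (\<chi> a b. if a \<in> B \<and> b \<in> B then w b \<bullet> row a (smat \<nu>) else if a = b then 1 else 0) :: real ^ ('m::{finite,linorder}) ^ ('m::{finite,linorder}))"
 have "real_polynomial_function (%\<nu>. det (M \<nu>))"
 proof (rule det_polynomial)
  fix a b
  have "real_polynomial_function (%\<nu>. w b \<bullet> row a (smat \<nu>))"
   unfolding inner_vec_def row_def using smat_entry_polynomial
   by (auto intro!: real_polynomial_function_sum real_polynomial_function.intros(4) real_polynomial_function.intros(2))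
  then show "real_polynomial_function (%\<nu>. M \<nu> $ a $ b)"
   by (cases "a \<in> B \<and> b \<in> B") (auto simp: M_def intro: real_polynomial_function.intros(2))
 qed
 moreover have "M \<nu>0 = mat 1" by (auto simp: M_def mat_def vec_eq_iff w)
 then have "det (M \<nu>0) ~= 0" by simp
 moreover have "dim (rows \<nu>0 S) <= dim (rows \<nu> S)" if det: "det (M \<nu>) ~= 0" for \<nu>
 proof -
  have comb: "c a = 0" if z: "(\<Sum>a\<in>B. c a *\<^sub>R row a (smat \<nu>)) = 0" and a: "a \<in> B" for c a
  proof -
   define c' where "c' = (%a. if a \<in> B then c a else 0)"
   have "(\<Sum>a\<in>UNIV. c' a * M \<nu> $ a $ b) = 0" for b
   proof (cases "b \<in> B")
    case True
    have "(\<Sum>a\<in>UNIV. c' a * M \<nu> $ a $ b) = (\<Sum>a\<in>B. c a * (w b \<bullet> row a (smat \<nu>)))"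
     using True by (intro sum.mono_neutral_cong_right) (auto simp: c'_def M_def)
    also have "... = w b \<bullet> (\<Sum>a\<in>B. c a *\<^sub>R row a (smat \<nu>))" by (simp add: inner_sum_right)
    finally show ?thesis using z by simp
   next
    case False
    then show ?thesis by (intro sum.neutral) (auto simp: c'_def M_def)
   qed
   from det_nonzero_row_combination[OF det this, of a] show ?thesis using a by (simp add: c'_def)
  qed
  have inj: "inj_on (%a. row a (smat \<nu>)) B"
  proof (rule inj_onI, rule ccontr)
   fix a b assume ab: "a \<in> B" "b \<in> B" "row a (smat \<nu>) = row b (smat \<nu>)" "a ~= b"
   define c where "c = (%x. if x = a then 1 else if x = b then - 1 else 0 :: real)"
   have "(\<Sum>x\<in>B. c x *\<^sub>R row x (smat \<nu>)) = (\<Sum>x\<in>{a, b}. c x *\<^sub>R row x (smat \<nu>))"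
    using ab by (intro sum.mono_neutral_right) (auto simp: c_def)
   also have "... = 0" using ab by (simp add: c_def)
   finally show False using comb[of c a] ab by (simp add: c_def)
  qed
  have "independent ((%a. row a (smat \<nu>)) ` B)"
  proof (rule independent_if_scalars_zero)
   fix f x assume "(\<Sum>x\<in>(%a. row a (smat \<nu>)) ` B. f x *\<^sub>R x) = 0" and x: "x \<in> (%a. row a (smat \<nu>)) ` B"
   then have "(\<Sum>a\<in>B. f (row a (smat \<nu>)) *\<^sub>R row a (smat \<nu>)) = 0" using inj by (simp add: sum.reindex)
   from comb[OF this] x show "f x = 0" by auto
  qed simp
  then have "card B = dim ((%a. row a (smat \<nu>)) ` B)"
   using inj by (simp add: dim_eq_card_independent card_image)
  also have "... <= dim (rows \<nu> S)" unfolding rows_def using B(1) by (intro dim_subset image_mono)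
  finally show ?thesis using cardC B by (simp add: card_image)
 qed
 ultimately show ?thesis by (intro exI[of _ "%\<nu>. det (M \<nu>)"]) auto
qed

lemma generic_ranks:
 "\<exists>W. zariski_open W \<and> W ~= {} \<and> (\<forall>\<nu>\<in>W. \<forall>S \<nu>'. dim (rows \<nu>' S) <= dim (rows \<nu> S))"
proof -
 have "\<exists>\<nu>0. \<forall>\<nu>'. dim (rows \<nu>' S) <= dim (rows \<nu>0 S)" for S
 proof -
  define R where "R = range (%\<nu>. dim (rows \<nu> S))"
  have "R \<subseteq> {..CARD('m)}" unfolding R_def using dim_subset_UNIV[of "rows _ S"] by auto
  then have R: "finite R" by (rule finite_subset) simp
  then have "Max R \<in> R" by (rule Max_in) (simp add: R_def)
  then obtain \<nu>0 where "Max R = dim (rows \<nu>0 S)" by (auto simp: R_def)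
  then show ?thesis using Max_ge[OF R] by (intro exI[of _ \<nu>0]) (auto simp: R_def)
 qed
 then obtain \<nu>0 where \<nu>0: "\<And>S \<nu>'. dim (rows \<nu>' S) <= dim (rows (\<nu>0 S) S)" by metis
 have "\<forall>S. \<exists>p. real_polynomial_function p \<and> p (\<nu>0 S) ~= 0 \<and>
   (\<forall>\<nu>. p \<nu> ~= 0 \<longrightarrow> dim (rows (\<nu>0 S) S) <= dim (rows \<nu> S))"
  by (rule allI) (rule rank_semicontinuous)
 from choice[OF this] obtain p where p: "\<And>S. real_polynomial_function (p S)" "\<And>S. p S (\<nu>0 S) ~= 0"
  "\<And>S \<nu>. p S \<nu> ~= 0 ==> dim (rows (\<nu>0 S) S) <= dim (rows \<nu> S)"
  by blast
 define W where "W = {\<nu>. (\<Prod>S\<in>UNIV. p S \<nu>) ~= 0}"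
 have "zariski_open W"
  unfolding zariski_open_def W_def
  by (intro exI[of _ "{%\<nu>. \<Prod>S\<in>UNIV. p S \<nu>}"]) (auto intro!: real_polynomial_function_prod p)
 moreover have "AE \<nu> in lborel. \<forall>S\<in>UNIV. p S \<nu> ~= 0"
  by (rule AE_finite_allI) (auto intro: polynomial_zero_set_null[OF p(1) p(2)])
 from AE_lborel_ex[OF this] have "W ~= {}" by (auto simp: W_def)
 moreover have "dim (rows \<nu>' S) <= dim (rows \<nu> S)" if "\<nu> \<in> W" for \<nu> S \<nu>'
  using that p(3)[of S \<nu>] \<nu>0[of \<nu>' S] by (auto simp: W_def intro: order_trans)
 ultimately show ?thesis by blast
qed

lemma Pset_generic:
 "\<exists>W. zariski_open W \<and> W ~= {} \<and> W \<subseteq> Uset \<and> (\<forall>\<nu>\<in>W. jump_set \<nu> = Pset)"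
proof -
 obtain W where W: "zariski_open W" "W ~= {}" and max: "\<And>\<nu> S \<nu>'. \<nu> \<in> W ==> dim (rows \<nu>' S) <= dim (rows \<nu> S)"
  using generic_ranks by blast
 have js: "jump_set \<nu> = {i. dim (rows \<nu> {..i}) > dim (rows \<nu> {..<i})}" for \<nu>
  by (simp add: jump_set_def rows_def)
 have same: "jump_set \<nu> = jump_set \<nu>'" if "\<nu> \<in> W" "\<nu>' \<in> W" for \<nu> \<nu>'
 proof -
  have "dim (rows \<nu> S) = dim (rows \<nu>' S)" for S using max that by (intro antisym) auto
  then show ?thesis by (simp add: js)
 qed
 obtain \<nu>1 where \<nu>1: "\<nu>1 \<in> W" using W by auto
 have "Pset = jump_set \<nu>1"
  unfolding Pset_def
 proof (rule the_equality)
  show "\<exists>W. zariski_open W \<and> W ~= {} \<and> (\<forall>\<nu>\<in>W. jump_set \<nu> = jump_set \<nu>1)" using W same \<nu>1 by blast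
  fix P assume "\<exists>W. zariski_open W \<and> W ~= {} \<and> (\<forall>\<nu>\<in>W. jump_set \<nu> = P)"
  then obtain W' where W': "zariski_open W'" "W' ~= {}" "\<forall>\<nu>\<in>W'. jump_set \<nu> = P" by blast
  have "AE \<nu> in lborel. \<nu> \<in> W \<and> \<nu> \<in> W'"
   using zariski_open_conull[OF W] zariski_open_conull[OF W'(1,2)] by eventually_elim simp
  from AE_lborel_ex[OF this] obtain \<nu> where "\<nu> \<in> W" "\<nu> \<in> W'" by blast
  then show "P = jump_set \<nu>1" using W'(3) same \<nu>1 by blast
 qed
 then have P: "jump_set \<nu> = Pset" if "\<nu> \<in> W" for \<nu> using same \<nu>1 that by blast
 moreover have "W \<subseteq> Uset" unfolding Uset_def dim_mspace using P max by auto
 ultimately show ?thesis using W by blast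
qed

lemma Uset_conull: "AE \<nu> in lborel. \<nu> \<in> Uset"
proof -
 obtain W where W: "zariski_open W" "W ~= {}" "W \<subseteq> Uset" using Pset_generic by blast
 show ?thesis using zariski_open_conull[OF W(1,2)] by eventually_elim (use W(3) in blast)
qed

text \<open>The rows with index in \<open>P\<close> are linearly independent: none of them is a combination of rows above it.\<close>

lemma radical_meets_P:
 assumes \<nu>: "\<nu> \<in> Uset" and w: "w \<in> radical \<nu>" and Q: "\<And>q. q \<in> Qset ==> w \<bullet> V q = 0"
 shows "w = 0"
proof (rule ccontr)
 assume "w ~= 0"
 have wv: "w \<in> vspace" using w by (simp add: radical_def)
 define A where "A = {a. w \<bullet> V a ~= 0}"
 have "A ~= {}"
 proof
  assume "A = {}"
  then have "w \<bullet> V i = 0" for i by (auto simp: A_def)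
  then show False using vspace_expansion[OF wv] \<open>w ~= 0\<close> by simp
 qed
 define a where "a = Max A"
 have a: "a \<in> A" "\<And>b. b \<in> A ==> b <= a" unfolding a_def using \<open>A ~= {}\<close> by auto
 have "a \<in> Pset" using Q[of a] a(1) by (auto simp: A_def Qset_def)
 then have jump: "dim (rows \<nu> {..a}) > dim (rows \<nu> {..<a})"
  using \<nu> by (auto simp: Uset_def jump_set_def rows_def)
 have "0 = rowmap \<nu> w" using w wv by (simp add: rowmap_eq_0_iff)
 also have "rowmap \<nu> w = rowmap \<nu> (\<Sum>i\<in>UNIV. (w \<bullet> V i) *\<^sub>R V i)" using vspace_expansion[OF wv] by simp
 also have "... = (\<Sum>i\<in>UNIV. (w \<bullet> V i) *\<^sub>R row i (smat \<nu>))"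
  using rowmap_linear[of \<nu>] by (simp add: linear_sum linear_cmul rowmap_V)
 also have "... = (\<Sum>i\<in>{..a}. (w \<bullet> V i) *\<^sub>R row i (smat \<nu>))"
  using a(2) by (intro sum.mono_neutral_right) (auto simp: A_def)
 also have "... = (w \<bullet> V a) *\<^sub>R row a (smat \<nu>) + (\<Sum>i\<in>{..<a}. (w \<bullet> V i) *\<^sub>R row i (smat \<nu>))"
  by (subst sum.remove[of _ a]) (auto intro!: sum.cong)
 finally have "(w \<bullet> V a) *\<^sub>R row a (smat \<nu>) = - (\<Sum>i\<in>{..<a}. (w \<bullet> V i) *\<^sub>R row i (smat \<nu>))"
  by (simp add: eq_neg_iff_add_eq_0)
 moreover have "(\<Sum>i\<in>{..<a}. (w \<bullet> V i) *\<^sub>R row i (smat \<nu>)) \<in> span (rows \<nu> {..<a})"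
  by (intro span_sum span_scale span_base) (auto simp: rows_def)
 ultimately have "(w \<bullet> V a) *\<^sub>R row a (smat \<nu>) \<in> span (rows \<nu> {..<a})" by (simp add: span_neg)
 then have "(1 / (w \<bullet> V a)) *\<^sub>R ((w \<bullet> V a) *\<^sub>R row a (smat \<nu>)) \<in> span (rows \<nu> {..<a})" by (rule span_scale)
 then have "row a (smat \<nu>) \<in> span (rows \<nu> {..<a})" using a(1) by (simp add: A_def)
 moreover have "rows \<nu> {..a} = insert (row a (smat \<nu>)) (rows \<nu> {..<a})" by (auto simp: rows_def le_less)
 ultimately have "dim (rows \<nu> {..a}) = dim (rows \<nu> {..<a})" by (simp add: dim_insert)
 then show False using jump by simp
qed

lemma MW_Qset_empty:
 assumes MW_group shows "Qset = {}"
proof -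
 obtain \<nu>0 where \<nu>0': "\<forall>x\<in>vspace. (\<forall>y\<in>vspace. bform \<nu>0 x y = 0) \<longrightarrow> x = 0"
  using assms unfolding MW_group_def by blast
 then have \<nu>0: "\<And>x. x \<in> vspace ==> (\<And>y. y \<in> vspace ==> bform \<nu>0 x y = 0) ==> x = 0" by blast
 have "det (smat \<nu>0) ~= 0"
 proof
  assume "det (smat \<nu>0) = 0"
  then have "\<not> invertible (transpose (smat \<nu>0))" by (simp add: invertible_det_nz)
  then have "\<not> (\<forall>c. transpose (smat \<nu>0) *v c = 0 \<longrightarrow> c = 0)"
   unfolding matrix_left_invertible_ker[symmetric] invertible_left_inverse .
  then obtain c where c: "transpose (smat \<nu>0) *v c = 0" "c ~= 0" by blast
  define x where "x = (\<Sum>i\<in>UNIV. c $ i *\<^sub>R V i)"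
  have xv: "x \<in> vspace" unfolding x_def vspace_def by (intro span_sum span_scale span_base) auto
  have "rowmap \<nu>0 x = (\<Sum>i\<in>UNIV. c $ i *\<^sub>R row i (smat \<nu>0))"
   unfolding x_def using rowmap_linear[of \<nu>0] by (simp add: linear_sum linear_cmul rowmap_V)
  also have "... = 0"
   using c(1) by (simp add: vec_eq_iff matrix_vector_mult_def transpose_def row_def mult.commute)
  finally have "x \<in> radical \<nu>0" using rowmap_eq_0_iff[OF xv] by simp
  then have "x = 0" using \<nu>0[OF xv] by (simp add: radical_def)
  moreover have "x \<bullet> V i = c $ i" for i
   unfolding x_def by (rule orthonormal_sum_inner[OF V_orthonormal finite]) simp
  ultimately show False using c(2) by (simp add: vec_eq_iff)
 qed
 moreover have "real_polynomial_function (%\<nu>. det (smat \<nu>))" by (rule det_polynomial[OF smat_entry_polynomial])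
 ultimately have ae: "AE \<nu> in lborel. det (smat \<nu>) ~= 0" by (intro polynomial_zero_set_null[of _ \<nu>0])
 have "AE \<nu> in lborel. det (smat \<nu>) ~= 0 \<and> \<nu> \<in> Uset" using ae Uset_conull by eventually_elim simp
 from AE_lborel_ex[OF this] obtain \<nu> where \<nu>: "det (smat \<nu>) ~= 0" "\<nu> \<in> Uset" by blast
 have "i \<in> jump_set \<nu>" for i
 proof -
  have "row i (smat \<nu>) \<notin> span (rows \<nu> {..<i})"
  proof
   assume "row i (smat \<nu>) \<in> span (rows \<nu> {..<i})"
   also have "... \<subseteq> span {row j (smat \<nu>) | j. j ~= i}" by (rule span_mono) (auto simp: rows_def)
   finally have "- row i (smat \<nu>) \<in> span {row j (smat \<nu>) | j. j ~= i}" by (rule span_neg)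
   then have "- row i (smat \<nu>) \<in> vec.span {row j (smat \<nu>) | j. j ~= i}" by (simp add: span_vec_eq)
   from det_row_span[OF this] have "det (\<chi> k. if k = i then row i (smat \<nu>) + - row i (smat \<nu>) else row k (smat \<nu>)) = det (smat \<nu>)" .
   moreover have "det (\<chi> k. if k = i then row i (smat \<nu>) + - row i (smat \<nu>) else row k (smat \<nu>)) = 0"
    by (rule det_zero_row(2)[of i]) (simp add: row_def vec_eq_iff)
   ultimately show False using \<nu>(1) by simp
  qed
  moreover have "rows \<nu> {..i} = insert (row i (smat \<nu>)) (rows \<nu> {..<i})" by (auto simp: rows_def le_less)
  ultimately show ?thesis by (simp add: jump_set_def rows_def[symmetric] dim_insert)
 qed
 then show ?thesis using \<nu>(2) by (auto simp: Uset_def Qset_def)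
qed

end




section \<open>Hilbert--Schmidt norms of twisted convolution operators\<close>

abbreviation euc :: "nat => (nat => real) measure" where
 "euc n \<equiv> Pi\<^sub>M {..<n} (%_. lborel)"

abbreviation euc3 :: "nat => nat => (((nat => real) \<times> (nat => real)) \<times> (nat => real)) measure" where
 "euc3 n r \<equiv> (euc n \<Otimes>\<^sub>M euc r) \<Otimes>\<^sub>M euc n"

lemma euc_sigma_finite: "sigma_finite_measure (euc n)"
proof -
 interpret finite_product_sigma_finite "%_::nat. lborel :: real measure" "{..<n}" by standard simp
 show ?thesis by unfold_locales
qed

lemma euc_restrict_measurable:
 assumes "\<And>j. j < n ==> (%x. f x j) \<in> borel_measurable M"
 shows "(%x. \<lambda>j\<in>{..<n}. f x j) \<in> M \<rightarrow>\<^sub>M euc n"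
 using assms by (intro measurable_restrict) auto

lemma euc_component: "j < n ==> (%x. x j) \<in> borel_measurable (euc n)"
 using measurable_component_singleton[of j "{..<n}" "%_. lborel :: real measure"] by simp

lemma euc_affine_measurable:
 assumes f: "f \<in> M \<rightarrow>\<^sub>M euc n" and g: "g \<in> M \<rightarrow>\<^sub>M euc n"
 shows "(%x. \<lambda>j\<in>{..<n}. a j * f x j + b j * g x j) \<in> M \<rightarrow>\<^sub>M euc n"
proof (rule euc_restrict_measurable)
 fix j assume j: "j < n"
 have [measurable]: "(%x. f x j) \<in> borel_measurable M" "(%x. g x j) \<in> borel_measurable M"
  using measurable_compose[OF f euc_component[OF j]] measurable_compose[OF g euc_component[OF j]] by auto
 show "(%x. a j * f x j + b j * g x j) \<in> borel_measurable M" by measurable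
qed

lemma euc_dot_measurable:
 assumes f: "f \<in> M \<rightarrow>\<^sub>M euc n" and g: "g \<in> M \<rightarrow>\<^sub>M euc n"
 shows "(%x. \<Sum>j<n. f x j * g x j) \<in> borel_measurable M"
proof (rule borel_measurable_sum)
 fix j assume j: "j \<in> {..<n}"
 have [measurable]: "(%x. f x j) \<in> borel_measurable M" "(%x. g x j) \<in> borel_measurable M"
  using j measurable_compose[OF f euc_component] measurable_compose[OF g euc_component] by auto
 show "(%x. f x j * g x j) \<in> borel_measurable M" by measurable
qed

lemma euc_reflect:
 "distr (euc n) (euc n) (%y. \<lambda>j\<in>{..<n}. a j - y j) = euc n"
proof (rule measure_eqI)
 have m[measurable]: "(%y. \<lambda>j\<in>{..<n}. a j - y j) \<in> euc n \<rightarrow>\<^sub>M euc n"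
  by (rule euc_restrict_measurable) (use euc_component in measurable)
 fix S assume "S \<in> sets (distr (euc n) (euc n) (%y. \<lambda>j\<in>{..<n}. a j - y j))"
 then have S[measurable]: "S \<in> sets (euc n)" by simp
 have "emeasure (euc n) S = (\<integral>\<^sup>+x. indicator S x \<partial>euc n)" by simp
 also have "... = (\<integral>\<^sup>+x. indicator S (\<lambda>i\<in>{..<n}. a i + (- 1) * x i) \<partial>euc n)"
  by (subst PiM_lborel_affine[where c="%_. - 1" and a=a]) auto
 also have "... = (\<integral>\<^sup>+x. indicator S x \<partial>distr (euc n) (euc n) (%y. \<lambda>j\<in>{..<n}. a j - y j))"
  by (subst nn_integral_distr) (auto simp: m)
 finally show "emeasure (distr (euc n) (euc n) (%y. \<lambda>j\<in>{..<n}. a j - y j)) S = emeasure (euc n) S"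
  by simp
qed simp

lemma gaussian_space_euc2:
 "gaussian_space (euc n \<Otimes>\<^sub>M euc r) (%(a, b) (c, d). (\<Sum>j<n. a j * c j) + (\<Sum>j<r. b j * d j))
  (%(a, b) (c, d). (\<Sum>j<n. (a j - c j)\<^sup>2) + (\<Sum>j<r. (b j - d j)\<^sup>2))
  (%(a, b). (\<Sum>j<n. (a j)\<^sup>2) + (\<Sum>j<r. (b j)\<^sup>2)) (n + r)"
 using gaussian_space_prod[OF gaussian_space_PiM[of "{..<n}"] gaussian_space_PiM[of "{..<r}"]] by simp

definition partial_ft ::
  "nat => nat => (((nat => real) \<times> (nat => real)) \<times> (nat => real) => complex) =>
  (nat => real) => (nat => real) => (nat => real) => complex" where
 "partial_ft n r w s m y =
  (LINT (x, u)|(euc n \<Otimes>\<^sub>M euc r). w ((x, u), y) * cis (- (2 * pi * ((\<Sum>j<n. s j * x j) + (\<Sum>j<r. m j * u j)))))"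

lemma partial_ft_eq:
 "partial_ft n r w s m y = gaussian_space.ft (euc n \<Otimes>\<^sub>M euc r)
  (%(a, b) (c, d). (\<Sum>j<n. a j * c j) + (\<Sum>j<r. b j * d j)) (%xu. w (xu, y)) (s, m)"
 unfolding partial_ft_def gaussian_space.ft_def[OF gaussian_space_euc2] by (simp add: case_prod_unfold)

lemma partial_ft_measurable:
 assumes w[measurable]: "w \<in> borel_measurable (euc3 n r)"
 shows "(%((s, m), y). partial_ft n r w s m y) \<in> borel_measurable (euc3 n r)"
proof -
 interpret E: sigma_finite_measure "euc n \<Otimes>\<^sub>M euc r"
  using gaussian_space_euc2[of n r] by (simp add: gaussian_space_def)
 let ?A = "euc3 n r" and ?B = "euc n \<Otimes>\<^sub>M euc r"
 have [measurable]: "(%p. \<Sum>j<n. fst (fst (fst p)) j * fst (snd p) j) \<in> borel_measurable (?A \<Otimes>\<^sub>M ?B)"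
  "(%p. \<Sum>j<r. snd (fst (fst p)) j * snd (snd p) j) \<in> borel_measurable (?A \<Otimes>\<^sub>M ?B)"
  by (rule euc_dot_measurable; measurable)+
 have "(%p. \<integral>q. w (q, snd p) * cis (- (2 * pi * ((\<Sum>j<n. fst (fst p) j * fst q j)
     + (\<Sum>j<r. snd (fst p) j * snd q j)))) \<partial>?B) \<in> borel_measurable ?A"
  by (rule E.borel_measurable_lebesgue_integral) (unfold case_prod_beta, measurable)
 then show ?thesis unfolding partial_ft_def by (simp add: case_prod_unfold)
qed

lemma partial_ft_measurable':
 assumes w: "w \<in> borel_measurable (euc3 n r)"
  and "f \<in> M \<rightarrow>\<^sub>M euc n" "g \<in> M \<rightarrow>\<^sub>M euc r" "h \<in> M \<rightarrow>\<^sub>M euc n"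
 shows "(%x. partial_ft n r w (f x) (g x) (h x)) \<in> borel_measurable M"
proof -
 have "(%x. ((f x, g x), h x)) \<in> M \<rightarrow>\<^sub>M (euc3 n r)" using assms by measurable
 from measurable_compose[OF this partial_ft_measurable[OF w]] show ?thesis by simp
qed

lemma partial_ft_fubini:
 assumes w: "w \<in> borel_measurable (euc3 n r)"
 shows "(\<integral>\<^sup>+m. \<integral>\<^sup>+y. \<integral>\<^sup>+s. sqnorm (partial_ft n r w s m y) \<partial>euc n \<partial>euc n \<partial>euc r)
   = (\<integral>\<^sup>+y. \<integral>\<^sup>+p. sqnorm (partial_ft n r w (fst p) (snd p) y) \<partial>(euc n \<Otimes>\<^sub>M euc r) \<partial>euc n)"
proof -
 interpret N: sigma_finite_measure "euc n" by (rule euc_sigma_finite)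
 interpret R: sigma_finite_measure "euc r" by (rule euc_sigma_finite)
 interpret NR: pair_sigma_finite "euc n" "euc r" ..
 interpret RN: pair_sigma_finite "euc r" "euc n" ..
 note pm[measurable (raw)] = partial_ft_measurable'[OF w]
 have "(\<integral>\<^sup>+m. \<integral>\<^sup>+y. \<integral>\<^sup>+s. sqnorm (partial_ft n r w s m y) \<partial>euc n \<partial>euc n \<partial>euc r)
   = (\<integral>\<^sup>+y. \<integral>\<^sup>+m. \<integral>\<^sup>+s. sqnorm (partial_ft n r w s m y) \<partial>euc n \<partial>euc r \<partial>euc n)"
  by (rule NR.Fubini') measurable
 also have "... = (\<integral>\<^sup>+y. \<integral>\<^sup>+p. sqnorm (partial_ft n r w (fst p) (snd p) y) \<partial>(euc n \<Otimes>\<^sub>M euc r) \<partial>euc n)"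
 proof (rule nn_integral_cong)
  fix y assume y: "y \<in> space (euc n)"
  then have [measurable]: "(%_. y) \<in> (euc n \<Otimes>\<^sub>M euc r) \<rightarrow>\<^sub>M euc n" by simp
  have "(%p. sqnorm (partial_ft n r w (fst p) (snd p) y)) \<in> borel_measurable (euc n \<Otimes>\<^sub>M euc r)"
   by measurable
  from NR.nn_integral_snd[OF this]
  show "(\<integral>\<^sup>+m. \<integral>\<^sup>+s. sqnorm (partial_ft n r w s m y) \<partial>euc n \<partial>euc r)
    = (\<integral>\<^sup>+p. sqnorm (partial_ft n r w (fst p) (snd p) y) \<partial>(euc n \<Otimes>\<^sub>M euc r))"
   by simp
 qed
 finally show ?thesis .
qed

text \<open>
 Plancherel's inequality for almost every fixed \<open>y\<close>.
\<close>

lemma partial_ft_L2: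
 assumes w: "integrable (euc3 n r) w"
 shows "(\<integral>\<^sup>+m. \<integral>\<^sup>+y. \<integral>\<^sup>+s. sqnorm (partial_ft n r w s m y) \<partial>euc n \<partial>euc n \<partial>euc r)
   <= (\<integral>\<^sup>+p. sqnorm (w p) \<partial>(euc3 n r))"
proof -
 interpret N: sigma_finite_measure "euc n" by (rule euc_sigma_finite)
 interpret E: gaussian_space "euc n \<Otimes>\<^sub>M euc r" "%(a, b) (c, d). (\<Sum>j<n. a j * c j) + (\<Sum>j<r. b j * d j)"
  "%(a, b) (c, d). (\<Sum>j<n. (a j - c j)\<^sup>2) + (\<Sum>j<r. (b j - d j)\<^sup>2)"
  "%(a, b). (\<Sum>j<n. (a j)\<^sup>2) + (\<Sum>j<r. (b j)\<^sup>2)" "n + r" by (rule gaussian_space_euc2)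
 interpret EN: pair_sigma_finite "euc n \<Otimes>\<^sub>M euc r" "euc n" ..
 have wm[measurable]: "w \<in> borel_measurable (euc3 n r)" using w by simp
 have w': "integrable (euc3 n r) (case_prod (%p y. w (p, y)))" using w by simp
 have "(\<integral>\<^sup>+y. \<integral>\<^sup>+p. sqnorm (partial_ft n r w (fst p) (snd p) y) \<partial>(euc n \<Otimes>\<^sub>M euc r) \<partial>euc n)
   <= (\<integral>\<^sup>+y. \<integral>\<^sup>+p. sqnorm (w (p, y)) \<partial>(euc n \<Otimes>\<^sub>M euc r) \<partial>euc n)"
 proof (rule nn_integral_mono_AE)
  show "AE y in euc n. (\<integral>\<^sup>+p. sqnorm (partial_ft n r w (fst p) (snd p) y) \<partial>(euc n \<Otimes>\<^sub>M euc r))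
    <= (\<integral>\<^sup>+p. sqnorm (w (p, y)) \<partial>(euc n \<Otimes>\<^sub>M euc r))"
   using EN.AE_integrable_snd[OF w'] by eventually_elim (use E.plancherel_le in \<open>simp add: partial_ft_eq\<close>)
 qed
 also have "... = (\<integral>\<^sup>+p. sqnorm (w p) \<partial>(euc3 n r))"
  by (subst EN.nn_integral_snd[symmetric]) auto
 finally show ?thesis by (simp add: partial_ft_fubini[OF wm])
qed

text \<open>
 The operator has the kernel \<open>K \<xi> \<eta> = \<F>w(d (\<xi> + \<eta>) / 2, m, \<xi> - \<eta>)\<close>. In the double integral of
 \<open>|K|\<^sup>2\<close> substitute \<open>\<eta> = \<xi> - y\<close>, and then \<open>s = d (\<xi> - y / 2)\<close> for \<open>\<xi>\<close>; the second step is where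
 the product of the \<open>d j\<close>, which is the Pfaffian, comes from.
\<close>

lemma weyl_hs_norm:
 fixes w :: "((nat => real) \<times> (nat => real)) \<times> (nat => real) => complex"
 assumes d: "\<And>j. j < n ==> 0 < d j"
  and w: "w \<in> borel_measurable (euc3 n r)" and m: "m \<in> space (euc r)"
  and T: "\<And>e. e \<in> L2 (euc n) ==> AE \<xi> in euc n. T e \<xi> =
    (LINT y|(euc n). partial_ft n r w (\<lambda>j\<in>{..<n}. d j * \<xi> j + (- (d j / 2)) * y j) m y * e (\<lambda>j\<in>{..<n}. \<xi> j - y j))"
  and fin: "(\<integral>\<^sup>+y. \<integral>\<^sup>+s. sqnorm (partial_ft n r w s m y) \<partial>euc n \<partial>euc n) < \<infinity>"
 shows "ennreal (\<Prod>j<n. d j) * (hs_norm (euc n) T)\<^sup>2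
   = (\<integral>\<^sup>+y. \<integral>\<^sup>+s. sqnorm (partial_ft n r w s m y) \<partial>euc n \<partial>euc n)"
proof -
 let ?q = "%\<xi> y. \<lambda>j\<in>{..<n}. d j * \<xi> j + (- (d j / 2)) * y j"
 interpret N: sigma_finite_measure "euc n" by (rule euc_sigma_finite)
 interpret NN: pair_sigma_finite "euc n" "euc n" ..
 note pm = partial_ft_measurable'[OF w]
 define K where "K = (%\<xi> \<eta>. partial_ft n r w (\<lambda>j\<in>{..<n}. (d j / 2) * \<xi> j + (d j / 2) * \<eta> j) m (\<lambda>j\<in>{..<n}. 1 * \<xi> j + (- 1) * \<eta> j))"
 have Kcomp: "(%x. K (f x) (g x)) \<in> borel_measurable M" if "f \<in> M \<rightarrow>\<^sub>M euc n" "g \<in> M \<rightarrow>\<^sub>M euc n" for f g and M :: "'z measure"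
  unfolding K_def by (intro pm euc_affine_measurable that) (simp add: m)
 have Km[measurable]: "(%(x, y). K x y) \<in> borel_measurable (euc n \<Otimes>\<^sub>M euc n)"
  unfolding K_def case_prod_beta by (intro pm euc_affine_measurable) (simp_all add: m)
 have refl[measurable]: "(%y. \<lambda>j\<in>{..<n}. a j - y j) \<in> euc n \<rightarrow>\<^sub>M euc n" for a :: "nat => real"
  by (rule euc_restrict_measurable) (use euc_component in measurable)
 have Ks: "K \<xi> (\<lambda>j\<in>{..<n}. \<xi> j - y j) = partial_ft n r w (?q \<xi> y) m y"
  if "y \<in> space (euc n)" for \<xi> y
 proof -
  have "(\<lambda>j\<in>{..<n}. 1 * \<xi> j + (- 1) * (\<lambda>j\<in>{..<n}. \<xi> j - y j) j) = y"
   using that by (auto simp: space_PiM PiE_def extensional_def fun_eq_iff)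
  moreover have "(\<lambda>j\<in>{..<n}. (d j / 2) * \<xi> j + (d j / 2) * (\<lambda>j\<in>{..<n}. \<xi> j - y j) j)
   = (?q \<xi> y)"
   by (auto simp: fun_eq_iff field_simps)
  ultimately show ?thesis unfolding K_def by simp
 qed
 have subst: "(\<integral>\<^sup>+\<xi>. \<integral>\<^sup>+\<eta>. sqnorm (K \<xi> \<eta>) \<partial>euc n \<partial>euc n)
   = (\<integral>\<^sup>+\<xi>. \<integral>\<^sup>+y. sqnorm (partial_ft n r w (?q \<xi> y) m y) \<partial>euc n \<partial>euc n)"
 proof (rule nn_integral_cong)
  fix \<xi> assume x: "\<xi> \<in> space (euc n)"
  have [measurable]: "K \<xi> \<in> borel_measurable (euc n)" using Km x by measurable
  have "(\<integral>\<^sup>+\<eta>. sqnorm (K \<xi> \<eta>) \<partial>euc n)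
    = (\<integral>\<^sup>+\<eta>. sqnorm (K \<xi> \<eta>) \<partial>distr (euc n) (euc n) (%y. \<lambda>j\<in>{..<n}. \<xi> j - y j))"
   by (simp only: euc_reflect)
  also have "... = (\<integral>\<^sup>+y. sqnorm (K \<xi> (\<lambda>j\<in>{..<n}. \<xi> j - y j)) \<partial>euc n)"
   by (rule nn_integral_distr) measurable
  also have "... = (\<integral>\<^sup>+y. sqnorm (partial_ft n r w (?q \<xi> y) m y) \<partial>euc n)"
   by (rule nn_integral_cong) (simp only: Ks)
  finally show "(\<integral>\<^sup>+\<eta>. sqnorm (K \<xi> \<eta>) \<partial>euc n)
   = (\<integral>\<^sup>+y. sqnorm (partial_ft n r w (?q \<xi> y) m y) \<partial>euc n)" .
 qed
 have swap: "(\<integral>\<^sup>+\<xi>. \<integral>\<^sup>+y. sqnorm (partial_ft n r w (?q \<xi> y) m y) \<partial>euc n \<partial>euc n)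
  = (\<integral>\<^sup>+y. \<integral>\<^sup>+\<xi>. sqnorm (partial_ft n r w (?q \<xi> y) m y) \<partial>euc n \<partial>euc n)"
 proof -
  have [measurable]: "(%p. partial_ft n r w (\<lambda>j\<in>{..<n}. d j * snd p j + (- (d j / 2)) * fst p j) m (fst p)) \<in> borel_measurable (euc n \<Otimes>\<^sub>M euc n)"
   by (intro pm euc_affine_measurable) (simp_all add: m)
  have "(%p. sqnorm (partial_ft n r w (\<lambda>j\<in>{..<n}. d j * snd p j + (- (d j / 2)) * fst p j) m (fst p))) \<in> borel_measurable (euc n \<Otimes>\<^sub>M euc n)"
   by measurable
  then show ?thesis by (intro NN.Fubini') (simp add: case_prod_unfold)
 qed
 have scale: "ennreal (\<Prod>j<n. d j) * (\<integral>\<^sup>+\<xi>. sqnorm (partial_ft n r w (?q \<xi> y) m y) \<partial>euc n)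
   = (\<integral>\<^sup>+s. sqnorm (partial_ft n r w s m y) \<partial>euc n)" if y: "y \<in> space (euc n)" for y
 proof -
  have [measurable]: "(%s. partial_ft n r w s m y) \<in> borel_measurable (euc n)"
   by (intro pm) (simp_all add: m y)
  have "(\<Prod>j<n. \<bar>d j\<bar>) = (\<Prod>j<n. d j)" by (intro prod.cong) (auto simp: abs_of_pos d)
  moreover have "(\<integral>\<^sup>+s. sqnorm (partial_ft n r w s m y) \<partial>euc n)
   = ennreal (\<Prod>j<n. \<bar>d j\<bar>) * (\<integral>\<^sup>+x. sqnorm (partial_ft n r w (\<lambda>j\<in>{..<n}. - (d j / 2) * y j + d j * x j) m y) \<partial>euc n)"
   by (rule PiM_lborel_affine) (use d in \<open>auto simp: less_imp_neq[symmetric]\<close>)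
  ultimately show ?thesis by (simp add: add.commute)
 qed
 let ?D = "ennreal (\<Prod>j<n. d j)"
 have Dpos: "0 < (\<Prod>j<n. d j)" by (intro prod_pos) (auto simp: d)
 have main: "?D * (\<integral>\<^sup>+\<xi>. \<integral>\<^sup>+\<eta>. sqnorm (K \<xi> \<eta>) \<partial>euc n \<partial>euc n)
  = (\<integral>\<^sup>+y. \<integral>\<^sup>+s. sqnorm (partial_ft n r w s m y) \<partial>euc n \<partial>euc n)"
 proof -
  have mm: "(%y. \<integral>\<^sup>+\<xi>. sqnorm (partial_ft n r w (?q \<xi> y) m y) \<partial>euc n) \<in> borel_measurable (euc n)"
  proof -
   have [measurable]: "(%p. partial_ft n r w (\<lambda>j\<in>{..<n}. d j * snd p j + (- (d j / 2)) * fst p j) m (fst p)) \<in> borel_measurable (euc n \<Otimes>\<^sub>M euc n)"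
    by (intro pm euc_affine_measurable) (simp_all add: m)
   show ?thesis by (rule N.borel_measurable_nn_integral) (unfold case_prod_beta, measurable)
  qed
  show ?thesis unfolding subst swap nn_integral_cmult[OF mm, symmetric]
   by (rule nn_integral_cong) (rule scale)
 qed
 have finK: "(\<integral>\<^sup>+\<xi>. \<integral>\<^sup>+\<eta>. sqnorm (K \<xi> \<eta>) \<partial>euc n \<partial>euc n) < \<infinity>"
 proof (rule ccontr)
  assume "\<not> ?thesis"
  then have "(\<integral>\<^sup>+\<xi>. \<integral>\<^sup>+\<eta>. sqnorm (K \<xi> \<eta>) \<partial>euc n \<partial>euc n) = \<top>" by (simp add: less_top[symmetric])
  moreover have "?D * \<top> = \<top>" using Dpos by (simp add: ennreal_mult_eq_top_iff ennreal_eq_0_iff)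
  ultimately show False using main fin by simp
 qed
 have TK: "AE \<xi> in euc n. T e \<xi> = (LINT \<eta>|(euc n). K \<xi> \<eta> * e \<eta>)" if e: "e \<in> L2 (euc n)" for e
 proof -
  have [measurable]: "e \<in> borel_measurable (euc n)" by (rule L2_measurable[OF e])
  have "(LINT y|(euc n). partial_ft n r w (?q \<xi> y) m y * e (\<lambda>j\<in>{..<n}. \<xi> j - y j))
   = (LINT \<eta>|(euc n). K \<xi> \<eta> * e \<eta>)" if x: "\<xi> \<in> space (euc n)" for \<xi>
  proof -
   have [measurable]: "K \<xi> \<in> borel_measurable (euc n)" using Km x by measurable
   have "(LINT \<eta>|(euc n). K \<xi> \<eta> * e \<eta>) = (LINT \<eta>|(distr (euc n) (euc n) (%y. \<lambda>j\<in>{..<n}. \<xi> j - y j)). K \<xi> \<eta> * e \<eta>)"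
    by (simp only: euc_reflect)
   also have "... = (LINT y|(euc n). K \<xi> (\<lambda>j\<in>{..<n}. \<xi> j - y j) * e (\<lambda>j\<in>{..<n}. \<xi> j - y j))"
    by (rule integral_distr) measurable
   also have "... = (LINT y|(euc n). partial_ft n r w (?q \<xi> y) m y * e (\<lambda>j\<in>{..<n}. \<xi> j - y j))"
    by (rule Bochner_Integration.integral_cong) (simp_all only: Ks)
   finally show ?thesis by simp
  qed
  with T[OF e] show ?thesis by (auto elim!: AE_mp intro!: AE_I2)
 qed
 obtain D where D: "countable D" "D \<subseteq> L2 (euc n)"
  "\<And>\<phi>. \<phi> \<in> L2 (euc n) ==> (\<And>d. d \<in> D ==> L2_inner (euc n) d \<phi> = 0) ==> AE x in euc n. \<phi> x = 0"
  using L2_PiM_total[of "{..<n}"] by auto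
 have "(hs_norm (euc n) T)\<^sup>2 = (\<integral>\<^sup>+x. \<integral>\<^sup>+y. sqnorm (K x y) \<partial>euc n \<partial>euc n)"
  by (rule hs_norm_kernel[OF euc_sigma_finite D Km TK finK])
 then show ?thesis using main by simp
qed

lemma fiber_integral:
 fixes w :: "((nat => real) \<times> (nat => real)) \<times> (nat => real) => complex"
 assumes "integrable (euc3 n r)
   (%((x, u), y). w ((x, u), y) * cis (- (2 * pi * ((\<Sum>j<n. s y j * x j) + (\<Sum>j<r. m j * u j)))) * e y)"
 shows "(\<integral>((x, u), y). w ((x, u), y) * cis (- (2 * pi * ((\<Sum>j<n. s y j * x j) + (\<Sum>j<r. m j * u j)))) * e y
      \<partial>(euc3 n r))
   = (LINT y|(euc n). partial_ft n r w (s y) m y * e y)"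
proof -
 interpret N: sigma_finite_measure "euc n" by (rule euc_sigma_finite)
 interpret E: sigma_finite_measure "euc n \<Otimes>\<^sub>M euc r"
  using gaussian_space_euc2[of n r] by (simp add: gaussian_space_def)
 interpret EN: pair_sigma_finite "euc n \<Otimes>\<^sub>M euc r" "euc n" ..
 have *: "(%((x, u), y). w ((x, u), y) * cis (- (2 * pi * ((\<Sum>j<n. s y j * x j) + (\<Sum>j<r. m j * u j)))) * e y)
  = case_prod (%p y. (case p of (x, u) => w ((x, u), y) * cis (- (2 * pi * ((\<Sum>j<n. s y j * x j) + (\<Sum>j<r. m j * u j))))) * e y)"
  by auto
 show ?thesis
  using EN.integral_snd[OF assms[unfolded *]] unfolding * partial_ft_def
  by (simp add: integral_mult_left_zero)
qed

text \<open>
 Against a Gaussian in \<open>x\<close> and \<open>u\<close>, the function \<open>w\<close> may be replaced by its partial transform and the Gaussian by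
 its transform; Cauchy--Schwarz finishes the proof. The constant depends on the dimensions and the width
 only, which makes the bound uniform in \<open>\<nu>\<close> later.
\<close>

lemma gauss_test_bound:
 fixes w :: "((nat => real) \<times> (nat => real)) \<times> (nat => real) => complex"
 assumes t: "0 < t"
 obtains \<kappa> where "0 <= \<kappa>" 
  "\<And>w a b c. integrable (euc3 n r) w ==> a \<in> space (euc n) ==> b \<in> space (euc r) ==> c \<in> space (euc n) ==>
   sqnorm (\<integral>((x, u), y). w ((x, u), y) * of_real (exp (- pi * (((\<Sum>j<n. (a j - x j)\<^sup>2) + (\<Sum>j<r. (b j - u j)\<^sup>2))
     + (\<Sum>j<n. (y j - c j)\<^sup>2)) / t)) \<partial>(euc3 n r))
    <= ennreal \<kappa> * (\<integral>\<^sup>+m. \<integral>\<^sup>+y. \<integral>\<^sup>+s. sqnorm (partial_ft n r w s m y) \<partial>euc n \<partial>euc n \<partial>euc r)"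
proof -
 let ?p = "%(a, b) (c, d). (\<Sum>j<n. a j * c j) + (\<Sum>j<r. b j * d j) :: real"
 let ?\<delta> = "%(a, b) (c, d). (\<Sum>j<n. (a j - c j)\<^sup>2) + (\<Sum>j<r. (b j - d j)\<^sup>2) :: real"
 let ?q = "%(a, b). (\<Sum>j<n. (a j)\<^sup>2) + (\<Sum>j<r. (b j)\<^sup>2) :: real"
 let ?E = "euc n \<Otimes>\<^sub>M euc r"
 interpret E: gaussian_space ?E ?p ?\<delta> ?q "n + r" by (rule gaussian_space_euc2)
 interpret N: gaussian_space "euc n" "%s x. \<Sum>i<n. s i * x i" "%x y. \<Sum>i<n. (x i - y i)\<^sup>2" "%x. \<Sum>i<n. (x i)\<^sup>2" "card {..<n}"
  by (rule gaussian_space_PiM) simp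
 interpret EN: pair_sigma_finite ?E "euc n" ..
 interpret NE: pair_sigma_finite "euc n" ?E ..
 define J where "J = (LINT s|?E. exp (- pi * (2 * t) * ?q s))"
 define b0 where "b0 = (1 / sqrt t) ^ (n + r)"
 have b0: "0 < b0" unfolding b0_def using t by simp
 define \<kappa> where "\<kappa> = (1 / b0)\<^sup>2 * ((1 / sqrt (2 / t)) ^ card {..<n} * J)"
 have J0: "0 <= J" unfolding J_def by (rule Bochner_Integration.integral_nonneg) simp
 have Jn: "(\<integral>\<^sup>+s. ennreal (exp (- pi * (2 * t) * ?q s)) \<partial>?E) = ennreal J"
  unfolding J_def by (rule nn_integral_eq_integral[OF E.gauss_integrable]) (use t in auto)
 have "0 <= \<kappa>" unfolding \<kappa>_def using J0 t by simp
 moreover have "sqnorm (\<integral>((x, u), y). w ((x, u), y) * of_real (exp (- pi * (((\<Sum>j<n. (a j - x j)\<^sup>2) + (\<Sum>j<r. (b j - u j)\<^sup>2))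
     + (\<Sum>j<n. (y j - c j)\<^sup>2)) / t)) \<partial>(?E \<Otimes>\<^sub>M euc n))
    <= ennreal \<kappa> * (\<integral>\<^sup>+m. \<integral>\<^sup>+y. \<integral>\<^sup>+s. sqnorm (partial_ft n r w s m y) \<partial>euc n \<partial>euc n \<partial>euc r)"
  if wi: "integrable (?E \<Otimes>\<^sub>M euc n) w" and sp: "a \<in> space (euc n)" "b \<in> space (euc r)" "c \<in> space (euc n)"
  for w :: "((nat => real) \<times> (nat => real)) \<times> (nat => real) => complex" and a b c
 proof -
  have w[measurable]: "w \<in> borel_measurable (?E \<Otimes>\<^sub>M euc n)" using wi by simp
  have ab: "(a, b) \<in> space ?E" using sp by (simp add: space_pair_measure)
  define e1 where "e1 = (%y. exp (- pi * (\<Sum>j<n. (y j - c j)\<^sup>2) / t))"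
  define e2 where "e2 = (%p. exp (- pi * t * ?q p))"
  define L where "L = (\<integral>((x, u), y). w ((x, u), y) * of_real (exp (- pi * (((\<Sum>j<n. (a j - x j)\<^sup>2) + (\<Sum>j<r. (b j - u j)\<^sup>2))
     + (\<Sum>j<n. (y j - c j)\<^sup>2)) / t)) \<partial>(?E \<Otimes>\<^sub>M euc n))"
  have dm: "(%p. ?\<delta> (a, b) p) \<in> borel_measurable ?E"
   using measurable_compose[OF measurable_Pair1'[OF ab] E.\<delta>_measurable] by simp
  have dm1: "(%y. \<Sum>j<n. (y j - c j)\<^sup>2) \<in> borel_measurable (euc n)"
   using measurable_compose[OF measurable_Pair2'[OF sp(3)] N.\<delta>_measurable] by simp
  have e1m[measurable]: "e1 \<in> borel_measurable (euc n)" unfolding e1_def using dm1 by measurable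
  have e2m[measurable]: "e2 \<in> borel_measurable ?E" unfolding e2_def by measurable
  have split: "exp (- pi * (?\<delta> (a, b) p + (\<Sum>j<n. (y j - c j)\<^sup>2)) / t) = exp (- pi * ?\<delta> (a, b) p / t) * e1 y" for p y
   unfolding e1_def exp_add[symmetric] by (rule arg_cong[of _ _ exp]) (simp only: distrib_left add_divide_distrib)
  have Leq: "L = (LINT (p, y)|(?E \<Otimes>\<^sub>M euc n). w (p, y) * of_real (exp (- pi * ?\<delta> (a, b) p / t)) * of_real (e1 y))"
   unfolding L_def
  proof (rule Bochner_Integration.integral_cong[OF refl])
   fix q :: "((nat => real) \<times> (nat => real)) \<times> (nat => real)"
   obtain x u y where q: "q = ((x, u), y)" by (metis surj_pair)
   note sp = split[of "(x, u)" y, unfolded case_prod_conv]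
   show "(case q of (xa, y) => (case xa of (x, u) => %y. w ((x, u), y) * of_real (exp (- pi * (((\<Sum>j<n. (a j - x j)\<^sup>2) + (\<Sum>j<r. (b j - u j)\<^sup>2))
     + (\<Sum>j<n. (y j - c j)\<^sup>2)) / t))) y) = (case q of (p, y) => w (p, y) * of_real (exp (- pi * ?\<delta> (a, b) p / t)) * of_real (e1 y))"
    unfolding q case_prod_conv sp of_real_mult mult.assoc ..
  qed
  have bd1: "0 <= exp (- pi * ?\<delta> (a, b) p / t)" "exp (- pi * ?\<delta> (a, b) p / t) <= 1" for p
   using t by (auto simp: case_prod_beta intro!: divide_nonneg_pos mult_nonneg_nonneg add_nonneg_nonneg sum_nonneg)
  have bd2: "0 <= e1 y" "e1 y <= 1" for y unfolding e1_def
   using t by (auto intro!: divide_nonneg_pos mult_nonneg_nonneg sum_nonneg)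
  have int: "integrable (?E \<Otimes>\<^sub>M euc n) (case_prod (%p y. w (p, y) * of_real (exp (- pi * ?\<delta> (a, b) p / t)) * of_real (e1 y)))"
  proof (rule Bochner_Integration.integrable_bound[OF wi])
   show "case_prod (%p y. w (p, y) * of_real (exp (- pi * ?\<delta> (a, b) p / t)) * of_real (e1 y)) \<in> borel_measurable (?E \<Otimes>\<^sub>M euc n)"
    using dm unfolding case_prod_beta[where f="%p y. w (p, y) * of_real (exp (- pi * ?\<delta> (a, b) p / t)) * of_real (e1 y)"] by measurable
   show "AE q in ?E \<Otimes>\<^sub>M euc n. norm (case_prod (%p y. w (p, y) * of_real (exp (- pi * ?\<delta> (a, b) p / t)) * of_real (e1 y)) q) <= norm (w q)"
   proof (rule AE_I2)
    fix q assume "q \<in> space (?E \<Otimes>\<^sub>M euc n)"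
    obtain p y where q: "q = (p, y)" by (cases q)
    have "norm (w (p, y)) * (exp (- pi * ?\<delta> (a, b) p / t) * e1 y) <= norm (w (p, y)) * 1"
     by (intro mult_left_mono mult_le_one bd1 bd2) auto
    then show "norm (case_prod (%p y. w (p, y) * of_real (exp (- pi * ?\<delta> (a, b) p / t)) * of_real (e1 y)) q) <= norm (w q)"
     unfolding q using bd2 by (simp add: norm_mult abs_mult mult.assoc)
   qed
  qed
  have L2: "L = (LINT y|(euc n). (LINT p|?E. w (p, y) * of_real (exp (- pi * ?\<delta> (a, b) p / t))) * of_real (e1 y))"
   unfolding Leq using EN.integral_snd[OF int] by simp
  have w': "integrable (?E \<Otimes>\<^sub>M euc n) (case_prod (%p y. w (p, y)))" using wi by simp
  have inner: "AE y in euc n. ennreal (b0 * cmod (LINT p|?E. w (p, y) * of_real (exp (- pi * ?\<delta> (a, b) p / t))))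
    <= (\<integral>\<^sup>+p. ennreal (e2 p * cmod (partial_ft n r w (fst p) (snd p) y)) \<partial>?E)"
   using EN.AE_integrable_snd[OF w']
  proof eventually_elim
   case (elim y)
   have "b0 * cmod (LINT p|?E. w (p, y) * of_real (exp (- pi * ?\<delta> (a, b) p / t)))
     = cmod (LINT p|?E. w (p, y) * of_real (b0 * exp (- pi * ?\<delta> (a, b) p / t)))"
   proof -
    have "(LINT p|?E. w (p, y) * of_real (b0 * exp (- pi * ?\<delta> (a, b) p / t)))
     = (LINT p|?E. of_real b0 * (w (p, y) * of_real (exp (- pi * ?\<delta> (a, b) p / t))))"
     by (rule Bochner_Integration.integral_cong) (simp_all add: mult_ac)
    also have "... = of_real b0 * (LINT p|?E. w (p, y) * of_real (exp (- pi * ?\<delta> (a, b) p / t)))" by simp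
    finally show ?thesis using b0 by (simp add: norm_mult)
   qed
   also have "... = cmod (LINT s|?E. exp (- pi * t * ?q s) * cis (2 * pi * ?p s (a, b)) * E.ft (%p. w (p, y)) s)"
    unfolding b0_def by (subst E.gauss_pairing[OF elim t ab]) simp
   finally have "ennreal (b0 * cmod (LINT p|?E. w (p, y) * of_real (exp (- pi * ?\<delta> (a, b) p / t))))
    <= (\<integral>\<^sup>+s. ennreal (cmod (exp (- pi * t * ?q s) * cis (2 * pi * ?p s (a, b)) * E.ft (%p. w (p, y)) s)) \<partial>?E)"
    using norm_integral_le_nn_integral by simp
   also have "... = (\<integral>\<^sup>+p. ennreal (e2 p * cmod (partial_ft n r w (fst p) (snd p) y)) \<partial>?E)"
    by (rule nn_integral_cong) (simp add: norm_mult partial_ft_eq e2_def)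
   finally show ?case .
  qed
  note pm[measurable (raw)] = partial_ft_measurable'[OF w]
  have "ennreal (b0 * cmod L) = ennreal b0 * ennreal (cmod L)" using b0 by (simp add: ennreal_mult)
  also have "... <= ennreal b0 * (\<integral>\<^sup>+y. ennreal (cmod ((LINT p|?E. w (p, y) * of_real (exp (- pi * ?\<delta> (a, b) p / t))) * of_real (e1 y))) \<partial>euc n)"
   unfolding L2 by (rule mult_left_mono[OF norm_integral_le_nn_integral]) simp
  also have "... <= (\<integral>\<^sup>+y. ennreal b0 * ennreal (cmod ((LINT p|?E. w (p, y) * of_real (exp (- pi * ?\<delta> (a, b) p / t))) * of_real (e1 y))) \<partial>euc n)"
  proof (subst nn_integral_cmult)
   show "(%y. ennreal (cmod ((LINT p|?E. w (p, y) * of_real (exp (- pi * ?\<delta> (a, b) p / t))) * of_real (e1 y)))) \<in> borel_measurable (euc n)"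
    using borel_measurable_integrable[OF EN.integrable_snd[OF int]] by simp
  qed simp
  also have "... <= (\<integral>\<^sup>+y. \<integral>\<^sup>+p. ennreal (e1 y * e2 p * cmod (partial_ft n r w (fst p) (snd p) y)) \<partial>?E \<partial>euc n)"
  proof (rule nn_integral_mono_AE)
   have "AE y in euc n. y \<in> space (euc n)" by simp
   with inner show "AE y in euc n. ennreal b0 * ennreal (cmod ((LINT p|?E. w (p, y) * of_real (exp (- pi * ?\<delta> (a, b) p / t))) * of_real (e1 y)))
    <= (\<integral>\<^sup>+p. ennreal (e1 y * e2 p * cmod (partial_ft n r w (fst p) (snd p) y)) \<partial>?E)"
   proof eventually_elim
    case (elim y)
    have [measurable]: "(%p. partial_ft n r w (fst p) (snd p) y) \<in> borel_measurable ?E"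
     by (intro pm) (simp_all add: elim)
    have "ennreal b0 * ennreal (cmod ((LINT p|?E. w (p, y) * of_real (exp (- pi * ?\<delta> (a, b) p / t))) * of_real (e1 y)))
      = ennreal (e1 y) * ennreal (b0 * cmod (LINT p|?E. w (p, y) * of_real (exp (- pi * ?\<delta> (a, b) p / t))))"
     using b0 bd2[of y] by (simp add: norm_mult mult_ac flip: ennreal_mult)
    also have "... <= ennreal (e1 y) * (\<integral>\<^sup>+p. ennreal (e2 p * cmod (partial_ft n r w (fst p) (snd p) y)) \<partial>?E)"
     by (rule mult_left_mono[OF elim(1)]) simp
    also have "... = (\<integral>\<^sup>+p. ennreal (e1 y) * ennreal (e2 p * cmod (partial_ft n r w (fst p) (snd p) y)) \<partial>?E)"
     by (rule nn_integral_cmult[symmetric]) measurable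
    finally show ?case using bd2[of y] by (simp add: mult.assoc ennreal_mult e2_def)
   qed
  qed
  also have "... = (\<integral>\<^sup>+z. ennreal (e1 (fst z) * e2 (snd z)) * ennreal (cmod (partial_ft n r w (fst (snd z)) (snd (snd z)) (fst z))) \<partial>(euc n \<Otimes>\<^sub>M ?E))"
   using bd2 by (subst E.nn_integral_fst[symmetric]) (auto simp: ennreal_mult e2_def)
  finally have L3: "ennreal (b0 * cmod L) <= ..." .
  have CS: "(\<integral>\<^sup>+z. ennreal (e1 (fst z) * e2 (snd z)) * ennreal (cmod (partial_ft n r w (fst (snd z)) (snd (snd z)) (fst z))) \<partial>(euc n \<Otimes>\<^sub>M ?E))\<^sup>2
   <= (\<integral>\<^sup>+z. (ennreal (e1 (fst z) * e2 (snd z)))\<^sup>2 \<partial>(euc n \<Otimes>\<^sub>M ?E))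
    * (\<integral>\<^sup>+z. (ennreal (cmod (partial_ft n r w (fst (snd z)) (snd (snd z)) (fst z))))\<^sup>2 \<partial>(euc n \<Otimes>\<^sub>M ?E))"
   by (rule Cauchy_Schwarz_nn_integral) measurable
  have G1: "(\<integral>\<^sup>+z. (ennreal (e1 (fst z) * e2 (snd z)))\<^sup>2 \<partial>(euc n \<Otimes>\<^sub>M ?E)) = ennreal ((1 / sqrt (2 / t)) ^ card {..<n} * J)"
  proof -
   have "(\<integral>\<^sup>+z. (ennreal (e1 (fst z) * e2 (snd z)))\<^sup>2 \<partial>(euc n \<Otimes>\<^sub>M ?E))
     = (\<integral>\<^sup>+y. \<integral>\<^sup>+p. (ennreal (e1 y * e2 p))\<^sup>2 \<partial>?E \<partial>euc n)"
    by (subst E.nn_integral_fst[symmetric]) auto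
   also have "... = (\<integral>\<^sup>+y. \<integral>\<^sup>+p. ennreal (exp (- pi * (2 / t) * (\<Sum>j<n. (y j - c j)\<^sup>2))) * ennreal (exp (- pi * (2 * t) * ?q p)) \<partial>?E \<partial>euc n)"
   proof -
    have "(ennreal (e1 y * e2 p))\<^sup>2 = ennreal (exp (- pi * (2 / t) * (\<Sum>j<n. (y j - c j)\<^sup>2))) * ennreal (exp (- pi * (2 * t) * ?q p))" for y p
    proof -
     have "(e1 y)\<^sup>2 = exp (- pi * (2 / t) * (\<Sum>j<n. (y j - c j)\<^sup>2))"
      unfolding e1_def exp_double[symmetric] by (simp add: field_simps)
     moreover have "(e2 p)\<^sup>2 = exp (- pi * (2 * t) * ?q p)"
      unfolding e2_def exp_double[symmetric] by (simp add: algebra_simps)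
     ultimately show ?thesis using bd2[of y] by (simp add: ennreal_power e2_def power_mult_distrib flip: ennreal_mult)
    qed
    then show ?thesis by simp
   qed
   also have "... = (\<integral>\<^sup>+y. ennreal (exp (- pi * (2 / t) * (\<Sum>j<n. (y j - c j)\<^sup>2))) * ennreal J \<partial>euc n)"
    by (subst nn_integral_cmult) (auto simp: Jn[simplified])
   also have "... = (\<integral>\<^sup>+y. ennreal (exp (- pi * (2 / t) * (\<Sum>j<n. (y j - c j)\<^sup>2))) \<partial>euc n) * ennreal J"
    by (rule nn_integral_multc) (use dm1 in measurable)
   also have "... = ennreal ((1 / sqrt (2 / t)) ^ card {..<n}) * ennreal J"
    using t by (subst N.gauss_mass[OF _ sp(3)]) auto
   finally show ?thesis using J0 t by (simp add: ennreal_mult)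
  qed
  have G2: "(\<integral>\<^sup>+z. (ennreal (cmod (partial_ft n r w (fst (snd z)) (snd (snd z)) (fst z))))\<^sup>2 \<partial>(euc n \<Otimes>\<^sub>M ?E))
   = (\<integral>\<^sup>+m. \<integral>\<^sup>+y. \<integral>\<^sup>+s. sqnorm (partial_ft n r w s m y) \<partial>euc n \<partial>euc n \<partial>euc r)"
   unfolding partial_ft_fubini[OF w] by (subst E.nn_integral_fst[symmetric]) (auto simp: ennreal_power)
  have "ennreal ((cmod L)\<^sup>2) = ennreal ((1 / b0)\<^sup>2) * (ennreal (b0 * cmod L))\<^sup>2"
   using b0 by (simp add: ennreal_power power_mult_distrib power_divide flip: ennreal_mult)
  also have "... <= ennreal ((1 / b0)\<^sup>2) * (ennreal ((1 / sqrt (2 / t)) ^ card {..<n} * J) *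
    (\<integral>\<^sup>+m. \<integral>\<^sup>+y. \<integral>\<^sup>+s. sqnorm (partial_ft n r w s m y) \<partial>euc n \<partial>euc n \<partial>euc r))"
   using order_trans[OF power_mono[OF L3, of 2] CS] unfolding G1 G2 by (intro mult_left_mono) auto
  also have "... = ennreal \<kappa> * (\<integral>\<^sup>+m. \<integral>\<^sup>+y. \<integral>\<^sup>+s. sqnorm (partial_ft n r w s m y) \<partial>euc n \<partial>euc n \<partial>euc r)"
  proof -
   have "ennreal \<kappa> = ennreal ((1 / b0)\<^sup>2) * ennreal ((1 / sqrt (2 / t)) ^ card {..<n} * J)"
    unfolding \<kappa>_def using t J0 by (intro ennreal_mult) auto
   then show ?thesis by (simp only: mult.assoc)
  qed
  finally show ?thesis unfolding L_def .
 qed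
 ultimately show ?thesis by (rule that)
qed




section \<open>The Fourier transform in the centre and the representations\<close>

context two_step_group
begin

definition zemb :: "real ^ 'k => 'g" where
 "zemb z = (\<Sum>j\<in>UNIV. z $ j *\<^sub>R Z j)"

lemma zemb_linear: "linear zemb"
 unfolding zemb_def by (rule linearI) (simp_all add: scaleR_add_left sum.distrib scaleR_sum_right)

lemma zemb_measurable[measurable]: "zemb \<in> borel_measurable borel"
 by (rule borel_measurable_continuous_onI) (simp add: linear_continuous_on linear_conv_bounded_linear[symmetric] zemb_linear)

lemma zcoord_measurable[measurable]: "zcoord \<in> borel_measurable borel"
 by (rule borel_measurable_continuous_onI) (simp add: linear_continuous_on linear_conv_bounded_linear[symmetric] zcoord_linear)

lemma zcoord_zemb: "zcoord (zemb z) = z"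
 unfolding zcoord_def zemb_def using Z_orthonormal
 by (simp add: vec_eq_iff inner_sum_left orthonormal_on_def if_distrib[of "%x. _ * x"] cong: if_cong)

lemma vspace_Z: "v \<in> vspace ==> v \<bullet> Z j = 0"
 unfolding vspace_def by (induction rule: span_induct_alt) (auto simp: inner_add_left V_Z_orthogonal)

lemma zcoord_vspace: "v \<in> vspace ==> zcoord v = 0"
 unfolding zcoord_def by (simp add: vspace_Z vec_eq_iff)

lemma vspace_zemb: "v \<in> vspace ==> v \<bullet> zemb z = 0"
 unfolding zemb_def by (simp add: inner_sum_right vspace_Z)

lemma norm_zemb: "norm (zemb z) = norm z"
proof -
 have "(norm (zemb z))\<^sup>2 = (\<Sum>j\<in>UNIV. (z $ j)\<^sup>2)" unfolding zemb_def by (rule orthonormal_sum_norm[OF Z_orthonormal]) simp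
 also have "... = (norm z)\<^sup>2" by (simp only: power2_norm_eq_inner[of z] inner_vec_def) (simp add: power2_eq_square)
 finally show ?thesis by (simp add: power2_eq_iff_nonneg)
qed

lemma zcoord_sum: "v \<in> vspace ==> zcoord (v + zemb z) = z"
 by (simp add: linear_add[OF zcoord_linear] zcoord_vspace zcoord_zemb)

text \<open>
 Every orthonormal parametrisation of \<open>\<vv>\<close> extends to one of the whole group, so integrals over \<open>G\<close> can be computed
 in the fixed basis \<open>V\<close> as well as in the bases that vary with \<open>\<nu>\<close>.
\<close>

lemma vz_frame:
 assumes "frame A \<Gamma> vspace"
 shows "frame (A \<Otimes>\<^sub>M lborel) (%(w, z). \<Gamma> w + zemb z) UNIV"
proof (rule frame_prod[OF assms])
 show "frame lborel zemb (span (range Z))" using frame_vec[OF Z_orthonormal] by (simp add: zemb_def[abs_def])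
 show "s \<bullet> t = 0" if "s \<in> vspace" "t \<in> span (range Z)" for s t
  using that(2) by (induction rule: span_induct_alt) (auto simp: inner_add_right vspace_Z that(1))
 show "UNIV = (%(s, t). s + t) ` (vspace \<times> span (range Z))"
 proof (intro equalityI subsetI)
  fix x :: 'g assume "x \<in> UNIV"
  have "x \<in> span (range V \<union> range Z)" using basis by simp
  then obtain a b where "x = a + b" "a \<in> span (range V)" "b \<in> span (range Z)" unfolding span_Un by auto
  then show "x \<in> (%(s, t). s + t) ` (vspace \<times> span (range Z))"
   unfolding vspace_def by (intro image_eqI[where x="(a, b)"]) auto
 qed simp
qed

lemma frame_space: "frame A \<Gamma> S ==> x \<in> space A ==> \<Gamma> x \<in> S"
 and frame_measurable: "frame A \<Gamma> S ==> \<Gamma> \<in> A \<rightarrow>\<^sub>M borel"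
 and frame_sigma_finite: "frame A \<Gamma> S ==> sigma_finite_measure A"
 unfolding frame_def shift_invariant_def by auto

lemma vz_distr:
 assumes "frame A \<Gamma> vspace"
 shows "distr (A \<Otimes>\<^sub>M lborel) borel (%(w, z). \<Gamma> w + zemb z) = lborel"
  and "(%(w, z). \<Gamma> w + zemb z) \<in> (A \<Otimes>\<^sub>M lborel) \<rightarrow>\<^sub>M borel"
 using frame_distr_lborel[OF vz_frame[OF assms]] frame_measurable[OF vz_frame[OF assms]] by auto

lemma vz_nn_integral:
 assumes "frame A \<Gamma> vspace" and [measurable]: "h \<in> borel_measurable borel"
 shows "(\<integral>\<^sup>+g. h g \<partial>lborel) = (\<integral>\<^sup>+p. h (\<Gamma> (fst p) + zemb (snd p)) \<partial>(A \<Otimes>\<^sub>M lborel))"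
 by (subst vz_distr(1)[OF assms(1), symmetric], subst nn_integral_distr[OF vz_distr(2)[OF assms(1)]])
  (auto simp: case_prod_unfold)

lemma vz_integral:
 fixes h :: "'g => complex"
 assumes "frame A \<Gamma> vspace" and [measurable]: "h \<in> borel_measurable borel"
 shows "(LINT g|lborel. h g) = (LINT p|(A \<Otimes>\<^sub>M lborel). h (\<Gamma> (fst p) + zemb (snd p)))"
  and "integrable lborel h \<longleftrightarrow> integrable (A \<Otimes>\<^sub>M lborel) (%p. h (\<Gamma> (fst p) + zemb (snd p)))"
proof -
 show "(LINT g|lborel. h g) = (LINT p|(A \<Otimes>\<^sub>M lborel). h (\<Gamma> (fst p) + zemb (snd p)))"
  by (subst vz_distr(1)[OF assms(1), symmetric], subst integral_distr[OF vz_distr(2)[OF assms(1)]])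
   (auto simp: case_prod_unfold)
 show "integrable lborel h \<longleftrightarrow> integrable (A \<Otimes>\<^sub>M lborel) (%p. h (\<Gamma> (fst p) + zemb (snd p)))"
  by (subst vz_distr(1)[OF assms(1), symmetric], subst integrable_distr_eq[OF vz_distr(2)[OF assms(1)]])
   (auto simp: case_prod_unfold)
qed

definition vfourier :: "('g => complex) => real ^ 'k => 'g => complex" where
 "vfourier f \<nu> v = (LINT z|lborel. f (v + zemb z) * cis (- (2 * pi * (\<nu> \<bullet> z))))"

lemma vfourier_measurable:
 assumes [measurable]: "f \<in> borel_measurable borel"
 shows "(%(\<nu>, v). vfourier f \<nu> v) \<in> borel_measurable (borel \<Otimes>\<^sub>M borel)"
 unfolding vfourier_def case_prod_unfold by (rule lborel.borel_measurable_lebesgue_integral) measurable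

lemma vfourier_measurable':
 assumes f: "f \<in> borel_measurable borel" and "a \<in> M \<rightarrow>\<^sub>M borel" "b \<in> M \<rightarrow>\<^sub>M borel"
 shows "(%x. vfourier f (a x) (b x)) \<in> borel_measurable M"
proof -
 have "(%x. (a x, b x)) \<in> M \<rightarrow>\<^sub>M (borel \<Otimes>\<^sub>M borel)" using assms by measurable
 from measurable_compose[OF this vfourier_measurable[OF f]] show ?thesis by simp
qed

lemma vfourier_frame:
 assumes fr: "frame A \<Gamma> vspace" and f: "integrable lborel f"
  and b[measurable]: "b \<in> borel_measurable borel" and bd: "\<And>v. cmod (b v) <= B"
 shows "integrable A (%w. vfourier f \<nu> (\<Gamma> w) * b (\<Gamma> w))"
  and "(LINT w|A. vfourier f \<nu> (\<Gamma> w) * b (\<Gamma> w))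
   = (LINT g|lborel. f g * b (g - zemb (zcoord g)) * cis (- (2 * pi * (\<nu> \<bullet> zcoord g))))"
  and "integrable lborel (%g. f g * b (g - zemb (zcoord g)) * cis (- (2 * pi * (\<nu> \<bullet> zcoord g))))"
proof -
 interpret A: sigma_finite_measure A by (rule frame_sigma_finite[OF fr])
 interpret AL: pair_sigma_finite A "lborel :: (real ^ 'k) measure" ..
 have fm[measurable]: "f \<in> borel_measurable borel" using f by simp
 have [measurable]: "\<Gamma> \<in> A \<rightarrow>\<^sub>M borel" by (rule frame_measurable[OF fr])
 let ?h = "%g. f g * b (g - zemb (zcoord g)) * cis (- (2 * pi * (\<nu> \<bullet> zcoord g)))"
 have B0: "0 <= B" using bd[of 0] norm_ge_zero order_trans by blast
 show hi: "integrable lborel ?h"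
 proof (rule Bochner_Integration.integrable_bound)
  show "integrable lborel (%g. B * norm (f g))" using f by auto
  show "AE g in lborel. norm (?h g) <= norm (B * norm (f g))"
   using B0 by (auto simp: norm_mult mult.commute[of B] intro!: AE_I2 mult_left_mono bd)
 qed measurable
 have hm: "?h \<in> borel_measurable borel" by measurable
 have eq: "?h (\<Gamma> (fst p) + zemb (snd p))
   = (%w z. b (\<Gamma> w) * (f (\<Gamma> w + zemb z) * cis (- (2 * pi * (\<nu> \<bullet> z))))) (fst p) (snd p)"
  if "p \<in> space (A \<Otimes>\<^sub>M lborel)" for p
 proof -
  have "\<Gamma> (fst p) \<in> vspace" using that by (auto simp: space_pair_measure intro: frame_space[OF fr])
  then show ?thesis by (simp add: zcoord_sum)
 qed
 have hi2: "integrable (A \<Otimes>\<^sub>M lborel) (case_prod (%w z. b (\<Gamma> w) * (f (\<Gamma> w + zemb z) * cis (- (2 * pi * (\<nu> \<bullet> z))))))"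
  using hi unfolding vz_integral(2)[OF fr hm] case_prod_unfold
  by (subst Bochner_Integration.integrable_cong[OF refl eq[symmetric]]) auto
 show "integrable A (%w. vfourier f \<nu> (\<Gamma> w) * b (\<Gamma> w))"
  using AL.integrable_fst[OF hi2] by (simp add: vfourier_def mult.commute)
 have "(LINT g|lborel. ?h g) = (LINT p|(A \<Otimes>\<^sub>M lborel). (case_prod (%w z. b (\<Gamma> w) * (f (\<Gamma> w + zemb z) * cis (- (2 * pi * (\<nu> \<bullet> z)))))) p)"
  unfolding vz_integral(1)[OF fr hm] case_prod_unfold
  by (rule Bochner_Integration.integral_cong[OF refl]) (rule eq)
 also have "... = (LINT w|A. vfourier f \<nu> (\<Gamma> w) * b (\<Gamma> w))"
  using AL.integral_fst[OF hi2] by (simp add: vfourier_def mult.commute)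
 finally show "(LINT w|A. vfourier f \<nu> (\<Gamma> w) * b (\<Gamma> w)) = (LINT g|lborel. ?h g)" by simp
qed

lemma V_frame: "frame (Pi\<^sub>M UNIV (%_. lborel)) (%x. \<Sum>i\<in>UNIV. x i *\<^sub>R V i) vspace"
 using frame_PiM[OF finite V_orthonormal] by (simp add: vspace_def)

lemma vfourier_L2:
 assumes f: "integrable lborel f" "f \<in> L2 lborel" and fr: "frame A \<Gamma> vspace"
 shows "AE \<nu> in lborel. (\<integral>\<^sup>+w. sqnorm (vfourier f \<nu> (\<Gamma> w)) \<partial>A) < \<infinity>"
proof -
 interpret A: sigma_finite_measure A by (rule frame_sigma_finite[OF fr])
 interpret AL: pair_sigma_finite A "lborel :: (real ^ 'k) measure" ..
 interpret LA: pair_sigma_finite "lborel :: (real ^ 'k) measure" A ..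
 interpret L: gaussian_space "lborel :: (real ^ 'k) measure" "(\<bullet>)" "%x y. (norm (x - y))\<^sup>2" "%x. (norm x)\<^sup>2" "DIM(real ^ 'k)"
  by (rule gaussian_space_lborel)
 have fm[measurable]: "f \<in> borel_measurable borel" using f by simp
 have Gm[measurable]: "\<Gamma> \<in> A \<rightarrow>\<^sub>M borel" by (rule frame_measurable[OF fr])
 note [measurable (raw)] = vfourier_measurable'[OF fm]
 have int: "integrable (A \<Otimes>\<^sub>M lborel) (case_prod (%w z. f (\<Gamma> w + zemb z)))"
  using f(1) unfolding vz_integral(2)[OF fr fm] by (simp add: case_prod_unfold)
 have "(\<integral>\<^sup>+\<nu>. \<integral>\<^sup>+w. sqnorm (vfourier f \<nu> (\<Gamma> w)) \<partial>A \<partial>lborel)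
   = (\<integral>\<^sup>+w. \<integral>\<^sup>+\<nu>. sqnorm (vfourier f \<nu> (\<Gamma> w)) \<partial>lborel \<partial>A)"
  by (rule AL.Fubini') measurable
 also have "... <= (\<integral>\<^sup>+w. \<integral>\<^sup>+z. sqnorm (f (\<Gamma> w + zemb z)) \<partial>lborel \<partial>A)"
 proof (rule nn_integral_mono_AE)
  show "AE w in A. (\<integral>\<^sup>+\<nu>. sqnorm (vfourier f \<nu> (\<Gamma> w)) \<partial>lborel) <= (\<integral>\<^sup>+z. sqnorm (f (\<Gamma> w + zemb z)) \<partial>lborel)"
   using AL.AE_integrable_fst[OF int]
   by eventually_elim (use L.plancherel_le in \<open>simp add: vfourier_def L.ft_def\<close>)
 qed
 also have "... = (\<integral>\<^sup>+g. sqnorm (f g) \<partial>lborel)"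
  by (subst vz_nn_integral[OF fr], measurable, subst lborel.nn_integral_fst[symmetric]) auto
 also have "... < \<infinity>" using L2_nn_integral[OF f(2)] by simp
 finally have "(\<integral>\<^sup>+\<nu>. \<integral>\<^sup>+w. sqnorm (vfourier f \<nu> (\<Gamma> w)) \<partial>A \<partial>lborel) ~= \<infinity>" by simp
 then have "AE \<nu> in lborel. (\<integral>\<^sup>+w. sqnorm (vfourier f \<nu> (\<Gamma> w)) \<partial>A) ~= \<infinity>"
  by (intro nn_integral_noteq_infinite A.borel_measurable_nn_integral) (auto simp: case_prod_unfold, measurable)
 then show ?thesis by (simp add: less_top)
qed

end

context two_step_reps
begin

definition Gam :: "real ^ 'k => ((nat => real) \<times> (nat => real)) \<times> (nat => real) => 'g" where
 "Gam \<nu> = (%((x, u), y). ((\<Sum>j<dim_n. x j *\<^sub>R X \<nu> j) + (\<Sum>j<dim_r. u j *\<^sub>R U \<nu> j)) + (\<Sum>j<dim_n. y j *\<^sub>R Y \<nu> j))"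

lemma U_X_orthogonal: "[|\<nu> \<in> Uset; i < dim_n; j < dim_r|] ==> U \<nu> j \<bullet> X \<nu> i = 0"
 and U_Y_orthogonal: "[|\<nu> \<in> Uset; i < dim_n; j < dim_r|] ==> U \<nu> j \<bullet> Y \<nu> i = 0"
 and Y_X_orthogonal: "[|\<nu> \<in> Uset; i < dim_n; j < dim_n|] ==> Y \<nu> j \<bullet> X \<nu> i = 0"
 using X_U_orthogonal Y_U_orthogonal X_Y_orthogonal by (auto simp: inner_commute)

lemma Gam_X: "\<nu> \<in> Uset ==> i < dim_n ==> Gam \<nu> ((x, u), y) \<bullet> X \<nu> i = x i"
 and Gam_Y: "\<nu> \<in> Uset ==> i < dim_n ==> Gam \<nu> ((x, u), y) \<bullet> Y \<nu> i = y i"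
 and Gam_U: "\<nu> \<in> Uset ==> k < dim_r ==> Gam \<nu> ((x, u), y) \<bullet> U \<nu> k = u k"
 using orthonormal_sum_inner[OF X_orthonormal, of \<nu> i] orthonormal_sum_inner[OF Y_orthonormal, of \<nu> i]
  orthonormal_sum_inner[OF U_orthonormal, of \<nu> k]
 unfolding Gam_def by (simp_all add: inner_add_left inner_sum_left U_X_orthogonal U_Y_orthogonal
   Y_X_orthogonal X_Y_orthogonal X_U_orthogonal Y_U_orthogonal)

lemma Gam_frame:
 assumes \<nu>: "\<nu> \<in> Uset"
 shows "frame (euc3 dim_n dim_r) (Gam \<nu>) vspace"
proof -
 let ?SX = "span (X \<nu> ` {..<dim_n})" and ?SY = "span (Y \<nu> ` {..<dim_n})" and ?SU = "span (U \<nu> ` {..<dim_r})"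
 have XU: "s \<bullet> t = 0" if s: "s \<in> ?SX" and t: "t \<in> ?SU" for s t
 proof -
  have *: "X \<nu> i \<bullet> t = 0" if "i < dim_n" for i
   using t by (induction rule: span_induct_alt) (use that in \<open>auto simp: inner_add_right X_U_orthogonal[OF \<nu>]\<close>)
  show ?thesis using s by (induction rule: span_induct_alt) (auto simp: inner_add_left *)
 qed
 have f1: "frame (euc dim_n \<Otimes>\<^sub>M euc dim_r) (%(x, u). (\<Sum>j<dim_n. x j *\<^sub>R X \<nu> j) + (\<Sum>j<dim_r. u j *\<^sub>R U \<nu> j))
   (span (X \<nu> ` {..<dim_n} \<union> U \<nu> ` {..<dim_r}))"
  by (rule frame_prod[OF frame_PiM[OF _ X_orthonormal[OF \<nu>]] frame_PiM[OF _ U_orthonormal[OF \<nu>]] XU])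
   (auto simp: span_Un image_def)
 have XUY: "s \<bullet> t = 0" if s: "s \<in> span (X \<nu> ` {..<dim_n} \<union> U \<nu> ` {..<dim_r})" and t: "t \<in> ?SY" for s t
 proof -
  have *: "X \<nu> i \<bullet> t = 0" if "i < dim_n" for i
   using t by (induction rule: span_induct_alt) (use that in \<open>auto simp: inner_add_right X_Y_orthogonal[OF \<nu>]\<close>)
  have **: "U \<nu> i \<bullet> t = 0" if "i < dim_r" for i
   using t by (induction rule: span_induct_alt) (use that in \<open>auto simp: inner_add_right U_Y_orthogonal[OF \<nu>]\<close>)
  show ?thesis using s by (induction rule: span_induct_alt) (auto simp: inner_add_left * **)
 qed
 have "frame (euc3 dim_n dim_r)
  (%(p, y). (%(x, u). (\<Sum>j<dim_n. x j *\<^sub>R X \<nu> j) + (\<Sum>j<dim_r. u j *\<^sub>R U \<nu> j)) p + (\<Sum>j<dim_n. y j *\<^sub>R Y \<nu> j)) vspace"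
 proof (rule frame_prod[OF f1 frame_PiM[OF _ Y_orthonormal[OF \<nu>]] XUY])
  have "vspace = span ((X \<nu> ` {..<dim_n} \<union> U \<nu> ` {..<dim_r}) \<union> Y \<nu> ` {..<dim_n})"
   using frame_span[OF \<nu>] by (simp add: Un_ac)
  then show "vspace = (%(s, t). s + t) ` (span (X \<nu> ` {..<dim_n} \<union> U \<nu> ` {..<dim_r}) \<times> ?SY)"
   by (simp only: span_Un[of "_ \<union> _"]) (auto simp: image_def)
 qed auto
 moreover have "(%(p, y). (%(x, u). (\<Sum>j<dim_n. x j *\<^sub>R X \<nu> j) + (\<Sum>j<dim_r. u j *\<^sub>R U \<nu> j)) p + (\<Sum>j<dim_n. y j *\<^sub>R Y \<nu> j)) = Gam \<nu>"
  unfolding Gam_def by (auto simp: fun_eq_iff)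
 ultimately show ?thesis by simp
qed

definition mtil :: "('m => real) => real ^ 'k => nat => real" where
 "mtil \<mu> \<nu> = (\<lambda>i\<in>{..<dim_r}. mu_tilde \<mu> \<nu> i)"

lemma mtil_space: "mtil \<mu> \<nu> \<in> space (euc dim_r)"
 unfolding mtil_def by (simp add: space_PiM)

text \<open>
 By Plancherel in the frequency of \<open>x\<close>, this is the square of the Hilbert--Schmidt norm times \<open>d\<^sub>1 \<cdots> d\<^sub>n\<close>,
 as a function of the frequency of \<open>u\<close>.
\<close>

definition hs_mass :: "('g => complex) => real ^ 'k => (nat => real) => ennreal" where
 "hs_mass f \<nu> m = (\<integral>\<^sup>+y. \<integral>\<^sup>+s. sqnorm (partial_ft dim_n dim_r (%p. vfourier f \<nu> (Gam \<nu> p)) s m y) \<partial>euc dim_n \<partial>euc dim_n)"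

text \<open>
 For \<open>\<phi>\<close> in \<open>L\<^sup>2\<close> the integrand is absolutely integrable for almost every \<open>\<xi>\<close>, since \<open>|f| |\<phi>| <= |f| (1 + |\<phi>|\<^sup>2)\<close> and the
 integral of \<open>|f| |\<phi>|\<^sup>2\<close> over \<open>\<xi>\<close> is finite. This justifies integrating first over \<open>z\<close> and then over \<open>(x, u)\<close>.
\<close>

lemma pi_op_kernel:
 assumes \<nu>: "\<nu> \<in> Uset" and f: "integrable lborel f" and e: "e \<in> L2 (euc dim_n)"
 shows "AE \<xi> in euc dim_n. pi_op \<mu> \<nu> f e \<xi> =
  (LINT y|(euc dim_n). partial_ft dim_n dim_r (%p. vfourier f \<nu> (Gam \<nu> p)) (\<lambda>j\<in>{..<dim_n}. d \<nu> j * \<xi> j + (- (d \<nu> j / 2)) * y j) (mtil \<mu> \<nu>) y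
    * e (\<lambda>j\<in>{..<dim_n}. \<xi> j - y j))"
proof -
 let ?A = "euc3 dim_n dim_r"
 note fr = Gam_frame[OF \<nu>]
 interpret A: sigma_finite_measure ?A by (rule frame_sigma_finite[OF fr])
 interpret AL: pair_sigma_finite ?A "lborel :: (real ^ 'k) measure" ..
 interpret N: sigma_finite_measure "euc dim_n" by (rule euc_sigma_finite)
 interpret NL: pair_sigma_finite "euc dim_n" "lborel :: 'g measure" ..
 have em[measurable]: "e \<in> borel_measurable (euc dim_n)" by (rule L2_measurable[OF e])
 have fm[measurable]: "f \<in> borel_measurable borel" using f by simp
 have em2: "(%p. e (\<lambda>j\<in>{..<dim_n}. fst p j - snd p \<bullet> Y \<nu> j)) \<in> borel_measurable (euc dim_n \<Otimes>\<^sub>M borel)"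
 proof (rule measurable_compose[OF euc_restrict_measurable em])
  fix j assume j: "j < dim_n"
  have [measurable]: "(%p. fst p j) \<in> borel_measurable (euc dim_n \<Otimes>\<^sub>M (borel :: 'g measure))"
   by (rule measurable_compose[OF measurable_fst euc_component[OF j]])
  show "(%p. fst p j - snd p \<bullet> Y \<nu> j) \<in> borel_measurable (euc dim_n \<Otimes>\<^sub>M borel)" by measurable
 qed
 have em3[measurable]: "(%g. e (\<lambda>j\<in>{..<dim_n}. \<xi> j - g \<bullet> Y \<nu> j)) \<in> borel_measurable borel" for \<xi>
  by (rule measurable_compose[OF euc_restrict_measurable em]) measurable
 have emass: "(\<integral>\<^sup>+\<xi>. sqnorm (e (\<lambda>j\<in>{..<dim_n}. \<xi> j - g \<bullet> Y \<nu> j)) \<partial>euc dim_n) = (\<integral>\<^sup>+\<xi>. sqnorm (e \<xi>) \<partial>euc dim_n)" for g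
  by (subst PiM_lborel_affine[where c="%_. 1" and a="%j. - (g \<bullet> Y \<nu> j)" and h="%\<xi>. sqnorm (e \<xi>)"]) auto
 have "(\<integral>\<^sup>+\<xi>. \<integral>\<^sup>+g. ennreal (cmod (f g)) * sqnorm (e (\<lambda>j\<in>{..<dim_n}. \<xi> j - g \<bullet> Y \<nu> j)) \<partial>lborel \<partial>euc dim_n)
   = (\<integral>\<^sup>+g. \<integral>\<^sup>+\<xi>. ennreal (cmod (f g)) * sqnorm (e (\<lambda>j\<in>{..<dim_n}. \<xi> j - g \<bullet> Y \<nu> j)) \<partial>euc dim_n \<partial>lborel)"
 proof -
  have m: "(%p. ennreal (cmod (f (snd p))) * sqnorm (e (\<lambda>j\<in>{..<dim_n}. fst p j - snd p \<bullet> Y \<nu> j))) \<in> borel_measurable (euc dim_n \<Otimes>\<^sub>M lborel)"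
   using em2 by measurable
  show ?thesis by (rule NL.Fubini'[symmetric]) (use m in \<open>simp add: case_prod_unfold\<close>)
 qed
 also have "... = (\<integral>\<^sup>+g. ennreal (cmod (f g)) * (\<integral>\<^sup>+\<xi>. sqnorm (e \<xi>) \<partial>euc dim_n) \<partial>lborel)"
 proof (rule nn_integral_cong)
  fix g
  have "(%\<xi>. e (\<lambda>j\<in>{..<dim_n}. \<xi> j - g \<bullet> Y \<nu> j)) \<in> borel_measurable (euc dim_n)"
   by (rule measurable_compose[OF euc_restrict_measurable em]) (use euc_component in measurable)
  then show "(\<integral>\<^sup>+\<xi>. ennreal (cmod (f g)) * sqnorm (e (\<lambda>j\<in>{..<dim_n}. \<xi> j - g \<bullet> Y \<nu> j)) \<partial>euc dim_n)
    = ennreal (cmod (f g)) * (\<integral>\<^sup>+\<xi>. sqnorm (e \<xi>) \<partial>euc dim_n)"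
   unfolding emass[of g, symmetric] by (intro nn_integral_cmult) measurable
 qed
 also have "... = (\<integral>\<^sup>+g. ennreal (cmod (f g)) \<partial>lborel) * (\<integral>\<^sup>+\<xi>. sqnorm (e \<xi>) \<partial>euc dim_n)"
  by (rule nn_integral_multc) measurable
 also have "... < \<infinity>"
  using f unfolding integrable_iff_bounded L2_nn_integral[OF e] by (auto simp: ennreal_mult_less_top)
 finally have "(\<integral>\<^sup>+\<xi>. \<integral>\<^sup>+g. ennreal (cmod (f g)) * sqnorm (e (\<lambda>j\<in>{..<dim_n}. \<xi> j - g \<bullet> Y \<nu> j)) \<partial>lborel \<partial>euc dim_n) ~= \<infinity>"
  by simp
 then have "AE \<xi> in euc dim_n. (\<integral>\<^sup>+g. ennreal (cmod (f g)) * sqnorm (e (\<lambda>j\<in>{..<dim_n}. \<xi> j - g \<bullet> Y \<nu> j)) \<partial>lborel) ~= \<infinity>"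
 proof (rule nn_integral_noteq_infinite[rotated])
  have m: "(%p. ennreal (cmod (f (snd p))) * sqnorm (e (\<lambda>j\<in>{..<dim_n}. fst p j - snd p \<bullet> Y \<nu> j))) \<in> borel_measurable (euc dim_n \<Otimes>\<^sub>M lborel)"
   using em2 by measurable
  show "(%\<xi>. \<integral>\<^sup>+g. ennreal (cmod (f g)) * sqnorm (e (\<lambda>j\<in>{..<dim_n}. \<xi> j - g \<bullet> Y \<nu> j)) \<partial>lborel) \<in> borel_measurable (euc dim_n)"
   by (rule lborel.borel_measurable_nn_integral) (use m in \<open>simp add: case_prod_unfold\<close>)
 qed
 then show ?thesis
 proof eventually_elim
  case (elim \<xi>)
  define F where "F = (%g. f g * pi_rep \<mu> \<nu> (- g) e \<xi>)"
  have rep: "pi_rep \<mu> \<nu> (- g) e \<xi> = cis (2 * pi * (\<nu> \<bullet> zcoord (- g)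
      + (\<Sum>j<dim_r. mu_tilde \<mu> \<nu> j * (- g \<bullet> U \<nu> j))
      + (\<Sum>j<dim_n. d \<nu> j * ((- g \<bullet> X \<nu> j) * \<xi> j + 1/2 * (- g \<bullet> X \<nu> j) * (- g \<bullet> Y \<nu> j)))))
    * e (\<lambda>j\<in>{..<dim_n}. \<xi> j - g \<bullet> Y \<nu> j)" for g
   unfolding pi_rep_def by simp
  have Fm: "F \<in> borel_measurable borel" unfolding F_def rep by measurable
  have "integrable lborel F"
  proof (rule integrableI_bounded)
   have "(\<integral>\<^sup>+g. ennreal (norm (F g)) \<partial>lborel) <= (\<integral>\<^sup>+g. ennreal (cmod (f g)) + ennreal (cmod (f g)) * sqnorm (e (\<lambda>j\<in>{..<dim_n}. \<xi> j - g \<bullet> Y \<nu> j)) \<partial>lborel)"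
   proof (rule nn_integral_mono)
    fix g
    have x: "x <= 1 + x\<^sup>2" for x :: real using zero_le_power2[of "x - 1/2"] by (simp add: power2_eq_square algebra_simps)
    have "norm (F g) <= cmod (f g) * (1 + (cmod (e (\<lambda>j\<in>{..<dim_n}. \<xi> j - g \<bullet> Y \<nu> j)))\<^sup>2)"
     unfolding F_def rep norm_mult norm_cis by (intro mult_left_mono) (use x in auto)
    then have "ennreal (norm (F g)) <= ennreal (cmod (f g) * (1 + (cmod (e (\<lambda>j\<in>{..<dim_n}. \<xi> j - g \<bullet> Y \<nu> j)))\<^sup>2))" by (rule ennreal_leI)
    then show "ennreal (norm (F g)) <= ennreal (cmod (f g)) + ennreal (cmod (f g)) * sqnorm (e (\<lambda>j\<in>{..<dim_n}. \<xi> j - g \<bullet> Y \<nu> j))"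
     by (simp add: ring_distribs ennreal_plus ennreal_mult del: ennreal_plus[symmetric])
   qed
   also have "... = (\<integral>\<^sup>+g. ennreal (cmod (f g)) \<partial>lborel) + (\<integral>\<^sup>+g. ennreal (cmod (f g)) * sqnorm (e (\<lambda>j\<in>{..<dim_n}. \<xi> j - g \<bullet> Y \<nu> j)) \<partial>lborel)"
    by (rule nn_integral_add) measurable
   also have "... < \<infinity>" using f elim unfolding integrable_iff_bounded by (simp add: less_top)
   finally show "(\<integral>\<^sup>+g. ennreal (norm (F g)) \<partial>lborel) < \<infinity>" .
  qed (use Fm in simp)
  define s where "s = (%y. \<lambda>j\<in>{..<dim_n}. d \<nu> j * \<xi> j + (- (d \<nu> j / 2)) * y j)"
  define R where "R = (%((x, u), y). cis (- (2 * pi * ((\<Sum>j<dim_n. s y j * x j) + (\<Sum>j<dim_r. mtil \<mu> \<nu> j * u j))))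
    * e (\<lambda>j\<in>{..<dim_n}. \<xi> j - y j))"
  have FR: "F (Gam \<nu> (fst p) + zemb (snd p)) = (%w z. (f (Gam \<nu> w + zemb z) * cis (- (2 * pi * (\<nu> \<bullet> z)))) * R w) (fst p) (snd p)"
   if p: "p \<in> space (?A \<Otimes>\<^sub>M lborel)" for p
  proof -
   obtain x u y z where pe: "p = (((x, u), y), z)" by (metis surj_pair)
   have Gv: "Gam \<nu> ((x, u), y) \<in> vspace" using p frame_space[OF fr] unfolding pe by (auto simp: space_pair_measure)
   let ?g = "Gam \<nu> ((x, u), y) + zemb z"
   have c: "?g \<bullet> X \<nu> j = x j" "?g \<bullet> Y \<nu> j = y j" if "j < dim_n" for j
   proof -
    have "X \<nu> j \<in> vspace" "Y \<nu> j \<in> vspace"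
     unfolding frame_span[OF \<nu>, symmetric] using that by (auto intro!: span_base)
    then show "?g \<bullet> X \<nu> j = x j" "?g \<bullet> Y \<nu> j = y j"
     using that \<nu> by (simp_all add: inner_add_left Gam_X Gam_Y vspace_zemb inner_commute[of "zemb z"])
   qed
   have c2: "?g \<bullet> U \<nu> j = u j" if "j < dim_r" for j
   proof -
    have "U \<nu> j \<in> vspace" unfolding frame_span[OF \<nu>, symmetric] using that by (auto intro!: span_base)
    then show ?thesis
     using that \<nu> by (simp add: inner_add_left Gam_U vspace_zemb inner_commute[of "zemb z"])
   qed
   have zc: "zcoord (- ?g) = - z" using linear_neg[OF zcoord_linear, of ?g] by (simp only: zcoord_sum[OF Gv])
   have ph: "2 * pi * (\<nu> \<bullet> zcoord (- ?g) + (\<Sum>j<dim_r. mu_tilde \<mu> \<nu> j * (- ?g \<bullet> U \<nu> j))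
      + (\<Sum>j<dim_n. d \<nu> j * ((- ?g \<bullet> X \<nu> j) * \<xi> j + 1/2 * (- ?g \<bullet> X \<nu> j) * (- ?g \<bullet> Y \<nu> j))))
     = - (2 * pi * (\<nu> \<bullet> z)) + - (2 * pi * ((\<Sum>j<dim_n. s y j * x j) + (\<Sum>j<dim_r. mtil \<mu> \<nu> j * u j)))"
   proof -
    have "(\<Sum>j<dim_r. mu_tilde \<mu> \<nu> j * (- ?g \<bullet> U \<nu> j)) = - (\<Sum>j<dim_r. mtil \<mu> \<nu> j * u j)"
     unfolding sum_negf[symmetric] by (intro sum.cong) (simp_all only: inner_minus_left c2 lessThan_iff, simp add: mtil_def)
    moreover have "(\<Sum>j<dim_n. d \<nu> j * ((- ?g \<bullet> X \<nu> j) * \<xi> j + 1/2 * (- ?g \<bullet> X \<nu> j) * (- ?g \<bullet> Y \<nu> j))) = - (\<Sum>j<dim_n. s y j * x j)"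
     unfolding sum_negf[symmetric] by (intro sum.cong) (simp_all only: inner_minus_left c lessThan_iff, simp add: s_def algebra_simps)
    ultimately show ?thesis unfolding zc by (simp add: algebra_simps)
   qed
   have ee: "(\<lambda>j\<in>{..<dim_n}. \<xi> j - ?g \<bullet> Y \<nu> j) = (\<lambda>j\<in>{..<dim_n}. \<xi> j - y j)" by (auto simp: fun_eq_iff c)
   have "F ?g = f ?g * (cis (- (2 * pi * (\<nu> \<bullet> z)) + - (2 * pi * ((\<Sum>j<dim_n. s y j * x j) + (\<Sum>j<dim_r. mtil \<mu> \<nu> j * u j))))
    * e (\<lambda>j\<in>{..<dim_n}. \<xi> j - y j))"
    unfolding F_def rep ph ee ..
   then show ?thesis unfolding pe R_def by (simp only: fst_conv snd_conv case_prod_conv cis_mult[symmetric] mult.assoc)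
  qed
  have Fi: "integrable (?A \<Otimes>\<^sub>M lborel) (case_prod (%w z. (f (Gam \<nu> w + zemb z) * cis (- (2 * pi * (\<nu> \<bullet> z)))) * R w))"
   using \<open>integrable lborel F\<close> unfolding vz_integral(2)[OF fr Fm] case_prod_unfold
   by (subst Bochner_Integration.integrable_cong[OF refl FR[symmetric]]) auto
  have "pi_op \<mu> \<nu> f e \<xi> = (LINT g|lborel. F g)" unfolding pi_op_def F_def ..
  also have "... = (LINT p|(?A \<Otimes>\<^sub>M lborel). (case_prod (%w z. (f (Gam \<nu> w + zemb z) * cis (- (2 * pi * (\<nu> \<bullet> z)))) * R w)) p)"
   unfolding vz_integral(1)[OF fr Fm] case_prod_unfold
   by (rule Bochner_Integration.integral_cong[OF refl]) (rule FR)
  also have "... = (LINT w|?A. vfourier f \<nu> (Gam \<nu> w) * R w)"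
   using AL.integral_fst[OF Fi] by (simp add: vfourier_def)
  also have Req: "(%w. vfourier f \<nu> (Gam \<nu> w) * R w) = (%((x, u), y). vfourier f \<nu> (Gam \<nu> ((x, u), y)) *
    cis (- (2 * pi * ((\<Sum>j<dim_n. s y j * x j) + (\<Sum>j<dim_r. mtil \<mu> \<nu> j * u j)))) * e (\<lambda>j\<in>{..<dim_n}. \<xi> j - y j))"
   unfolding R_def by (auto simp: fun_eq_iff mult.assoc)
  also have "integral\<^sup>L ?A ... = (LINT y|(euc dim_n). partial_ft dim_n dim_r (%p. vfourier f \<nu> (Gam \<nu> p)) (s y) (mtil \<mu> \<nu>) y
    * e (\<lambda>j\<in>{..<dim_n}. \<xi> j - y j))"
  proof (rule fiber_integral)
   have "integrable ?A (%w. vfourier f \<nu> (Gam \<nu> w) * R w)" using AL.integrable_fst[OF Fi] by (simp add: vfourier_def)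
   then show "integrable ?A (%((x, u), y). vfourier f \<nu> (Gam \<nu> ((x, u), y)) *
    cis (- (2 * pi * ((\<Sum>j<dim_n. s y j * x j) + (\<Sum>j<dim_r. mtil \<mu> \<nu> j * u j)))) * e (\<lambda>j\<in>{..<dim_n}. \<xi> j - y j))"
    unfolding Req .
  qed
  finally show ?case unfolding s_def .
 qed
qed

lemma pi_hs_square:
 assumes \<nu>: "\<nu> \<in> Uset" and f: "integrable lborel f" and fin: "hs_mass f \<nu> (mtil \<mu> \<nu>) < \<infinity>"
 shows "ennreal (\<Prod>j<dim_n. d \<nu> j) * (pi_hs \<mu> \<nu> f)\<^sup>2 = hs_mass f \<nu> (mtil \<mu> \<nu>)"
proof -
 have fm: "f \<in> borel_measurable borel" using f by simp
 have m: "(%p. vfourier f \<nu> (Gam \<nu> p)) \<in> borel_measurable (euc3 dim_n dim_r)"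
  by (intro vfourier_measurable'[OF fm] frame_measurable[OF Gam_frame[OF \<nu>]]) simp
 show ?thesis
  unfolding pi_hs_def eta_measure_def hs_mass_def
  by (rule weyl_hs_norm[OF d_pos[OF \<nu>] m mtil_space pi_op_kernel[OF \<nu> f] fin[unfolded hs_mass_def]])
qed

end




section \<open>Uniqueness\<close>

context two_step_group
begin

text \<open>
 The projections of the \<open>V q\<close>, \<open>q\<close> in \<open>Q\<close>, span the radical, because the radical meets the span of the
 other basis vectors only in \<open>0\<close>.
\<close>

lemma radical_projections_span:
 assumes \<nu>: "\<nu> \<in> Uset" and b: "orthonormal_on I b" "finite I" "span (b ` I) = radical \<nu>"
 shows "span ((%q. \<Sum>i\<in>I. (V q \<bullet> b i) *\<^sub>R b i) ` Qset) = radical \<nu>"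
proof (rule ccontr)
 let ?w = "%q. \<Sum>i\<in>I. (V q \<bullet> b i) *\<^sub>R b i"
 assume neq: "span (?w ` Qset) ~= radical \<nu>"
 have "?w q \<in> span (b ` I)" for q by (intro span_sum span_scale span_base) auto
 then have "span (?w ` Qset) \<subseteq> span (b ` I)" by (intro span_minimal) auto
 then have "span (?w ` Qset) \<subset> span (b ` I)" using neq b(3) by auto
 then obtain z where z: "z ~= 0" "z \<in> span (b ` I)" "\<And>y. y \<in> span (?w ` Qset) ==> orthogonal z y"
  by (rule orthogonal_to_subspace_exists_gen) auto
 have ze: "(\<Sum>i\<in>I. (z \<bullet> b i) *\<^sub>R b i) = z" by (rule orthonormal_expansion[OF b(1,2) z(2)])
 have "z \<bullet> V q = 0" if q: "q \<in> Qset" for q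
 proof -
  have "z \<bullet> V q = (\<Sum>i\<in>I. (z \<bullet> b i) * (V q \<bullet> b i))"
  proof -
   have "z \<bullet> V q = (\<Sum>i\<in>I. (z \<bullet> b i) *\<^sub>R b i) \<bullet> V q" by (simp only: ze)
   then show ?thesis by (simp add: inner_sum_left inner_commute[of "b _" "V q"])
  qed
  also have "... = z \<bullet> ?w q" by (simp add: inner_sum_right mult.commute)
  also have "... = 0" using z(3)[OF span_base[of "?w q"]] q by (simp add: orthogonal_def)
  finally show ?thesis .
 qed
 then have "z = 0" using z(2) b(3) by (intro radical_meets_P[OF \<nu>]) auto
 with z(1) show False ..
qed

text \<open>
 The integral of \<open>f\<close> over \<open>\<vv>\<close> against \<open>b\<close>, as a function on \<open>\<zz>\<close>.
\<close>

definition vtest :: "('g => complex) => ('g => complex) => real ^ 'k => complex" where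
 "vtest f b z = (LINT x|(Pi\<^sub>M UNIV (%_. lborel)). f ((\<Sum>i\<in>UNIV. x i *\<^sub>R V i) + zemb z) * b (\<Sum>i\<in>UNIV. x i *\<^sub>R V i))"

lemma vtest_properties:
 assumes f: "integrable lborel f"
  and b[measurable]: "b \<in> borel_measurable borel" and bd: "\<And>v. cmod (b v) <= B"
 shows "integrable lborel (vtest f b)"
  and "\<And>h. h \<in> borel_measurable borel ==> (\<And>z. cmod (h z) <= 1) ==>
   (LINT z|lborel. vtest f b z * h z) = (LINT g|lborel. f g * b (g - zemb (zcoord g)) * h (zcoord g))"
  and "AE g in lborel. norm (zcoord g) < \<epsilon> \<longrightarrow> f g = 0 ==> AE z in lborel. norm z < \<epsilon> \<longrightarrow> vtest f b z = 0"
proof -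
 define A where "A = (Pi\<^sub>M UNIV (%_. lborel) :: ('m => real) measure)"
 define \<Gamma> where "\<Gamma> = (%x::'m => real. \<Sum>i\<in>UNIV. x i *\<^sub>R V i)"
 have fr: "frame A \<Gamma> vspace" unfolding A_def \<Gamma>_def by (rule V_frame)
 interpret A: sigma_finite_measure A by (rule frame_sigma_finite[OF fr])
 interpret AL: pair_sigma_finite A "lborel :: (real ^ 'k) measure" ..
 have fm[measurable]: "f \<in> borel_measurable borel" using f by simp
 have [measurable]: "\<Gamma> \<in> A \<rightarrow>\<^sub>M borel" by (rule frame_measurable[OF fr])
 have B0: "0 <= B" using bd[of 0] norm_ge_zero order_trans by blast
 have vt: "vtest f b z = (LINT w|A. f (\<Gamma> w + zemb z) * b (\<Gamma> w))" for z
  unfolding vtest_def A_def \<Gamma>_def ..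
 have main: "integrable (A \<Otimes>\<^sub>M lborel) (case_prod (%w z. f (\<Gamma> w + zemb z) * b (\<Gamma> w) * h z))
   \<and> (LINT g|lborel. f g * b (g - zemb (zcoord g)) * h (zcoord g))
    = (LINT p|(A \<Otimes>\<^sub>M lborel). case_prod (%w z. f (\<Gamma> w + zemb z) * b (\<Gamma> w) * h z) p)"
  if h[measurable]: "h \<in> borel_measurable borel" and h1: "\<And>z. cmod (h z) <= 1" for h
 proof -
  let ?h = "%g. f g * b (g - zemb (zcoord g)) * h (zcoord g)"
  have hi: "integrable lborel ?h"
  proof (rule Bochner_Integration.integrable_bound)
   show "integrable lborel (%g. B * norm (f g))" using f by auto
   have "norm (?h g) <= norm (f g) * B * 1" for g
    unfolding norm_mult by (intro mult_mono bd h1 order_refl) (auto intro: mult_nonneg_nonneg B0)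
   then show "AE g in lborel. norm (?h g) <= norm (B * norm (f g))"
    using B0 by (auto simp: mult.commute[of B])
  qed measurable
  have hm: "?h \<in> borel_measurable borel" by measurable
  have eq: "?h (\<Gamma> (fst p) + zemb (snd p)) = (%w z. f (\<Gamma> w + zemb z) * b (\<Gamma> w) * h z) (fst p) (snd p)"
   if "p \<in> space (A \<Otimes>\<^sub>M lborel)" for p
  proof -
   have "\<Gamma> (fst p) \<in> vspace" using that by (auto simp: space_pair_measure intro: frame_space[OF fr])
   then show ?thesis by (simp add: zcoord_sum)
  qed
  have "integrable (A \<Otimes>\<^sub>M lborel) (case_prod (%w z. f (\<Gamma> w + zemb z) * b (\<Gamma> w) * h z))"
   using hi unfolding vz_integral(2)[OF fr hm] case_prod_unfold
   by (subst Bochner_Integration.integrable_cong[OF refl eq[symmetric]]) auto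
  moreover have "(LINT g|lborel. ?h g) = (LINT p|(A \<Otimes>\<^sub>M lborel). case_prod (%w z. f (\<Gamma> w + zemb z) * b (\<Gamma> w) * h z) p)"
   unfolding vz_integral(1)[OF fr hm] case_prod_unfold
   by (rule Bochner_Integration.integral_cong[OF refl]) (rule eq)
  ultimately show ?thesis ..
 qed
 have "integrable lborel (%z. \<integral>w. f (\<Gamma> w + zemb z) * b (\<Gamma> w) * 1 \<partial>A)"
  by (rule AL.integrable_snd) (rule conjunct1[OF main], simp_all)
 then show "integrable lborel (vtest f b)" unfolding vt[abs_def] by simp
 show "(LINT z|lborel. vtest f b z * h z) = (LINT g|lborel. f g * b (g - zemb (zcoord g)) * h (zcoord g))"
  if h: "h \<in> borel_measurable borel" "\<And>z. cmod (h z) <= 1" for h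
  using AL.integral_snd[OF conjunct1[OF main[OF h]]] unfolding conjunct2[OF main[OF h]] vt by simp
 show "AE z in lborel. norm z < \<epsilon> \<longrightarrow> vtest f b z = 0" if van: "AE g in lborel. norm (zcoord g) < \<epsilon> \<longrightarrow> f g = 0"
 proof -
  define H where "H = (%g. ennreal (cmod (f g) * (if norm (zcoord g) < \<epsilon> then 1 else 0)))"
  have [measurable]: "H \<in> borel_measurable borel" unfolding H_def by measurable
  have "(\<integral>\<^sup>+g. H g \<partial>lborel) = (\<integral>\<^sup>+g. 0 \<partial>(lborel :: 'g measure))"
   by (rule nn_integral_cong_AE) (use van in \<open>auto simp: H_def elim!: AE_mp\<close>)
  then have Hp: "(\<integral>\<^sup>+p. H (\<Gamma> (fst p) + zemb (snd p)) \<partial>(A \<Otimes>\<^sub>M lborel)) = 0"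
   by (subst vz_nn_integral[OF fr, symmetric]) auto
  have "(\<integral>\<^sup>+z. \<integral>\<^sup>+w. H (\<Gamma> w + zemb z) \<partial>A \<partial>lborel) = 0"
  proof -
   have "(%p. H (\<Gamma> (fst p) + zemb (snd p))) \<in> borel_measurable (A \<Otimes>\<^sub>M lborel)" by measurable
   from AL.nn_integral_snd[OF this] show ?thesis using Hp by simp
  qed
  moreover have "(%z. \<integral>\<^sup>+w. H (\<Gamma> w + zemb z) \<partial>A) \<in> borel_measurable lborel"
   by (rule A.borel_measurable_nn_integral) measurable
  ultimately have "AE z in lborel. (\<integral>\<^sup>+w. H (\<Gamma> w + zemb z) \<partial>A) = 0"
   by (simp add: nn_integral_0_iff_AE)
  then show ?thesis
  proof (rule AE_mp, intro AE_I2 impI)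
   fix z :: "real ^ 'k" assume z: "(\<integral>\<^sup>+w. H (\<Gamma> w + zemb z) \<partial>A) = 0" "norm z < \<epsilon>"
   then have "AE w in A. H (\<Gamma> w + zemb z) = 0" by (subst (asm) nn_integral_0_iff_AE) auto
   moreover have "AE w in A. \<Gamma> w \<in> vspace" using frame_space[OF fr] by (auto intro: AE_I2)
   ultimately have "AE w in A. f (\<Gamma> w + zemb z) * b (\<Gamma> w) = 0"
    by eventually_elim (use z(2) in \<open>auto simp: H_def zcoord_sum ennreal_eq_0_iff split: if_splits\<close>)
   then have "(LINT w|A. f (\<Gamma> w + zemb z) * b (\<Gamma> w)) = (LINT w|A. 0)"
    by (intro integral_cong_AE) auto
   then show "vtest f b z = 0" by (simp add: vt)
  qed
 qed
qed

lemma abs_Pf_bound: "\<exists>K\<ge>0. \<forall>\<nu>. 1 <= norm \<nu> \<longrightarrow> \<bar>abs_Pf \<nu>\<bar> <= K * norm \<nu> ^ card Pset"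
proof -
 obtain B where B: "B > 0" "\<And>\<nu> x y. \<bar>bform \<nu> x y\<bar> <= B * norm \<nu> * norm x * norm y" using bform_bounded by blast
 have nV: "norm (V i) = 1" for i using V_orthonormal by (auto simp: orthonormal_on_def norm_eq_1)
 define c where "c = real (card {p. p permutes Pset})"
 show ?thesis
 proof (intro exI[of _ "1 + c * B ^ card Pset"] conjI allI impI)
  show "0 <= 1 + c * B ^ card Pset" using B(1) by (simp add: c_def)
  fix \<nu> :: "real ^ 'k" assume n1: "1 <= norm \<nu>"
  define s where "s = (\<Sum>p | p permutes Pset. of_int (sign p) * (\<Prod>i\<in>Pset. bform \<nu> (V i) (V (p i))))"
  have "\<bar>s\<bar> <= (\<Sum>p | p permutes Pset. (B * norm \<nu>) ^ card Pset)"
   unfolding s_def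
  proof (rule order_trans[OF sum_abs sum_mono])
   fix p
   have "\<bar>\<Prod>i\<in>Pset. bform \<nu> (V i) (V (p i))\<bar> <= (\<Prod>i\<in>Pset. B * norm \<nu>)"
    unfolding abs_prod using B(2)[of \<nu> "V _" "V _"] by (intro prod_mono) (auto simp: nV)
   then show "\<bar>real_of_int (sign p) * (\<Prod>i\<in>Pset. bform \<nu> (V i) (V (p i)))\<bar> <= (B * norm \<nu>) ^ card Pset"
    by (simp add: abs_mult sign_def)
  qed
  also have "... = c * B ^ card Pset * norm \<nu> ^ card Pset" by (simp add: c_def power_mult_distrib)
  finally have s: "\<bar>s\<bar> <= c * B ^ card Pset * norm \<nu> ^ card Pset" .
  have "\<bar>sqrt s\<bar> = sqrt \<bar>s\<bar>" by (simp add: real_sqrt_abs2 real_sqrt_minus abs_if)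
  also have "... <= 1 + \<bar>s\<bar>"
  proof (rule real_le_lsqrt)
   have "0 <= \<bar>s\<bar> + \<bar>s\<bar>\<^sup>2" by simp
   then show "\<bar>s\<bar> <= (1 + \<bar>s\<bar>)\<^sup>2" by (simp add: power2_sum)
  qed auto
  also have "... <= norm \<nu> ^ card Pset + c * B ^ card Pset * norm \<nu> ^ card Pset"
   using s one_le_power[OF n1, of "card Pset"] by linarith
  finally show "\<bar>abs_Pf \<nu>\<bar> <= (1 + c * B ^ card Pset) * norm \<nu> ^ card Pset"
   unfolding abs_Pf_def s_def by (simp add: algebra_simps)
 qed
qed

end

context two_step_reps
begin

text \<open>
 The coordinates \<open>\<mu>\<close> parametrise the radical redundantly or with a distortion. The image measure is translation
 invariant, hence a multiple of Lebesgue measure; comparing Gaussians shows that the factor is at least \<open>1\<close>, as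
 projections shorten vectors.
\<close>

lemma mu_pushforward:
 assumes \<nu>: "\<nu> \<in> Uset"
 obtains c where "1 <= c" "\<And>H. H \<in> borel_measurable (euc dim_r) ==>
  (\<integral>\<^sup>+\<mu>. H (mtil \<mu> \<nu>) \<partial>mu_measure) = c * (\<integral>\<^sup>+m. H m \<partial>euc dim_r)"
proof -
 define w where "w = (%q. \<Sum>i<dim_r. (V q \<bullet> U \<nu> i) *\<^sub>R U \<nu> i)"
 define L where "L = (%\<mu>. \<Sum>q\<in>Qset. \<mu> q *\<^sub>R w q)"
 have Lm: "L \<mu> = (\<Sum>i<dim_r. mu_tilde \<mu> \<nu> i *\<^sub>R U \<nu> i)" for \<mu>
  unfolding L_def w_def mu_tilde_def scaleR_sum_right scaleR_sum_left by (subst sum.swap) simp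
 note on = U_orthonormal[OF \<nu>]
 have LU: "L \<mu> \<bullet> U \<nu> i = mu_tilde \<mu> \<nu> i" if "i < dim_r" for \<mu> i
  unfolding Lm using orthonormal_sum_inner[OF on, of i "mu_tilde \<mu> \<nu>"] that by simp
 have shi: "shift_invariant mu_measure L (radical \<nu>)"
  unfolding mu_measure_def
  by (rule shift_invariant_PiM[of Qset L w])
   (use radical_projections_span[OF \<nu> on _ U_span[OF \<nu>]] in \<open>simp_all add: L_def w_def\<close>)
 have fr: "frame (euc dim_r) (%m. \<Sum>i<dim_r. m i *\<^sub>R U \<nu> i) (radical \<nu>)"
  using frame_PiM[OF _ on] U_span[OF \<nu>] by simp
 define c where "c = (\<integral>\<^sup>+\<mu>. ennreal (gauss (L \<mu>)) \<partial>mu_measure)"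
 show ?thesis
 proof (rule that[of c])
  define v where "v = (%\<mu>. \<Sum>q\<in>Qset. \<mu> q *\<^sub>R V q)"
  have "frame mu_measure v (span (V ` Qset))" unfolding mu_measure_def v_def
   using V_orthonormal by (intro frame_PiM) (auto simp: orthonormal_on_def)
  then have "1 = (\<integral>\<^sup>+\<mu>. ennreal (gauss (v \<mu>)) \<partial>mu_measure)" by (simp add: frame_def)
  also have "... <= c" unfolding c_def
  proof (intro nn_integral_mono ennreal_leI)
   fix \<mu>
   have "(norm (L \<mu>))\<^sup>2 = (\<Sum>i<dim_r. (mu_tilde \<mu> \<nu> i)\<^sup>2)" unfolding Lm by (rule orthonormal_sum_norm[OF on]) simp
   also have "... = L \<mu> \<bullet> v \<mu>"
   proof -
    have "mu_tilde \<mu> \<nu> i = v \<mu> \<bullet> U \<nu> i" for i unfolding mu_tilde_def v_def by (simp add: inner_sum_left)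
    moreover have "L \<mu> \<bullet> v \<mu> = (\<Sum>i<dim_r. mu_tilde \<mu> \<nu> i * (v \<mu> \<bullet> U \<nu> i))"
     unfolding Lm by (simp add: inner_sum_left inner_commute[of "U \<nu> _"])
    ultimately show ?thesis by (simp add: power2_eq_square)
   qed
   also have "... <= norm (L \<mu>) * norm (v \<mu>)" by (rule norm_cauchy_schwarz)
   finally have "norm (L \<mu>) <= norm (v \<mu>)"
    unfolding power2_eq_square by (cases "L \<mu> = 0") (auto simp: mult_le_cancel_left)
   then show "gauss (v \<mu>) <= gauss (L \<mu>)" unfolding gauss_def by (simp add: power_mono)
  qed
  finally show "1 <= c" .
  fix H :: "(nat => real) => ennreal" assume H: "H \<in> borel_measurable (euc dim_r)"
  define h where "h = (%x::'g. H (\<lambda>i\<in>{..<dim_r}. x \<bullet> U \<nu> i))"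
  have hm: "h \<in> borel_measurable borel" unfolding h_def
   by (rule measurable_compose[OF euc_restrict_measurable H]) measurable
  have "(\<integral>\<^sup>+\<mu>. h (L \<mu>) \<partial>mu_measure) = c * (\<integral>\<^sup>+m. h (\<Sum>i<dim_r. m i *\<^sub>R U \<nu> i) \<partial>euc dim_r)"
   unfolding c_def by (rule shift_invariant_unique[OF shi fr radical_subspace hm])
  moreover have "h (L \<mu>) = H (mtil \<mu> \<nu>)" for \<mu>
   unfolding h_def mtil_def by (rule arg_cong[of _ _ H]) (auto simp: LU fun_eq_iff)
  moreover have "h (\<Sum>i<dim_r. m i *\<^sub>R U \<nu> i) = H m" if "m \<in> space (euc dim_r)" for m
   unfolding h_def by (rule arg_cong[of _ _ H])
    (use that orthonormal_sum_inner[OF on] in \<open>auto simp: fun_eq_iff space_PiM PiE_def extensional_def\<close>)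
  ultimately show "(\<integral>\<^sup>+\<mu>. H (mtil \<mu> \<nu>) \<partial>mu_measure) = c * (\<integral>\<^sup>+m. H m \<partial>euc dim_r)"
   by (simp cong: nn_integral_cong)
 qed
qed

lemma hs_mass_measurable:
 assumes \<nu>: "\<nu> \<in> Uset" and f: "f \<in> borel_measurable borel"
 shows "hs_mass f \<nu> \<in> borel_measurable (euc dim_r)"
proof -
 interpret N: sigma_finite_measure "euc dim_n" by (rule euc_sigma_finite)
 have m: "(%p. vfourier f \<nu> (Gam \<nu> p)) \<in> borel_measurable (euc3 dim_n dim_r)"
  by (intro vfourier_measurable'[OF f] frame_measurable[OF Gam_frame[OF \<nu>]]) simp
 note [measurable (raw)] = partial_ft_measurable'[OF m]
 show ?thesis unfolding hs_mass_def[abs_def] by measurable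
qed

lemma vfourier_Gam_integrable:
 assumes "\<nu> \<in> Uset" "integrable lborel f"
 shows "integrable (euc3 dim_n dim_r) (%p. vfourier f \<nu> (Gam \<nu> p))"
 using vfourier_frame(1)[OF Gam_frame[OF assms(1)] assms(2), of "%_. 1" 1] by simp

lemma hs_mass_total:
 assumes "\<nu> \<in> Uset" "integrable lborel f"
 shows "(\<integral>\<^sup>+m. hs_mass f \<nu> m \<partial>euc dim_r)
  <= (\<integral>\<^sup>+p. sqnorm (vfourier f \<nu> (Gam \<nu> p)) \<partial>(euc3 dim_n dim_r))"
 unfolding hs_mass_def by (rule partial_ft_L2[OF vfourier_Gam_integrable[OF assms]])

text \<open>
 The formula for \<open>pi_hs\<close> requires \<open>hs_mass\<close> to be finite. By the finiteness of its integral this holds for almost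
 every frequency, and thus for almost every \<open>\<mu>\<close>.
\<close>

lemma hs_mass_bound:
 assumes \<nu>: "\<nu> \<in> Uset" and f: "integrable lborel f"
  and fin: "(\<integral>\<^sup>+p. sqnorm (vfourier f \<nu> (Gam \<nu> p)) \<partial>(euc3 dim_n dim_r)) < \<infinity>"
  and H: "H \<in> borel_measurable (completion mu_measure)" and c: "0 <= c"
  and bd: "\<And>\<mu>. \<mu> \<in> Qset \<rightarrow>\<^sub>E UNIV ==> pi_hs \<mu> \<nu> f <= ennreal (c * cmod (H \<mu>))"
 shows "(\<integral>\<^sup>+m. hs_mass f \<nu> m \<partial>euc dim_r)
  <= ennreal ((\<Prod>j<dim_n. d \<nu> j) * c\<^sup>2) * (\<integral>\<^sup>+\<mu>. sqnorm (H \<mu>) \<partial>completion mu_measure)"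
proof -
 let ?D = "\<Prod>j<dim_n. d \<nu> j"
 have D0: "0 <= ?D" by (intro prod_nonneg) (auto intro: less_imp_le d_pos[OF \<nu>])
 obtain k where k: "1 <= k" "\<And>H. H \<in> borel_measurable (euc dim_r) ==>
  (\<integral>\<^sup>+\<mu>. H (mtil \<mu> \<nu>) \<partial>mu_measure) = k * (\<integral>\<^sup>+m. H m \<partial>euc dim_r)" by (rule mu_pushforward[OF \<nu>]) blast
 have hm[measurable]: "hs_mass f \<nu> \<in> borel_measurable (euc dim_r)" by (rule hs_mass_measurable[OF \<nu>]) (use f in simp)
 have "(\<integral>\<^sup>+m. hs_mass f \<nu> m \<partial>euc dim_r) ~= \<infinity>" using hs_mass_total[OF \<nu> f] fin by auto
 then have "AE m in euc dim_r. hs_mass f \<nu> m ~= \<infinity>" by (intro nn_integral_noteq_infinite hm)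
 then have z: "(\<integral>\<^sup>+m. (if hs_mass f \<nu> m = \<infinity> then 1 else 0) \<partial>euc dim_r) = 0"
  by (subst nn_integral_0_iff_AE) auto
 have mtm: "(%\<mu>. mtil \<mu> \<nu>) \<in> mu_measure \<rightarrow>\<^sub>M euc dim_r"
  unfolding mtil_def
 proof (rule euc_restrict_measurable)
  show "(%\<mu>. mu_tilde \<mu> \<nu> i) \<in> borel_measurable mu_measure" for i
   unfolding mu_tilde_def mu_measure_def
  proof (rule borel_measurable_sum)
   fix j assume "j \<in> Qset"
   then have [measurable]: "(%\<mu>. \<mu> j) \<in> borel_measurable (Pi\<^sub>M Qset (%_. lborel :: real measure))"
    using measurable_component_singleton[of j Qset "%_. lborel :: real measure"] by simp
   show "(%\<mu>. \<mu> j * (V j \<bullet> U \<nu> i)) \<in> borel_measurable (Pi\<^sub>M Qset (%_. lborel))" by measurable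
  qed
 qed
 have "(\<integral>\<^sup>+\<mu>. (if hs_mass f \<nu> (mtil \<mu> \<nu>) = \<infinity> then 1 else 0) \<partial>mu_measure) = 0"
  using k(2)[of "%m. if hs_mass f \<nu> m = \<infinity> then 1 else 0"] z by simp
 moreover have hmt: "(%\<mu>. hs_mass f \<nu> (mtil \<mu> \<nu>)) \<in> borel_measurable mu_measure" by (rule measurable_compose[OF mtm hm])
 ultimately have ae: "AE \<mu> in mu_measure. hs_mass f \<nu> (mtil \<mu> \<nu>) ~= \<infinity>"
  by (subst (asm) nn_integral_0_iff_AE) (auto split: if_splits)
 have "(\<integral>\<^sup>+m. hs_mass f \<nu> m \<partial>euc dim_r) <= k * (\<integral>\<^sup>+m. hs_mass f \<nu> m \<partial>euc dim_r)"
  using mult_right_mono[OF k(1), of "\<integral>\<^sup>+m. hs_mass f \<nu> m \<partial>euc dim_r"] by simp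
 also have "... = (\<integral>\<^sup>+\<mu>. hs_mass f \<nu> (mtil \<mu> \<nu>) \<partial>mu_measure)" using k(2)[OF hm] by simp
 also have "... <= (\<integral>\<^sup>+\<mu>. ennreal (?D * c\<^sup>2) * sqnorm (H \<mu>) \<partial>mu_measure)"
 proof (rule nn_integral_mono_AE)
  have "AE \<mu> in mu_measure. \<mu> \<in> space mu_measure" by simp
  with ae show "AE \<mu> in mu_measure. hs_mass f \<nu> (mtil \<mu> \<nu>) <= ennreal (?D * c\<^sup>2) * sqnorm (H \<mu>)"
  proof eventually_elim
   case (elim \<mu>)
   then have "\<mu> \<in> Qset \<rightarrow>\<^sub>E UNIV" by (simp add: mu_measure_def space_PiM)
   have "hs_mass f \<nu> (mtil \<mu> \<nu>) = ennreal ?D * (pi_hs \<mu> \<nu> f)\<^sup>2"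
    by (rule pi_hs_square[OF \<nu> f, symmetric]) (use elim in \<open>simp add: less_top\<close>)
   also have "... <= ennreal ?D * (ennreal (c * cmod (H \<mu>)))\<^sup>2"
    by (intro mult_left_mono power_mono bd) (fact, simp_all)
   also have "... = ennreal (?D * c\<^sup>2) * sqnorm (H \<mu>)"
    using D0 c by (simp add: ennreal_power power_mult_distrib mult_ac flip: ennreal_mult)
   finally show ?case .
  qed
 qed
 also have "... = (\<integral>\<^sup>+\<mu>. ennreal (?D * c\<^sup>2) * sqnorm (H \<mu>) \<partial>completion mu_measure)"
  by (rule nn_integral_completion[symmetric])
 also have "... = ennreal (?D * c\<^sup>2) * (\<integral>\<^sup>+\<mu>. sqnorm (H \<mu>) \<partial>completion mu_measure)"
  by (rule nn_integral_cmult) (use H in measurable)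
 finally show ?thesis .
qed

lemma Gam_surj:
 assumes \<nu>: "\<nu> \<in> Uset" and v: "v \<in> vspace"
 shows "Gam \<nu> ((\<lambda>j\<in>{..<dim_n}. v \<bullet> X \<nu> j, \<lambda>j\<in>{..<dim_r}. v \<bullet> U \<nu> j), \<lambda>j\<in>{..<dim_n}. v \<bullet> Y \<nu> j) = v"
proof -
 let ?q = "((\<lambda>j\<in>{..<dim_n}. v \<bullet> X \<nu> j, \<lambda>j\<in>{..<dim_r}. v \<bullet> U \<nu> j), \<lambda>j\<in>{..<dim_n}. v \<bullet> Y \<nu> j)"
 define e where "e = v - Gam \<nu> ?q"
 have "Gam \<nu> ?q \<in> vspace"
  by (rule frame_space[OF Gam_frame[OF \<nu>]]) (auto simp: space_pair_measure space_PiM)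
 then have ev: "e \<in> vspace" unfolding e_def by (intro subspace_diff vspace_subspace v)
 have o: "e \<bullet> X \<nu> j = 0" "e \<bullet> Y \<nu> j = 0" if "j < dim_n" for j
  unfolding e_def inner_diff_left using that \<nu> by (simp_all add: Gam_X Gam_Y)
 have o2: "e \<bullet> U \<nu> j = 0" if "j < dim_r" for j
  unfolding e_def inner_diff_left using that \<nu> by (simp add: Gam_U)
 have "e \<bullet> s = 0" if "s \<in> span (X \<nu> ` {..<dim_n} \<union> Y \<nu> ` {..<dim_n} \<union> U \<nu> ` {..<dim_r})" for s
  using that by (induction rule: span_induct_alt) (auto simp: inner_add_right o o2)
 then have "e \<bullet> e = 0" using ev unfolding frame_span[OF \<nu>] by blast
 then show ?thesis by (simp add: e_def)
qed

lemma Gam_dist: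
 assumes \<nu>: "\<nu> \<in> Uset"
 shows "(norm (Gam \<nu> ((x, u), y) - Gam \<nu> ((a, b), c)))\<^sup>2
  = ((\<Sum>j<dim_n. (a j - x j)\<^sup>2) + (\<Sum>j<dim_r. (b j - u j)\<^sup>2)) + (\<Sum>j<dim_n. (y j - c j)\<^sup>2)"
proof -
 let ?G = "Gam \<nu> ((%j. x j - a j, %j. u j - b j), %j. y j - c j)"
 have "Gam \<nu> ((x, u), y) - Gam \<nu> ((a, b), c) = ?G"
  unfolding Gam_def by (simp add: scaleR_diff_left sum_subtractf)
 moreover have G1: "?G \<bullet> ?G = ((\<Sum>j<dim_n. (x j - a j) * (?G \<bullet> X \<nu> j)) + (\<Sum>j<dim_r. (u j - b j) * (?G \<bullet> U \<nu> j)))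
   + (\<Sum>j<dim_n. (y j - c j) * (?G \<bullet> Y \<nu> j))"
 proof -
  have "g \<bullet> ?G = ((\<Sum>j<dim_n. (x j - a j) * (g \<bullet> X \<nu> j)) + (\<Sum>j<dim_r. (u j - b j) * (g \<bullet> U \<nu> j)))
   + (\<Sum>j<dim_n. (y j - c j) * (g \<bullet> Y \<nu> j))" for g
   unfolding Gam_def by (simp add: inner_add_right inner_sum_right)
  then show ?thesis .
 qed
 moreover have "?G \<bullet> ?G = ((\<Sum>j<dim_n. (a j - x j)\<^sup>2) + (\<Sum>j<dim_r. (b j - u j)\<^sup>2)) + (\<Sum>j<dim_n. (y j - c j)\<^sup>2)"
  by (subst G1) (use \<nu> in \<open>simp add: Gam_X Gam_Y Gam_U power2_eq_square algebra_simps\<close>)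
 ultimately show ?thesis by (simp only: power2_norm_eq_inner)
qed

definition gtest :: "'g => real => 'g => complex" where
 "gtest a t v = of_real (exp (- pi * (norm (v - a))\<^sup>2 / t))"

lemma gtest_measurable[measurable]: "gtest a t \<in> borel_measurable borel"
 unfolding gtest_def[abs_def] by measurable

lemma gtest_le_1: "0 < t ==> cmod (gtest a t v) <= 1"
 unfolding gtest_def by simp

lemma fourier_vtest:
 assumes "integrable lborel f" "b \<in> borel_measurable borel" "\<And>v. cmod (b v) <= B"
 shows "fourier (vtest f b) \<nu> = (LINT g|lborel. f g * b (g - zemb (zcoord g)) * cis (- (2 * pi * (\<nu> \<bullet> zcoord g))))"
 unfolding fourier_def by (rule vtest_properties(2)[OF assms]) simp_all

text \<open>
 Computed in the frame of \<open>\<nu>\<close>, the transform at \<open>\<nu>\<close> of the Gaussian average is the integral of the partial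
 transform of \<open>f\<close> against a product Gaussian, because the frame is orthonormal.
\<close>

lemma fourier_vtest_bound:
 assumes t: "0 < t"
 obtains \<kappa> where "0 <= \<kappa>" "\<And>f a \<nu>. integrable lborel f ==> a \<in> vspace ==> \<nu> \<in> Uset ==>
  sqnorm (fourier (vtest f (gtest a t)) \<nu>) <= ennreal \<kappa> * (\<integral>\<^sup>+m. hs_mass f \<nu> m \<partial>euc dim_r)"
proof -
 obtain \<kappa> where k: "0 <= \<kappa>"
  "\<And>w a b c. integrable (euc3 dim_n dim_r) w ==> a \<in> space (euc dim_n) ==> b \<in> space (euc dim_r) ==> c \<in> space (euc dim_n) ==>
   sqnorm (\<integral>((x, u), y). w ((x, u), y) * of_real (exp (- pi * (((\<Sum>j<dim_n. (a j - x j)\<^sup>2) + (\<Sum>j<dim_r. (b j - u j)\<^sup>2))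
     + (\<Sum>j<dim_n. (y j - c j)\<^sup>2)) / t)) \<partial>(euc3 dim_n dim_r))
    <= ennreal \<kappa> * (\<integral>\<^sup>+m. \<integral>\<^sup>+y. \<integral>\<^sup>+s. sqnorm (partial_ft dim_n dim_r w s m y) \<partial>euc dim_n \<partial>euc dim_n \<partial>euc dim_r)"
  by (rule gauss_test_bound[OF t, of dim_n dim_r]) blast
 show ?thesis
 proof (rule that[OF k(1)])
  fix f :: "'g => complex" and a :: 'g and \<nu> :: "real ^ 'k" assume f: "integrable lborel f" and a: "a \<in> vspace" and \<nu>: "\<nu> \<in> Uset"
  let ?A = "euc3 dim_n dim_r"
  let ?a = "\<lambda>j\<in>{..<dim_n}. a \<bullet> X \<nu> j" and ?b = "\<lambda>j\<in>{..<dim_r}. a \<bullet> U \<nu> j" and ?c = "\<lambda>j\<in>{..<dim_n}. a \<bullet> Y \<nu> j"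
  have "fourier (vtest f (gtest a t)) \<nu> = (LINT g|lborel. f g * gtest a t (g - zemb (zcoord g)) * cis (- (2 * pi * (\<nu> \<bullet> zcoord g))))"
   by (rule fourier_vtest[OF f _ gtest_le_1[OF t]]) simp
  also have "... = (LINT p|?A. vfourier f \<nu> (Gam \<nu> p) * gtest a t (Gam \<nu> p))"
   by (rule vfourier_frame(2)[OF Gam_frame[OF \<nu>] f _ gtest_le_1[OF t], symmetric]) simp
  also have "(%p. vfourier f \<nu> (Gam \<nu> p) * gtest a t (Gam \<nu> p)) = (%((x, u), y). vfourier f \<nu> (Gam \<nu> ((x, u), y)) *
    of_real (exp (- pi * (((\<Sum>j<dim_n. (?a j - x j)\<^sup>2) + (\<Sum>j<dim_r. (?b j - u j)\<^sup>2))
     + (\<Sum>j<dim_n. (y j - ?c j)\<^sup>2)) / t)))"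
  proof (rule ext)
   fix p :: "((nat => real) \<times> (nat => real)) \<times> (nat => real)"
   obtain x u y where p: "p = ((x, u), y)" by (metis surj_pair)
   have "gtest a t (Gam \<nu> ((x, u), y)) = of_real (exp (- pi * (norm (Gam \<nu> ((x, u), y) - Gam \<nu> ((?a, ?b), ?c)))\<^sup>2 / t))"
    unfolding gtest_def Gam_surj[OF \<nu> a] ..
   then show "vfourier f \<nu> (Gam \<nu> p) * gtest a t (Gam \<nu> p) = (case p of (xa, y) => (case xa of (x, u) => %y. vfourier f \<nu> (Gam \<nu> ((x, u), y)) *
    of_real (exp (- pi * (((\<Sum>j<dim_n. (?a j - x j)\<^sup>2) + (\<Sum>j<dim_r. (?b j - u j)\<^sup>2))
     + (\<Sum>j<dim_n. (y j - ?c j)\<^sup>2)) / t))) y)"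
    unfolding p case_prod_conv Gam_dist[OF \<nu>] by (rule arg_cong)
  qed
  finally have e: "fourier (vtest f (gtest a t)) \<nu> = integral\<^sup>L ?A ..." .
  show "sqnorm (fourier (vtest f (gtest a t)) \<nu>) <= ennreal \<kappa> * (\<integral>\<^sup>+m. hs_mass f \<nu> m \<partial>euc dim_r)"
   unfolding e hs_mass_def
   by (rule k(2)[OF vfourier_Gam_integrable[OF \<nu> f]]) (simp_all add: space_PiM PiE_iff extensional_def)
 qed
qed

text \<open>
 A function all of whose Gaussian averages over \<open>\<vv>\<close> vanish is zero: a product of a Gaussian on \<open>\<vv>\<close> and one
 on \<open>\<zz>\<close> of the same width is a Gaussian on \<open>\<gg>\<close>.
\<close>

lemma vtest_zero:
 assumes f: "integrable lborel f"
  and z: "\<And>a t. a \<in> vspace ==> 0 < t ==> AE z in lborel. vtest f (gtest a t) z = 0"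
 shows "AE x in lborel. f x = 0"
proof (rule mollify_zero[OF f, of "%x. of_real (gauss x)" "%n. 1 / real (Suc n)"])
 show "integrable lborel (%x::'g. complex_of_real (gauss x))" using gauss_integrable_lborel by auto
 have "(LINT x|lborel. gauss (x :: 'g)) = enn2real (\<integral>\<^sup>+x. ennreal (gauss (x :: 'g)) \<partial>lborel)"
  by (rule integral_eq_nn_integral) (auto simp: gauss_nonneg)
 then show "(LINT x|lborel. complex_of_real (gauss (x :: 'g))) ~= 0" by (simp add: gauss_mass_lborel)
 show "(%n. 1 / real (Suc n)) \<longlonglongrightarrow> 0" by (rule LIMSEQ_Suc[OF lim_1_over_n])
 show "(LINT y|lborel. f y * complex_of_real (gauss ((1 / (1 / real (Suc n))) *\<^sub>R (g0 - y)))) = 0" for n and g0 :: 'g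
 proof -
  define t where "t = (1 / real (Suc n))\<^sup>2"
  have t: "0 < t" by (simp add: t_def)
  define z0 where "z0 = zcoord g0"
  define a where "a = g0 - zemb z0"
  have vp: "g - zemb (zcoord g) \<in> vspace" for g :: 'g
  proof -
   have "g \<in> span (range V \<union> range Z)" using basis by simp
   then obtain u v where uv: "g = u + v" "u \<in> span (range V)" "v \<in> span (range Z)" unfolding span_Un by auto
   have u: "u \<in> vspace" using uv by (simp add: vspace_def)
   have "(\<Sum>j\<in>UNIV. (v \<bullet> Z j) *\<^sub>R Z j) = v" by (rule orthonormal_expansion[OF Z_orthonormal finite uv(3)])
   then have "v = zemb (zcoord v)" unfolding zemb_def zcoord_def by simp
   then have "zemb (zcoord g) = v" unfolding uv(1) linear_add[OF zcoord_linear] zcoord_vspace[OF u] by simp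
   then show ?thesis using u uv(1) by simp
  qed
  have a: "a \<in> vspace" unfolding a_def z0_def by (rule vp)
  let ?h = "%z. complex_of_real (exp (- pi * (norm (z0 - z))\<^sup>2 / t))"
  have split: "complex_of_real (gauss ((1 / (1 / real (Suc n))) *\<^sub>R (g0 - g)))
    = gtest a t (g - zemb (zcoord g)) * ?h (zcoord g)" for g
  proof -
   define v where "v = (g - zemb (zcoord g)) - a"
   have v: "v \<in> vspace" unfolding v_def by (intro subspace_diff vspace_subspace vp a)
   have "g0 - g = - v + zemb (z0 - zcoord g)" unfolding v_def a_def linear_diff[OF zemb_linear] by simp
   then have "(norm (g0 - g))\<^sup>2 = (norm v)\<^sup>2 + (norm (z0 - zcoord g))\<^sup>2"
    using vspace_zemb[OF v, of "z0 - zcoord g"] arg_cong[OF norm_zemb[of "z0 - zcoord g"], of "%x. x\<^sup>2"]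
    by (simp add: power2_norm_eq_inner inner_diff_left inner_diff_right inner_commute[of "zemb _" v])
   moreover have "gauss ((1 / (1 / real (Suc n))) *\<^sub>R (g0 - g)) = exp (- pi * (norm (g0 - g))\<^sup>2 / t)"
    unfolding gauss_def t_def norm_scaleR power_mult_distrib by (simp add: power_divide mult_ac del: of_nat_Suc)
   ultimately have "gauss ((1 / (1 / real (Suc n))) *\<^sub>R (g0 - g)) = exp (- pi * (norm v)\<^sup>2 / t) * exp (- pi * (norm (z0 - zcoord g))\<^sup>2 / t)"
    unfolding exp_add[symmetric] by (simp add: algebra_simps add_divide_distrib diff_divide_distrib)
   then show ?thesis unfolding gtest_def v_def of_real_mult[symmetric] by simp
  qed
  have "(LINT y|lborel. f y * complex_of_real (gauss ((1 / (1 / real (Suc n))) *\<^sub>R (g0 - y))))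
   = (LINT y|lborel. f y * gtest a t (y - zemb (zcoord y)) * ?h (zcoord y))"
   by (simp only: split mult.assoc)
  also have "... = (LINT z|lborel. vtest f (gtest a t) z * ?h z)"
   by (rule vtest_properties(2)[OF f gtest_measurable gtest_le_1[OF t], symmetric]) (use t in auto)
  also have "... = (LINT z|(lborel :: (real ^ 'k) measure). 0)"
  proof (rule integral_cong_AE)
   have "integrable lborel (vtest f (gtest a t))"
    by (rule vtest_properties(1)[OF f gtest_measurable gtest_le_1[OF t]])
   then have [measurable]: "vtest f (gtest a t) \<in> borel_measurable borel" by simp
   show "(%z. vtest f (gtest a t) z * ?h z) \<in> borel_measurable lborel" by measurable
   show "AE z in lborel. vtest f (gtest a t) z * ?h z = 0" using z[OF a t] by eventually_elim simp
  qed simp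
  finally show ?thesis by simp
 qed
qed simp

lemma pfaffian_bound:
 assumes \<nu>: "\<nu> \<in> Uset" and B: "\<And>\<nu> x y. \<bar>bform \<nu> x y\<bar> <= B * norm \<nu> * norm x * norm y"
 shows "(\<Prod>j<dim_n. d \<nu> j) <= (B * norm \<nu>) ^ dim_n"
proof -
 have "(\<Prod>j<dim_n. d \<nu> j) <= (\<Prod>j<dim_n. B * norm \<nu>)"
 proof (rule prod_mono, intro conjI)
  fix j assume j: "j \<in> {..<dim_n}"
  then show "0 <= d \<nu> j" using d_pos[OF \<nu>] by (auto intro: less_imp_le)
  have "norm (X \<nu> j) = 1" "norm (Y \<nu> j) = 1"
   using X_orthonormal[OF \<nu>] Y_orthonormal[OF \<nu>] j by (auto simp: orthonormal_on_def norm_eq_1)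
  then show "d \<nu> j <= B * norm \<nu>" using B[of \<nu> "X \<nu> j" "Y \<nu> j"] bform_X_Y[OF \<nu>, of j j] j by simp
 qed
 then show ?thesis by simp
qed

theorem uniqueness:
 fixes f :: "'g => complex" and H :: "('m => real) => complex"
 assumes \<theta>: "\<And>t. 0 <= \<theta> t" "radial_decreasing \<theta>" and div: "theta_integral \<theta> = \<infinity>"
  and f: "integrable lborel f" "f \<in> L2 lborel" and H: "H \<in> L2 (completion mu_measure)"
  and bd: "\<And>\<mu> \<nu>. \<mu> \<in> Qset \<rightarrow>\<^sub>E UNIV ==> \<nu> \<in> Uset ==>
   pi_hs \<mu> \<nu> f <= ennreal (C * cmod (H \<mu>) * sqrt (abs_Pf \<nu>) * exp (- norm \<nu> * \<theta> \<nu>))"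
  and \<epsilon>: "0 < \<epsilon>" and van: "AE x in lborel. norm (zcoord x) < \<epsilon> \<longrightarrow> f x = 0"
 shows "AE x in lborel. f x = 0"
proof (rule vtest_zero[OF f(1)])
 fix a :: 'g and t :: real assume a: "a \<in> vspace" and t: "0 < t"
 obtain g where g: "\<And>t. \<theta> t = g (norm t)" and dec: "\<And>s t. 0 <= s ==> s <= t ==> g t <= g s"
  using \<theta>(2) unfolding radial_decreasing_def by auto
 have gnn: "0 <= g s" if "0 <= s" for s
  using \<theta>(1)[of "s *\<^sub>R axis undefined 1"] that by (simp add: g norm_axis_1)
 have ndiv: "\<not> summable (%n. g (real (Suc n)) / real (Suc n))"
 proof -
  have "summable (%n. g (real (Suc n)) / real (Suc n)) \<longleftrightarrow> theta_integral \<theta> < \<infinity>"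
   by (rule theta_integral_shells) (fact \<theta>(1), fact g, fact dec)
  then show ?thesis using div by simp
 qed
 obtain \<kappa> where \<kappa>: "0 <= \<kappa>" "\<And>f a \<nu>. integrable lborel f ==> a \<in> vspace ==> \<nu> \<in> Uset ==>
  sqnorm (fourier (vtest f (gtest a t)) \<nu>) <= ennreal \<kappa> * (\<integral>\<^sup>+m. hs_mass f \<nu> m \<partial>euc dim_r)"
  by (rule fourier_vtest_bound[OF t]) blast
 obtain B where B: "B > 0" "\<And>\<nu> x y. \<bar>bform \<nu> x y\<bar> <= B * norm \<nu> * norm x * norm y" using bform_bounded by blast
 obtain K where K: "0 <= K" "\<And>\<nu>. 1 <= norm \<nu> ==> \<bar>abs_Pf \<nu>\<bar> <= K * norm \<nu> ^ card Pset" using abs_Pf_bound by blast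
 define I where "I = (LINT \<mu>|(completion mu_measure). (cmod (H \<mu>))\<^sup>2)"
 have I0: "0 <= I" unfolding I_def by (rule Bochner_Integration.integral_nonneg) simp
 have HI: "(\<integral>\<^sup>+\<mu>. sqnorm (H \<mu>) \<partial>completion mu_measure) = ennreal I"
  unfolding I_def by (rule L2_nn_integral[OF H])
 define N where "N = dim_n + card Pset"
 define M where "M = \<kappa> * (B ^ dim_n * (C\<^sup>2 * K) * I)"
 have M0: "0 <= M" unfolding M_def using \<kappa>(1) B(1) K(1) I0 by simp
 have decay: "cmod (fourier (vtest f (gtest a t)) \<nu>) <= sqrt M * norm \<nu> ^ N * exp (- norm \<nu> * g (norm \<nu>))"
  if \<nu>: "\<nu> \<in> Uset" and n1: "1 <= norm \<nu>"
   and fin: "(\<integral>\<^sup>+p. sqnorm (vfourier f \<nu> (Gam \<nu> p)) \<partial>(euc3 dim_n dim_r)) < \<infinity>" for \<nu>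
 proof -
  define E where "E = exp (- norm \<nu> * \<theta> \<nu>)"
  define c where "c = \<bar>C\<bar> * sqrt \<bar>abs_Pf \<nu>\<bar> * E"
  have E0: "0 < E" by (simp add: E_def)
  have c0: "0 <= c" unfolding c_def using E0 by simp
  let ?D = "\<Prod>j<dim_n. d \<nu> j"
  have D0: "0 <= ?D" by (intro prod_nonneg) (auto intro: less_imp_le d_pos[OF \<nu>])
  have D: "?D <= (B * norm \<nu>) ^ dim_n" by (rule pfaffian_bound[OF \<nu> B(2)])
  have hb: "pi_hs \<mu> \<nu> f <= ennreal (c * cmod (H \<mu>))" if \<mu>: "\<mu> \<in> Qset \<rightarrow>\<^sub>E UNIV" for \<mu>
  proof (rule order_trans[OF bd[OF \<mu> \<nu>] ennreal_leI])
   have "C * sqrt (abs_Pf \<nu>) <= \<bar>C\<bar> * sqrt \<bar>abs_Pf \<nu>\<bar>"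
   proof -
    have "\<bar>sqrt (abs_Pf \<nu>)\<bar> = sqrt \<bar>abs_Pf \<nu>\<bar>" by (simp add: abs_if real_sqrt_minus)
    then show ?thesis using abs_ge_self[of "C * sqrt (abs_Pf \<nu>)"] by (simp add: abs_mult)
   qed
   then have "(C * sqrt (abs_Pf \<nu>)) * (cmod (H \<mu>) * E) <= (\<bar>C\<bar> * sqrt \<bar>abs_Pf \<nu>\<bar>) * (cmod (H \<mu>) * E)"
    using E0 by (intro mult_right_mono) auto
   then show "C * cmod (H \<mu>) * sqrt (abs_Pf \<nu>) * exp (- norm \<nu> * \<theta> \<nu>) <= c * cmod (H \<mu>)"
    unfolding c_def E_def by (simp only: mult_ac)
  qed
  have "sqnorm (fourier (vtest f (gtest a t)) \<nu>) <= ennreal \<kappa> * (ennreal (?D * c\<^sup>2) * ennreal I)"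
   using order_trans[OF \<kappa>(2)[OF f(1) a \<nu>] mult_left_mono[OF hs_mass_bound[OF \<nu> f(1) fin L2_measurable[OF H] c0 hb]]]
   unfolding HI by simp
  also have "... = ennreal (\<kappa> * (?D * c\<^sup>2 * I))"
   using \<kappa>(1) D0 I0 by (simp add: ennreal_mult)
  finally have "(cmod (fourier (vtest f (gtest a t)) \<nu>))\<^sup>2 <= \<kappa> * (?D * c\<^sup>2 * I)"
   using \<kappa>(1) D0 I0 by (subst (asm) ennreal_le_iff) auto
  also have "... <= \<kappa> * ((B * norm \<nu>) ^ dim_n * (C\<^sup>2 * (K * norm \<nu> ^ card Pset) * E\<^sup>2) * I)"
  proof -
   have "c\<^sup>2 = C\<^sup>2 * \<bar>abs_Pf \<nu>\<bar> * E\<^sup>2" unfolding c_def by (simp add: power_mult_distrib)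
   also have "... <= C\<^sup>2 * (K * norm \<nu> ^ card Pset) * E\<^sup>2" by (intro mult_right_mono mult_left_mono K(2)[OF n1]) auto
   finally show ?thesis using \<kappa>(1) B(1) I0 D0 D by (intro mult_left_mono mult_right_mono mult_mono) auto
  qed
  also have "... = M * norm \<nu> ^ N * E\<^sup>2"
   unfolding M_def N_def by (simp add: power_mult_distrib power_add mult_ac)
  also have "... <= M * (norm \<nu> ^ N)\<^sup>2 * E\<^sup>2"
  proof -
   have "norm \<nu> ^ N * 1 <= norm \<nu> ^ N * norm \<nu> ^ N" using one_le_power[OF n1, of N] by (intro mult_left_mono) auto
   then show ?thesis using M0 by (intro mult_right_mono mult_left_mono) (auto simp: power2_eq_square)
  qed
  also have "... = (sqrt M * norm \<nu> ^ N * E)\<^sup>2" using M0 by (simp add: power_mult_distrib)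
  finally have "cmod (fourier (vtest f (gtest a t)) \<nu>) <= sqrt M * norm \<nu> ^ N * E"
   by (rule power2_le_imp_le) (use M0 E0 in auto)
  then show ?thesis unfolding E_def g .
 qed
 show "AE z in lborel. vtest f (gtest a t) z = 0"
 proof (rule ingham_uniqueness[OF vtest_properties(1)[OF f(1) gtest_measurable gtest_le_1[OF t]] \<epsilon>
   vtest_properties(3)[OF f(1) gtest_measurable gtest_le_1[OF t] van] _ _ ndiv])
  show "0 <= g s" if "1 <= s" for s using gnn that by simp
  show "g t' <= g s" if "1 <= s" "s <= t'" for s t' using dec that by simp
  show "AE s in lborel. 1 <= norm s \<longrightarrow> cmod (fourier (vtest f (gtest a t)) s) <= sqrt M * norm s ^ N * exp (- norm s * g (norm s))"
   using Uset_conull vfourier_L2[OF f V_frame]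
  proof eventually_elim
   case (elim \<nu>)
   have fm: "f \<in> borel_measurable borel" using f(1) by simp
   have vm: "(%v. sqnorm (vfourier f \<nu> v)) \<in> borel_measurable borel"
    using vfourier_measurable'[OF fm, of "%_. \<nu>" borel "%v. v"] by measurable
   show ?case
    using decay[OF elim(1)] elim(2) frame_unique[OF V_frame Gam_frame[OF elim(1)] vspace_subspace vm] by auto
  qed
 qed
qed

end




section \<open>Existence for MW groups\<close>

context two_step_group
begin

lemma smat_scaleR: "det (smat (c *\<^sub>R \<nu>)) = c ^ CARD('m) * det (smat \<nu>)"
proof -
 have "smat (c *\<^sub>R \<nu>) = (\<chi> i. c *s (smat \<nu> $ i))"
  unfolding smat_def bform_def by (simp add: vec_eq_iff)
 then show ?thesis using det_rows_mul[of "%_. c" "%i. smat \<nu> $ i"] by simp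
qed

text \<open>
 The determinant of \<open>S\<^sub>\<nu>\<close> is a polynomial in the numbers \<open>\<nu>([V i, V j])\<close>, hence a sum of products of
 directional derivatives; the cardinal sines come from averaging, which keeps the function Lipschitz after
 each derivative.
\<close>

lemma determinant_multiplier:
 assumes b: "lip_supp L R b"
 shows "\<exists>h L' R'. lip_supp L' R' h \<and> (\<forall>s. fourier h s = of_real (det (smat s))
  * of_real (\<Prod>q\<in>UNIV. cardinal_sine (2 * pi * (s \<bullet> zcoord (br (V (fst q)) (V (snd q)))))) * fourier b s)"
proof -
 let ?w = "%q::'m \<times> 'm. zcoord (br (V (fst q)) (V (snd q)))"
 let ?c = "%s. complex_of_real (\<Prod>q\<in>UNIV. cardinal_sine (2 * pi * (s \<bullet> ?w q)))"
 let ?t = "%s p. of_int (sign p) * (\<Prod>i\<in>UNIV. bform s (V i) (V (p i)))"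
 have one: "\<exists>h L' R'. lip_supp L' R' h \<and> (\<forall>s. fourier h s = of_real (?t s p) * ?c s * fourier b s)" for p
 proof -
  obtain h L' R' where h: "lip_supp L' R' h" "\<And>s. fourier h s
   = of_real (\<Prod>j\<in>range (%i. (i, p i)). s \<bullet> ?w j) * ?c s * fourier b s"
   using fourier_multiplier[OF b finite subset_UNIV, where M="range (%i. (i, p i))" and w="?w"] by blast
  have "(\<Prod>j\<in>range (%i. (i, p i)). s \<bullet> ?w j) = (\<Prod>i\<in>UNIV. bform s (V i) (V (p i)))" for s
   by (subst prod.reindex) (auto simp: inj_on_def bform_def)
  then have "fourier (%x. of_int (sign p) * h x) s = of_real (?t s p) * ?c s * fourier b s" for s
   unfolding fourier_cmult h(2) by simp
  then show ?thesis using lip_supp_cmult[OF h(1)] by blast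
 qed
 have "\<exists>h L' R'. lip_supp L' R' h \<and> (\<forall>s. fourier h s = of_real (\<Sum>p\<in>S. ?t s p) * ?c s * fourier b s)"
  if "finite S" for S
  using that
 proof (induction S rule: finite_induct)
  case empty
  have "lip_supp 0 0 (%_::real ^ 'k. 0)" by (simp add: lip_supp_def)
  then show ?case by (intro exI[of _ "%_. 0"] exI[of _ 0]) (simp add: fourier_def)
 next
  case (insert p S)
  obtain h L1 R1 where h: "lip_supp L1 R1 h" "\<And>s. fourier h s = of_real (\<Sum>p\<in>S. ?t s p) * ?c s * fourier b s"
   using insert.IH by blast
  obtain k L2 R2 where k: "lip_supp L2 R2 k" "\<And>s. fourier k s = of_real (?t s p) * ?c s * fourier b s"
   using one[of p] by blast
  have "fourier (%x. k x + h x) s = of_real (\<Sum>p\<in>insert p S. ?t s p) * ?c s * fourier b s" for s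
   unfolding fourier_add[OF lip_supp_integrable[OF k(1)] lip_supp_integrable[OF h(1)]] k(2) h(2)
    sum.insert[OF insert.hyps] of_real_add by (simp only: ring_distribs)
  then show ?case using lip_supp_add[OF k(1) h(1)] by blast
 qed
 from this[of "{p. p permutes (UNIV :: 'm set)}"] show ?thesis
  by (simp add: det_def smat_def finite_permutations)
qed

text \<open>
 Along a ray the determinant is a multiple of a power, so it does not vanish on the ray near \<open>0\<close>, where the other
 factors are close to their nonzero values at \<open>0\<close>.
\<close>

lemma fourier_nonzero_near_0:
 fixes b :: "real ^ 'k => complex"
 assumes b: "integrable lborel b" "fourier b 0 ~= 0" and d: "det (smat \<nu>) ~= 0"
 shows "\<exists>s. of_real (det (smat s))
  * of_real (\<Prod>q\<in>UNIV. cardinal_sine (2 * pi * (s \<bullet> zcoord (br (V (fst q)) (V (snd q)))))) * fourier b s ~= 0"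
proof -
 define c where "c = (%n. 1 / real (Suc n))"
 have c0: "c \<longlonglongrightarrow> 0" unfolding c_def by (rule LIMSEQ_Suc[OF lim_1_over_n])
 have [measurable]: "b \<in> borel_measurable borel" using b(1) by simp
 have "(%n. fourier b (c n *\<^sub>R \<nu>)) \<longlonglongrightarrow> fourier b 0"
  unfolding fourier_def
 proof (rule integral_dominated_convergence[where w="%x. cmod (b x)"])
  show "AE x in lborel. (%n. b x * cis (- (2 * pi * (c n *\<^sub>R \<nu> \<bullet> x)))) \<longlonglongrightarrow> b x * cis (- (2 * pi * (0 \<bullet> x)))"
  proof (rule AE_I2)
   fix x :: "real ^ 'k"
   have "(%n. c n *\<^sub>R \<nu>) \<longlonglongrightarrow> 0 *\<^sub>R \<nu>" by (intro tendsto_intros c0)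
   then have "(%n. - (2 * pi * (c n *\<^sub>R \<nu> \<bullet> x))) \<longlonglongrightarrow> - (2 * pi * ((0 *\<^sub>R \<nu>) \<bullet> x))"
    by (intro tendsto_minus tendsto_mult tendsto_inner tendsto_const)
   then have "(%n. cis (- (2 * pi * (c n *\<^sub>R \<nu> \<bullet> x)))) \<longlonglongrightarrow> cis (- (2 * pi * ((0 *\<^sub>R \<nu>) \<bullet> x)))"
    unfolding cis_conv_exp by (intro tendsto_exp tendsto_mult[OF tendsto_const] tendsto_of_real) assumption
   then show "(%n. b x * cis (- (2 * pi * (c n *\<^sub>R \<nu> \<bullet> x)))) \<longlonglongrightarrow> b x * cis (- (2 * pi * (0 \<bullet> x)))"
    by (intro tendsto_mult tendsto_const) simp
  qed
 qed (use b(1) in \<open>auto simp: norm_mult\<close>)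
 then have e1: "\<forall>\<^sub>F n in sequentially. fourier b (c n *\<^sub>R \<nu>) ~= 0" by (rule tendsto_imp_eventually_ne) (rule b(2))
 have e2: "\<forall>\<^sub>F n in sequentially. cardinal_sine (2 * pi * (c n *\<^sub>R \<nu> \<bullet> w)) ~= 0" for w :: "real ^ 'k"
 proof -
  have "(%n. 2 * pi * (c n * (\<nu> \<bullet> w))) \<longlonglongrightarrow> 2 * pi * (0 * (\<nu> \<bullet> w))" by (intro tendsto_intros c0)
  then have "\<forall>\<^sub>F n in sequentially. dist (2 * pi * (c n * (\<nu> \<bullet> w))) 0 < 3"
   by (intro tendstoD) auto
  then show ?thesis
  proof eventually_elim
   case (elim n)
   define x where "x = 2 * pi * (c n *\<^sub>R \<nu> \<bullet> w)"
   have x: "\<bar>x\<bar> < pi" using elim pi_gt3 by (simp add: x_def)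
   have "sin x ~= 0" if "x ~= 0"
    using sin_gt_zero[of x] sin_gt_zero[of "- x"] x that by (cases "x > 0") auto
   then show ?case unfolding x_def[symmetric] cardinal_sine_def by simp
  qed
 qed
 have "\<forall>\<^sub>F n in sequentially. \<forall>q\<in>(UNIV :: ('m \<times> 'm) set). cardinal_sine (2 * pi * (c n *\<^sub>R \<nu> \<bullet> zcoord (br (V (fst q)) (V (snd q))))) ~= 0"
  by (rule eventually_ball_finite) (use e2 in auto)
 with e1 have "\<forall>\<^sub>F n in sequentially. fourier b (c n *\<^sub>R \<nu>) ~= 0 \<and>
  (\<forall>q\<in>(UNIV :: ('m \<times> 'm) set). cardinal_sine (2 * pi * (c n *\<^sub>R \<nu> \<bullet> zcoord (br (V (fst q)) (V (snd q))))) ~= 0)"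
  by eventually_elim blast
 then obtain n where n: "fourier b (c n *\<^sub>R \<nu>) ~= 0"
  "\<And>q::'m \<times> 'm. cardinal_sine (2 * pi * (c n *\<^sub>R \<nu> \<bullet> zcoord (br (V (fst q)) (V (snd q))))) ~= 0"
  unfolding eventually_sequentially by blast
 have "det (smat (c n *\<^sub>R \<nu>)) ~= 0" unfolding smat_scaleR using d by (simp add: c_def)
 moreover have "(\<Prod>q\<in>(UNIV :: ('m \<times> 'm) set). cardinal_sine (2 * pi * (c n *\<^sub>R \<nu> \<bullet> zcoord (br (V (fst q)) (V (snd q)))))) ~= 0"
  using n(2) by simp
 ultimately show ?thesis using n(1) by (intro exI[of _ "c n *\<^sub>R \<nu>"]) (simp only: mult_eq_0_iff of_real_eq_0_iff simp_thms)
qed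

end

context two_step_reps
begin

text \<open>
 In the orthonormal basis \<open>X, Y\<close> of \<open>\<vv>\<close> the matrix of \<open>B\<^sub>\<nu>\<close> has, up to sign, the single entry \<open>d j\<close> in each of
 the rows of \<open>X j\<close> and \<open>Y j\<close>, so the square of its determinant is the product of the \<open>(d j)\<^sup>4\<close>. The sign is
 settled by skew symmetry.
\<close>

lemma det_smat:
 assumes MW: MW_group and \<nu>: "\<nu> \<in> Uset"
 shows "det (smat \<nu>) = (\<Prod>j<dim_n. d \<nu> j)\<^sup>2"
proof -
 have Q: "Qset = {}" by (rule MW_Qset_empty[OF MW])
 then have P: "Pset = UNIV" by (auto simp: Qset_def)
 have r0: "dim_r = 0" by (simp add: dim_r_def Q)
 have sp: "span (X \<nu> ` {..<dim_n} \<union> Y \<nu> ` {..<dim_n}) = vspace" using frame_span[OF \<nu>] r0 by simp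
 have V1: "V i \<bullet> V j = (if i = j then 1 else 0)" for i j using V_orthonormal by (auto simp: orthonormal_on_def)
 have injV: "inj V"
 proof (rule injI)
  fix i j assume "V i = V j" then show "i = j" using V1[of i j] V1[of i i] by (auto split: if_splits)
 qed
 have dimv: "dim vspace = CARD('m)"
 proof -
  have "pairwise orthogonal (range V)" "0 \<notin> range V"
   using V1 by (auto simp: pairwise_def orthogonal_def, metis inner_zero_left zero_neq_one)
  then have "independent (range V)" by (rule pairwise_orthogonal_independent)
  then show ?thesis unfolding vspace_def dim_span by (simp add: dim_eq_card_independent card_image[OF injV])
 qed
 have "dim vspace <= card (X \<nu> ` {..<dim_n} \<union> Y \<nu> ` {..<dim_n})"
  unfolding sp[symmetric] dim_span by (rule dim_le_card') simp
 also have "... <= dim_n + dim_n"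
  by (rule order_trans[OF card_Un_le add_mono]) (use card_image_le[of "{..<dim_n}"] in auto)
 finally have n2: "CARD('m) = dim_n + dim_n" unfolding dimv by (simp add: dim_n_def P)
 have "card (UNIV :: 'm set) = card ({..<dim_n} <+> {..<dim_n})" by (subst card_Plus) (auto simp: n2)
 then obtain \<beta> where \<beta>: "bij_betw \<beta> (UNIV :: 'm set) ({..<dim_n} <+> {..<dim_n})"
  using finite_same_card_bij[of "UNIV :: 'm set" "{..<dim_n} <+> {..<dim_n}"] by auto
 define e where "e = (%a. case \<beta> a of Inl j => X \<nu> j | Inr j => Y \<nu> j)"
 define e' where "e' = (%a. case \<beta> a of Inl j => Y \<nu> j | Inr j => X \<nu> j)"
 define \<sigma> where "\<sigma> = (%a. case \<beta> a of Inl j => d \<nu> j | Inr j => - d \<nu> j)"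
 have \<beta>cases: "(\<exists>j<dim_n. \<beta> a = Inl j) \<or> (\<exists>j<dim_n. \<beta> a = Inr j)" for a
 proof -
  have "\<beta> a \<in> {..<dim_n} <+> {..<dim_n}" using \<beta> by (auto simp: bij_betw_def)
  then show ?thesis by (elim PlusE) auto
 qed
 have \<beta>inj: "\<beta> a = \<beta> b \<longleftrightarrow> a = b" for a b using \<beta> by (auto simp: bij_betw_def inj_on_def)
 have on: "X \<nu> i \<bullet> X \<nu> j = (if i = j then 1 else 0)" "Y \<nu> i \<bullet> Y \<nu> j = (if i = j then 1 else 0)"
  if "i < dim_n" "j < dim_n" for i j
  using X_orthonormal[OF \<nu>] Y_orthonormal[OF \<nu>] that by (auto simp: orthonormal_on_def)
 have eon: "e a \<bullet> e b = (if a = b then 1 else 0)" and e'on: "e' a \<bullet> e' b = (if a = b then 1 else 0)" for a b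
  using \<beta>cases[of a] \<beta>cases[of b] \<beta>inj[of a b] unfolding e_def e'_def
  by (auto simp: on X_Y_orthogonal[OF \<nu>] Y_X_orthogonal[OF \<nu>])
 have re: "range e = X \<nu> ` {..<dim_n} \<union> Y \<nu> ` {..<dim_n}"
 proof -
  have "range e = (case_sum (X \<nu>) (Y \<nu>)) ` (\<beta> ` UNIV)" unfolding e_def image_image by (simp add: case_sum_if split: sum.split)
  also have "\<beta> ` UNIV = {..<dim_n} <+> {..<dim_n}" using \<beta> by (auto simp: bij_betw_def)
  also have "case_sum (X \<nu>) (Y \<nu>) ` ({..<dim_n} <+> {..<dim_n}) = X \<nu> ` {..<dim_n} \<union> Y \<nu> ` {..<dim_n}"
   unfolding Plus_def image_Un image_image by simp
  finally show ?thesis .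
 qed
 have exp: "(\<Sum>a\<in>UNIV. (v \<bullet> e a) *\<^sub>R e a) = v" if "v \<in> vspace" for v
  by (rule orthonormal_expansion) (use that eon sp re in \<open>auto simp: orthonormal_on_def\<close>)
 have inn: "(\<Sum>a\<in>UNIV. (u \<bullet> e a) * (v \<bullet> e a)) = u \<bullet> v" if "v \<in> vspace" for u v
 proof -
  have "u \<bullet> v = u \<bullet> (\<Sum>a\<in>UNIV. (v \<bullet> e a) *\<^sub>R e a)" by (simp only: exp[OF that])
  then show ?thesis by (simp add: inner_sum_right mult.commute)
 qed
 have XYv: "X \<nu> j \<in> vspace" "Y \<nu> j \<in> vspace" if "j < dim_n" for j
  unfolding sp[symmetric] using that by (auto intro!: span_base)
 have e'v: "e' a \<in> vspace" for a using \<beta>cases[of a] XYv by (auto simp: e'_def)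
 have BE: "bform \<nu> (e a) (e c) = \<sigma> a * (e' a \<bullet> e c)" for a c
 proof -
  have YX: "bform \<nu> (Y \<nu> i) (X \<nu> j) = (if i = j then - d \<nu> j else 0)" if "i < dim_n" "j < dim_n" for i j
   using bform_skew[of \<nu> "Y \<nu> i" "X \<nu> j"] bform_X_Y[OF \<nu> that(2,1)] by auto
  show ?thesis
   using \<beta>cases[of a] \<beta>cases[of c] unfolding e_def e'_def \<sigma>_def
   by (auto simp: on X_Y_orthogonal[OF \<nu>] Y_X_orthogonal[OF \<nu>] bform_X_Y[OF \<nu>] bform_X_X[OF \<nu>] bform_Y_Y[OF \<nu>] YX)
 qed
 define W :: "real ^ ('m::{finite,linorder}) ^ ('m::{finite,linorder})" where "W = (\<chi> i a. V i \<bullet> e a)"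
 define E :: "real ^ ('m::{finite,linorder}) ^ ('m::{finite,linorder})" where "E = (\<chi> a b. bform \<nu> (e a) (e b))"
 have "W ** transpose W = mat 1"
  unfolding W_def by (simp add: vec_eq_iff matrix_matrix_mult_def transpose_def mat_def inn[OF V_vspace] V1)
 then have "det W * det W = 1" using det_mul[of W "transpose W"] by (simp add: det_transpose)
 moreover have "smat \<nu> = W ** E ** transpose W"
 proof -
  have "bform \<nu> (V i) (V j) = (\<Sum>b\<in>UNIV. (\<Sum>a\<in>UNIV. (V i \<bullet> e a) * bform \<nu> (e a) (e b)) * (V j \<bullet> e b))" for i j
  proof -
   have "bform \<nu> (V i) (V j) = bform \<nu> (\<Sum>a\<in>UNIV. (V i \<bullet> e a) *\<^sub>R e a) (\<Sum>b\<in>UNIV. (V j \<bullet> e b) *\<^sub>R e b)"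
    by (simp only: exp[OF V_vspace])
   then show ?thesis
    by (simp add: linear_sum[OF bform_linear_left] linear_sum[OF bform_linear_right] bform_scale_left bform_scale_right
      sum_distrib_right mult_ac)
  qed
  then show ?thesis unfolding smat_def W_def E_def
   by (simp add: vec_eq_iff matrix_matrix_mult_def transpose_def)
 qed
 ultimately have dE: "det (smat \<nu>) = det E" by (simp add: det_mul det_transpose mult_ac)
 have EE: "(E ** transpose E) $ a $ b = (if a = b then (\<sigma> a)\<^sup>2 else 0)" for a b
 proof -
  have "(E ** transpose E) $ a $ b = \<sigma> a * \<sigma> b * (\<Sum>c\<in>UNIV. (e' a \<bullet> e c) * (e' b \<bullet> e c))"
   unfolding E_def by (simp add: matrix_matrix_mult_def transpose_def BE sum_distrib_left mult_ac)
  then show ?thesis by (simp add: inn[OF e'v] e'on power2_eq_square)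
 qed
 have "(det E)\<^sup>2 = det (E ** transpose E)" by (simp add: det_mul det_transpose power2_eq_square)
 also have "... = (\<Prod>a\<in>UNIV. (\<sigma> a)\<^sup>2)" by (subst det_diagonal) (simp_all add: EE)
 also have "... = (\<Prod>q\<in>{..<dim_n} <+> {..<dim_n}. (case q of Inl j => d \<nu> j | Inr j => - d \<nu> j)\<^sup>2)"
  unfolding \<sigma>_def by (rule prod.reindex_bij_betw[OF \<beta>])
 also have "... = ((\<Prod>j<dim_n. d \<nu> j)\<^sup>2)\<^sup>2"
 proof -
  have "(\<Prod>q\<in>{..<dim_n} <+> {..<dim_n}. (case q of Inl j => d \<nu> j | Inr j => - d \<nu> j)\<^sup>2)
    = (\<Prod>j<dim_n. (d \<nu> j)\<^sup>2) * (\<Prod>j<dim_n. (d \<nu> j)\<^sup>2)"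
   by (subst prod.Plus) (simp_all add: comp_def)
  also have "... = ((\<Prod>j<dim_n. d \<nu> j)\<^sup>2)\<^sup>2"
   unfolding prod_power_distrib[symmetric] by (rule power2_eq_square[symmetric])
  finally show ?thesis .
 qed
 finally have sqE: "(det E)\<^sup>2 = ((\<Prod>j<dim_n. d \<nu> j)\<^sup>2)\<^sup>2" .
 have sq: "(det (smat \<nu>))\<^sup>2 = ((\<Prod>j<dim_n. d \<nu> j)\<^sup>2)\<^sup>2" by (simp only: dE sqE)
 have "0 <= det (smat \<nu>)"
 proof (rule det_skew_nonneg)
  show "transpose (smat \<nu>) = - smat \<nu>"
   unfolding smat_def by (simp add: vec_eq_iff transpose_def) (intro allI, rule bform_skew)
 qed
 then show ?thesis by (rule power2_eq_imp_eq[OF sq _ zero_le_power2])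
qed

lemma abs_Pf_MW:
 assumes MW: MW_group and \<nu>: "\<nu> \<in> Uset"
 shows "abs_Pf \<nu> = (\<Prod>j<dim_n. d \<nu> j)"
proof -
 have "Pset = UNIV" using MW_Qset_empty[OF MW] by (auto simp: Qset_def)
 then have "abs_Pf \<nu> = sqrt (det (smat \<nu>))" unfolding abs_Pf_def det_def smat_def by simp
 moreover have "0 <= (\<Prod>j<dim_n. d \<nu> j)" by (intro prod_nonneg) (auto intro: less_imp_le d_pos[OF \<nu>])
 ultimately show ?thesis unfolding det_smat[OF assms] by simp
qed

definition tent :: "(real ^ 'k => complex) => 'g => complex" where
 "tent h g = of_real (max 0 (1 - norm (g - zemb (zcoord g)))) * h (zcoord g)"

lemma tent_support:
 assumes h: "lip_supp L R h"
 shows "continuous_on UNIV (tent h)" and "1 + R < norm g ==> tent h g = 0"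
proof -
 have c: "continuous_on UNIV zcoord" "continuous_on UNIV zemb"
  by (simp_all add: linear_continuous_on linear_conv_bounded_linear[symmetric] zcoord_linear zemb_linear)
 show "continuous_on UNIV (tent h)" unfolding tent_def[abs_def]
  by (intro continuous_intros c continuous_on_compose2[OF c(2) c(1)] continuous_on_compose2[OF lip_supp_continuous[OF h, of UNIV] c(1)]) auto
 assume g: "1 + R < norm g"
 have "norm g <= norm (g - zemb (zcoord g)) + norm (zcoord g)"
  using norm_triangle_ineq[of "g - zemb (zcoord g)" "zemb (zcoord g)"] by (simp add: norm_zemb)
 then have "1 < norm (g - zemb (zcoord g)) \<or> R < norm (zcoord g)" using g by linarith
 then show "tent h g = 0" using h unfolding tent_def lip_supp_def by auto
qed

text \<open>For this function the partial Fourier transform in the centre is a multiple of one fixed function on \<open>\<vv>\<close>.\<close>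

lemma pi_hs_tent:
 assumes MW: MW_group and h: "lip_supp L R h" and \<nu>: "\<nu> \<in> Uset"
 shows "ennreal (\<Prod>j<dim_n. d \<nu> j) * (pi_hs \<mu> \<nu> (tent h))\<^sup>2 <= ennreal (exp pi * (cmod (fourier h \<nu>))\<^sup>2)"
proof -
 let ?A = "euc3 dim_n dim_r"
 note fr = Gam_frame[OF \<nu>]
 have f: "integrable lborel (tent h)" by (rule compact_support_integrable[OF tent_support(1)[OF h] tent_support(2)[OF h]])
 have vf: "vfourier (tent h) \<nu> v = of_real (max 0 (1 - norm v)) * fourier h \<nu>" if v: "v \<in> vspace" for v
  unfolding vfourier_def tent_def fourier_def zcoord_sum[OF v] by (simp add: mult.assoc)
 have bd: "(\<integral>\<^sup>+p. sqnorm (vfourier (tent h) \<nu> (Gam \<nu> p)) \<partial>?A) <= ennreal (exp pi * (cmod (fourier h \<nu>))\<^sup>2)"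
 proof -
  have "(\<integral>\<^sup>+p. sqnorm (vfourier (tent h) \<nu> (Gam \<nu> p)) \<partial>?A)
    <= (\<integral>\<^sup>+p. ennreal (exp pi * (cmod (fourier h \<nu>))\<^sup>2) * ennreal (gauss (Gam \<nu> p)) \<partial>?A)"
  proof (rule nn_integral_mono)
   fix p assume "p \<in> space ?A"
   then have p: "Gam \<nu> p \<in> vspace" by (rule frame_space[OF fr])
   have *: "(max 0 (1 - t))\<^sup>2 <= exp pi * exp (- pi * t\<^sup>2)" if "0 <= t" for t :: real
   proof (cases "t <= 1")
    case True
    then have "(max 0 (1 - t))\<^sup>2 <= 1" using that by (simp add: power_le_one)
    moreover have "1 <= exp pi * exp (- pi * t\<^sup>2)"
     using True that unfolding exp_add[symmetric] by (simp add: power_le_one)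
    ultimately show ?thesis by linarith
   qed simp
   have "(cmod (vfourier (tent h) \<nu> (Gam \<nu> p)))\<^sup>2 = (max 0 (1 - norm (Gam \<nu> p)))\<^sup>2 * (cmod (fourier h \<nu>))\<^sup>2"
    unfolding vf[OF p] norm_mult norm_of_real power_mult_distrib power2_abs ..
   also have "... <= exp pi * exp (- pi * (norm (Gam \<nu> p))\<^sup>2) * (cmod (fourier h \<nu>))\<^sup>2"
    by (intro mult_right_mono *) auto
   finally show "sqnorm (vfourier (tent h) \<nu> (Gam \<nu> p)) <= ennreal (exp pi * (cmod (fourier h \<nu>))\<^sup>2) * ennreal (gauss (Gam \<nu> p))"
    unfolding gauss_def by (subst ennreal_mult[symmetric]) (auto intro!: ennreal_leI simp: mult_ac)
  qed
  also have "... = ennreal (exp pi * (cmod (fourier h \<nu>))\<^sup>2) * (\<integral>\<^sup>+p. ennreal (gauss (Gam \<nu> p)) \<partial>?A)"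
   by (rule nn_integral_cmult) (use frame_measurable[OF fr] in measurable)
  also have "... = ennreal (exp pi * (cmod (fourier h \<nu>))\<^sup>2)" using fr by (simp add: frame_def)
  finally show ?thesis .
 qed
 have r0: "dim_r = 0" by (simp add: dim_r_def MW_Qset_empty[OF MW])
 have "(\<integral>\<^sup>+m. hs_mass (tent h) \<nu> m \<partial>euc dim_r) = hs_mass (tent h) \<nu> (mtil \<mu> \<nu>)"
  by (simp add: r0 mtil_def PiM_empty nn_integral_count_space_finite restrict_def)
 with order_trans[OF hs_mass_total[OF \<nu> f] bd]
 have m: "hs_mass (tent h) \<nu> (mtil \<mu> \<nu>) <= ennreal (exp pi * (cmod (fourier h \<nu>))\<^sup>2)" by simp
 show ?thesis using pi_hs_square[OF \<nu> f, of \<mu>] m order_le_less_trans[OF m ennreal_less_top] by simp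
qed

theorem existence:
 fixes \<theta> :: "real ^ 'k => real"
 assumes \<theta>: "\<And>t. 0 <= \<theta> t" "radial_decreasing \<theta>" "(\<theta> \<longlongrightarrow> 0) at_infinity" and conv: "theta_integral \<theta> < \<infinity>"
  and MW: MW_group
 shows "\<exists>(f :: 'g => complex) C. continuous_on UNIV f \<and> compact (closure {x. f x ~= 0}) \<and> (\<exists>x. f x ~= 0) \<and>
  (\<forall>\<mu> \<nu>. \<nu> \<in> Uset \<longrightarrow> pi_hs \<mu> \<nu> f <= ennreal (C * sqrt (abs_Pf \<nu>) * exp (- norm \<nu> * \<theta> \<nu>)))"
proof -
 obtain g where g: "\<And>t. \<theta> t = g (norm t)" and dec: "\<And>s t. 0 <= s ==> s <= t ==> g t <= g s"
  using \<theta>(2) unfolding radial_decreasing_def by auto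
 have gax: "g s = \<theta> (s *\<^sub>R axis undefined 1)" if "0 <= s" for s
  using that by (simp add: g norm_axis_1)
 have gnn: "0 <= g s" if "0 <= s" for s using gax[OF that] \<theta>(1) by simp
 have gsum: "summable (%n. g (real (Suc n)) / real (Suc n))"
 proof -
  have "summable (%n. g (real (Suc n)) / real (Suc n)) \<longleftrightarrow> theta_integral \<theta> < \<infinity>"
   by (rule theta_integral_shells) (fact \<theta>(1), fact g, fact dec)
  then show ?thesis using conv by simp
 qed
 have glim: "(g \<longlongrightarrow> 0) at_top"
 proof (rule tendstoI)
  fix e :: real assume "0 < e"
  then have "\<forall>\<^sub>F x in at_infinity. dist (\<theta> x) 0 < e" by (rule tendstoD[OF \<theta>(3)])
  then obtain r where r: "\<And>x. r <= norm x ==> dist (\<theta> x) 0 < e" unfolding eventually_at_infinity by blast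
  show "\<forall>\<^sub>F x in at_top. dist (g x) 0 < e"
   using eventually_ge_at_top[of "max r 0"]
   by eventually_elim (use r[of "_ *\<^sub>R axis undefined 1"] in \<open>auto simp: gax norm_axis_1\<close>)
 qed
 \<comment> \<open>The extra \<open>1 / sqrt t\<close> buys the factor \<open>exp (- sqrt t)\<close>, which absorbs every power of \<open>|\<nu>|\<close>.\<close>
 define \<phi> where "\<phi> = (%t. g t + 1 / sqrt t)"
 obtain b :: "real ^ 'k => complex" and L R C1 where b: "lip_supp L R b" "fourier b 0 ~= 0" "0 <= C1"
  "\<And>s. 1 <= norm s ==> cmod (fourier b s) <= C1 * exp (- norm s * \<phi> (norm s))"
 proof (rule ingham_function[of \<phi>])
  show "0 <= \<phi> t" if "1 <= t" for t using gnn that by (simp add: \<phi>_def)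
  show "\<phi> t <= \<phi> s" if "1 <= s" "s <= t" for s t
   unfolding \<phi>_def using that dec by (intro add_mono) (auto intro!: divide_left_mono)
  have "((%t. 1 / sqrt t) \<longlongrightarrow> 0) at_top" by real_asymp
  with glim have "((%t. g t + 1 / sqrt t) \<longlongrightarrow> 0 + 0) at_top" by (rule tendsto_add)
  then show "(\<phi> \<longlongrightarrow> 0) at_top" by (simp add: \<phi>_def)
  have "summable (%n. real (Suc n) powr (- 3/2))"
   using summable_Suc_iff[of "%n. real n powr (- 3/2)"] summable_real_powr_iff[of "- 3/2"] by simp
  moreover have "real (Suc n) powr (- 3/2) = 1 / sqrt (real (Suc n)) / real (Suc n)" for n
  proof -
   define x where "x = real (Suc n)"
   have x: "0 < x" by (simp add: x_def)
   have e: "(- 3/2 :: real) = - (1/2) + - 1" by simp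
   have "x powr (- (1/2)) = inverse (sqrt x)" unfolding powr_minus powr_half_sqrt[OF less_imp_le[OF x]] ..
   moreover have "x powr (- 1) = inverse x" using x by (simp add: powr_neg_one divide_inverse)
   ultimately have "x powr (- 3/2) = inverse (sqrt x) * inverse x" unfolding e powr_add by (simp only:)
   then show ?thesis unfolding x_def[symmetric] by (simp only: divide_inverse mult_1)
  qed
  ultimately have "summable (%n. 1 / sqrt (real (Suc n)) / real (Suc n))" by simp
  from summable_add[OF gsum this]
  show "summable (%n. \<phi> (real (Suc n)) / real (Suc n))" by (simp add: \<phi>_def add_divide_distrib)
 next
  fix h :: "real ^ 'k => complex" and L R C2
  assume h: "lip_supp L R h" "fourier h 0 ~= 0" "0 <= C2"
   "\<And>s. 1 <= norm s ==> cmod (fourier h s) <= C2 * exp (- norm s * \<phi> (norm s))"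
  show thesis by (rule that[OF h])
 qed
 let ?S = "%s. (\<Prod>q\<in>(UNIV :: ('m \<times> 'm) set). cardinal_sine (2 * pi * (s \<bullet> zcoord (br (V (fst q)) (V (snd q))))))"
 obtain h L' R' where h: "lip_supp L' R' h" "\<And>s. fourier h s = of_real (det (smat s)) * of_real (?S s) * fourier b s"
  using determinant_multiplier[OF b(1)] by blast
 have bi: "integrable lborel b" by (rule lip_supp_integrable[OF b(1)])
 obtain \<nu>0 where \<nu>0: "\<nu>0 \<in> Uset" using AE_lborel_ex[OF Uset_conull] by blast
 have "det (smat \<nu>0) ~= 0" unfolding det_smat[OF MW \<nu>0] using d_pos[OF \<nu>0] by (auto simp: less_imp_neq[symmetric])
 from fourier_nonzero_near_0[OF bi b(2) this] obtain s0 where "fourier h s0 ~= 0" unfolding h(2)[symmetric] by blast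
 then have "\<exists>z. h z ~= 0" by (rule contrapos_np) (simp add: fourier_def)
 then obtain z0 where z0: "h z0 ~= 0" by blast
 obtain B where B: "B > 0" "\<And>\<nu> x y. \<bar>bform \<nu> x y\<bar> <= B * norm \<nu> * norm x * norm y" using bform_bounded by blast
 define b1 where "b1 = (LINT x|lborel. cmod (b x))"
 have b10: "0 <= b1" unfolding b1_def by (rule Bochner_Integration.integral_nonneg) simp
 define F where "F = B ^ dim_n * (C1 * fact (2 * dim_n) + b1 * exp (g 0))"
 have F0: "0 <= F" unfolding F_def using B(1) b(3) b10 by simp
 have decay: "(\<Prod>j<dim_n. d \<nu> j) * cmod (fourier b \<nu>) <= F * exp (- norm \<nu> * \<theta> \<nu>)" if \<nu>: "\<nu> \<in> Uset" for \<nu>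
 proof (cases "1 <= norm \<nu>")
  case True
  define x where "x = sqrt (norm \<nu>)"
  have x2: "norm \<nu> = x\<^sup>2" and x0: "0 <= x" unfolding x_def by auto
  have x1: "x > 0" using True by (auto simp: x_def)
  have "(\<Prod>j<dim_n. d \<nu> j) * cmod (fourier b \<nu>) <= (B * norm \<nu>) ^ dim_n * (C1 * exp (- norm \<nu> * \<phi> (norm \<nu>)))"
   using B(1) by (intro mult_mono pfaffian_bound[OF \<nu> B(2)] b(4)[OF True]) auto
  also have "exp (- norm \<nu> * \<phi> (norm \<nu>)) = exp (- norm \<nu> * \<theta> \<nu>) * exp (- 1 * x)"
   unfolding \<phi>_def g x2 exp_add[symmetric] using x1 by (simp add: field_simps power2_eq_square real_sqrt_mult)
  also have "(B * norm \<nu>) ^ dim_n * (C1 * (exp (- norm \<nu> * \<theta> \<nu>) * exp (- 1 * x)))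
    = B ^ dim_n * C1 * (x ^ (2 * dim_n) * exp (- 1 * x)) * exp (- norm \<nu> * \<theta> \<nu>)"
   unfolding x2 by (simp add: power_mult_distrib power_mult mult_ac)
  also have "... <= B ^ dim_n * C1 * (fact (2 * dim_n) / 1 ^ (2 * dim_n)) * exp (- norm \<nu> * \<theta> \<nu>)"
   using B(1) b(3) x0 by (intro mult_right_mono mult_left_mono power_exp_bound) auto
  also have "... <= F * exp (- norm \<nu> * \<theta> \<nu>)"
   unfolding F_def using B(1) b10 by (intro mult_right_mono) (auto simp: ring_distribs)
  finally show ?thesis .
 next
  case False
  have "(\<Prod>j<dim_n. d \<nu> j) * cmod (fourier b \<nu>) <= B ^ dim_n * b1"
  proof (rule mult_mono)
   show "(\<Prod>j<dim_n. d \<nu> j) <= B ^ dim_n"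
    by (rule order_trans[OF pfaffian_bound[OF \<nu> B(2)] power_mono]) (use B(1) False in \<open>auto simp: mult_le_cancel_left1\<close>)
   show "cmod (fourier b \<nu>) <= b1" unfolding b1_def by (rule fourier_bound[OF bi])
  qed (use B(1) in auto)
  also have "... <= B ^ dim_n * b1 * (exp (g 0) * exp (- norm \<nu> * \<theta> \<nu>))"
  proof -
   have "norm \<nu> * \<theta> \<nu> <= 1 * g 0"
    using False dec[of 0 "norm \<nu>"] gnn[of 0] gnn[of "norm \<nu>"] unfolding g by (intro mult_mono) auto
   then have "1 <= exp (g 0) * exp (- norm \<nu> * \<theta> \<nu>)" unfolding exp_add[symmetric] by simp
   then show ?thesis using mult_left_mono[of 1 _ "B ^ dim_n * b1"] B(1) b10 by simp
  qed
  also have "... <= F * exp (- norm \<nu> * \<theta> \<nu>)"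
   unfolding F_def mult.assoc[symmetric] using B(1) b(3) by (intro mult_right_mono) (auto simp: ring_distribs)
  finally show ?thesis .
 qed
 define C where "C = exp (pi / 2) * F"
 have C0: "0 <= C" unfolding C_def using F0 by simp
 show ?thesis
 proof (intro exI[of _ "tent h"] exI[of _ C] conjI allI impI)
  show "continuous_on UNIV (tent h)" by (rule tent_support(1)[OF h(1)])
  have "bounded {x. tent h x ~= 0}"
   unfolding bounded_iff using tent_support(2)[OF h(1)] by (intro exI[of _ "1 + R'"]) (auto simp: not_less[symmetric])
  then show "compact (closure {x. tent h x ~= 0})" by (simp add: compact_closure)
  show "\<exists>x. tent h x ~= 0"
   by (rule exI[of _ "zemb z0"]) (simp add: tent_def zcoord_zemb z0)
  fix \<mu> \<nu> assume \<nu>: "\<nu> \<in> Uset"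
  let ?D = "\<Prod>j<dim_n. d \<nu> j"
  define E where "E = exp (- norm \<nu> * \<theta> \<nu>)"
  have D0: "0 < ?D" by (intro prod_pos) (auto simp: d_pos[OF \<nu>])
  define c where "c = C * sqrt ?D * E"
  have c0: "0 <= c" unfolding c_def E_def using C0 D0 by simp
  have S1: "\<bar>?S \<nu>\<bar> <= 1" unfolding abs_prod by (intro prod_le_1) (auto simp: cardinal_sine_le_1)
  have "cmod (fourier h \<nu>) = ?D * (\<bar>?S \<nu>\<bar> * (?D * cmod (fourier b \<nu>)))"
   unfolding h(2) norm_mult norm_of_real det_smat[OF MW \<nu>] by (simp add: power2_eq_square)
  also have "... <= ?D * (1 * (F * E))"
   using D0 F0 unfolding E_def by (intro mult_left_mono mult_mono S1 decay[OF \<nu>]) auto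
  finally have hD: "cmod (fourier h \<nu>) <= ?D * (F * E)" by simp
  have "exp pi * (cmod (fourier h \<nu>))\<^sup>2 <= exp pi * (?D * (F * E))\<^sup>2"
   by (intro mult_left_mono power_mono hD) auto
  also have "... = ?D * c\<^sup>2"
  proof -
   have "exp pi = (exp (pi / 2))\<^sup>2" by (simp flip: exp_double)
   then show ?thesis unfolding c_def C_def using D0 by (simp add: power_mult_distrib power2_eq_square mult_ac)
  qed
  finally have "ennreal ?D * (pi_hs \<mu> \<nu> (tent h))\<^sup>2 <= ennreal (?D * c\<^sup>2)"
   using pi_hs_tent[OF MW h(1) \<nu>, of \<mu>] by (meson ennreal_leI order_trans)
  then have le: "ennreal ?D * (pi_hs \<mu> \<nu> (tent h))\<^sup>2 <= ennreal ?D * (ennreal c)\<^sup>2"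
   using D0 c0 by (simp add: ennreal_mult ennreal_power)
  have "pi_hs \<mu> \<nu> (tent h) <= ennreal c"
  proof (cases "pi_hs \<mu> \<nu> (tent h)")
   case top
   then show ?thesis using le D0 by (simp add: ennreal_mult_eq_top_iff power2_eq_square ennreal_mult_less_top ennreal_eq_0_iff top_unique ennreal_top_mult flip: ennreal_mult)
  next
   case (real p)
   then have "ennreal (?D * p\<^sup>2) <= ennreal (?D * c\<^sup>2)" using le D0 c0 by (simp add: ennreal_mult ennreal_power)
   then have "?D * p\<^sup>2 <= ?D * c\<^sup>2" using D0 by (subst (asm) ennreal_le_iff) auto
   then have "p\<^sup>2 <= c\<^sup>2" using D0 by simp
   then have "p <= c" using c0 by (rule power2_le_imp_le)
   then show ?thesis using real by (simp add: ennreal_leI)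
  qed
  then show "pi_hs \<mu> \<nu> (tent h) <= ennreal (C * sqrt (abs_Pf \<nu>) * exp (- norm \<nu> * \<theta> \<nu>))"
   unfolding c_def E_def abs_Pf_MW[OF MW \<nu>] .
 qed
qed

end

theorem theorem3p5:
 fixes G :: "'g::euclidean_space monoid"
  and br :: "'g => 'g => 'g"
  and V :: "'m::{finite,linorder} => 'g"
  and Z :: "'k::finite => 'g"
  and X Y U :: "real ^ 'k => nat => 'g"
  and d :: "real ^ 'k => nat => real"
  and \<theta> :: "real ^ 'k => real"
 assumes "two_step_reps G br V Z X Y U d"
  and "\<And>t. 0 <= \<theta> t"
  and "radial_decreasing \<theta>"
  and "(\<theta> \<longlongrightarrow> 0) at_infinity"
 shows
  "(\<forall>(f :: 'g => complex) (H :: ('m => real) => complex) (C :: real) (\<epsilon> :: real).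
    integrable lborel f \<and> f \<in> L2 lborel \<and>
    integrable (completion (two_step_group.mu_measure br V Z)) H \<and>
    H \<in> L2 (completion (two_step_group.mu_measure br V Z)) \<and>
    (\<forall>(\<mu>, \<nu>) \<in> two_step_group.Lambda br V Z.
     two_step_reps.pi_hs br V Z X Y U d \<mu> \<nu> f
      <= ennreal (C * cmod (H \<mu>) * sqrt (two_step_group.abs_Pf br V Z \<nu>)
             * exp (- norm \<nu> * \<theta> \<nu>))) \<and>
    0 < \<epsilon> \<and>
    (AE x in lborel. norm (two_step_group.zcoord Z x) < \<epsilon> \<longrightarrow> f x = 0) \<and>
    theta_integral \<theta> = \<infinity>
    \<longrightarrow> (AE x in lborel. f x = 0))
  \<and>
  (two_step_group.MW_group br V Z \<and> theta_integral \<theta> < \<infinity> \<longrightarrow>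
    (\<exists>(f :: 'g => complex) (C :: real).
     continuous_on UNIV f \<and> compact (closure {x. f x ~= 0}) \<and> (\<exists>x. f x ~= 0) \<and>
     (\<forall>(\<mu>, \<nu>) \<in> two_step_group.Lambda br V Z.
       two_step_reps.pi_hs br V Z X Y U d \<mu> \<nu> f
        <= ennreal (C * sqrt (two_step_group.abs_Pf br V Z \<nu>)
              * exp (- norm \<nu> * \<theta> \<nu>)))))"
proof -
 interpret two_step_reps G br V Z X Y U d by (rule assms(1))
 show ?thesis
 proof (intro conjI allI impI)
  fix f :: "'g => complex" and H :: "('m => real) => complex" and C \<epsilon> :: real
  assume A: "integrable lborel f \<and> f \<in> L2 lborel \<and> integrable (completion mu_measure) H \<and>
    H \<in> L2 (completion mu_measure) \<and>
    (\<forall>(\<mu>, \<nu>) \<in> Lambda. pi_hs \<mu> \<nu> f <= ennreal (C * cmod (H \<mu>) * sqrt (abs_Pf \<nu>) * exp (- norm \<nu> * \<theta> \<nu>))) \<and>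
    0 < \<epsilon> \<and> (AE x in lborel. norm (zcoord x) < \<epsilon> \<longrightarrow> f x = 0) \<and> theta_integral \<theta> = \<infinity>"
  have bd: "pi_hs \<mu> \<nu> f <= ennreal (C * cmod (H \<mu>) * sqrt (abs_Pf \<nu>) * exp (- norm \<nu> * \<theta> \<nu>))"
   if "\<mu> \<in> Qset \<rightarrow>\<^sub>E UNIV" "\<nu> \<in> Uset" for \<mu> \<nu>
   using A that unfolding Lambda_def by blast
  show "AE x in lborel. f x = 0"
   by (rule uniqueness[where \<epsilon>=\<epsilon>, OF assms(2,3) _ _ _ _ bd]) (use A in simp_all)
 next
  assume A: "MW_group \<and> theta_integral \<theta> < \<infinity>"
  obtain f :: "'g => complex" and C where f: "continuous_on UNIV f" "compact (closure {x. f x ~= 0})" "\<exists>x. f x ~= 0"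
   "\<And>\<mu> \<nu>. \<nu> \<in> Uset ==> pi_hs \<mu> \<nu> f <= ennreal (C * sqrt (abs_Pf \<nu>) * exp (- norm \<nu> * \<theta> \<nu>))"
   using existence[OF assms(2,3,4) conjunct2[OF A] conjunct1[OF A]] by blast
  have "\<forall>(\<mu>, \<nu>) \<in> Lambda. pi_hs \<mu> \<nu> f <= ennreal (C * sqrt (abs_Pf \<nu>) * exp (- norm \<nu> * \<theta> \<nu>))"
   using f(4) unfolding Lambda_def by auto
  with f(1-3) show "\<exists>(f :: 'g => complex) (C :: real). continuous_on UNIV f \<and> compact (closure {x. f x ~= 0}) \<and> (\<exists>x. f x ~= 0) \<and>
   (\<forall>(\<mu>, \<nu>) \<in> Lambda. pi_hs \<mu> \<nu> f <= ennreal (C * sqrt (abs_Pf \<nu>) * exp (- norm \<nu> * \<theta> \<nu>)))"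
   by blast
 qed
qed


end
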